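(* Let $n,d$ be positive integers with $3\le d\le n^\theta$ for a constant $\theta\in(0,1)$, and let $\varepsilon\in(0,1)$. If #BIS does not admit an FPRAS, then there exists $h=O(1)$ such that when $\beta d=\omega(\log n)$ there is no polynomial running time algorithm that solves the $\varepsilon$-identity testing problem for the class $\mathcal{M}^+_{\textsc{RBM}}(n,d,\beta,h)$ of ferromagnetic RBMs with inconsistent external fields.
   Context: A $q$-state Potts model is given by a graph $G=(V,E)$, edge weights $\beta_G:E\to\mathbb{R}$ and an external field $h_G:V\times[q]\to\mathbb{R}$; its Gibbs distribution is $\mu(\sigma)\propto\exp\big(\sum_{\{u,v\}\in E}\beta_G(\{u,v\})\mathbb{1}(\sigma(u)=\sigma(v))+\sum_{v}h_G(v,\sigma(v))\big)$, $\sigma\in[q]^V$. The Ising model is $q=2$ (spins $\{1,2\}$); an RBM is an Ising model on a bipartite graph. It is ferromagnetic if $\beta_G(e)>0$ for all edges. $\mathcal{M}^+_{\textsc{RBM}}(n,d,\beta,h)$ is the family of ferromagnetic RBMs on $n$-vertex bipartite graphs of maximum degree at most $d$ with $|\beta_G(e)|\le\beta$ and $|h_G(v,i)|\le h$ for all $e,v,i$. An Ising field is consistent if either $h_G(v,1)\ge0,h_G(v,2)=0$ for all $v$, or $h_G(v,2)\ge0,h_G(v,1)=0$ for all $v$; otherwise inconsistent. The $\varepsilon$-identity testing problem for a family $\mathcal{M}$: given an explicit $M\in\mathcal{M}$ and sample access to $\mu_{M^*}$ for an unknown $M^*\in\mathcal{M}$, distinguish with probability at least $3/4$ between $\mu_M=\mu_{M^*}$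 and $\|\mu_M-\mu_{M^*}\|_{\mathrm{TV}}\ge1-\varepsilon$. #BIS is the problem of counting independent sets in a bipartite graph; an FPRAS for a quantity $Z$ outputs, for any $\rho>0$, $\hat Z$ with $e^{-\rho}Z\le\hat Z\le e^{\rho}Z$ with probability at least $3/4$ in time polynomial in the input size and $1/\rho$. *)

theory Defs
  imports
    "HOL-Probability.Probability"
    "HOL-Library.Landau_Symbols"
    "HOL-Library.Ramsey"
    "HOL-Computational_Algebra.Polynomial"
begin

section \<open>Polynomial time: Jones's WHILE language with coin flips and a sample oracle\<close>

text \<open>
  All data are binary trees. A step executes one command, and the only test is whether a tree
  is \<open>Leaf\<close>; with trees stored as shared graphs every step has constant cost on a
  pointer machine, so polynomially many steps are the same as polynomial time on a Turing machine
  (N. D. Jones, \<^emph>\<open>Computability and Complexity from a Programming Perspective\<close>). There is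
  deliberately no equality test on trees and no arithmetic on unboundedly large atoms.
\<close>

datatype data = Leaf | Node data data

primrec left :: "data \<Rightarrow> data" where
  "left Leaf = Leaf"
| "left (Node a b) = a"

primrec right :: "data \<Rightarrow> data" where
  "right Leaf = Leaf"
| "right (Node a b) = b"

type_synonym store = "nat \<Rightarrow> data"

datatype expr = Var nat | LeafE | NodeE expr expr | LeftE expr | RightE expr

primrec eval_expr :: "expr \<Rightarrow> store \<Rightarrow> data" where
  "eval_expr (Var x) s = s x"
| "eval_expr LeafE s = Leaf"
| "eval_expr (NodeE e f) s = Node (eval_expr e s) (eval_expr f s)"
| "eval_expr (LeftE e) s = left (eval_expr e s)"
| "eval_expr (RightE e) s = right (eval_expr e s)"

datatype com =
    Skip
  | Assign nat expr
  | Seq com com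
  | If expr com com
  | While expr com
  | Flip nat
  | Sample nat

definition enc_bool :: "bool \<Rightarrow> data" where
  "enc_bool b = (if b then Node Leaf Leaf else Leaf)"

text \<open>
  \<open>D\<close> is the distribution of the sample oracle. \<open>Skip\<close> is the halted program; it steps to itself.
\<close>

primrec step :: "data pmf \<Rightarrow> com \<Rightarrow> store \<Rightarrow> (com \<times> store) pmf" where
  "step D Skip s = return_pmf (Skip, s)"
| "step D (Assign x e) s = return_pmf (Skip, s(x := eval_expr e s))"
| "step D (Seq c1 c2) s =
     (if c1 = Skip then return_pmf (c2, s)
      else map_pmf (\<lambda>(c, s'). (Seq c c2, s')) (step D c1 s))"
| "step D (If e c1 c2) s = return_pmf (if eval_expr e s \<noteq> Leaf then c1 else c2, s)"
| "step D (While e c) s =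
     return_pmf (if eval_expr e s \<noteq> Leaf then Seq c (While e c) else Skip, s)"
| "step D (Flip x) s = map_pmf (\<lambda>b. (Skip, s(x := enc_bool b))) (bernoulli_pmf (1/2))"
| "step D (Sample x) s = map_pmf (\<lambda>t. (Skip, s(x := t))) D"

text \<open>Variable 0 holds the input initially and the output finally.\<close>

primrec exec :: "data pmf \<Rightarrow> com \<Rightarrow> data \<Rightarrow> nat \<Rightarrow> (com \<times> store) pmf" where
  "exec D c inp 0 = return_pmf (c, (\<lambda>_. Leaf)(0 := inp))"
| "exec D c inp (Suc t) = bind_pmf (exec D c inp t) (\<lambda>(c', s). step D c' s)"

definition halts_within :: "data pmf \<Rightarrow> com \<Rightarrow> data \<Rightarrow> nat \<Rightarrow> bool" where
  "halts_within D c inp t \<longleftrightarrow> (\<forall>(c', s) \<in> set_pmf (exec D c inp t). c' = Skip)"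

definition output_dist :: "data pmf \<Rightarrow> com \<Rightarrow> data \<Rightarrow> nat \<Rightarrow> data pmf" where
  "output_dist D c inp t = map_pmf (\<lambda>(c', s). s 0) (exec D c inp t)"

section \<open>Encodings\<close>

definition enc_list :: "('a \<Rightarrow> data) \<Rightarrow> 'a list \<Rightarrow> data" where
  "enc_list f xs = foldr (\<lambda>x. Node (f x)) xs Leaf"

definition enc_unary :: "nat \<Rightarrow> data" where
  "enc_unary n = enc_list (\<lambda>_. Leaf) (replicate n ())"

fun enc_nat :: "nat \<Rightarrow> data" where
  "enc_nat n = (if n = 0 then Leaf else Node (enc_bool (odd n)) (enc_nat (n div 2)))"

declare enc_nat.simps [simp del]

definition enc_rat :: "rat \<Rightarrow> data" where
  "enc_rat r = (case quotient_of r of (a, b) \<Rightarrow>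
     Node (enc_bool (a < 0)) (Node (enc_nat (nat \<bar>a\<bar>)) (enc_nat (nat b))))"

section \<open>Graphs and the problem \#BIS\<close>

definition simple_graph :: "'a set \<Rightarrow> 'a set set \<Rightarrow> bool" where
  "simple_graph V E \<longleftrightarrow> finite V \<and> E \<subseteq> [V]\<^bsup>2\<^esup>"

definition bipartite :: "'a set \<Rightarrow> 'a set set \<Rightarrow> bool" where
  "bipartite V E \<longleftrightarrow>
     (\<exists>A B. A \<union> B = V \<and> A \<inter> B = {} \<and> (\<forall>e\<in>E. \<exists>a\<in>A. \<exists>b\<in>B. e = {a, b}))"

definition degree_in :: "'a set set \<Rightarrow> 'a \<Rightarrow> nat" where
  "degree_in E v = card {e \<in> E. v \<in> e}"

text \<open>A graph on \<open>{..<n}\<close> is presented as \<open>n\<close> together with a list of its edges.\<close>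

type_synonym graph_desc = "nat \<times> (nat \<times> nat) list"

definition desc_edges :: "graph_desc \<Rightarrow> nat set set" where
  "desc_edges G = (\<lambda>(u, v). {u, v}) ` set (snd G)"

definition BIS_instances :: "graph_desc set" where
  "BIS_instances = {G. distinct (map (\<lambda>(u, v). {u, v}) (snd G)) \<and>
     simple_graph {..<fst G} (desc_edges G) \<and> bipartite {..<fst G} (desc_edges G)}"

definition num_indep_sets :: "graph_desc \<Rightarrow> nat" where
  "num_indep_sets G = card {I. I \<subseteq> {..<fst G} \<and> indep I (desc_edges G)}"

definition enc_graph :: "graph_desc \<Rightarrow> data" where
  "enc_graph G =
     Node (enc_unary (fst G)) (enc_list (\<lambda>(u, v). Node (enc_nat u) (enc_nat v)) (snd G))"

text \<open>
  The estimate is returned as a fraction, not necessarily in lowest terms. No sample oracle is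
  available: the command \<open>Sample\<close> always returns \<open>Leaf\<close>.
\<close>

definition admits_FPRAS :: "'a set \<Rightarrow> ('a \<Rightarrow> data) \<Rightarrow> ('a \<Rightarrow> real) \<Rightarrow> bool" where
  "admits_FPRAS X enc Z \<longleftrightarrow>
     (\<exists>c (p :: nat poly). \<forall>x\<in>X. \<forall>\<rho>::rat. \<rho> > 0 \<longrightarrow>
        (let inp = Node (enc x) (enc_rat \<rho>);
             t = poly p (size inp + nat \<lceil>1 / \<rho>\<rceil>);
             D = return_pmf Leaf
         in halts_within D c inp t \<and>
            measure_pmf.prob (output_dist D c inp t)
              {y. \<exists>a b. b > 0 \<and> y = Node (enc_nat a) (enc_nat b) \<and>
                    exp (- real_of_rat \<rho>) * Z x \<le> real a / real b \<and>
                    real a / real b \<le> exp (real_of_rat \<rho>) * Z x} \<ge> 3/4))"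

definition BIS_admits_FPRAS :: bool where
  "BIS_admits_FPRAS \<longleftrightarrow> admits_FPRAS BIS_instances enc_graph (\<lambda>G. real (num_indep_sets G))"

section \<open>Potts models, the Ising model and RBMs\<close>

record potts =
  vertices :: "nat set"
  edges :: "nat set set"
  edge_weight :: "nat set \<Rightarrow> real"
  ext_field :: "nat \<Rightarrow> nat \<Rightarrow> real"

text \<open>Configurations are extensional, so that they correspond to maps from the vertices to the spins.\<close>

definition configs :: "nat \<Rightarrow> potts \<Rightarrow> (nat \<Rightarrow> nat) set" where
  "configs q M = vertices M \<rightarrow>\<^sub>E {1..q}"

definition gibbs_weight :: "potts \<Rightarrow> (nat \<Rightarrow> nat) \<Rightarrow> real" where
  "gibbs_weight M \<sigma> =
     exp ((\<Sum>e\<in>edges M. edge_weight M e * of_bool (\<forall>u\<in>e. \<forall>v\<in>e. \<sigma> u = \<sigma> v))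
          + (\<Sum>v\<in>vertices M. ext_field M v (\<sigma> v)))"

definition partition_function :: "nat \<Rightarrow> potts \<Rightarrow> real" where
  "partition_function q M = (\<Sum>\<sigma>\<in>configs q M. gibbs_weight M \<sigma>)"

definition gibbs :: "nat \<Rightarrow> potts \<Rightarrow> (nat \<Rightarrow> nat) pmf" where
  "gibbs q M = embed_pmf
     (\<lambda>\<sigma>. of_bool (\<sigma> \<in> configs q M) * gibbs_weight M \<sigma> / partition_function q M)"

lemma pmf_gibbs:
  assumes "finite (vertices M)" "q \<ge> 1"
  shows "pmf (gibbs q M) \<sigma> =
    of_bool (\<sigma> \<in> configs q M) * gibbs_weight M \<sigma> / partition_function q M"
proof -
  let ?f = "\<lambda>\<sigma>. of_bool (\<sigma> \<in> configs q M) * gibbs_weight M \<sigma> / partition_function q M"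
  have fin: "finite (configs q M)"
    unfolding configs_def using assms by (intro finite_PiE) auto
  have ne: "configs q M \<noteq> {}"
    unfolding configs_def using assms by (auto simp: PiE_eq_empty_iff)
  have pos: "partition_function q M > 0"
    unfolding partition_function_def by (intro sum_pos fin ne) (simp add: gibbs_weight_def)
  have nonneg: "?f \<sigma> \<ge> 0" for \<sigma>
    using pos by (simp add: gibbs_weight_def)
  have "(\<integral>\<^sup>+ \<sigma>. ennreal (?f \<sigma>) \<partial>count_space UNIV)
      = (\<integral>\<^sup>+ \<sigma>. ennreal (?f \<sigma>) \<partial>count_space (configs q M))"
    by (rule nn_integral_count_space_eq) auto
  also have "\<dots> = (\<Sum>\<sigma>\<in>configs q M. ennreal (?f \<sigma>))"
    by (rule nn_integral_count_space_finite[OF fin])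
  also have "\<dots> = ennreal (\<Sum>\<sigma>\<in>configs q M. ?f \<sigma>)"
    by (intro sum_ennreal nonneg)
  also have "(\<Sum>\<sigma>\<in>configs q M. ?f \<sigma>) = (\<Sum>\<sigma>\<in>configs q M. gibbs_weight M \<sigma>) / partition_function q M"
    by (simp add: sum_divide_distrib)
  also have "\<dots> = 1"
    using pos by (simp add: partition_function_def)
  finally have "(\<integral>\<^sup>+ \<sigma>. ennreal (?f \<sigma>) \<partial>count_space UNIV) = 1"
    by simp
  then show ?thesis
    unfolding gibbs_def by (intro pmf_embed_pmf nonneg)
qed

abbreviation ising_gibbs :: "potts \<Rightarrow> (nat \<Rightarrow> nat) pmf" where
  "ising_gibbs \<equiv> gibbs 2"

definition is_RBM :: "potts \<Rightarrow> bool" where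
  "is_RBM M \<longleftrightarrow> simple_graph (vertices M) (edges M) \<and> bipartite (vertices M) (edges M)"

definition ferromagnetic :: "potts \<Rightarrow> bool" where
  "ferromagnetic M \<longleftrightarrow> (\<forall>e\<in>edges M. edge_weight M e > 0)"

definition consistent_field :: "potts \<Rightarrow> bool" where
  "consistent_field M \<longleftrightarrow>
     (\<forall>v\<in>vertices M. ext_field M v 1 \<ge> 0 \<and> ext_field M v 2 = 0) \<or>
     (\<forall>v\<in>vertices M. ext_field M v 2 \<ge> 0 \<and> ext_field M v 1 = 0)"

definition ferro_RBMs :: "nat \<Rightarrow> nat \<Rightarrow> real \<Rightarrow> real \<Rightarrow> potts set" where
  "ferro_RBMs n d \<beta> h = {M. vertices M = {..<n} \<and> is_RBM M \<and> ferromagnetic M \<and>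
     (\<forall>v\<in>vertices M. degree_in (edges M) v \<le> d) \<and>
     (\<forall>e\<in>edges M. \<bar>edge_weight M e\<bar> \<le> \<beta>) \<and>
     (\<forall>v\<in>vertices M. \<forall>i\<in>{1..2}. \<bar>ext_field M v i\<bar> \<le> h)}"

definition inconsistent_ferro_RBMs :: "nat \<Rightarrow> nat \<Rightarrow> real \<Rightarrow> real \<Rightarrow> potts set" where
  "inconsistent_ferro_RBMs n d \<beta> h = {M \<in> ferro_RBMs n d \<beta> h. \<not> consistent_field M}"

section \<open>Identity testing\<close>

definition tv_dist :: "'a pmf \<Rightarrow> 'a pmf \<Rightarrow> real" where
  "tv_dist \<mu> \<nu> = (SUP A. \<bar>measure_pmf.prob \<mu> A - measure_pmf.prob \<nu> A\<bar>)"

text \<open>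
  An explicitly given Ising model is a finite object, so its parameters are rational: the number of
  vertices, the list of weighted edges, and for each vertex the two values of the field.
\<close>

type_synonym ising_desc = "nat \<times> (nat \<times> nat \<times> rat) list \<times> (rat \<times> rat) list"

definition describes :: "ising_desc \<Rightarrow> potts \<Rightarrow> bool" where
  "describes X M \<longleftrightarrow> (case X of (n, es, fs) \<Rightarrow>
     vertices M = {..<n} \<and>
     distinct (map (\<lambda>(u, v, w). {u, v}) es) \<and>
     edges M = (\<lambda>(u, v, w). {u, v}) ` set es \<and>
     (\<forall>(u, v, w)\<in>set es. edge_weight M {u, v} = real_of_rat w) \<and>
     length fs = n \<and>
     (\<forall>v<n. ext_field M v 1 = real_of_rat (fst (fs ! v)) \<and>
            ext_field M v 2 = real_of_rat (snd (fs ! v))))"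

definition enc_ising :: "ising_desc \<Rightarrow> data" where
  "enc_ising X = (case X of (n, es, fs) \<Rightarrow>
     Node (enc_unary n)
       (Node (enc_list (\<lambda>(u, v, w). Node (enc_nat u) (Node (enc_nat v) (enc_rat w))) es)
             (enc_list (\<lambda>(a, b). Node (enc_rat a) (enc_rat b)) fs)))"

definition enc_config :: "nat \<Rightarrow> (nat \<Rightarrow> nat) \<Rightarrow> data" where
  "enc_config n \<sigma> = enc_list (\<lambda>v. enc_nat (\<sigma> v)) [0..<n]"

text \<open>
  The tester \<open>c\<close> is one program for all \<open>n\<close>; it receives the visible model \<open>M\<close> as input and
  samples of the hidden model \<open>M'\<close> from the oracle. As the families are indexed by \<open>n\<close> and all
  side conditions on their parameters are asymptotic, it only has to succeed for all large \<open>n\<close>.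
\<close>

definition solves_identity_testing :: "real \<Rightarrow> (nat \<Rightarrow> potts set) \<Rightarrow> com \<Rightarrow> nat poly \<Rightarrow> bool" where
  "solves_identity_testing \<epsilon> \<M> c p \<longleftrightarrow>
     (\<forall>\<^sub>F n in sequentially. \<forall>M\<in>\<M> n. \<forall>M'\<in>\<M> n. \<forall>X. describes X M \<longrightarrow>
        (let inp = enc_ising X;
             t = poly p (size inp);
             D = map_pmf (enc_config n) (ising_gibbs M')
         in halts_within D c inp t \<and>
            (ising_gibbs M = ising_gibbs M' \<longrightarrow>
               measure_pmf.prob (output_dist D c inp t) {enc_bool True} \<ge> 3/4) \<and>
            (tv_dist (ising_gibbs M) (ising_gibbs M') \<ge> 1 - \<epsilon> \<longrightarrow>
               measure_pmf.prob (output_dist D c inp t) {enc_bool False} \<ge> 3/4)))"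

definition poly_time_identity_testable :: "real \<Rightarrow> (nat \<Rightarrow> potts set) \<Rightarrow> bool" where
  "poly_time_identity_testable \<epsilon> \<M> \<longleftrightarrow> (\<exists>c p. solves_identity_testing \<epsilon> \<M> c p)"

end

theory Submission
  imports Defs
begin

text \<open>
  A polynomial time tester \<open>c\<close> is turned into an FPRAS for \#BIS by counting through self-reducibility.

  \<^item> \<^emph>\<open>Model.\<close> A graph relation \<open>Rel\<close> between \<open>A\<close> left and \<open>C\<close> right
  objects is realised by a ferromagnetic RBM: every object is a long wire of blobs of \<open>b\<close> vertices joined by
  complete bipartite graphs of weight \<open>w\<close>, and every related pair meets in many connecting edges whose fields
  penalise only the pattern ``left spin 2, right spin 1''. By a Peierls argument on each wire the Gibbs measure is,
  up to a factor \<open>1 + o(1)\<close>, uniform on coherent configurations that violate no related pair; these correspond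
  to independent sets of a bipartite graph.

  \<^item> \<^emph>\<open>Phase coexistence.\<close> Take \<open>k\<close> copies of the bipartite double cover of the instance and \<open>m\<close> further right objects
  related to all left objects. The configurations with no left object number \<open>2\<^sup>C\<close> and are trivial to sample;
  the others number about \<open>Z\<^bsup>2k\<^esup>\<close> times an explicit power of 2 that decreases with \<open>m\<close>.
  Feeding the tester fake samples from the trivial phase makes it accept when the trivial phase dominates and reject when it is
  negligible (there the hidden model is the one with all pairs related), so the switching value of \<open>m\<close>
  determines \<open>Z\<^bsup>2k\<^esup>\<close> up to a polynomial factor and \<open>Z\<close> up to a factor close to 1.

  \<^item> \<^emph>\<open>Unknown parameters.\<close> The functions \<open>d\<close> and \<open>\<beta>\<close> need not be computable, so all
  polynomially many guesses for \<open>b\<close> and \<open>w\<close> are tried. For each guess a random independent set is built vertex by vertex with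
  probabilities \<open>j / Q\<close>; the product \<open>J\<close> of the numerators used satisfies \<open>E[Q\<^sup>N / J] \<le> Z\<close>
  whatever the guess, hence no guess overestimates \<open>Z\<close> by much (Markov), and the correct guess does not underestimate it.

  \<^item> \<^emph>\<open>Programs.\<close> \<open>PT E e f\<close> and \<open>RT E e f\<close> say that a (random) function is
  computed in polynomial time by a WHILE program between the given encodings; they are closed under composition, branching and bounded loops.
\<close>

section \<open>Polynomial-time programs\<close>

text \<open>The reduction must imitate samples of a measure that it cannot sample. It can sample the
  trivial phase; if that phase carries a fraction \<kappa> of the measure, true samples dominate the
  fakes pointwise up to \<kappa>, and \<open>t\<close> steps lose at most \<kappa>^t. So \<kappa> >=
  1 - 1/(5 S^e) outlasts a clock of S^e. The switching value then locates the ratio of the phases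
  only up to a factor polynomial in S. This is why k = S^4 copies are taken: the
  \<open>2 * kk S\<close>-th root turns S^(e+2) into at most exp(1/S^3), which is small enough for S
  rounds of self-reduction. The weights may be tiny; only weight times degree is large. Blobs
  collect it: a contour mark costs at least \<open>w * b / 4\<close>. Fields are at most 1, so each
  pair is connected at \<open>r = S\<close> positions, which makes a violated pair cost at least 2
  S. With n = n1^(q+1) vertices and blobs of size up to n1^q, all degrees up to n^\<theta> with
  \<theta> <= q/(q+1) are covered; spare slots become isolated vertices, so that n does not depend
  on the guess. The double cover is used because it can be built without knowing the bipartition of
  the instance.\<close>

primrec run :: "data pmf => com \<times> store => nat => (com \<times> store) pmf" where
 "run D cs 0 = return_pmf cs"
| "run D cs (Suc t) = bind_pmf (step D (fst cs) (snd cs)) (%cs'. run D cs' t)"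

lemma run_add: "run D cs (a + b) = bind_pmf (run D cs a) (%cs'. run D cs' b)"
 by (induction a arbitrary: cs) (simp_all add: bind_return_pmf bind_assoc_pmf)

lemma run_Suc_last: "run D cs (Suc t) = bind_pmf (run D cs t) (%(c, s). step D c s)"
proof -
 have "run D cs (Suc t) = bind_pmf (run D cs t) (%cs'. run D cs' 1)"
  using run_add[of D cs t 1] by (simp only: Suc_eq_plus1)
 then show ?thesis by (simp add: case_prod_beta' bind_return_pmf')
qed

text \<open>\<open>exec\<close> adds the last step and always starts from an input;
  \<open>run\<close> peels off the first step from an arbitrary command and store, the form that
  inductions over program structure need.\<close>

lemma exec_eq_run: "exec D c inp t = run D (c, (%_. Leaf)(0 := inp)) t"
 by (induction t) (simp_all only: exec.simps run_Suc_last run.simps(1))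

lemma run_Skip [simp]: "run D (Skip, s) t = return_pmf (Skip, s)"
 by (induction t) (simp_all add: bind_return_pmf)

text \<open>The oracle is frozen to \<open>Leaf\<close>, as in the notion of an FPRAS. Since
  \<open>Skip\<close> steps to itself, the equation says that every run has halted by time
  \<open>t\<close>, and \<open>t\<close> may be enlarged freely.\<close>

definition evals :: "com => store => store pmf => nat => bool" where
 "evals c s \<mu> t \<longleftrightarrow> run (return_pmf Leaf) (c, s) t = map_pmf (Pair Skip) \<mu>"

lemma evals_mono: "evals c s \<mu> t ==> t <= t' ==> evals c s \<mu> t'"
 using run_add[of "return_pmf Leaf" "(c, s)" t "t' - t"]
 by (simp add: evals_def bind_map_pmf) (simp add: map_pmf_def)

lemma evals_Skip: "evals Skip s (return_pmf s) t"
 by (simp add: evals_def)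

lemma evals_Suc:
 assumes "step (return_pmf Leaf) c s = return_pmf (c', s')" "evals c' s' \<mu> t"
 shows "evals c s \<mu> (Suc t)"
 using assms by (simp add: evals_def bind_return_pmf)

text \<open>Raise both times to the maximum. Uniqueness lets the final law of a second command be
  picked by Hilbert choice separately for each intermediate store, as \<open>bind_obs\<close>
  does.\<close>

lemma evals_unique:
 assumes "evals c s \<mu> t" "evals c s \<nu> t'"
 shows "\<mu> = \<nu>"
proof -
 have "map_pmf (Pair Skip) \<mu> = map_pmf (Pair Skip) \<nu>"
  using evals_mono[OF assms(1), of "max t t'"] evals_mono[OF assms(2), of "max t t'"]
  by (simp add: evals_def)
 then have "map_pmf snd (map_pmf (Pair Skip) \<mu>) = map_pmf snd (map_pmf (Pair Skip) \<nu>)" by simp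
 then show ?thesis by (simp add: map_pmf_comp)
qed

lemma evals_Assign: "evals (Assign x e) s (return_pmf (s(x := eval_expr e s))) 1"
 by (simp add: evals_def bind_return_pmf)

lemma evals_Flip: "evals (Flip x) s (map_pmf (%b. s(x := enc_bool b)) (bernoulli_pmf (1/2))) 1"
 by (simp add: evals_def bind_return_pmf' map_pmf_comp)

lemma evals_If:
 assumes "evals (if eval_expr e s ~= Leaf then c1 else c2) s \<mu> t"
 shows "evals (If e c1 c2) s \<mu> (Suc t)"
 using assms by (intro evals_Suc) auto

lemma evals_Seq_Skip: "evals c s \<mu> t ==> evals (Seq Skip c) s \<mu> (Suc t)"
 by (rule evals_Suc[where c' = c and s' = s]) auto

text \<open>Induction on the time of the first command; time 0 means that it is already
  \<open>Skip\<close> with a point mass. The extra 1 is the step that discards a finished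
  \<open>Skip\<close>.\<close>

lemma evals_Seq:
 assumes "evals c1 s \<mu> t1" and "\<And>s'. s' \<in> set_pmf \<mu> ==> evals c2 s' (\<nu> s') t2"
 shows "evals (Seq c1 c2) s (bind_pmf \<mu> \<nu>) (t1 + t2 + 1)"
 using assms
proof (induction t1 arbitrary: c1 s \<mu>)
 case 0
 have "map_pmf (Pair Skip) \<mu> = return_pmf (c1, s)" using 0(1) by (simp add: evals_def)
 then have "set_pmf (map_pmf (Pair Skip) \<mu>) = {(c1, s)}" by simp
 then have im: "Pair Skip ` set_pmf \<mu> = {(c1, s)}" by simp
 then have c: "c1 = Skip" by blast
 have "set_pmf \<mu> \<subseteq> {s}" using im by blast
 then have m: "\<mu> = return_pmf s" by (simp add: set_pmf_subset_singleton)
 have "evals c2 s (\<nu> s) t2" by (rule 0(2)) (simp add: m)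
 then show ?case using evals_Seq_Skip by (simp add: m c bind_return_pmf)
next
 case (Suc t1)
 show ?case
 proof (cases "c1 = Skip")
  case True
  have "\<mu> = return_pmf s" using evals_unique[OF Suc(2)] evals_Skip True by blast
  moreover from this have "evals c2 s (\<nu> s) t2" by (intro Suc(3)) simp
  ultimately show ?thesis
   by (auto simp: True bind_return_pmf intro!: evals_mono[OF evals_Seq_Skip])
 next
  case False
  let ?D = "return_pmf Leaf :: data pmf"
  let ?st = "step ?D c1 s"
  define \<kappa> where "\<kappa> cs = map_pmf snd (run ?D cs t1)" for cs
  have e: "map_pmf (Pair Skip) \<mu> = bind_pmf ?st (%cs. run ?D cs t1)"
   using Suc(2) by (simp add: evals_def)
  have k: "evals (fst cs) (snd cs) (\<kappa> cs) t1" if "cs \<in> set_pmf ?st" for cs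
  proof -
   have "set_pmf (run ?D cs t1) \<subseteq> set_pmf (map_pmf (Pair Skip) \<mu>)" unfolding e using that by auto
   then have "map_pmf (%x. (Skip, snd x)) (run ?D cs t1) = map_pmf (%x. x) (run ?D cs t1)"
    by (intro map_pmf_cong) auto
   then show ?thesis by (simp add: evals_def \<kappa>_def map_pmf_comp)
  qed
  have mu: "\<mu> = bind_pmf ?st \<kappa>"
  proof -
   have "\<mu> = map_pmf snd (map_pmf (Pair Skip) \<mu>)" by (simp add: map_pmf_comp)
   then show ?thesis unfolding e by (simp add: map_bind_pmf \<kappa>_def[abs_def])
  qed
  have r: "run ?D (Seq (fst cs) c2, snd cs) (t1 + t2 + 1) = map_pmf (Pair Skip) (bind_pmf (\<kappa> cs) \<nu>)"
   if "cs \<in> set_pmf ?st" for cs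
   unfolding evals_def[symmetric]
   by (rule Suc(1)[OF k[OF that]], rule Suc(3)) (use that in \<open>auto simp: mu\<close>)
  have "run ?D (Seq c1 c2, s) (Suc t1 + t2 + 1) =
   bind_pmf ?st (%cs. run ?D (Seq (fst cs) c2, snd cs) (t1 + t2 + 1))"
   using False by (simp add: bind_map_pmf case_prod_beta)
  also have "\<dots> = bind_pmf ?st (%cs. map_pmf (Pair Skip) (bind_pmf (\<kappa> cs) \<nu>))"
   by (intro bind_pmf_cong refl r)
  also have "\<dots> = map_pmf (Pair Skip) (bind_pmf \<mu> \<nu>)"
   by (simp add: mu map_bind_pmf bind_assoc_pmf)
  finally show ?thesis by (simp add: evals_def)
 qed
qed

lemma evals_Seq_Assign:
 assumes "evals c2 (s(x := eval_expr e s)) \<mu> t"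
 shows "evals (Seq (Assign x e) c2) s \<mu> (t + 2)"
proof -
 have "evals (Seq (Assign x e) c2) s (bind_pmf (return_pmf (s(x := eval_expr e s))) (%_. \<mu>)) (1 + t + 1)"
  by (rule evals_Seq[OF evals_Assign]) (use assms in auto)
 then show ?thesis by (simp add: bind_return_pmf)
qed

lemma evals_While_False: "eval_expr e s = Leaf ==> evals (While e c) s (return_pmf s) 1"
 by (simp add: evals_def bind_return_pmf)

lemma evals_While_True:
 assumes "eval_expr e s ~= Leaf" "evals c s \<mu> t1" "\<And>s'. s' \<in> set_pmf \<mu> ==> evals (While e c) s' (\<nu> s') t2"
 shows "evals (While e c) s (bind_pmf \<mu> \<nu>) (t1 + t2 + 2)"
proof -
 have "evals (Seq c (While e c)) s (bind_pmf \<mu> \<nu>) (t1 + t2 + 1)"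
  by (rule evals_Seq[OF assms(2,3)])
 then have "evals (While e c) s (bind_pmf \<mu> \<nu>) (Suc (t1 + t2 + 1))"
  by (rule evals_Suc[rotated]) (use assms(1) in auto)
 then show ?thesis by simp
qed

section \<open>Polynomial-time functions and their closure properties\<close>

lemma poly_nat_mono: "a <= b ==> poly p a <= poly p (b::nat)"
 by (induction p) (auto intro!: add_mono mult_mono)

text \<open>An environment \<open>E\<close> assigns to a value its data together with a numeric
  allowance. The allowance counts as input size, so that a bound may depend polynomially on 1/\<rho>
  although \<rho> itself is written in binary.\<close>

definition ms :: "('a => nat \<times> data) => 'a => nat" where
 "ms E a = fst (E a) + size (snd (E a))"

definition enc_pair :: "('a => data) => ('b => data) => 'a \<times> 'b => data" where
 "enc_pair e e' z = Node (e (fst z)) (e' (snd z))"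

text \<open>A typing context: each bound variable is appended on the right of the nested pair, and
  the allowance is inherited. Over \<open>env_pair (env_pair E e1) e2\<close> the accesses
  \<open>fst (fst z)\<close>, \<open>snd (fst z)\<close> and \<open>snd z\<close> are the context,
  the first and the second variable.\<close>

definition env_pair :: "('a => nat \<times> data) => ('b => data) => 'a \<times> 'b => nat \<times> data" where
 "env_pair E e z = (fst (E (fst z)), Node (snd (E (fst z))) (e (snd z)))"

text \<open>Registers from \<open>B\<close> on are preserved, which makes them safe storage for
  surrounding code. All registers except 0 may initially hold anything, so that programs can be run
  one after another and in loops.\<close>

definition comp_by :: "com => nat => ('a => nat) => ('a => data) => ('b => data) => ('a => 'b pmf) => bool" where
 "comp_by c B T e e' f \<longleftrightarrow> (\<forall>a s. s 0 = e a -->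
  (\<exists>\<mu>. evals c s \<mu> (T a) \<and> map_pmf (%s. s 0) \<mu> = map_pmf e' (f a) \<and>
     (\<forall>s'\<in>set_pmf \<mu>. \<forall>v\<ge>B. s' v = s v)))"

lemma comp_by_mono: "comp_by c B T e e' f ==> B <= B' ==> (\<And>a. T a <= T' a) ==> comp_by c B' T' e e' f"
 unfolding comp_by_def by (blast intro: evals_mono order_trans)

text \<open>The output size is bounded separately because time does not control it:
  \<open>Assign 0 (NodeE (Var 0) (Var 0))\<close> doubles a tree in a single step. This clause is
  what makes polynomial time compose.\<close>

definition RT :: "('a => nat \<times> data) => ('b => data) => ('a => 'b pmf) => bool" where
 "RT E e' f \<longleftrightarrow> (\<exists>c B p. comp_by c B (%a. poly p (ms E a)) (snd \<circ> E) e' f \<and>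
  (\<forall>a. \<forall>b\<in>set_pmf (f a). size (e' b) <= poly p (ms E a)))"

abbreviation PT :: "('a => nat \<times> data) => ('b => data) => ('a => 'b) => bool" where
 "PT E e' f \<equiv> RT E e' (%a. return_pmf (f a))"

lemma RT_E:
 assumes "RT E e' f"
 obtains c B p where "comp_by c B (%a. poly p (ms E a)) (snd \<circ> E) e' f" "B > 0"
  "\<And>a b. b\<in>set_pmf (f a) ==> size (e' b) <= poly p (ms E a)"
proof -
 obtain c B p where c: "comp_by c B (%a. poly p (ms E a)) (snd \<circ> E) e' f"
  and s: "\<And>a b. b\<in>set_pmf (f a) ==> size (e' b) <= poly p (ms E a)"
  using assms unfolding RT_def by blast
 have "comp_by c (Suc B) (%a. poly p (ms E a)) (snd \<circ> E) e' f"
  by (rule comp_by_mono[OF c]) auto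
 then show ?thesis using that s by blast
qed

lemma PT_E:
 assumes "PT E e' f"
 obtains c B p where "comp_by c B (%a. poly p (ms E a)) (snd \<circ> E) e' (%a. return_pmf (f a))" "B > 0"
  "\<And>a. size (e' (f a)) <= poly p (ms E a)"
 by (rule RT_E[OF assms]) (rule that, auto)

lemma RT_I:
 assumes "comp_by c B T (snd \<circ> E) e' f" "\<And>a. T a <= poly p (ms E a)"
  "\<And>a b. b\<in>set_pmf (f a) ==> size (e' b) <= poly q (ms E a)"
 shows "RT E e' f"
 unfolding RT_def
proof (intro exI conjI allI ballI)
 show "comp_by c B (%a. poly (p + q) (ms E a)) (snd \<circ> E) e' f"
  by (rule comp_by_mono[OF assms(1)]) (use assms(2) in \<open>auto intro: trans_le_add1\<close>)
 show "size (e' b) <= poly (p + q) (ms E a)" if "b \<in> set_pmf (f a)" for a b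
  using assms(3)[OF that] by auto
qed

lemma PT_size:
 assumes "RT E e' f"
 shows "\<exists>p. \<forall>a. \<forall>b\<in>set_pmf (f a). size (e' b) <= poly p (ms E a)"
 using assms unfolding RT_def by blast

lemma ms_env_pair: "ms (env_pair E e) (a, b) = ms E a + size (e b) + 1"
 by (simp add: ms_def env_pair_def)

text \<open>Composition when the first command is known only through an observation
  \<open>obs\<close> of its final store, distributed like the encoded \<open>M\<close>. Stores with
  equal observation may differ in scratch registers, hence one law \<open>N s'\<close> per store;
  what they share, the law of \<open>h\<close>, is factored through the observed data by
  \<open>K\<close>.\<close>

lemma bind_obs:
 assumes obs: "map_pmf obs \<mu> = map_pmf e M"
  and ex: "\<And>b s'. b \<in> set_pmf M ==> s' \<in> set_pmf \<mu> ==> obs s' = e b ==>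
   \<exists>\<nu>. evals c2 s' \<nu> t2 \<and> map_pmf h \<nu> = map_pmf e2 (g b) \<and> (\<forall>s''\<in>set_pmf \<nu>. P s'')"
 obtains N where "\<And>s'. s' \<in> set_pmf \<mu> ==> evals c2 s' (N s') t2"
  "map_pmf h (bind_pmf \<mu> N) = map_pmf e2 (bind_pmf M g)" "\<forall>s''\<in>set_pmf (bind_pmf \<mu> N). P s''"
proof -
 define N where "N s' = (SOME \<nu>. evals c2 s' \<nu> t2)" for s'
 have wit: "\<exists>b\<in>set_pmf M. obs s' = e b" if "s' \<in> set_pmf \<mu>" for s'
 proof -
  have "obs s' \<in> set_pmf (map_pmf e M)" unfolding obs[symmetric] using that by auto
  then show ?thesis by auto
 qed
 have N: "evals c2 s' (N s') t2 \<and> map_pmf h (N s') = map_pmf e2 (g b) \<and> (\<forall>s''\<in>set_pmf (N s'). P s'')"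
  if s': "b \<in> set_pmf M" "s' \<in> set_pmf \<mu>" "obs s' = e b" for b s'
 proof -
  obtain \<nu> where \<nu>: "evals c2 s' \<nu> t2" "map_pmf h \<nu> = map_pmf e2 (g b)" "\<forall>s''\<in>set_pmf \<nu>. P s''"
   using ex[OF s'] by blast
  have "evals c2 s' (N s') t2" unfolding N_def using \<nu>(1) by (rule someI)
  then have "N s' = \<nu>" using \<nu>(1) evals_unique by blast
  then show ?thesis using \<nu> by blast
 qed
 have wit2: "\<exists>s'. s' \<in> set_pmf \<mu> \<and> obs s' = e b" if "b \<in> set_pmf M" for b
 proof -
  have "e b \<in> set_pmf (map_pmf obs \<mu>)" unfolding obs using that by auto
  then show ?thesis by auto
 qed
 define K where "K d = map_pmf h (N (SOME s'. s' \<in> set_pmf \<mu> \<and> obs s' = d))" for d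
 have K: "K (e b) = map_pmf e2 (g b)" if "b \<in> set_pmf M" for b
  using someI_ex[OF wit2[OF that]] N[OF that] unfolding K_def by simp
 have NK: "map_pmf h (N s') = K (obs s')" if "s' \<in> set_pmf \<mu>" for s'
  using wit[OF that] K N that by auto
 have "map_pmf h (bind_pmf \<mu> N) = bind_pmf \<mu> (%s'. K (obs s'))"
  unfolding map_bind_pmf by (intro bind_pmf_cong refl NK)
 also have "\<dots> = bind_pmf (map_pmf obs \<mu>) K" by (simp add: bind_map_pmf)
 also have "\<dots> = bind_pmf M (%b. map_pmf e2 (g b))"
  unfolding obs bind_map_pmf by (intro bind_pmf_cong refl K)
 finally have 1: "map_pmf h (bind_pmf \<mu> N) = map_pmf e2 (bind_pmf M g)" by (simp add: map_bind_pmf)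
 have 2: "evals c2 s' (N s') t2" "\<forall>s''\<in>set_pmf (N s'). P s''" if "s' \<in> set_pmf \<mu>" for s'
  using wit[OF that] N that by blast+
 have 3: "\<forall>s''\<in>set_pmf (bind_pmf \<mu> N). P s''"
  using 2(2) by simp
 show ?thesis by (rule that[OF 2(1) 1 3])
qed

lemma evals_Seq_obs:
 assumes "evals c1 s \<mu> t1" "map_pmf obs \<mu> = map_pmf e M"
  and "\<And>b s'. b \<in> set_pmf M ==> s' \<in> set_pmf \<mu> ==> obs s' = e b ==>
   \<exists>\<nu>. evals c2 s' \<nu> t2 \<and> map_pmf h \<nu> = map_pmf e2 (g b) \<and> (\<forall>s''\<in>set_pmf \<nu>. P s'')"
 shows "\<exists>\<nu>. evals (Seq c1 c2) s \<nu> (t1 + t2 + 1) \<and> map_pmf h \<nu> = map_pmf e2 (bind_pmf M g) \<and>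
  (\<forall>s''\<in>set_pmf \<nu>. P s'')"
proof -
 obtain N where N: "\<And>s'. s' \<in> set_pmf \<mu> ==> evals c2 s' (N s') t2"
  "map_pmf h (bind_pmf \<mu> N) = map_pmf e2 (bind_pmf M g)" "\<forall>s''\<in>set_pmf (bind_pmf \<mu> N). P s''"
  using bind_obs[where ?c2.0 = c2 and h = h and ?e2.0 = e2 and g = g and P = P and ?t2.0 = t2, OF assms(2,3)] by blast
 have "evals (Seq c1 c2) s (bind_pmf \<mu> N) (t1 + t2 + 1)" by (rule evals_Seq[OF assms(1) N(1)])
 then show ?thesis using N(2,3) by blast
qed

lemma comp_by_apply:
 assumes "comp_by c B T e e' f" "s 0 = e a"
 shows "\<exists>\<mu>. evals c s \<mu> (T a) \<and> map_pmf (%s. s 0) \<mu> = map_pmf e' (f a) \<and>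
     (\<forall>s'\<in>set_pmf \<mu>. \<forall>v\<ge>B. s' v = s v)"
 using assms unfolding comp_by_def by blast

primrec datae :: "data => expr" where
 "datae Leaf = LeafE"
| "datae (Node a b) = NodeE (datae a) (datae b)"

lemma eval_datae [simp]: "eval_expr (datae d) s = d"
 by (induction d) auto

lemma PT_expr:
 assumes "\<And>a s. s 0 = snd (E a) ==> eval_expr x s = e' (f a)" "\<And>a. size (e' (f a)) <= poly p (ms E a)"
 shows "PT E e' f"
proof (rule RT_I[where c = "Assign 0 x" and B = 1 and T = "%_. 1" and p = 1 and q = p])
 show "comp_by (Assign 0 x) 1 (%_. 1) (snd \<circ> E) e' (%a. return_pmf (f a))"
  unfolding comp_by_def
 proof (intro allI impI)
  fix a and s :: store assume s: "s 0 = (snd \<circ> E) a"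
  have "eval_expr x s = e' (f a)" using assms(1) s by simp
  then show "\<exists>\<mu>. evals (Assign 0 x) s \<mu> 1 \<and> map_pmf (%s. s 0) \<mu> = map_pmf e' (return_pmf (f a)) \<and>
      (\<forall>s'\<in>set_pmf \<mu>. \<forall>v\<ge>1. s' v = s v)"
   by (intro exI[of _ "return_pmf (s(0 := eval_expr x s))"]) (use evals_Assign[of 0 x s] in auto)
 qed
qed (use assms(2) in auto)

lemma PT_const: "PT E e' (%_. c)"
 by (rule PT_expr[where x = "datae (e' c)" and p = "[:size (e' c):]"]) auto

lemma PT_id: "PT (env_pair E e) e snd"
 by (rule PT_expr[where x = "RightE (Var 0)" and p = "[:0, 1:]"]) (auto simp: env_pair_def ms_def)

text \<open>The input is parked in register \<open>B\<close>, beyond the reach of both programs, and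
  later paired with the intermediate result to form the environment of the second program.\<close>

lemma RT_bind:
 assumes "RT E e1 f" "RT (env_pair E e1) e2 (%z. g (fst z) (snd z))"
 shows "RT E e2 (%x. bind_pmf (f x) (g x))"
proof -
 obtain c1 B1 p1 where 1: "comp_by c1 B1 (%a. poly p1 (ms E a)) (snd \<circ> E) e1 f" "B1 > 0"
  "\<And>a b. b\<in>set_pmf (f a) ==> size (e1 b) <= poly p1 (ms E a)"
  by (rule RT_E[OF assms(1)]) (rule that, auto)
 obtain c2 B2 p2 where 2: "comp_by c2 B2 (%a. poly p2 (ms (env_pair E e1) a)) (snd \<circ> env_pair E e1) e2 (%z. g (fst z) (snd z))" "B2 > 0"
  "\<And>a b. b\<in>set_pmf (g (fst a) (snd a)) ==> size (e2 b) <= poly p2 (ms (env_pair E e1) a)"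
  by (rule RT_E[OF assms(2)]) (rule that, auto)
 define B where "B = max B1 B2"
 have B: "B1 <= B" "B2 <= B" by (auto simp: B_def)
 define q where "q = pcompose p2 ([:1, 1:] + p1)"
 have q: "poly p2 (ms (env_pair E e1) (a, b)) <= poly q (ms E a)" if "b \<in> set_pmf (f a)" for a b
  using 1(3)[OF that] unfolding q_def poly_pcompose by (intro poly_nat_mono) (simp add: ms_env_pair)
 define c where "c = Seq (Assign B (Var 0)) (Seq c1 (Seq (Assign 0 (NodeE (Var B) (Var 0))) c2))"
 define T where "T a = poly p1 (ms E a) + poly q (ms E a) + 5" for a
 have "comp_by c (Suc B) T (snd \<circ> E) e2 (%x. bind_pmf (f x) (g x))"
  unfolding comp_by_def
 proof (intro allI impI)
  fix a and s :: store assume s: "s 0 = (snd \<circ> E) a"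
  define s1 where "s1 = s(B := s 0)"
  have s10: "s1 0 = (snd \<circ> E) a" using s 1(2) by (simp add: s1_def)
  obtain \<mu> where \<mu>: "evals c1 s1 \<mu> (poly p1 (ms E a))" "map_pmf (%s. s 0) \<mu> = map_pmf e1 (f a)"
   "\<forall>s'\<in>set_pmf \<mu>. \<forall>v\<ge>B1. s' v = s1 v" using comp_by_apply[OF 1(1), where s = s1, OF s10] by blast
  have "\<exists>\<nu>. evals (Seq c1 (Seq (Assign 0 (NodeE (Var B) (Var 0))) c2)) s1 \<nu>
    (poly p1 (ms E a) + (poly q (ms E a) + 2) + 1) \<and>
   map_pmf (%s. s 0) \<nu> = map_pmf e2 (bind_pmf (f a) (g a)) \<and> (\<forall>s''\<in>set_pmf \<nu>. \<forall>v\<ge>Suc B. s'' v = s v)"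
  proof (rule evals_Seq_obs[OF \<mu>(1,2)])
   fix b s' assume b: "b \<in> set_pmf (f a)" "s' \<in> set_pmf \<mu>" "s' 0 = e1 b"
   define s2 where "s2 = s'(0 := eval_expr (NodeE (Var B) (Var 0)) s')"
   have "s' B = snd (E a)" using \<mu>(3) b(2) s by (auto simp: B_def s1_def)
   then have s20: "s2 0 = (snd \<circ> env_pair E e1) (a, b)" using b by (simp add: s2_def env_pair_def)
   obtain \<nu> where \<nu>: "evals c2 s2 \<nu> (poly p2 (ms (env_pair E e1) (a, b)))"
    "map_pmf (%s. s 0) \<nu> = map_pmf e2 (g a b)" "\<forall>s''\<in>set_pmf \<nu>. \<forall>v\<ge>B2. s'' v = s2 v"
    using comp_by_apply[OF 2(1), where s = s2, OF s20] by auto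
   have "evals (Seq (Assign 0 (NodeE (Var B) (Var 0))) c2) s' \<nu> (poly q (ms E a) + 2)"
    by (rule evals_Seq_Assign) (use evals_mono[OF \<nu>(1) q[OF b(1)]] in \<open>simp add: s2_def\<close>)
   moreover have "\<forall>s''\<in>set_pmf \<nu>. \<forall>v\<ge>Suc B. s'' v = s v"
   proof (intro ballI allI impI)
    fix s'' v assume v: "s'' \<in> set_pmf \<nu>" "Suc B <= v"
    have "s'' v = s2 v" using \<nu>(3) v B by simp
    also have "\<dots> = s1 v" using \<mu>(3) b(2) v B by (simp add: s2_def)
    finally show "s'' v = s v" using v by (simp add: s1_def)
   qed
   ultimately show "\<exists>\<nu>. evals (Seq (Assign 0 (NodeE (Var B) (Var 0))) c2) s' \<nu> (poly q (ms E a) + 2) \<and>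
     map_pmf (%s. s 0) \<nu> = map_pmf e2 (g a b) \<and> (\<forall>s''\<in>set_pmf \<nu>. \<forall>v\<ge>Suc B. s'' v = s v)"
    using \<nu>(2) by blast
  qed
  then obtain \<nu> where "evals (Seq c1 (Seq (Assign 0 (NodeE (Var B) (Var 0))) c2)) s1 \<nu> (poly p1 (ms E a) + (poly q (ms E a) + 2) + 1)"
   and n: "map_pmf (%s. s 0) \<nu> = map_pmf e2 (bind_pmf (f a) (g a)) \<and> (\<forall>s''\<in>set_pmf \<nu>. \<forall>v\<ge>Suc B. s'' v = s v)" by blast
  then have "evals c s \<nu> (poly p1 (ms E a) + (poly q (ms E a) + 2) + 1 + 2)"
   unfolding c_def by (intro evals_Seq_Assign) (simp add: s1_def)
  then have "evals c s \<nu> (T a)" unfolding T_def by (rule evals_mono) auto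
  then show "\<exists>\<mu>. evals c s \<mu> (T a) \<and> map_pmf (%s. s 0) \<mu> = map_pmf e2 (f a \<bind> g a) \<and> (\<forall>s'\<in>set_pmf \<mu>. \<forall>v\<ge>Suc B. s' v = s v)"
   using n by blast
 qed
 then show ?thesis
 proof (rule RT_I[where p = "p1 + q + 5" and q = q])
  show "size (e2 b) <= poly q (ms E a)" if ba: "b \<in> set_pmf (f a \<bind> g a)" for a b
  proof -
   obtain y where y: "y \<in> set_pmf (f a)" "b \<in> set_pmf (g a y)" using ba by auto
   show ?thesis using 2(3)[of b "(a, y)"] q[OF y(1)] y(2) by simp
  qed
 qed (simp add: T_def)
qed

text \<open>The language can only test for \<open>Leaf\<close>, so a condition enters as a computed
  value \<open>F\<close> whose encoding is \<open>Leaf\<close> exactly when \<open>P\<close> holds;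
  the other branch may still use that value.\<close>

lemma RT_branch:
 assumes F: "PT E eF F"
  and f: "RT E e' f" and g: "RT (env_pair E eF) e' (%z. g (fst z) (snd z))"
  and leaf: "\<And>x. eF (F x) = Leaf \<longleftrightarrow> P x"
 shows "RT E e' (%x. if P x then f x else g x (F x))"
proof -
 obtain c0 B0 p0 where 0: "comp_by c0 B0 (%a. poly p0 (ms E a)) (snd \<circ> E) eF (%a. return_pmf (F a))" "B0 > 0"
  "\<And>a. size (eF (F a)) <= poly p0 (ms E a)"
  by (rule PT_E[OF F]) (rule that, auto)
 obtain c1 B1 p1 where 1: "comp_by c1 B1 (%a. poly p1 (ms E a)) (snd \<circ> E) e' f" "B1 > 0"
  "\<And>a b. b\<in>set_pmf (f a) ==> size (e' b) <= poly p1 (ms E a)"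
  by (rule RT_E[OF f]) (rule that, auto)
 obtain c2 B2 p2 where 2: "comp_by c2 B2 (%a. poly p2 (ms (env_pair E eF) a)) (snd \<circ> env_pair E eF) e' (%z. g (fst z) (snd z))" "B2 > 0"
  "\<And>a b. b\<in>set_pmf (g (fst a) (snd a)) ==> size (e' b) <= poly p2 (ms (env_pair E eF) a)"
  by (rule RT_E[OF g]) (rule that, auto)
 define B where "B = Max {B0, B1, B2}"
 have B: "B0 <= B" "B1 <= B" "B2 <= B" by (auto simp: B_def)
 define q where "q = pcompose p2 ([:1, 1:] + p0)"
 have q: "poly p2 (ms (env_pair E eF) (a, F a)) <= poly q (ms E a)" for a
  using 0(3) unfolding q_def poly_pcompose by (intro poly_nat_mono) (simp add: ms_env_pair)
 define c where "c = Seq (Assign B (Var 0)) (Seq c0 (If (Var 0)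
  (Seq (Assign 0 (NodeE (Var B) (Var 0))) c2) (Seq (Assign 0 (Var B)) c1)))"
 define t where "t a = poly p1 (ms E a) + poly q (ms E a) + 3" for a
 have "comp_by c (Suc B) (%a. poly p0 (ms E a) + t a + 3) (snd \<circ> E) e' (%x. if P x then f x else g x (F x))"
  unfolding comp_by_def
 proof (intro allI impI)
  fix a and s :: store assume s: "s 0 = (snd \<circ> E) a"
  define s1 where "s1 = s(B := s 0)"
  have s10: "s1 0 = (snd \<circ> E) a" using s 0(2) B by (simp add: s1_def)
  obtain \<mu> where \<mu>: "evals c0 s1 \<mu> (poly p0 (ms E a))" "map_pmf (%s. s 0) \<mu> = map_pmf eF (return_pmf (F a))"
   "\<forall>s'\<in>set_pmf \<mu>. \<forall>v\<ge>B0. s' v = s1 v" using comp_by_apply[OF 0(1), where s = s1, OF s10] by blast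
  let ?if = "If (Var 0) (Seq (Assign 0 (NodeE (Var B) (Var 0))) c2) (Seq (Assign 0 (Var B)) c1)"
  have "\<exists>\<nu>. evals (Seq c0 ?if) s1 \<nu> (poly p0 (ms E a) + t a + 1) \<and>
   map_pmf (%s. s 0) \<nu> = map_pmf e' (bind_pmf (return_pmf (F a)) (%d. if P a then f a else g a d)) \<and>
   (\<forall>s''\<in>set_pmf \<nu>. \<forall>v\<ge>Suc B. s'' v = s v)"
  proof (rule evals_Seq_obs[OF \<mu>(1,2)])
   fix b s' assume b: "b \<in> set_pmf (return_pmf (F a))" "s' \<in> set_pmf \<mu>" "s' 0 = eF b"
   have bF: "b = F a" using b by simp
   have sB: "s' B = snd (E a)" using \<mu>(3) b(2) s B by (auto simp: s1_def)
   have fr: "s' v = s v" if "v >= Suc B" for v using \<mu>(3) b(2) B that by (auto simp: s1_def)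
   show "\<exists>\<nu>. evals ?if s' \<nu> (t a) \<and> map_pmf (%s. s 0) \<nu> = map_pmf e' (if P a then f a else g a b) \<and>
      (\<forall>s''\<in>set_pmf \<nu>. \<forall>v\<ge>Suc B. s'' v = s v)"
   proof (cases "P a")
    case True
    define s2 where "s2 = s'(0 := eval_expr (Var B) s')"
    have s20: "s2 0 = (snd \<circ> E) a" using sB by (simp add: s2_def)
    obtain \<nu> where \<nu>: "evals c1 s2 \<nu> (poly p1 (ms E a))"
     "map_pmf (%s. s 0) \<nu> = map_pmf e' (f a)" "\<forall>s''\<in>set_pmf \<nu>. \<forall>v\<ge>B1. s'' v = s2 v"
     using comp_by_apply[OF 1(1), where s = s2, OF s20] by auto
    have "evals (Seq (Assign 0 (Var B)) c1) s' \<nu> (poly p1 (ms E a) + 2)"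
     by (rule evals_Seq_Assign) (use \<nu>(1) in \<open>simp add: s2_def\<close>)
    then have "evals ?if s' \<nu> (Suc (poly p1 (ms E a) + 2))"
     using b(3) bF leaf True by (intro evals_If) simp
    then have "evals ?if s' \<nu> (t a)" by (rule evals_mono) (simp add: t_def)
    then show ?thesis using \<nu>(2,3) fr B True by (intro exI[of _ \<nu>]) (auto simp: s2_def)
   next
    case False
    define s2 where "s2 = s'(0 := eval_expr (NodeE (Var B) (Var 0)) s')"
    have s20: "s2 0 = (snd \<circ> env_pair E eF) (a, b)" using b sB by (simp add: s2_def env_pair_def)
    obtain \<nu> where \<nu>: "evals c2 s2 \<nu> (poly p2 (ms (env_pair E eF) (a, b)))"
     "map_pmf (%s. s 0) \<nu> = map_pmf e' (g a b)" "\<forall>s''\<in>set_pmf \<nu>. \<forall>v\<ge>B2. s'' v = s2 v"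
     using comp_by_apply[OF 2(1), where s = s2, OF s20] by auto
    have "evals (Seq (Assign 0 (NodeE (Var B) (Var 0))) c2) s' \<nu> (poly q (ms E a) + 2)"
     by (rule evals_Seq_Assign) (use evals_mono[OF \<nu>(1)[unfolded bF] q] in \<open>simp add: s2_def\<close>)
    then have "evals ?if s' \<nu> (Suc (poly q (ms E a) + 2))"
     using b(3) bF leaf False by (intro evals_If) simp
    then have "evals ?if s' \<nu> (t a)" by (rule evals_mono) (simp add: t_def)
    then show ?thesis using \<nu>(2,3) fr B False by (intro exI[of _ \<nu>]) (auto simp: s2_def)
   qed
  qed
  then obtain \<nu> where "evals (Seq c0 ?if) s1 \<nu> (poly p0 (ms E a) + t a + 1)"
   and n: "map_pmf (%s. s 0) \<nu> = map_pmf e' (if P a then f a else g a (F a)) \<and> (\<forall>s''\<in>set_pmf \<nu>. \<forall>v\<ge>Suc B. s'' v = s v)"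
   by (auto simp: bind_return_pmf)
  then have "evals c s \<nu> (poly p0 (ms E a) + t a + 1 + 2)"
   unfolding c_def by (intro evals_Seq_Assign) (simp add: s1_def)
  then show "\<exists>\<mu>. evals c s \<mu> (poly p0 (ms E a) + t a + 3) \<and> map_pmf (%s. s 0) \<mu> = map_pmf e' (if P a then f a else g a (F a)) \<and>
    (\<forall>s'\<in>set_pmf \<mu>. \<forall>v\<ge>Suc B. s' v = s v)"
   using n by (intro exI[of _ \<nu>]) (simp add: numeral_3_eq_3)
 qed
 then show ?thesis
 proof (rule RT_I[where p = "p0 + (p1 + q + 3) + 3" and q = "p1 + q"])
  show "size (e' b) <= poly (p1 + q) (ms E a)" if "b \<in> set_pmf (if P a then f a else g a (F a))" for a b
   using that 1(3)[of b a] 2(3)[of b "(a, F a)"] q[of a] by (cases "P a") simp_all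
 qed (simp add: t_def)
qed

primrec foldM :: "('b => 'c => 'c pmf) => 'b list => 'c => 'c pmf" where
 "foldM g [] a = return_pmf a"
| "foldM g (y # ys) a = bind_pmf (g y a) (foldM g ys)"

lemma enc_list_simps [simp]: "enc_list e [] = Leaf" "enc_list e (x # xs) = Node (e x) (enc_list e xs)"
 by (auto simp: enc_list_def)

text \<open>Registers \<open>B\<close>, \<open>B + 1\<close> and \<open>B + 2\<close> hold the
  context, the remaining list and the accumulator. The invariant \<open>R\<close> on the
  accumulators that occur bounds the time of one round; 8 is the bookkeeping of a round, and the
  final 1 is the failing loop test.\<close>

lemma evals_foldM_loop:
 fixes E :: "'a => nat \<times> data" and e1 :: "'b => data" and e2 :: "'c => data" and g :: "'a => 'b => 'c => 'c pmf"
 assumes c: "comp_by c B T (snd \<circ> env_pair (env_pair E e1) e2) e2 (%z. g (fst (fst z)) (snd (fst z)) (snd z))"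
  and B: "B > 0"
  and w: "w = While (Var (B + 1)) (Seq (Assign 0 (NodeE (NodeE (Var B) (LeftE (Var (B + 1)))) (Var (B + 2))))
    (Seq c (Seq (Assign (B + 2) (Var 0)) (Assign (B + 1) (RightE (Var (B + 1)))))))"
  and T: "\<And>y acc. y \<in> set ys ==> R acc ==> T ((x, y), acc) <= t"
  and R: "\<And>i acc'. acc' \<in> set_pmf (foldM (g x) (take i ys) acc) ==> R acc'"
  and s: "s B = snd (E x)" "s (B + 1) = enc_list e1 ys" "s (B + 2) = e2 acc"
 shows "\<exists>\<nu>. evals w s \<nu> (length ys * (t + 8) + 1) \<and> map_pmf (%s. s (B + 2)) \<nu> = map_pmf e2 (foldM (g x) ys acc) \<and>
  (\<forall>s''\<in>set_pmf \<nu>. \<forall>v\<ge>B + 3. s'' v = s v)"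
 using T R s
proof (induction ys arbitrary: acc s)
 case Nil
 then show ?case unfolding w
  by (intro exI[of _ "return_pmf s"]) (auto simp: evals_While_False[simplified])
next
 case (Cons y ys)
 let ?body = "Seq (Assign 0 (NodeE (NodeE (Var B) (LeftE (Var (B + 1)))) (Var (B + 2))))
    (Seq c (Seq (Assign (B + 2) (Var 0)) (Assign (B + 1) (RightE (Var (B + 1))))))"
 define s1 where "s1 = s(0 := Node (Node (snd (E x)) (e1 y)) (e2 acc))"
 have s10: "s1 0 = (snd \<circ> env_pair (env_pair E e1) e2) ((x, y), acc)" by (simp add: s1_def env_pair_def)
 have Racc: "R acc" using Cons.prems(2)[of _ 0] by simp
 have tb: "T ((x, y), acc) <= t" using Cons.prems(1) Racc by simp
 obtain \<mu> where \<mu>: "evals c s1 \<mu> (T ((x, y), acc))" "map_pmf (%s. s 0) \<mu> = map_pmf e2 (g x y acc)"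
   "\<forall>s'\<in>set_pmf \<mu>. \<forall>v\<ge>B. s' v = s1 v" using comp_by_apply[OF c, where a = "((x, y), acc)" and s = s1, OF s10] by auto
 have "\<exists>\<nu>. evals (Seq c (Seq (Assign (B + 2) (Var 0)) (Assign (B + 1) (RightE (Var (B + 1)))))) s1 \<nu> (t + 3 + 1) \<and>
   map_pmf (%s. s (B + 2)) \<nu> = map_pmf e2 (bind_pmf (g x y acc) return_pmf) \<and>
   (\<forall>s''\<in>set_pmf \<nu>. s'' B = snd (E x) \<and> s'' (B + 1) = enc_list e1 ys \<and> (\<forall>v\<ge>B + 3. s'' v = s v))"
 proof (rule evals_Seq_obs[OF evals_mono[OF \<mu>(1) tb] \<mu>(2)])
  fix b s' assume b: "s' \<in> set_pmf \<mu>" "s' 0 = e2 b"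
  define s2 where "s2 = s'(B + 2 := s' 0)"
  define s3 where "s3 = s2(B + 1 := right (s2 (B + 1)))"
  have "evals (Seq (Assign (B + 2) (Var 0)) (Assign (B + 1) (RightE (Var (B + 1))))) s' (return_pmf s3) (1 + 2)"
   unfolding s3_def s2_def using evals_Assign[of "B + 1" "RightE (Var (B + 1))" "s'(B + 2 := s' 0)"]
   by (intro evals_Seq_Assign) simp
  moreover have "s3 (B + 2) = e2 b" by (simp add: s3_def s2_def b)
  moreover have "s3 B = snd (E x)" "s3 (B + 1) = enc_list e1 ys" "\<forall>v\<ge>B + 3. s3 v = s v"
   using \<mu>(3) b(1) Cons.prems(3-5) B by (auto simp: s3_def s2_def s1_def)
  ultimately show "\<exists>\<nu>. evals (Seq (Assign (B + 2) (Var 0)) (Assign (B + 1) (RightE (Var (B + 1))))) s' \<nu> 3 \<and>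
   map_pmf (%s. s (B + 2)) \<nu> = map_pmf e2 (return_pmf b) \<and>
   (\<forall>s''\<in>set_pmf \<nu>. s'' B = snd (E x) \<and> s'' (B + 1) = enc_list e1 ys \<and> (\<forall>v\<ge>B + 3. s'' v = s v))"
   by (intro exI[of _ "return_pmf s3"]) (auto simp: numeral_3_eq_3)
 qed
 then obtain \<nu> where \<nu>: "evals (Seq c (Seq (Assign (B + 2) (Var 0)) (Assign (B + 1) (RightE (Var (B + 1)))))) s1 \<nu> (t + 3 + 1)"
   "map_pmf (%s. s (B + 2)) \<nu> = map_pmf e2 (g x y acc)"
   "\<forall>s''\<in>set_pmf \<nu>. s'' B = snd (E x) \<and> s'' (B + 1) = enc_list e1 ys \<and> (\<forall>v\<ge>B + 3. s'' v = s v)"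
  by (auto simp: bind_return_pmf')
 have body: "evals ?body s \<nu> (t + 3 + 1 + 2)"
  using \<nu>(1) Cons.prems(3-5) by (intro evals_Seq_Assign) (simp add: s1_def)
 obtain N where N: "\<And>s'. s' \<in> set_pmf \<nu> ==> evals w s' (N s') (length ys * (t + 8) + 1)"
  "map_pmf (%s. s (B + 2)) (bind_pmf \<nu> N) = map_pmf e2 (bind_pmf (g x y acc) (foldM (g x) ys))"
  "\<forall>s''\<in>set_pmf (bind_pmf \<nu> N). \<forall>v\<ge>B + 3. s'' v = s v"
 proof (rule bind_obs[OF \<nu>(2), where ?c2.0 = w and ?t2.0 = "length ys * (t + 8) + 1" and h = "%s. s (B + 2)" and ?e2.0 = e2
    and g = "foldM (g x) ys" and P = "%s''. \<forall>v\<ge>B + 3. s'' v = s v"])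
  fix b s' assume b: "b \<in> set_pmf (g x y acc)" "s' \<in> set_pmf \<nu>" "s' (B + 2) = e2 b"
  have "\<exists>\<nu>a. evals w s' \<nu>a (length ys * (t + 8) + 1) \<and>
    map_pmf (%s. s (B + 2)) \<nu>a = map_pmf e2 (foldM (g x) ys b) \<and> (\<forall>s''\<in>set_pmf \<nu>a. \<forall>v\<ge>B + 3. s'' v = s' v)"
  proof (rule Cons.IH)
   show "R acc'" if "acc' \<in> set_pmf (foldM (g x) (take i ys) b)" for i acc'
    using Cons.prems(2)[of acc' "Suc i"] that b(1) by auto
  qed (use Cons.prems(1) \<nu>(3) b in auto)
  then show "\<exists>\<nu>a. evals w s' \<nu>a (length ys * (t + 8) + 1) \<and>
    map_pmf (%s. s (B + 2)) \<nu>a = map_pmf e2 (foldM (g x) ys b) \<and> (\<forall>s''\<in>set_pmf \<nu>a. \<forall>v\<ge>B + 3. s'' v = s v)"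
   using \<nu>(3) b(2) by auto
 qed blast
 have "evals w s (bind_pmf \<nu> N) (t + 3 + 1 + 2 + (length ys * (t + 8) + 1) + 2)"
  unfolding w by (rule evals_While_True[OF _ body]) (use Cons.prems(4) N(1) in \<open>auto simp: w\<close>)
 then show ?case using N(2,3)
  by (intro exI[of _ "bind_pmf \<nu> N"]) (auto simp: algebra_simps)
qed

lemma size_enc_list_mem: "y \<in> set ys ==> size (e y) < size (enc_list e ys)"
 by (induction ys) auto

lemma length_le_size_enc_list: "length ys <= size (enc_list e ys)"
 by (induction ys) auto

text \<open>A polynomial bound per round would not do, since an accumulator could square its size in
  every round. Hence \<open>bnd\<close> bounds every intermediate accumulator in terms of the
  original input.\<close>

lemma RT_foldM:
 assumes F: "PT E (enc_list e1) F" and A: "PT E e2 A"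
  and g: "RT (env_pair (env_pair E e1) e2) e2 (%z. g (fst (fst z)) (snd (fst z)) (snd z))"
  and bnd: "\<And>x i acc. acc \<in> set_pmf (foldM (g x) (take i (F x)) (A x)) ==> size (e2 acc) <= poly q (ms E x)"
 shows "RT E e2 (%x. foldM (g x) (F x) (A x))"
proof -
 obtain c1 B1 p1 where 1: "comp_by c1 B1 (%a. poly p1 (ms E a)) (snd \<circ> E) (enc_list e1) (%a. return_pmf (F a))" "B1 > 0"
  "\<And>a. size (enc_list e1 (F a)) <= poly p1 (ms E a)"
  by (rule PT_E[OF F]) (rule that, auto)
 obtain c2 B2 p2 where 2: "comp_by c2 B2 (%a. poly p2 (ms E a)) (snd \<circ> E) e2 (%a. return_pmf (A a))" "B2 > 0"
  "\<And>a. size (e2 (A a)) <= poly p2 (ms E a)"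
  by (rule PT_E[OF A]) (rule that, auto)
 obtain c3 B3 p3 where 3: "comp_by c3 B3 (%a. poly p3 (ms (env_pair (env_pair E e1) e2) a))
   (snd \<circ> env_pair (env_pair E e1) e2) e2 (%z. g (fst (fst z)) (snd (fst z)) (snd z))" "B3 > 0"
  "\<And>a b. b\<in>set_pmf (g (fst (fst a)) (snd (fst a)) (snd a)) ==> size (e2 b) <= poly p3 (ms (env_pair (env_pair E e1) e2) a)"
  by (rule RT_E[OF g]) (rule that, auto)
 define B where "B = Max {B1, B2, B3}"
 have B: "B1 <= B" "B2 <= B" "B3 <= B" "B > 0" using 1(2) by (auto simp: B_def)
 have 3: "comp_by c3 B (%a. poly p3 (ms (env_pair (env_pair E e1) e2) a))
   (snd \<circ> env_pair (env_pair E e1) e2) e2 (%z. g (fst (fst z)) (snd (fst z)) (snd z))"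
  by (rule comp_by_mono[OF 3(1)]) (use B in auto)
 define r where "r = pcompose p3 ([:2, 1:] + p1 + q)"
 have r: "poly p3 (ms (env_pair (env_pair E e1) e2) ((x, y), acc)) <= poly r (ms E x)"
  if "y \<in> set (F x)" "size (e2 acc) <= poly q (ms E x)" for x y acc
  using size_enc_list_mem[OF that(1), of e1] 1(3)[of x] that(2) unfolding r_def poly_pcompose
  by (intro poly_nat_mono) (simp add: ms_env_pair)
 define w where "w = While (Var (B + 1)) (Seq (Assign 0 (NodeE (NodeE (Var B) (LeftE (Var (B + 1)))) (Var (B + 2))))
    (Seq c3 (Seq (Assign (B + 2) (Var 0)) (Assign (B + 1) (RightE (Var (B + 1)))))))"
 let ?k3 = "Seq w (Assign 0 (Var (B + 2)))"
 let ?k2 = "Seq c2 (Seq (Assign (B + 2) (Var 0)) ?k3)"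
 let ?k1 = "Seq c1 (Seq (Assign (B + 1) (Var 0)) (Seq (Assign 0 (Var B)) ?k2))"
 define c where "c = Seq (Assign B (Var 0)) ?k1"
 define t3 where "t3 x = poly p1 (ms E x) * (poly r (ms E x) + 8) + 1 + 1 + 1" for x
 define t2 where "t2 x = poly p2 (ms E x) + (t3 x + 2) + 1" for x
 define t1 where "t1 x = poly p1 (ms E x) + (t2 x + 2 + 2) + 1" for x
 have "comp_by c (B + 3) (%x. t1 x + 2) (snd \<circ> E) e2 (%x. foldM (g x) (F x) (A x))"
  unfolding comp_by_def
 proof (intro allI impI)
  fix x and s :: store assume s: "s 0 = (snd \<circ> E) x"
  define s1 where "s1 = s(B := s 0)"
  have s10: "s1 0 = (snd \<circ> E) x" using s B by (simp add: s1_def)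
  obtain \<mu> where \<mu>: "evals c1 s1 \<mu> (poly p1 (ms E x))" "map_pmf (%s. s 0) \<mu> = map_pmf (enc_list e1) (return_pmf (F x))"
   "\<forall>s'\<in>set_pmf \<mu>. \<forall>v\<ge>B1. s' v = s1 v" using comp_by_apply[OF 1(1), where s = s1, OF s10] by blast
  have "\<exists>\<nu>. evals ?k1 s1 \<nu> (t1 x) \<and> map_pmf (%s. s 0) \<nu> = map_pmf e2 (bind_pmf (return_pmf (F x)) (%ys. foldM (g x) ys (A x))) \<and>
   (\<forall>s''\<in>set_pmf \<nu>. \<forall>v\<ge>B + 3. s'' v = s v)"
   unfolding t1_def
  proof (rule evals_Seq_obs[OF \<mu>(1,2)])
   fix ys s' assume b: "ys \<in> set_pmf (return_pmf (F x))" "s' \<in> set_pmf \<mu>" "s' 0 = enc_list e1 ys"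
   have ys: "ys = F x" using b by simp
   have sB: "s' B = snd (E x)" using \<mu>(3) b(2) s B by (auto simp: s1_def)
   define s2 where "s2 = s'(B + 1 := s' 0, 0 := s' B)"
   have s20: "s2 0 = (snd \<circ> E) x" using sB by (simp add: s2_def)
   obtain \<mu>2 where \<mu>2: "evals c2 s2 \<mu>2 (poly p2 (ms E x))" "map_pmf (%s. s 0) \<mu>2 = map_pmf e2 (return_pmf (A x))"
    "\<forall>s'\<in>set_pmf \<mu>2. \<forall>v\<ge>B2. s' v = s2 v" using comp_by_apply[OF 2(1), where s = s2, OF s20] by blast
   have "\<exists>\<nu>. evals ?k2 s2 \<nu> (t2 x) \<and> map_pmf (%s. s 0) \<nu> = map_pmf e2 (bind_pmf (return_pmf (A x)) (%a. foldM (g x) ys a)) \<and>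
    (\<forall>s''\<in>set_pmf \<nu>. \<forall>v\<ge>B + 3. s'' v = s v)"
    unfolding t2_def
   proof (rule evals_Seq_obs[OF \<mu>2(1,2)])
    fix a s'' assume a: "a \<in> set_pmf (return_pmf (A x))" "s'' \<in> set_pmf \<mu>2" "s'' 0 = e2 a"
    have aA: "a = A x" using a by simp
    define s3 where "s3 = s''(B + 2 := s'' 0)"
    have fr2: "s'' v = s2 v" if "v >= B" for v using \<mu>2(3) a(2) B that by simp
    have fr1: "s' v = s1 v" if "v >= B" for v using \<mu>(3) b(2) B that by simp
    have s3: "s3 B = snd (E x)" "s3 (B + 1) = enc_list e1 ys" "s3 (B + 2) = e2 a" "\<forall>v\<ge>B + 3. s3 v = s v"
     using fr2 fr1 a(3) B sB b(3) by (auto simp: s3_def s2_def s1_def)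
    have "\<exists>\<nu>. evals w s3 \<nu> (length ys * (poly r (ms E x) + 8) + 1) \<and>
     map_pmf (%s. s (B + 2)) \<nu> = map_pmf e2 (foldM (g x) ys a) \<and> (\<forall>s''\<in>set_pmf \<nu>. \<forall>v\<ge>B + 3. s'' v = s3 v)"
     by (rule evals_foldM_loop[OF 3 B(4) w_def, where R = "%acc. size (e2 acc) <= poly q (ms E x)"])
      (use r bnd s3 in \<open>auto simp: ys aA\<close>)
    then obtain \<nu> where \<nu>: "evals w s3 \<nu> (length ys * (poly r (ms E x) + 8) + 1)"
     "map_pmf (%s. s (B + 2)) \<nu> = map_pmf e2 (foldM (g x) ys a)" "\<forall>s''\<in>set_pmf \<nu>. \<forall>v\<ge>B + 3. s'' v = s3 v" by blast
    have len: "length ys * (poly r (ms E x) + 8) + 1 <= poly p1 (ms E x) * (poly r (ms E x) + 8) + 1"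
     using length_le_size_enc_list[of ys e1] 1(3)[of x] by (simp add: ys)
    have "\<exists>\<nu>. evals ?k3 s3 \<nu> (t3 x) \<and>
     map_pmf (%s. s 0) \<nu> = map_pmf e2 (bind_pmf (foldM (g x) ys a) return_pmf) \<and> (\<forall>s''\<in>set_pmf \<nu>. \<forall>v\<ge>B + 3. s'' v = s v)"
     unfolding t3_def
    proof (rule evals_Seq_obs[OF evals_mono[OF \<nu>(1) len] \<nu>(2)])
     fix b z assume z: "z \<in> set_pmf \<nu>" "z (B + 2) = e2 b"
     show "\<exists>\<nu>. evals (Assign 0 (Var (B + 2))) z \<nu> 1 \<and> map_pmf (%s. s 0) \<nu> = map_pmf e2 (return_pmf b) \<and>
      (\<forall>s''\<in>set_pmf \<nu>. \<forall>v\<ge>B + 3. s'' v = s v)"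
      using evals_Assign[of 0 "Var (B + 2)" z] z \<nu>(3) s3(4)
      by (intro exI[of _ "return_pmf (z(0 := z (B + 2)))"]) auto
    qed
    then obtain \<xi> where \<xi>: "evals ?k3 s3 \<xi> (t3 x)"
     "map_pmf (%s. s 0) \<xi> = map_pmf e2 (foldM (g x) ys a)" "\<forall>s''\<in>set_pmf \<xi>. \<forall>v\<ge>B + 3. s'' v = s v"
     by (auto simp: bind_return_pmf')
    have "evals (Seq (Assign (B + 2) (Var 0)) ?k3) s'' \<xi> (t3 x + 2)"
     by (rule evals_Seq_Assign) (use \<xi>(1) in \<open>simp add: s3_def\<close>)
    then show "\<exists>\<nu>. evals (Seq (Assign (B + 2) (Var 0)) ?k3) s'' \<nu> (t3 x + 2) \<and>
     map_pmf (%s. s 0) \<nu> = map_pmf e2 (foldM (g x) ys a) \<and> (\<forall>s''\<in>set_pmf \<nu>. \<forall>v\<ge>B + 3. s'' v = s v)"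
     using \<xi> by blast
   qed
   then obtain \<nu> where \<nu>: "evals ?k2 s2 \<nu> (t2 x)" "map_pmf (%s. s 0) \<nu> = map_pmf e2 (foldM (g x) ys (A x))"
    "\<forall>s''\<in>set_pmf \<nu>. \<forall>v\<ge>B + 3. s'' v = s v" by (auto simp: bind_return_pmf)
   have "evals (Seq (Assign (B + 1) (Var 0)) (Seq (Assign 0 (Var B)) ?k2)) s' \<nu> (t2 x + 2 + 2)"
    by (rule evals_Seq_Assign, rule evals_Seq_Assign) (use \<nu>(1) B in \<open>simp add: s2_def\<close>)
   then show "\<exists>\<nu>. evals (Seq (Assign (B + 1) (Var 0)) (Seq (Assign 0 (Var B)) ?k2)) s' \<nu> (t2 x + 2 + 2) \<and>
     map_pmf (%s. s 0) \<nu> = map_pmf e2 (foldM (g x) ys (A x)) \<and> (\<forall>s''\<in>set_pmf \<nu>. \<forall>v\<ge>B + 3. s'' v = s v)"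
    using \<nu> by blast
  qed
  then obtain \<nu> where \<nu>: "evals ?k1 s1 \<nu> (t1 x)" "map_pmf (%s. s 0) \<nu> = map_pmf e2 (foldM (g x) (F x) (A x))"
   "\<forall>s''\<in>set_pmf \<nu>. \<forall>v\<ge>B + 3. s'' v = s v" by (auto simp: bind_return_pmf)
  have "evals c s \<nu> (t1 x + 2)" unfolding c_def
   by (rule evals_Seq_Assign) (use \<nu>(1) in \<open>simp add: s1_def\<close>)
  then show "\<exists>\<mu>. evals c s \<mu> (t1 x + 2) \<and> map_pmf (%s. s 0) \<mu> = map_pmf e2 (foldM (g x) (F x) (A x)) \<and>
    (\<forall>s'\<in>set_pmf \<mu>. \<forall>v\<ge>B + 3. s' v = s v)" using \<nu> by blast
 qed
 then show ?thesis
 proof (rule RT_I[where q = q and p = "p1 + p2 + p1 * (r + 8) + 20"])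
  show "size (e2 b) <= poly q (ms E a)" if "b \<in> set_pmf (foldM (g a) (F a) (A a))" for a b
   using bnd[of b a "length (F a)"] that by simp
 qed (simp add: t1_def t2_def t3_def)
qed

lemma PT_comp2:
 "PT E e1 f ==> RT (env_pair E e1) e2 (%z. g (fst z) (snd z)) ==> RT E e2 (%x. g x (f x))"
 using RT_bind[of E e1 "%x. return_pmf (f x)" e2 g] by (simp add: bind_return_pmf)

text \<open>Change of context by an expression that rearranges the data; the weakenings
  \<open>RT_env\<close> and \<open>RT_lift\<close> are instances.\<close>

lemma RT_pre:
 assumes f: "RT E e f" and x: "\<And>a s. s 0 = snd (E' a) ==> eval_expr x s = snd (E (h a))"
  and m: "\<And>a. ms E (h a) <= ms E' a"
 shows "RT E' e (%a. f (h a))"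
proof -
 obtain c B p where 1: "comp_by c B (%a. poly p (ms E a)) (snd \<circ> E) e f" "B > 0"
  "\<And>a b. b\<in>set_pmf (f a) ==> size (e b) <= poly p (ms E a)"
  by (rule RT_E[OF f]) (rule that, auto)
 have mp: "poly p (ms E (h a)) <= poly p (ms E' a)" for a by (intro poly_nat_mono m)
 have "comp_by (Seq (Assign 0 x) c) B (%a. poly p (ms E' a) + 2) (snd \<circ> E') e (%a. f (h a))"
  unfolding comp_by_def
 proof (intro allI impI)
  fix a and s :: store assume s: "s 0 = (snd \<circ> E') a"
  define s1 where "s1 = s(0 := eval_expr x s)"
  have s10: "s1 0 = (snd \<circ> E) (h a)" using x[of s a] s by (simp add: s1_def)
  obtain \<mu> where \<mu>: "evals c s1 \<mu> (poly p (ms E (h a)))" "map_pmf (%s. s 0) \<mu> = map_pmf e (f (h a))"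
   "\<forall>s'\<in>set_pmf \<mu>. \<forall>v\<ge>B. s' v = s1 v" using comp_by_apply[OF 1(1), where s = s1, OF s10] by blast
  have "evals (Seq (Assign 0 x) c) s \<mu> (poly p (ms E' a) + 2)"
   by (rule evals_Seq_Assign) (use evals_mono[OF \<mu>(1) mp] in \<open>simp add: s1_def\<close>)
  then show "\<exists>\<mu>. evals (Seq (Assign 0 x) c) s \<mu> (poly p (ms E' a) + 2) \<and> map_pmf (%s. s 0) \<mu> = map_pmf e (f (h a)) \<and>
   (\<forall>s'\<in>set_pmf \<mu>. \<forall>v\<ge>B. s' v = s v)"
   using \<mu>(2,3) 1(2) by (intro exI[of _ \<mu>] conjI ballI allI impI) (simp_all add: s1_def)
 qed
 then show ?thesis
 proof (rule RT_I[where p = "p + 2" and q = p])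
  show "size (e b) <= poly p (ms E' a)" if "b \<in> set_pmf (f (h a))" for a b
   using 1(3)[OF that] mp[of a] by simp
 qed simp
qed

lemma RT_env: "RT E e f ==> RT (env_pair E e1) e (%z. f (fst z))"
 by (erule RT_pre[where x = "LeftE (Var 0)"]) (auto simp: env_pair_def ms_def)

lemma PT_post:
 assumes f: "PT E e1 f" and x: "\<And>a s. s 0 = e1 (f a) ==> eval_expr x s = e' (h a)"
  and sz: "\<And>a. size (e' (h a)) <= size (e1 (f a)) + C"
 shows "PT E e' h"
proof -
 obtain c B p where 1: "comp_by c B (%a. poly p (ms E a)) (snd \<circ> E) e1 (%a. return_pmf (f a))" "B > 0"
  "\<And>a. size (e1 (f a)) <= poly p (ms E a)"
  by (rule PT_E[OF f]) (rule that, auto)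
 have "comp_by (Seq c (Assign 0 x)) B (%a. poly p (ms E a) + 1 + 1) (snd \<circ> E) e' (%a. return_pmf (h a))"
  unfolding comp_by_def
 proof (intro allI impI)
  fix a and s :: store assume s: "s 0 = (snd \<circ> E) a"
  obtain \<mu> where \<mu>: "evals c s \<mu> (poly p (ms E a))" "map_pmf (%s. s 0) \<mu> = map_pmf e1 (return_pmf (f a))"
   "\<forall>s'\<in>set_pmf \<mu>. \<forall>v\<ge>B. s' v = s v" using comp_by_apply[OF 1(1), where s = s, OF s] by blast
  have "\<exists>\<nu>. evals (Seq c (Assign 0 x)) s \<nu> (poly p (ms E a) + 1 + 1) \<and>
   map_pmf (%s. s 0) \<nu> = map_pmf e' (bind_pmf (return_pmf (f a)) (%_. return_pmf (h a))) \<and> (\<forall>s'\<in>set_pmf \<nu>. \<forall>v\<ge>B. s' v = s v)"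
  proof (rule evals_Seq_obs[OF \<mu>(1,2)])
   fix b s' assume b: "b \<in> set_pmf (return_pmf (f a))" "s' \<in> set_pmf \<mu>" "s' 0 = e1 b"
   show "\<exists>\<nu>. evals (Assign 0 x) s' \<nu> 1 \<and> map_pmf (%s. s 0) \<nu> = map_pmf e' (return_pmf (h a)) \<and> (\<forall>s'\<in>set_pmf \<nu>. \<forall>v\<ge>B. s' v = s v)"
   proof (intro exI conjI)
    show "evals (Assign 0 x) s' (return_pmf (s'(0 := eval_expr x s'))) 1" by (rule evals_Assign)
    show "map_pmf (%s. s 0) (return_pmf (s'(0 := eval_expr x s'))) = map_pmf e' (return_pmf (h a))"
     using x[of s' a] b by simp
    show "\<forall>z\<in>set_pmf (return_pmf (s'(0 := eval_expr x s'))). \<forall>v\<ge>B. z v = s v"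
     using \<mu>(3) b(2) 1(2) by simp
   qed
  qed
  then show "\<exists>\<mu>. evals (Seq c (Assign 0 x)) s \<mu> (poly p (ms E a) + 1 + 1) \<and>
   map_pmf (%s. s 0) \<mu> = map_pmf e' (return_pmf (h a)) \<and> (\<forall>s'\<in>set_pmf \<mu>. \<forall>v\<ge>B. s' v = s v)"
   by (simp add: bind_return_pmf)
 qed
 then show ?thesis
 proof (rule RT_I[where p = "p + 2" and q = "p + [:C:]"])
  show "size (e' b) <= poly (p + [:C:]) (ms E a)" if "b \<in> set_pmf (return_pmf (h a))" for a b
   using sz[of a] 1(3)[of a] that by simp
 qed simp
qed

lemma PT_recode: "PT E e f ==> (\<And>a. e (f a) = e' (f' a)) ==> PT E e' f'"
 by (erule PT_post[where x = "Var 0" and C = 0]) auto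

lemma PT_pair: "PT E e1 f ==> PT E e2 g ==> PT E (enc_pair e1 e2) (%x. (f x, g x))"
proof -
 assume f: "PT E e1 f" and g: "PT E e2 g"
 have "PT (env_pair (env_pair E e1) e2) (enc_pair e1 e2) (%z. (snd (fst z), snd z))"
  by (rule PT_expr[where x = "NodeE (RightE (LeftE (Var 0))) (RightE (Var 0))" and p = "[:1, 1:]"])
   (auto simp: env_pair_def enc_pair_def ms_def)
 then have "PT (env_pair E e1) (enc_pair e1 e2) (%z. (snd z, g (fst z)))"
  by (rule PT_comp2[OF RT_env[OF g], where g = "%z y. return_pmf (snd z, y)"])
 then show ?thesis by (rule PT_comp2[OF f, where g = "%z y. return_pmf (y, g z)"])
qed

lemma PT_fst: "PT E (enc_pair e1 e2) f ==> PT E e1 (%x. fst (f x))"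
 by (erule PT_post[where x = "LeftE (Var 0)" and C = 0]) (auto simp: enc_pair_def)

lemma PT_snd: "PT E (enc_pair e1 e2) f ==> PT E e2 (%x. snd (f x))"
 by (erule PT_post[where x = "RightE (Var 0)" and C = 0]) (auto simp: enc_pair_def)

lemma enc_bool_simps [simp]: "enc_bool True = Node Leaf Leaf" "enc_bool False = Leaf" "enc_bool b = Leaf \<longleftrightarrow> \<not> b"
 by (auto simp: enc_bool_def)

lemma size_enc_bool: "size (enc_bool b) <= 1" by (simp add: enc_bool_def)

lemma RT_if:
 assumes "PT E enc_bool P" "RT E e f" "RT E e g"
 shows "RT E e (%x. if P x then f x else g x)"
proof -
 have "RT E e (%x. if \<not> P x then g x else f x)"
  by (rule RT_branch[OF assms(1,3), where g = "%x _. f x", OF RT_env[OF assms(2)]]) simp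
 moreover have "(%x. if \<not> P x then g x else f x) = (%x. if P x then f x else g x)" by auto
 ultimately show ?thesis by simp
qed

lemma PT_if:
 assumes "PT E enc_bool P" "PT E e f" "PT E e g"
 shows "PT E e (%x. if P x then f x else g x)"
proof -
 have "(%x. return_pmf (if P x then f x else g x)) = (%x. if P x then return_pmf (f x) else return_pmf (g x))"
  by auto
 then show ?thesis using RT_if[OF assms] by simp
qed

lemma PT_cong: "PT E e f ==> f = g ==> PT E e g" by simp

lemma PT_not: "PT E enc_bool P ==> PT E enc_bool (%x. \<not> P x)"
 by (rule PT_cong[OF PT_if[OF _ PT_const[of _ _ False] PT_const[of _ _ True]]]) (assumption, auto)

lemma PT_conj:
 assumes "PT E enc_bool P" "PT E enc_bool Q"
 shows "PT E enc_bool (%x. P x \<and> Q x)"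
 by (rule PT_cong[OF PT_if[OF assms PT_const[of _ _ False]]]) auto

lemma PT_disj:
 assumes "PT E enc_bool P" "PT E enc_bool Q"
 shows "PT E enc_bool (%x. P x \<or> Q x)"
 by (rule PT_cong[OF PT_if[OF assms(1) PT_const[of _ _ True] assms(2)]]) auto

lemma PT_flip: "RT E enc_bool (%_. bernoulli_pmf (1/2))"
proof (rule RT_I[where c = "Flip 0" and B = 1 and T = "%_. 1" and p = 1 and q = 1])
 show "comp_by (Flip 0) 1 (%_. 1) (snd \<circ> E) enc_bool (%_. bernoulli_pmf (1/2))"
  unfolding comp_by_def
  by (intro allI impI, rule exI, rule conjI[OF evals_Flip]) (auto simp: map_pmf_comp)
qed (auto simp: size_enc_bool[simplified])

lemma RT_case_list:
 assumes F: "PT E (enc_list e1) F" and f: "RT E e f"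
  and g: "RT (env_pair (env_pair E e1) (enc_list e1)) e (%z. g (fst (fst z)) (snd (fst z)) (snd z))"
 shows "RT E e (%x. case F x of [] => f x | y # ys => g x y ys)"
proof -
 obtain c B p where 1: "comp_by c B (%a. poly p (ms (env_pair (env_pair E e1) (enc_list e1)) a))
  (snd \<circ> env_pair (env_pair E e1) (enc_list e1)) e (%z. g (fst (fst z)) (snd (fst z)) (snd z))" "B > 0"
  "\<And>a b. b\<in>set_pmf (g (fst (fst a)) (snd (fst a)) (snd a)) ==> size (e b) <= poly p (ms (env_pair (env_pair E e1) (enc_list e1)) a)"
  by (rule RT_E[OF g]) (rule that, auto)
 have *: "RT (env_pair E (enc_list e1)) e (%z. if snd z = [] then f (fst z) else g (fst z) (hd (snd z)) (tl (snd z)))"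
 proof -
  obtain c1 B1 p1 where 2: "comp_by c1 B1 (%a. poly p1 (ms E a)) (snd \<circ> E) e f" "B1 > 0"
  "\<And>a b. b\<in>set_pmf (f a) ==> size (e b) <= poly p1 (ms E a)"
   by (rule RT_E[OF f]) (rule that, auto)
  define c' where "c' = If (RightE (Var 0)) (Seq (Assign 0 (NodeE (NodeE (LeftE (Var 0)) (LeftE (RightE (Var 0)))) (RightE (RightE (Var 0))))) c)
    (Seq (Assign 0 (LeftE (Var 0))) c1)"
  define T where "T a = poly (p + p1) (ms (env_pair E (enc_list e1)) a) + 3" for a
  have "comp_by c' (max B B1) T (snd \<circ> env_pair E (enc_list e1)) e
   (%z. if snd z = [] then f (fst z) else g (fst z) (hd (snd z)) (tl (snd z)))"
   unfolding comp_by_def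
  proof (intro allI impI)
   fix a and s :: store assume s: "s 0 = (snd \<circ> env_pair E (enc_list e1)) a"
   obtain x l where a: "a = (x, l)" by (cases a)
   show "\<exists>\<mu>. evals c' s \<mu> (T a) \<and>
      map_pmf (%s. s 0) \<mu> = map_pmf e (if snd a = [] then f (fst a) else g (fst a) (hd (snd a)) (tl (snd a))) \<and>
      (\<forall>s'\<in>set_pmf \<mu>. \<forall>v\<ge>max B B1. s' v = s v)"
   proof (cases l)
    case Nil
    define s1 where "s1 = s(0 := left (s 0))"
    have s10: "s1 0 = (snd \<circ> E) x" using s by (simp add: s1_def a env_pair_def)
    obtain \<mu> where \<mu>: "evals c1 s1 \<mu> (poly p1 (ms E x))" "map_pmf (%s. s 0) \<mu> = map_pmf e (f x)"
     "\<forall>s'\<in>set_pmf \<mu>. \<forall>v\<ge>B1. s' v = s1 v" using comp_by_apply[OF 2(1), where s = s1, OF s10] by blast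
    have "evals (Seq (Assign 0 (LeftE (Var 0))) c1) s \<mu> (poly p1 (ms E x) + 2)"
     by (rule evals_Seq_Assign) (use \<mu>(1) in \<open>simp add: s1_def\<close>)
    then have "evals c' s \<mu> (Suc (poly p1 (ms E x) + 2))" unfolding c'_def
     using s by (intro evals_If) (simp add: a Nil env_pair_def)
    moreover have "poly p1 (ms E x) <= poly p1 (ms (env_pair E (enc_list e1)) a)"
     by (intro poly_nat_mono) (simp add: a ms_env_pair)
    ultimately have "evals c' s \<mu> (T a)" by (elim evals_mono) (simp add: T_def)
    then show ?thesis using \<mu> 2(2) by (intro exI[of _ \<mu>]) (auto simp: a Nil s1_def)
   next
    case (Cons y ys)
    define s1 where "s1 = s(0 := Node (Node (left (s 0)) (left (right (s 0)))) (right (right (s 0))))"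
    have s10: "s1 0 = (snd \<circ> env_pair (env_pair E e1) (enc_list e1)) ((x, y), ys)"
     using s by (simp add: s1_def a env_pair_def Cons)
    obtain \<mu> where \<mu>: "evals c s1 \<mu> (poly p (ms (env_pair (env_pair E e1) (enc_list e1)) ((x, y), ys)))"
     "map_pmf (%s. s 0) \<mu> = map_pmf e (g x y ys)"
     "\<forall>s'\<in>set_pmf \<mu>. \<forall>v\<ge>B. s' v = s1 v"
     using comp_by_apply[OF 1(1), where s = s1 and a = "((x, y), ys)", OF s10] by auto
    let ?c = "Seq (Assign 0 (NodeE (NodeE (LeftE (Var 0)) (LeftE (RightE (Var 0)))) (RightE (RightE (Var 0))))) c"
    have "evals ?c s \<mu> (poly p (ms (env_pair (env_pair E e1) (enc_list e1)) ((x, y), ys)) + 2)"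
     by (rule evals_Seq_Assign) (use \<mu>(1) in \<open>simp add: s1_def\<close>)
    then have "evals c' s \<mu> (Suc (poly p (ms (env_pair (env_pair E e1) (enc_list e1)) ((x, y), ys)) + 2))" unfolding c'_def
     using s by (intro evals_If) (simp add: a Cons env_pair_def)
    moreover have "poly p (ms (env_pair (env_pair E e1) (enc_list e1)) ((x, y), ys)) <= poly p (ms (env_pair E (enc_list e1)) a)"
     by (intro poly_nat_mono) (simp add: a Cons ms_env_pair)
    ultimately have "evals c' s \<mu> (T a)" by (elim evals_mono) (simp add: T_def)
    then show ?thesis using \<mu> 1(2) by (intro exI[of _ \<mu>]) (auto simp: a Cons s1_def)
   qed
  qed
  then show ?thesis
  proof (rule RT_I[where p = "p + p1 + 3" and q = "p + p1"])
   fix a b assume b: "b \<in> set_pmf (if snd a = [] then f (fst a) else g (fst a) (hd (snd a)) (tl (snd a)))"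
   obtain x l where a: "a = (x, l)" by (cases a)
   show "size (e b) <= poly (p + p1) (ms (env_pair E (enc_list e1)) a)"
   proof (cases l)
    case Nil
    have "poly p1 (ms E x) <= poly p1 (ms (env_pair E (enc_list e1)) a)"
     by (intro poly_nat_mono) (simp add: a ms_env_pair)
    then show ?thesis using 2(3)[of b x] b by (simp add: a Nil)
   next
    case (Cons y ys)
    have "poly p (ms (env_pair (env_pair E e1) (enc_list e1)) ((x, y), ys)) <= poly p (ms (env_pair E (enc_list e1)) a)"
     by (intro poly_nat_mono) (simp add: a Cons ms_env_pair)
    then show ?thesis using 1(3)[of b "((x, y), ys)"] b by (simp add: a Cons)
   qed
  qed (simp add: T_def)
 qed
 have "RT E e (%x. if F x = [] then f x else g x (hd (F x)) (tl (F x)))"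
  using PT_comp2[OF F, where g = "%x l. if l = [] then f x else g x (hd l) (tl l)", OF *] .
 moreover have "(%x. if F x = [] then f x else g x (hd (F x)) (tl (F x))) = (%x. case F x of [] => f x | y # ys => g x y ys)"
  by (auto split: list.splits)
 ultimately show ?thesis by simp
qed

lemma foldM_return: "foldM (%y a. return_pmf (g y a)) ys a = return_pmf (fold g ys a)"
 by (induction ys arbitrary: a) (simp_all add: bind_return_pmf)

lemma PT_fold:
 assumes "PT E (enc_list e1) F" "PT E e2 A"
  "PT (env_pair (env_pair E e1) e2) e2 (%z. g (fst (fst z)) (snd (fst z)) (snd z))"
  "\<And>x i. size (e2 (fold (g x) (take i (F x)) (A x))) <= poly q (ms E x)"
 shows "PT E e2 (%x. fold (g x) (F x) (A x))"
 using RT_foldM[OF assms(1,2), where g = "%x y a. return_pmf (g x y a)" and q = q] assms(3,4)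
 by (simp add: foldM_return)

lemma fold_size_add:
 assumes "\<And>y acc. y \<in> set ys ==> size (e2 (g y acc)) <= size (e2 acc) + (c::nat)"
 shows "size (e2 (fold g ys a)) <= size (e2 a) + length ys * c"
 using assms
proof (induction ys arbitrary: a)
 case (Cons y ys)
 have "size (e2 (fold g ys (g y a))) <= size (e2 (g y a)) + length ys * c"
  by (rule Cons.IH) (use Cons.prems in auto)
 moreover have "size (e2 (g y a)) <= size (e2 a) + c" by (rule Cons.prems) simp
 ultimately show ?case by simp
qed simp

text \<open>The usual way to meet the size condition of \<open>PT_fold\<close>: the growth per round
  is bounded by a polynomial in context and list element that does not involve the accumulator, so
  the total growth is again polynomial.\<close>

lemma PT_fold_add:
 assumes F: "PT E (enc_list e1) F" and A: "PT E e2 A"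
  and g: "PT (env_pair (env_pair E e1) e2) e2 (%z. g (fst (fst z)) (snd (fst z)) (snd z))"
  and b: "\<And>x y acc. size (e2 (g x y acc)) <= size (e2 acc) + poly q (ms (env_pair E e1) (x, y))"
 shows "PT E e2 (%x. fold (g x) (F x) (A x))"
proof -
 obtain pF where pF: "\<And>x. size (enc_list e1 (F x)) <= poly pF (ms E x)" using PT_size[OF F] by auto
 obtain pA where pA: "\<And>x. size (e2 (A x)) <= poly pA (ms E x)" using PT_size[OF A] by auto
 define r where "r = pcompose q ([:1, 1:] + pF)"
 have "size (e2 (fold (g x) (take i (F x)) (A x))) <= poly (pA + pF * r) (ms E x)" for x i
 proof -
  have "size (e2 (fold (g x) (take i (F x)) (A x))) <= size (e2 (A x)) + length (take i (F x)) * poly r (ms E x)"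
  proof (rule fold_size_add)
   fix y acc assume "y \<in> set (take i (F x))"
   then have "size (e1 y) <= poly pF (ms E x)"
    using size_enc_list_mem[of y "F x" e1] pF[of x] by (auto dest: in_set_takeD)
   then have "poly q (ms (env_pair E e1) (x, y)) <= poly r (ms E x)"
    unfolding r_def poly_pcompose by (intro poly_nat_mono) (simp add: ms_env_pair)
   then show "size (e2 (g x y acc)) <= size (e2 acc) + poly r (ms E x)" using b[of x y acc] by simp
  qed
  also have "\<dots> <= poly pA (ms E x) + poly pF (ms E x) * poly r (ms E x)"
   using pA[of x] pF[of x] length_le_size_enc_list[of "F x" e1] by (intro add_mono mult_mono) auto
  finally show ?thesis by simp
 qed
 then show ?thesis by (intro PT_fold[OF F A g, where q = "pA + pF * r"])
qed

lemma PT_bound: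
 assumes "PT E e' f"
 obtains p where "\<And>a. size (e' (f a)) <= poly p (ms E a)"
 using PT_size[OF assms] by (simp only: set_return_pmf) blast

section \<open>Unary numbers and lists\<close>

abbreviation enc_unit :: "unit => data" where "enc_unit \<equiv> %_. Leaf"

lemma enc_unary_simps [simp]: "enc_unary 0 = Leaf" "enc_unary (Suc n) = Node Leaf (enc_unary n)"
 by (auto simp: enc_unary_def)

lemma size_enc_unary [simp]: "size (enc_unary n) = n"
 by (induction n) auto

lemma enc_unary_Leaf [simp]: "enc_unary n = Leaf \<longleftrightarrow> n = 0"
 by (cases n) auto

lemma enc_list_Leaf [simp]: "enc_list e xs = Leaf \<longleftrightarrow> xs = []"
 by (cases xs) auto

lemma PT_units: "PT E enc_unary F ==> PT E (enc_list enc_unit) (%x. replicate (F x) ())"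
 by (erule PT_recode) (simp add: enc_unary_def)

lemma PT_Suc: "PT E enc_unary F ==> PT E enc_unary (%x. Suc (F x))"
 by (erule PT_post[where x = "NodeE LeafE (Var 0)" and C = 1]) simp_all

lemma PT_pred: "PT E enc_unary F ==> PT E enc_unary (%x. F x - 1)"
proof (erule PT_post[where x = "RightE (Var 0)" and C = 0])
 fix a and s :: store assume "s 0 = enc_unary (F a)"
 then show "eval_expr (RightE (Var 0)) s = enc_unary (F a - 1)" by (cases "F a") auto
qed simp

lemma PT_is_Leaf:
 assumes "PT E e F" "\<And>x. e (F x) = Leaf \<longleftrightarrow> P x"
 shows "PT E enc_bool P"
proof -
 have "RT E enc_bool (%x. if P x then return_pmf True else return_pmf False)"
  by (rule RT_branch[OF assms(1) PT_const, where g = "%_ _. return_pmf False"]) (auto simp: assms(2) PT_const)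
 moreover have "(%x. if P x then return_pmf True else return_pmf False) = (%x. return_pmf (P x))" by auto
 ultimately show ?thesis by simp
qed

lemma PT_is_zero: "PT E enc_unary F ==> PT E enc_bool (%x. F x = 0)"
 by (erule PT_is_Leaf) simp

lemma PT_is_Nil: "PT E (enc_list e) F ==> PT E enc_bool (%x. F x = [])"
 by (erule PT_is_Leaf) simp

lemma PT_add:
 assumes "PT E enc_unary F" "PT E enc_unary G"
 shows "PT E enc_unary (%x. F x + G x)"
proof -
 have "PT E enc_unary (%x. fold (%_. Suc) (replicate (F x) ()) (G x))"
  by (rule PT_fold_add[OF PT_units[OF assms(1)] assms(2), where q = 1]) (auto intro: PT_Suc PT_id)
 moreover have "fold (%_. Suc) (replicate n ()) m = n + m" for n m by (induction n arbitrary: m) auto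
 ultimately show ?thesis by simp
qed

lemma PT_diff:
 assumes "PT E enc_unary F" "PT E enc_unary G"
 shows "PT E enc_unary (%x. F x - G x)"
proof -
 have "PT E enc_unary (%x. fold (%_ a. a - 1) (replicate (G x) ()) (F x))"
  by (rule PT_fold_add[OF PT_units[OF assms(2)] assms(1), where q = 1]) (auto intro: PT_pred[simplified] PT_id)
 moreover have "fold (%_ a. a - 1) (replicate n ()) m = m - n" for n and m :: nat
  by (induction n arbitrary: m) auto
 ultimately show ?thesis by simp
qed

lemma PT_mult:
 assumes F: "PT E enc_unary F" and G: "PT E enc_unary G"
 shows "PT E enc_unary (%x. F x * G x)"
proof -
 obtain p where p: "\<And>x. size (enc_unary (G x)) <= poly p (ms E x)" by (rule PT_bound[OF G], rule that, auto)
 have "PT E enc_unary (%x. fold (%_ a. a + G x) (replicate (F x) ()) 0)"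
 proof (rule PT_fold_add[OF PT_units[OF F] PT_const, where q = p])
  show "PT (env_pair (env_pair E enc_unit) enc_unary) enc_unary (%z. snd z + G (fst (fst z)))"
   by (intro PT_add PT_id RT_env G)
  fix x y and acc :: nat
  have "poly p (ms E x) <= poly p (ms (env_pair E enc_unit) (x, y))"
   by (intro poly_nat_mono) (simp add: ms_env_pair)
  then show "size (enc_unary (acc + G x)) <= size (enc_unary acc) + poly p (ms (env_pair E enc_unit) (x, y))"
   using p[of x] by simp
 qed
 moreover have "fold (%_ a. a + k) (replicate n ()) m = n * k + m" for n m k :: nat
  by (induction n arbitrary: m) auto
 ultimately show ?thesis by simp
qed

lemma PT_less: "PT E enc_unary F ==> PT E enc_unary G ==> PT E enc_bool (%x. F x < G x)"
 by (rule PT_cong[OF PT_not[OF PT_is_zero[OF PT_diff[of E G F]]]]) auto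

lemma PT_le: "PT E enc_unary F ==> PT E enc_unary G ==> PT E enc_bool (%x. F x <= G x)"
 by (rule PT_cong[OF PT_is_zero[OF PT_diff[of E F G]]]) auto

lemma PT_eq:
 assumes "PT E enc_unary F" "PT E enc_unary G"
 shows "PT E enc_bool (%x. F x = G x)"
 by (rule PT_cong[OF PT_conj[OF PT_le[OF assms] PT_le[OF assms(2,1)]]]) auto

lemma PT_power: "PT E enc_unary F ==> PT E enc_unary (%x. F x ^ c)"
 by (induction c) (simp_all add: PT_const PT_mult)

text \<open>One pass counts up a remainder and trades a full one for a unit of the quotient. For the
  divisor 0 the remainder never becomes full, which agrees with \<open>x div 0 = 0\<close> and
  \<open>x mod 0 = x\<close>.\<close>

lemma PT_divmod:
 assumes F: "PT E enc_unary F" and G: "PT E enc_unary G"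
 shows "PT E (enc_pair enc_unary enc_unary) (%x. (F x div G x, F x mod G x))"
proof -
 define st where "st k a = (if Suc (snd a) = k then (Suc (fst a), 0) else (fst a, Suc (snd a)))" for k and a :: "nat \<times> nat"
 have "PT E (enc_pair enc_unary enc_unary) (%x. fold (%_. st (G x)) (replicate (F x) ()) (0, 0))"
 proof (rule PT_fold_add[OF PT_units[OF F] PT_const, where q = 1])
  show "PT (env_pair (env_pair E enc_unit) (enc_pair enc_unary enc_unary)) (enc_pair enc_unary enc_unary)
    (%z. st (G (fst (fst z))) (snd z))"
   unfolding st_def
   by (intro PT_if PT_eq PT_Suc PT_pair PT_const PT_fst[OF PT_id] PT_snd[OF PT_id] RT_env G)
 qed (auto simp: st_def enc_pair_def)
 moreover have eq: "(st k ^^ n) (q, r) = (q + (r + n) div k, (r + n) mod k)" if "k > r \<or> k = 0" for n k q r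
  using that
 proof (induction n arbitrary: q r)
  case 0
  then show ?case by auto
 next
  case (Suc n)
  show ?case
  proof (cases "Suc r = k")
   case True
   then have k: "k > 0" "r + Suc n = n + k" by auto
   have "(st k ^^ n) (Suc q, 0) = (Suc q + (0 + n) div k, (0 + n) mod k)"
    by (rule Suc.IH) (use k in auto)
   moreover have "st k (q, r) = (Suc q, 0)" using True by (simp add: st_def)
   ultimately show ?thesis using k by (simp only: funpow_Suc_right o_apply) simp
  next
   case False
   then have "(st k ^^ n) (q, Suc r) = (q + (Suc r + n) div k, (Suc r + n) mod k)"
    using Suc.prems by (intro Suc.IH) auto
   moreover have "st k (q, r) = (q, Suc r)" using False by (simp add: st_def)
   ultimately show ?thesis by (simp only: funpow_Suc_right o_apply) simp
  qed
 qed
 moreover have "(st (G x) ^^ F x) (0, 0) = (F x div G x, F x mod G x)" for x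
  using eq[of 0 "G x" "F x" 0] by (cases "G x") auto
 ultimately show ?thesis by simp
qed

lemma PT_div: "PT E enc_unary F ==> PT E enc_unary G ==> PT E enc_unary (%x. F x div G x)"
 using PT_fst[OF PT_divmod[of E F G]] by simp

lemma PT_mod: "PT E enc_unary F ==> PT E enc_unary G ==> PT E enc_unary (%x. F x mod G x)"
 using PT_snd[OF PT_divmod[of E F G]] by simp

lemma PT_odd: "PT E enc_unary F ==> PT E enc_bool (%x. odd (F x))"
 by (rule PT_cong[OF PT_eq[OF PT_mod[OF _ PT_const[of _ _ 2]] PT_const[of _ _ 1], of E F]]) (auto simp: odd_iff_mod_2_eq_one)

lemma PT_Cons: "PT E e f ==> PT E (enc_list e) F ==> PT E (enc_list e) (%x. f x # F x)"
 by (rule PT_recode[OF PT_pair[of E e f "enc_list e" F]]) (auto simp: enc_pair_def)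

lemma PT_rev:
 assumes "PT E (enc_list e) F"
 shows "PT E (enc_list e) (%x. rev (F x))"
proof -
 have "PT E (enc_list e) (%x. fold (#) (F x) [])"
  by (rule PT_fold_add[OF assms PT_const, where q = "[:1, 1:]"])
   (auto simp: ms_env_pair intro!: PT_Cons PT_id RT_env[OF PT_id])
 then show ?thesis by (simp add: fold_Cons_rev)
qed

lemma PT_append:
 assumes "PT E (enc_list e) F" "PT E (enc_list e) G"
 shows "PT E (enc_list e) (%x. F x @ G x)"
proof -
 have "PT E (enc_list e) (%x. fold (#) (rev (F x)) (G x))"
  by (rule PT_fold_add[OF PT_rev[OF assms(1)] assms(2), where q = "[:1, 1:]"])
   (auto simp: ms_env_pair intro!: PT_Cons PT_id RT_env[OF PT_id])
 then show ?thesis by (simp add: fold_Cons_rev)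
qed

lemma size_enc_list_append: "size (enc_list e (xs @ ys)) = size (enc_list e xs) + size (enc_list e ys)"
 by (induction xs) auto

lemma PT_concat_map:
 assumes F: "PT E (enc_list e1) F" and g: "PT (env_pair E e1) (enc_list e2) (%z. g (fst z) (snd z))"
 shows "PT E (enc_list e2) (%x. concat (map (g x) (F x)))"
proof -
 obtain p where p: "\<And>z. size (enc_list e2 (g (fst z) (snd z))) <= poly p (ms (env_pair E e1) z)" by (rule PT_bound[OF g], rule that, auto)
 have "PT E (enc_list e2) (%x. fold (%y acc. acc @ g x y) (F x) [])"
 proof (rule PT_fold_add[OF F PT_const, where q = p])
  show "PT (env_pair (env_pair E e1) (enc_list e2)) (enc_list e2) (%z. snd z @ g (fst (fst z)) (snd (fst z)))"
   by (intro PT_append PT_id RT_env[OF g])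
  show "size (enc_list e2 (acc @ g x y)) <= size (enc_list e2 acc) + poly p (ms (env_pair E e1) (x, y))" for x y acc
   using p[of "(x, y)"] by (simp add: size_enc_list_append)
 qed
 moreover have "fold (%y acc. acc @ h y) ys a = a @ concat (map h ys)" for h :: "'b => 'c list" and ys a
  by (induction ys arbitrary: a) auto
 ultimately show ?thesis by simp
qed

lemma PT_map:
 assumes F: "PT E (enc_list e1) F" and g: "PT (env_pair E e1) e2 (%z. g (fst z) (snd z))"
 shows "PT E (enc_list e2) (%x. map (g x) (F x))"
proof -
 have "concat (map (%y. [h y]) l) = map h l" for h :: "'b => 'c" and l by (induction l) auto
 then show ?thesis
  using PT_concat_map[OF F, of e2 "%x y. [g x y]"] PT_Cons[OF g PT_const[of _ "enc_list e2" "[]"]] by simp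
qed

lemma PT_filter:
 assumes F: "PT E (enc_list e1) F" and P: "PT (env_pair E e1) enc_bool (%z. P (fst z) (snd z))"
 shows "PT E (enc_list e1) (%x. filter (P x) (F x))"
proof -
 have "concat (map (%y. if Q y then [y] else []) l) = filter Q l" for Q and l :: "'b list" by (induction l) auto
 moreover have "PT (env_pair E e1) (enc_list e1) (%z. if P (fst z) (snd z) then [snd z] else [])"
  by (intro PT_if P PT_Cons PT_id PT_const)
 ultimately show ?thesis
  using PT_concat_map[OF F, of e1 "%x y. if P x y then [y] else []"] by simp
qed

lemma PT_bex:
 assumes F: "PT E (enc_list e1) F" and P: "PT (env_pair E e1) enc_bool (%z. P (fst z) (snd z))"
 shows "PT E enc_bool (%x. \<exists>y\<in>set (F x). P x y)"
 by (rule PT_cong[OF PT_not[OF PT_is_Nil[OF PT_filter[OF F P]]]]) (auto simp: filter_empty_conv)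

lemma PT_length:
 assumes "PT E (enc_list e) F"
 shows "PT E enc_unary (%x. length (F x))"
proof -
 have "PT E enc_unary (%x. fold (%_. Suc) (F x) 0)"
  by (rule PT_fold_add[OF assms PT_const, where q = 1]) (auto intro: PT_Suc PT_id)
 moreover have "fold (%_. Suc) l m = length l + m" for l :: "'b list" and m by (induction l arbitrary: m) auto
 ultimately show ?thesis by simp
qed

lemma PT_upt:
 assumes F: "PT E enc_unary F"
 shows "PT E (enc_list enc_unary) (%x. [0..<F x])"
proof -
 obtain p where p: "\<And>x. size (enc_unary (F x)) <= poly p (ms E x)" by (rule PT_bound[OF F], rule that, auto)
 define st where "st a = (fst a - 1, (fst a - 1) # snd a)" for a :: "nat \<times> nat list"
 have eq: "fold (%_. st) (replicate i ()) (n, []) = (n - i, [n - i..<n])" if "i <= n" for i n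
  using that
 proof (induction i)
  case (Suc i)
  have "fold (%_. st) (replicate (Suc i) ()) (n, []) = st (fold (%_. st) (replicate i ()) (n, []))"
   by (simp add: funpow_swap1)
  also have "\<dots> = (n - Suc i, (n - Suc i) # [n - i..<n])"
   by (subst Suc.IH) (use Suc.prems in \<open>simp_all add: st_def\<close>)
  also have "(n - Suc i) # [n - i..<n] = [n - Suc i..<n]"
   using Suc.prems by (simp add: upt_rec[of "n - Suc i" n] Suc_diff_Suc)
  finally show ?case .
 qed simp
 have sz: "size (enc_list enc_unary [a..<n]) <= (n - a) * (n + 1)" for a n
 proof (induction "n - a" arbitrary: a)
  case (Suc k)
  then have "[a..<n] = a # [Suc a..<n]" by (simp add: upt_conv_Cons)
  moreover have "size (enc_list enc_unary [Suc a..<n]) <= (n - Suc a) * (n + 1)"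
   by (rule Suc.hyps(1)) (use Suc.hyps(2) in auto)
  moreover have "(n - a) * (n + 1) = (n - Suc a) * (n + 1) + (n + 1)" using Suc.hyps(2)
   by (metis Suc_diff_Suc add.commute mult_Suc zero_less_Suc zero_less_diff)
  ultimately show ?case using Suc.hyps(2) by simp
 qed simp
 have "PT E (enc_pair enc_unary (enc_list enc_unary)) (%x. fold (%_. st) (replicate (F x) ()) (F x, []))"
 proof (rule PT_fold[OF PT_units[OF F] PT_pair[OF F PT_const], where q = "p + 1 + p * (p + 1)"])
  show "PT (env_pair (env_pair E enc_unit) (enc_pair enc_unary (enc_list enc_unary))) (enc_pair enc_unary (enc_list enc_unary))
    (%z. st (snd z))"
   unfolding st_def by (intro PT_pair PT_pred PT_Cons PT_fst[OF PT_id] PT_snd[OF PT_id])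
  fix x i
  let ?j = "min i (F x)"
  have "take i (replicate (F x) ()) = replicate ?j ()" by simp
  then have e: "fold (%_. st) (take i (replicate (F x) ())) (F x, []) = (F x - ?j, [F x - ?j..<F x])"
   using eq[of ?j "F x"] by simp
  have "size (enc_list enc_unary [F x - ?j..<F x]) <= F x * (F x + 1)"
   using sz[of "F x - ?j" "F x"] mult_le_mono1[of "F x - (F x - ?j)" "F x" "F x + 1"] by linarith
  also have "\<dots> <= poly p (ms E x) * (poly p (ms E x) + 1)" using p[of x] by (intro mult_mono) auto
  finally show "size (enc_pair enc_unary (enc_list enc_unary) (fold (%_. st) (take i (replicate (F x) ())) (F x, [])))
    <= poly (p + 1 + p * (p + 1)) (ms E x)"
   using p[of x] unfolding e by (simp add: enc_pair_def)
 qed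
 from PT_snd[OF this] show ?thesis using eq[OF order_refl] by simp
qed

text \<open>A unary power of two is admissible only where a polynomial bound on it is known in
  advance; the smaller powers met on the way are then bounded too.\<close>

lemma PT_power2:
 assumes L: "PT E (enc_list e) L" and b: "\<And>x. 2 ^ length (L x) <= poly p (ms E x)"
 shows "PT E enc_unary (%x. 2 ^ length (L x))"
proof -
 have eq: "fold (%_ a. a + a) l m = 2 ^ length l * m" for l :: "'b list" and m :: nat
  by (induction l arbitrary: m) (auto simp: algebra_simps)
 have "PT E enc_unary (%x. fold (%_ a. a + a) (L x) 1)"
 proof (rule PT_fold[OF L PT_const, where q = p])
  show "PT (env_pair (env_pair E e) enc_unary) enc_unary (%z. snd z + snd z)" by (intro PT_add PT_id)
  fix x i
  have le: "(2::nat) ^ length (take i (L x)) <= 2 ^ length (L x)" by (intro power_increasing) auto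
  show "size (enc_unary (fold (%_ a. a + a) (take i (L x)) 1)) <= poly p (ms E x)"
   using order_trans[OF le b[of x]] by (simp add: eq)
 qed
 then show ?thesis by (simp add: eq)
qed

section \<open>Binary numbers and rational powers of two\<close>

fun bits :: "nat => bool list" where
 "bits n = (if n = 0 then [] else odd n # bits (n div 2))"

declare bits.simps [simp del]

lemma bits_0 [simp]: "bits 0 = []" by (simp add: bits.simps)

lemma enc_nat_bits: "enc_nat n = enc_list enc_bool (bits n)"
proof (induction n rule: less_induct)
 case (less n)
 show ?case using less[of "n div 2"] by (subst enc_nat.simps, subst bits.simps) auto
qed

lemma enc_nat_Leaf [simp]: "enc_nat n = Leaf \<longleftrightarrow> n = 0"
 by (subst enc_nat.simps) auto

lemma bits_double: "bits (2 * v + of_bool b) = (if v = 0 \<and> \<not> b then [] else b # bits v)"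
 by (subst bits.simps) (auto simp: of_bool_def)

lemma parity_split: "2 * (t div 2) + of_bool (odd t) = (t::nat)"
 by (cases "even t") simp_all

primrec val :: "bool list => nat" where
 "val [] = 0"
| "val (b # bs) = of_bool b + 2 * val bs"

lemma val_bits [simp]: "val (bits n) = n"
proof (induction n rule: less_induct)
 case (less n)
 show ?case
 proof (cases "n = 0")
  case False
  then have "bits n = odd n # bits (n div 2)" by (subst bits.simps) simp
  then show ?thesis using less[of "n div 2"] False parity_split[of n] by simp
 qed simp
qed

lemma length_bits: "length (bits n) <= e \<longleftrightarrow> n < 2 ^ e"
proof (induction n arbitrary: e rule: less_induct)
 case (less n)
 show ?case
 proof (cases "n = 0")
  case False
  then have l: "length (bits n) = Suc (length (bits (n div 2)))" by (subst bits.simps) auto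
  show ?thesis
  proof (cases e)
   case 0
   then show ?thesis using l False by simp
  next
   case (Suc e')
   have "length (bits (n div 2)) <= e' \<longleftrightarrow> n div 2 < 2 ^ e'" using less False by simp
   also have "\<dots> \<longleftrightarrow> n < 2 ^ Suc e'" by auto
   finally show ?thesis using l Suc by simp
  qed
 qed simp
qed

lemma size_enc_bools: "size (enc_list enc_bool l) <= 2 * length l"
 by (induction l) (auto simp: enc_bool_def)

lemma size_enc_nat: "n < 2 ^ e ==> size (enc_nat n) <= 2 * e"
 using size_enc_bools[of "bits n"] length_bits[of n e] by (simp add: enc_nat_bits)

lemma size_enc_nat_le: "size (enc_nat n) <= 2 * n"
 by (rule size_enc_nat) simp

lemma PT_bits: "PT E enc_nat F ==> PT E (enc_list enc_bool) (%x. bits (F x))"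
 by (erule PT_recode) (simp add: enc_nat_bits)

lemma PT_is_zero_bin: "PT E enc_nat F ==> PT E enc_bool (%x. F x = 0)"
 by (erule PT_is_Leaf) simp

lemma PT_double:
 assumes "PT E enc_nat F" "PT E enc_bool P"
 shows "PT E enc_nat (%x. 2 * F x + of_bool (P x))"
proof (rule PT_recode)
 show "PT E (enc_list enc_bool) (%x. if F x = 0 \<and> \<not> P x then [] else P x # bits (F x))"
  by (intro PT_if PT_conj PT_not PT_is_zero_bin PT_const PT_Cons PT_bits assms)
qed (simp only: enc_nat_bits bits_double)

text \<open>Reads digits with the most significant one first and places \<open>c\<close> above them.
  The loops below emit digits from the low end, each in front of the earlier ones, which yields this
  order.\<close>

definition horner :: "bool list => nat => nat" where
 "horner out c = fold (%b v. 2 * v + of_bool b) out c"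

lemma PT_horner:
 assumes "PT E (enc_list enc_bool) F"
 shows "PT E enc_nat (%x. horner (F x) 0)"
 unfolding horner_def
proof (rule PT_fold_add[OF assms PT_const, where q = 2])
 show "PT (env_pair (env_pair E enc_bool) enc_nat) enc_nat (%z. 2 * snd z + of_bool (snd (fst z)))"
  by (intro PT_double PT_id RT_env[OF PT_id])
 show "size (enc_nat (2 * acc + of_bool y)) <= size (enc_nat acc) + poly 2 (ms (env_pair E enc_bool) (x, y))" for x y acc
  using size_enc_bool[of y] unfolding enc_nat_bits bits_double by auto
qed

text \<open>School multiplication of a binary number by a unary \<open>j\<close>: the first
  component is the carry, kept in unary, the second the digits already written.\<close>

definition madd_step :: "nat => bool => nat \<times> bool list => nat \<times> bool list" where
 "madd_step j b a = ((fst a + (if b then j else 0)) div 2, odd (fst a + (if b then j else 0)) # snd a)"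

definition flush_step :: "nat \<times> bool list => nat \<times> bool list" where
 "flush_step a = (if fst a = 0 then a else (fst a div 2, odd (fst a) # snd a))"

lemma horner_Cons: "horner (b # out) c = horner out (2 * c + of_bool b)"
 by (simp add: horner_def)

text \<open>Loop invariant: the written digits, topped by the carry plus \<open>j\<close> times the
  unread part, always represent the same number.\<close>

lemma fold_madd_step:
 "horner (snd (fold (madd_step j) bs a)) (fst (fold (madd_step j) bs a)) = horner (snd a) (j * val bs + fst a)"
proof (induction bs arbitrary: a)
 case (Cons b bs)
 define t where "t = fst a + (if b then j else 0)"
 have "2 * (j * val bs + t div 2) + of_bool (odd t) = j * val (b # bs) + fst a"
 proof -
  have "j * val (b # bs) + fst a = 2 * (j * val bs) + t" unfolding t_def by (cases b) (simp_all add: algebra_simps)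
  then show ?thesis using parity_split[of t] by simp
 qed
 moreover have "madd_step j b a = (t div 2, odd t # snd a)" by (simp only: madd_step_def t_def)
 ultimately show ?case using Cons[of "madd_step j b a"] by (simp only: fold_simps fst_conv snd_conv horner_Cons)
qed simp

lemma flush_steps:
 "horner (snd ((flush_step ^^ i) a)) (fst ((flush_step ^^ i) a)) = horner (snd a) (fst a) \<and>
 fst ((flush_step ^^ i) a) = fst a div 2 ^ i"
proof (induction i)
 case (Suc i)
 define z where "z = (flush_step ^^ i) a"
 have "horner (snd (flush_step z)) (fst (flush_step z)) = horner (snd z) (fst z)" "fst (flush_step z) = fst z div 2"
  using parity_split[of "fst z"] by (auto simp: flush_step_def horner_Cons)
 moreover have "horner (snd z) (fst z) = horner (snd a) (fst a)" "fst z = fst a div 2 ^ i" using Suc unfolding z_def by blast+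
 moreover have "fst a div 2 ^ i div 2 = fst a div 2 ^ Suc i" by (simp add: div_mult2_eq[symmetric] mult.commute)
 ultimately show ?case by (simp only: funpow.simps o_apply z_def[symmetric])
qed simp

lemma PT_madd:
 assumes j: "PT E enc_unary j" and n: "PT E enc_nat n" and c: "PT E enc_unary c"
 shows "PT E enc_nat (%x. j x * n x + c x)"
proof -
 let ?e = "enc_pair enc_unary (enc_list enc_bool)"
 obtain p where p: "\<And>a. size (enc_unary (j a)) <= poly p (ms E a)" by (rule PT_bound[OF j], rule that, auto)
 define s1 where "s1 x = fold (madd_step (j x)) (bits (n x)) (c x, [])" for x
 have 1: "PT E ?e s1" unfolding s1_def
 proof (rule PT_fold_add[OF PT_bits[OF n] PT_pair[OF c PT_const], where q = "p + 2"])
  show "PT (env_pair (env_pair E enc_bool) ?e) ?e (%z. madd_step (j (fst (fst z))) (snd (fst z)) (snd z))"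
   unfolding madd_step_def
   by (intro PT_pair PT_div PT_add PT_if PT_Cons PT_odd PT_const PT_fst[OF PT_id] PT_snd[OF PT_id] RT_env[OF PT_id] RT_env j)
  fix x y acc
  have "poly p (ms E x) <= poly p (ms (env_pair E enc_bool) (x, y))" by (intro poly_nat_mono) (simp add: ms_env_pair)
  then have "j x <= poly p (ms (env_pair E enc_bool) (x, y))" using p[of x] by simp
  then show "size (?e (madd_step (j x) y acc)) <= size (?e acc) + poly (p + 2) (ms (env_pair E enc_bool) (x, y))"
  proof -
   define t where "t = fst acc + (if y then j x else 0)"
   have "madd_step (j x) y acc = (t div 2, odd t # snd acc)" by (simp only: madd_step_def t_def)
   moreover have "t div 2 <= fst acc + j x" by (cases y) (simp_all add: t_def)
   ultimately show ?thesis
    using size_enc_bool[of "odd t"] \<open>j x <= _\<close> by (simp add: enc_pair_def)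
  qed
 qed
 \<comment> \<open>A carry \<open>c\<close> is halved \<open>c\<close> times, and
   \<open>c div 2 ^ c = 0\<close>; once it is 0, \<open>flush_step\<close> does nothing.\<close>
 have 2: "PT E ?e (%x. fold (%_. flush_step) (replicate (fst (s1 x)) ()) (s1 x))"
 proof (rule PT_fold_add[OF PT_units[OF PT_fst[OF 1]] 1, where q = 2])
  show "PT (env_pair (env_pair E enc_unit) ?e) ?e (%z. flush_step (snd z))"
   unfolding flush_step_def
   by (intro PT_if PT_is_zero PT_pair PT_div PT_Cons PT_odd PT_const PT_id PT_fst[OF PT_id] PT_snd[OF PT_id])
  show "size (?e (flush_step acc)) <= size (?e acc) + poly 2 (ms (env_pair E enc_unit) (x, y))" for x y acc
   using size_enc_bool[of "odd (fst acc)"] by (auto simp: flush_step_def enc_pair_def)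
 qed
 have "horner (snd (fold (%_. flush_step) (replicate (fst (s1 x)) ()) (s1 x))) 0 = j x * n x + c x" for x
 proof -
  let ?z = "(flush_step ^^ fst (s1 x)) (s1 x)"
  have "fst ?z = 0" using conjunct2[OF flush_steps[of "fst (s1 x)" "s1 x"]] by simp
  moreover have "horner (snd ?z) (fst ?z) = horner (snd (s1 x)) (fst (s1 x))" by (rule conjunct1[OF flush_steps])
  moreover have "horner (snd (s1 x)) (fst (s1 x)) = j x * n x + c x"
   using fold_madd_step[of "j x" "bits (n x)" "(c x, [])"] by (simp add: s1_def[symmetric] horner_def)
  ultimately show ?thesis by simp
 qed
 then show ?thesis using PT_horner[OF PT_snd[OF 2]] by simp
qed

lemma PT_of_unary: "PT E enc_unary F ==> PT E enc_nat F"
 using PT_madd[OF PT_const[of _ _ 0] PT_const[of _ _ 0], of E F] by simp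

lemma PT_mult_bin: "PT E enc_unary j ==> PT E enc_nat n ==> PT E enc_nat (%x. j x * n x)"
 using PT_madd[OF _ _ PT_const[of _ _ 0], of E j n] by simp

lemma PT_power_bin:
 assumes j: "PT E enc_unary j" and t: "PT E enc_unary t"
 shows "PT E enc_nat (%x. j x ^ t x)"
proof -
 obtain p where p: "\<And>a. size (enc_unary (j a)) <= poly p (ms E a)" by (rule PT_bound[OF j], rule that, auto)
 obtain q where q: "\<And>a. size (enc_unary (t a)) <= poly q (ms E a)" by (rule PT_bound[OF t], rule that, auto)
 have eq: "fold (%_ a. k * a) (replicate i ()) (m::nat) = k ^ i * m" for i k m
  by (induction i arbitrary: m) (auto simp: algebra_simps)
 have "PT E enc_nat (%x. fold (%_ a. j x * a) (replicate (t x) ()) 1)"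
 proof (rule PT_fold[OF PT_units[OF t] PT_const, where q = "2 * (p * q + 1)"])
  show "PT (env_pair (env_pair E enc_unit) enc_nat) enc_nat (%z. j (fst (fst z)) * snd z)"
   by (intro PT_mult_bin PT_id RT_env j)
  fix x i
  let ?i = "min i (t x)"
  have "j x ^ ?i <= (2 ^ j x) ^ ?i" by (intro power_mono less_imp_le[OF less_exp]) simp
  also have "\<dots> = 2 ^ (j x * ?i)" by (simp add: power_mult)
  also have "\<dots> < 2 ^ (j x * ?i + 1)" by simp
  finally have "size (enc_nat (j x ^ ?i)) <= 2 * (j x * ?i + 1)" by (rule size_enc_nat)
  also have "\<dots> <= 2 * (poly p (ms E x) * poly q (ms E x) + 1)"
   using p[of x] q[of x] by (intro mult_mono add_mono) auto
  finally show "size (enc_nat (fold (%_ a. j x * a) (take i (replicate (t x) ())) 1)) <= poly (2 * (p * q + 1)) (ms E x)"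
   using eq[of "j x" ?i 1] by (simp add: take_replicate)
 qed
 then show ?thesis using eq[where m = 1] by simp
qed

text \<open>Comparison from the low end: the flag tells whether the digits read so far make the
  first number smaller, and each higher digit overrides it unless the two digits agree.\<close>

definition cmp_step :: "bool => bool list \<times> bool => bool list \<times> bool" where
 "cmp_step b a = (case fst a of [] => ([], snd a \<and> \<not> b) | y # l => (l, if b then y \<and> snd a else y \<or> snd a))"

text \<open>Digits of \<open>l\<close> left over at the end contain a leading 1, so the second
  number is larger whatever the flag says. This is where the canonical form without leading zeros
  enters.\<close>

lemma fold_cmp_step:
 assumes "l ~= [] ==> last l"
 shows "(case fold cmp_step xs (l, f) of (l', f') => f' \<or> l' ~= []) \<longleftrightarrow> val xs < val l \<or> (val xs = val l \<and> f)"
 using assms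
proof (induction xs arbitrary: l f)
 case Nil
 have "val l > 0" if "l ~= []" "last l" for l using that by (induction l) (auto split: if_splits)
 then show ?case using Nil by (cases "l = []") auto
next
 case (Cons b xs)
 show ?case
 proof (cases l)
  case Nil
  then show ?thesis using Cons.IH[of "[]" "f \<and> \<not> b"] by (auto simp: cmp_step_def)
 next
  case l: (Cons y l')
  have "l' ~= [] ==> last l'" using Cons.prems l by auto
  from Cons.IH[OF this] show ?thesis unfolding l by (cases b; cases y) (simp_all add: cmp_step_def, linarith+)
 qed
qed

lemma last_bits: "bits n ~= [] ==> last (bits n)"
proof (induction n rule: less_induct)
 case (less n)
 have n: "n ~= 0" using less.prems by (rule contrapos_nn) simp
 have b: "bits n = odd n # bits (n div 2)" using n by (subst bits.simps) auto
 show ?case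
 proof (cases "bits (n div 2) = []")
  case True
  then have "n div 2 = 0" by (metis val_bits val.simps(1))
  then show ?thesis using n b True by auto
 next
  case False
  then show ?thesis using less(1)[of "n div 2"] n b by simp
 qed
qed

lemma PT_case_list:
 assumes "PT E (enc_list e1) F" "PT E e f"
  and "PT (env_pair (env_pair E e1) (enc_list e1)) e (%z. g (fst (fst z)) (snd (fst z)) (snd z))"
 shows "PT E e (%x. case F x of [] => f x | y # ys => g x y ys)"
proof -
 have "(%x. case F x of [] => return_pmf (f x) | y # ys => return_pmf (g x y ys)) =
  (%x. return_pmf (case F x of [] => f x | y # ys => g x y ys))" by (auto split: list.splits)
 then show ?thesis using RT_case_list[OF assms(1,2), of "%x y ys. return_pmf (g x y ys)"] assms(3) by simp
qed

lemma PT_less_bin: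
 assumes F: "PT E enc_nat F" and G: "PT E enc_nat G"
 shows "PT E enc_bool (%x. F x < G x)"
proof -
 let ?e = "enc_pair (enc_list enc_bool) enc_bool"
 have 1: "PT E ?e (%x. fold cmp_step (bits (F x)) (bits (G x), False))"
 proof (rule PT_fold_add[OF PT_bits[OF F] PT_pair[OF PT_bits[OF G] PT_const], where q = 1])
  show "PT (env_pair (env_pair E enc_bool) ?e) ?e (%z. cmp_step (snd (fst z)) (snd z))"
   unfolding cmp_step_def
   by (rule PT_case_list[where ?e1.0 = enc_bool]; intro PT_pair PT_conj PT_disj PT_not PT_if PT_const PT_fst[OF PT_id] PT_snd[OF PT_id] PT_id RT_env[OF PT_id]
     PT_fst RT_env[OF PT_snd[OF PT_id]] RT_env[OF RT_env[OF RT_env[OF PT_id]]] RT_env[OF RT_env[OF PT_snd[OF PT_id]]])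
  show "size (?e (cmp_step y acc)) <= size (?e acc) + poly 1 (ms (env_pair E enc_bool) (x, y))" for x y acc
   using size_enc_bool[of "snd (cmp_step y acc)"]
   by (auto simp: cmp_step_def enc_pair_def split: list.splits)
 qed
 have "PT E enc_bool (%x. snd (fold cmp_step (bits (F x)) (bits (G x), False)) \<or> fst (fold cmp_step (bits (F x)) (bits (G x), False)) ~= [])"
  by (intro PT_disj PT_not PT_is_Nil[OF PT_fst[OF 1]] PT_snd[OF 1])
 moreover have "(%x. snd (fold cmp_step (bits (F x)) (bits (G x), False)) \<or> fst (fold cmp_step (bits (F x)) (bits (G x), False)) ~= []) = (%x. F x < G x)"
  using fold_cmp_step[OF last_bits, where f = False] by (auto simp: fun_eq_iff case_prod_beta)
 ultimately show ?thesis by (rule PT_cong)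
qed

lemma PT_eq_bin:
 assumes "PT E enc_nat F" "PT E enc_nat G"
 shows "PT E enc_bool (%x. F x = G x)"
 by (rule PT_cong[OF PT_conj[OF PT_not[OF PT_less_bin[OF assms]] PT_not[OF PT_less_bin[OF assms(2,1)]]]]) auto

lemma quotient_of_inverse_power2: "quotient_of (1 / 2 ^ n) = (1, 2 ^ n)"
proof -
 have "(1 / 2 ^ n :: rat) = Fract 1 (2 ^ n)" by (simp add: Fract_of_int_quotient)
 then show ?thesis by (simp add: quotient_of_Fract Rat.normalize_def)
qed

lemma quotient_of_power2: "quotient_of (2 ^ n) = (2 ^ n, 1)"
proof -
 have "(2 ^ n :: rat) = Fract (2 ^ n) 1" by (simp add: Fract_of_int_quotient)
 then show ?thesis by (simp add: quotient_of_Fract Rat.normalize_def)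
qed

lemma PT_rat_power2:
 assumes "PT E enc_unary F"
 shows "PT E enc_rat (%x. 2 ^ F x)"
proof (rule PT_recode)
 show "PT E (enc_pair enc_bool (enc_pair enc_nat enc_nat)) (%x. (False, 2 ^ F x, 1))"
  by (intro PT_pair PT_const PT_power_bin assms)
qed (simp add: enc_pair_def enc_rat_def quotient_of_power2 nat_power_eq)

lemma PT_rat_inverse_power2:
 assumes "PT E enc_unary F"
 shows "PT E enc_rat (%x. 1 / 2 ^ F x)"
proof (rule PT_recode)
 show "PT E (enc_pair enc_bool (enc_pair enc_nat enc_nat)) (%x. (False, 1, 2 ^ F x))"
  by (intro PT_pair PT_const PT_power_bin assms)
qed (simp add: enc_pair_def enc_rat_def quotient_of_inverse_power2 nat_power_eq)

section \<open>Clocked simulation of a program with a sample oracle\<close>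

primrec expr_vars :: "expr => nat" where
 "expr_vars (Var x) = Suc x"
| "expr_vars LeafE = 0"
| "expr_vars (NodeE a b) = max (expr_vars a) (expr_vars b)"
| "expr_vars (LeftE a) = expr_vars a"
| "expr_vars (RightE a) = expr_vars a"

primrec com_vars :: "com => nat" where
 "com_vars Skip = 0"
| "com_vars (Assign x e) = max (Suc x) (expr_vars e)"
| "com_vars (Seq c1 c2) = max (com_vars c1) (com_vars c2)"
| "com_vars (If e c1 c2) = max (expr_vars e) (max (com_vars c1) (com_vars c2))"
| "com_vars (While e c) = max (expr_vars e) (com_vars c)"
| "com_vars (Flip x) = Suc x"
| "com_vars (Sample x) = Suc x"

text \<open>A finite list of commands that contains the program and is closed under
  \<open>step\<close>: every possible rest of the program. The program counter of the simulation is
  an index into it.\<close>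

primrec reachable :: "com => com list" where
 "reachable Skip = [Skip]"
| "reachable (Assign x e) = [Assign x e, Skip]"
| "reachable (Seq c1 c2) = map (%c. Seq c c2) (reachable c1) @ reachable c2"
| "reachable (If e c1 c2) = If e c1 c2 # reachable c1 @ reachable c2"
| "reachable (While e c) = While e c # Skip # map (%c'. Seq c' (While e c)) (reachable c)"
| "reachable (Flip x) = [Flip x, Skip]"
| "reachable (Sample x) = [Sample x, Skip]"

lemma reachable_self: "c \<in> set (reachable c)"
 by (induction c) auto

lemma reachable_vars: "c' \<in> set (reachable c) ==> com_vars c' <= com_vars c"
 by (induction c arbitrary: c') (auto, (fastforce simp: le_max_iff_disj)+)

lemma reachable_step:
 "c' \<in> set (reachable c) ==> cs \<in> set_pmf (step D c' s) ==> fst cs \<in> set (reachable c)"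
proof (induction c arbitrary: c' cs)
 case (Seq c1 c2)
 show ?case
 proof (cases "c' \<in> set (reachable c2)")
  case True
  then show ?thesis using Seq.IH(2)[OF True Seq.prems(2)] by simp
 next
  case False
  then obtain d where d: "c' = Seq d c2" "d \<in> set (reachable c1)" using Seq.prems(1) by auto
  show ?thesis
  proof (cases "d = Skip")
   case True
   then show ?thesis using Seq.prems(2) d reachable_self[of c2] by simp
  next
   case False
   then obtain cs' where "cs' \<in> set_pmf (step D d s)" "fst cs = Seq (fst cs') c2" using Seq.prems(2) d by auto
   then show ?thesis using Seq.IH(1)[OF d(2)] by auto
  qed
 qed
next
 case (If e c1 c2)
 consider "c' = If e c1 c2" | "c' \<in> set (reachable c1)" | "c' \<in> set (reachable c2)" using If.prems(1) by auto
 then show ?case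
 proof cases
  case 1
  then show ?thesis using If.prems(2) reachable_self[of c1] reachable_self[of c2] by auto
 next
  case 2
  then show ?thesis using If.IH(1)[OF 2 If.prems(2)] by simp
 next
  case 3
  then show ?thesis using If.IH(2)[OF 3 If.prems(2)] by simp
 qed
next
 case (While e c)
 consider "c' = While e c" | "c' = Skip" | d where "c' = Seq d (While e c)" "d \<in> set (reachable c)"
  using While.prems(1) by auto
 then show ?case
 proof cases
  case 3
  show ?thesis
  proof (cases "d = Skip")
   case True
   then show ?thesis using While.prems(2) 3 by simp
  next
   case False
   then obtain cs' where "cs' \<in> set_pmf (step D d s)" "fst cs = Seq (fst cs') (While e c)" using While.prems(2) 3 by auto
   then show ?thesis using While.IH[OF 3(2)] by auto
  qed
 qed (use While.prems(2) reachable_self[of c] in \<open>auto split: if_splits\<close>)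
qed auto

primrec shift :: "nat => expr => expr" where
 "shift V (Var x) = Var (V + x)"
| "shift V LeafE = LeafE"
| "shift V (NodeE a b) = NodeE (shift V a) (shift V b)"
| "shift V (LeftE a) = LeftE (shift V a)"
| "shift V (RightE a) = RightE (shift V a)"

definition sim_store :: "nat => nat => store => store" where
 "sim_store V nv s = (%v. if v < nv then s (V + v) else Leaf)"

lemma eval_shift: "expr_vars e <= nv ==> eval_expr (shift V e) s = eval_expr e (sim_store V nv s)"
 by (induction e) (auto simp: sim_store_def)

text \<open>The list may contain a command several times; the least index makes the code a function
  of the command.\<close>

definition code :: "com => com => data" where
 "code c0 c = enc_unary (LEAST i. i < length (reachable c0) \<and> reachable c0 ! i = c)"

lemma code:
 assumes "c \<in> set (reachable c0)"
 obtains i where "code c0 c = enc_unary i" "i < length (reachable c0)" "reachable c0 ! i = c"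
proof -
 have "\<exists>i. i < length (reachable c0) \<and> reachable c0 ! i = c" using assms by (auto simp: in_set_conv_nth)
 from LeastI_ex[OF this] show ?thesis using that unfolding code_def by blast
qed

text \<open>Layout: \<open>B\<close> input of the generator, \<open>B + 1\<close> clock, \<open>B + 2\<close> program counter, \<open>B + 3\<close> its
 working copy, and from \<open>B + 4\<close> on the variables of the simulated program.\<close>

primrec sim_step :: "com => com => nat => com => (com => com) => com" where
 "sim_step c0 cg B Skip K = Assign (B + 2) (datae (code c0 (K Skip)))"
| "sim_step c0 cg B (Assign x e) K =
  Seq (Assign (B + 4 + x) (shift (B + 4) e)) (Assign (B + 2) (datae (code c0 (K Skip))))"
| "sim_step c0 cg B (Seq c1 c2) K =
  (if c1 = Skip then Assign (B + 2) (datae (code c0 (K c2))) else sim_step c0 cg B c1 (%c. K (Seq c c2)))"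
| "sim_step c0 cg B (If e c1 c2) K = If (shift (B + 4) e)
  (Assign (B + 2) (datae (code c0 (K c1)))) (Assign (B + 2) (datae (code c0 (K c2))))"
| "sim_step c0 cg B (While e c) K = If (shift (B + 4) e)
  (Assign (B + 2) (datae (code c0 (K (Seq c (While e c)))))) (Assign (B + 2) (datae (code c0 (K Skip))))"
| "sim_step c0 cg B (Flip x) K = Seq (Flip (B + 4 + x)) (Assign (B + 2) (datae (code c0 (K Skip))))"
| "sim_step c0 cg B (Sample x) K = Seq (Assign 0 (Var B)) (Seq cg
  (Seq (Assign (B + 4 + x) (Var 0)) (Assign (B + 2) (datae (code c0 (K Skip))))))"

primrec dispatch :: "com => com => nat => com list => com" where
 "dispatch c0 cg B [] = Skip"
| "dispatch c0 cg B (c # cs) = If (Var (B + 3))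
  (Seq (Assign (B + 3) (RightE (Var (B + 3)))) (dispatch c0 cg B cs)) (sim_step c0 cg B c id)"

definition sim_frame :: "nat => nat => store => store => bool" where
 "sim_frame B nv s s' \<longleftrightarrow> s' B = s B \<and> s' (B + 1) = s (B + 1) \<and> (\<forall>v\<ge>B + 4 + nv. s' v = s v)"

lemma evals_Assign': "evals (Assign x (datae d)) s (return_pmf (s(x := d))) 1"
 using evals_Assign[of x "datae d" s] by simp

lemma sim_store_upd:
 "v < nv ==> sim_store V nv (s(V + v := d)) = (sim_store V nv s)(v := d)"
 "v < V ==> sim_store V nv (s(v := d)) = sim_store V nv s"
 by (auto simp: sim_store_def fun_eq_iff)

text \<open>The argument \<open>K\<close> rebuilds the sequential context around the command in
  focus, so the next program counter is the code of \<open>K\<close> applied to what remains. A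
  sample request runs the generator \<open>cg\<close> on its saved input; all other commands act
  directly on the shifted variables.\<close>

lemma evals_sim_step:
 fixes s :: store
 assumes B: "B > 0" and d: "s B = d"
  and cg: "\<And>s. s 0 = d ==> \<exists>\<mu>. evals cg s \<mu> tg \<and> map_pmf (%s. s 0) \<mu> = D \<and> (\<forall>s'\<in>set_pmf \<mu>. \<forall>v\<ge>B. s' v = s v)"
  and nv: "com_vars c <= nv"
 shows "\<exists>\<mu>. evals (sim_step c0 cg B c K) s \<mu> (tg + 7) \<and>
  map_pmf (%s'. (s' (B + 2), sim_store (B + 4) nv s')) \<mu> =
   map_pmf (%cs. (code c0 (K (fst cs)), snd cs)) (step D c (sim_store (B + 4) nv s)) \<and>
  (\<forall>s'\<in>set_pmf \<mu>. sim_frame B nv s s')"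
 using nv
proof (induction c arbitrary: K)
 case Skip
 show ?case
  by (rule exI, rule conjI, unfold sim_step.simps, rule evals_mono[OF evals_Assign'])
   (auto simp: sim_store_upd sim_frame_def)
next
 case (Assign x e)
 let ?s = "s(B + 4 + x := eval_expr (shift (B + 4) e) s)"
 have "evals (sim_step c0 cg B (Assign x e) K) s (return_pmf (?s(B + 2 := code c0 (K Skip)))) (1 + 2)"
  unfolding sim_step.simps by (rule evals_Seq_Assign, rule evals_Assign')
 then have "evals (sim_step c0 cg B (Assign x e) K) s (return_pmf (?s(B + 2 := code c0 (K Skip)))) (tg + 7)"
  by (rule evals_mono) simp
 then show ?case using Assign
  by (intro exI conjI) (auto simp: sim_store_upd sim_frame_def eval_shift[where nv = nv] simp del: fun_upd_apply, auto)
next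
 case (Seq c1 c2)
 show ?case
 proof (cases "c1 = Skip")
  case True
  have "evals (sim_step c0 cg B (Seq c1 c2) K) s (return_pmf (s(B + 2 := code c0 (K c2)))) (tg + 7)"
   using evals_mono[OF evals_Assign'] True by simp
  then show ?thesis using True
   by (intro exI conjI) (auto simp: sim_store_upd sim_frame_def)
 next
  case False
  then show ?thesis using Seq.IH(1)[of "%c. K (Seq c c2)"] Seq.prems
   by (simp add: map_pmf_comp case_prod_beta)
 qed
next
 case (If e c1 c2)
 let ?c = "if eval_expr e (sim_store (B + 4) nv s) ~= Leaf then c1 else c2"
 have "evals (sim_step c0 cg B (If e c1 c2) K) s (return_pmf (s(B + 2 := code c0 (K ?c)))) (Suc 1)"
  unfolding sim_step.simps by (rule evals_If) (use If.prems evals_Assign' in \<open>auto simp: eval_shift[where nv = nv]\<close>)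
 then have "evals (sim_step c0 cg B (If e c1 c2) K) s (return_pmf (s(B + 2 := code c0 (K ?c)))) (tg + 7)"
  by (rule evals_mono) simp
 then show ?case by (intro exI conjI) (auto simp: sim_store_upd sim_frame_def)
next
 case (While e c)
 let ?c = "if eval_expr e (sim_store (B + 4) nv s) ~= Leaf then Seq c (While e c) else Skip"
 have "evals (sim_step c0 cg B (While e c) K) s (return_pmf (s(B + 2 := code c0 (K ?c)))) (Suc 1)"
  unfolding sim_step.simps by (rule evals_If) (use While.prems evals_Assign' in \<open>auto simp: eval_shift[where nv = nv]\<close>)
 then have "evals (sim_step c0 cg B (While e c) K) s (return_pmf (s(B + 2 := code c0 (K ?c)))) (tg + 7)"
  by (rule evals_mono) simp
 then show ?case by (intro exI conjI) (auto simp: sim_store_upd sim_frame_def)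
next
 case (Flip x)
 have x: "x < nv" using Flip by simp
 let ?N = "%s'. return_pmf (s'(B + 2 := code c0 (K Skip))) :: store pmf"
 have f: "evals (sim_step c0 cg B (Flip x) K) s
  (bind_pmf (map_pmf (%b. s(B + 4 + x := enc_bool b)) (bernoulli_pmf (1/2))) ?N) (1 + 1 + 1)"
  unfolding sim_step.simps by (rule evals_Seq[OF evals_Flip]) (rule evals_Assign')
 have e: "evals (sim_step c0 cg B (Flip x) K) s
  (map_pmf (%b. s(B + 4 + x := enc_bool b, B + 2 := code c0 (K Skip))) (bernoulli_pmf (1/2))) (tg + 7)"
 proof -
  have "bind_pmf (map_pmf (%b. s(B + 4 + x := enc_bool b)) (bernoulli_pmf (1/2))) ?N =
   map_pmf (%b. s(B + 4 + x := enc_bool b, B + 2 := code c0 (K Skip))) (bernoulli_pmf (1/2))"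
   by (simp add: map_pmf_def bind_assoc_pmf bind_return_pmf)
  then show ?thesis using evals_mono[OF f, of "tg + 7"] by simp
 qed
 have st: "sim_store (B + 4) nv (s(B + 4 + x := enc_bool b, B + 2 := code c0 (K Skip))) = (sim_store (B + 4) nv s)(x := enc_bool b)" for b
  using x by (simp add: sim_store_upd)
 show ?case
  by (rule exI, rule conjI[OF e]) (use x in \<open>auto simp: map_pmf_comp st[simplified] sim_frame_def\<close>)
next
 case (Sample x)
 have x: "x < nv" using Sample by simp
 let ?c3 = "Seq (Assign (B + 4 + x) (Var 0)) (Assign (B + 2) (datae (code c0 (K Skip))))"
 define s1 where "s1 = s(0 := s B)"
 obtain \<mu> where \<mu>: "evals cg s1 \<mu> tg" "map_pmf (%s. s 0) \<mu> = D" "\<forall>s'\<in>set_pmf \<mu>. \<forall>v\<ge>B. s' v = s1 v"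
  using cg[of s1] d by (auto simp: s1_def)
 have "\<exists>\<nu>. evals (Seq cg ?c3) s1 \<nu> (tg + 3 + 1) \<and>
  map_pmf (%s'. (s' (B + 2), sim_store (B + 4) nv s')) \<nu> =
   map_pmf (%x. x) (bind_pmf D (%t. return_pmf (code c0 (K Skip), (sim_store (B + 4) nv s)(x := t)))) \<and>
  (\<forall>s''\<in>set_pmf \<nu>. sim_frame B nv s s'')"
 proof (rule evals_Seq_obs[OF \<mu>(1), where obs = "%s. s 0" and e = id])
  show "map_pmf (%s. s 0) \<mu> = map_pmf id D" using \<mu>(2) by simp
  fix b s' assume b: "s' \<in> set_pmf \<mu>" "s' 0 = id b"
  have s': "s' v = s v" if "v >= B" for v using \<mu>(3) b(1) that B by (simp add: s1_def)
  let ?s = "s'(B + 4 + x := s' 0, B + 2 := code c0 (K Skip))"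
  have "evals ?c3 s' (return_pmf ?s) (1 + 2)"
   by (rule evals_Seq_Assign) (use evals_Assign' in simp)
  then have e3: "evals ?c3 s' (return_pmf ?s) 3" by (rule evals_mono) simp
  have stx: "sim_store (B + 4) nv ?s = (sim_store (B + 4) nv s)(x := b)"
   using b(2) x s' by (auto simp: sim_store_def fun_eq_iff)
  show "\<exists>\<nu>. evals ?c3 s' \<nu> 3 \<and>
    map_pmf (%s'. (s' (B + 2), sim_store (B + 4) nv s')) \<nu> =
    map_pmf (%x. x) (return_pmf (code c0 (K Skip), (sim_store (B + 4) nv s)(x := b))) \<and> (\<forall>s''\<in>set_pmf \<nu>. sim_frame B nv s s'')"
   by (rule exI, rule conjI[OF e3]) (use s' x stx in \<open>auto simp: sim_frame_def\<close>)
 qed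
 then obtain \<nu> where \<nu>: "evals (Seq cg ?c3) s1 \<nu> (tg + 3 + 1)"
  "map_pmf (%s'. (s' (B + 2), sim_store (B + 4) nv s')) \<nu> =
   map_pmf (%x. x) (bind_pmf D (%t. return_pmf (code c0 (K Skip), (sim_store (B + 4) nv s)(x := t))))"
  "\<forall>s''\<in>set_pmf \<nu>. sim_frame B nv s s''" by blast
 have "evals (sim_step c0 cg B (Sample x) K) s \<nu> (tg + 3 + 1 + 2)"
  unfolding sim_step.simps by (rule evals_Seq_Assign) (use \<nu>(1) in \<open>simp add: s1_def\<close>)
 then have e: "evals (sim_step c0 cg B (Sample x) K) s \<nu> (tg + 7)" by (rule evals_mono) simp
 have "map_pmf (%s'. (s' (B + 2), sim_store (B + 4) nv s')) \<nu> =
   map_pmf (%cs. (code c0 (K (fst cs)), snd cs)) (step D (Sample x) (sim_store (B + 4) nv s))"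
  unfolding \<nu>(2) by (simp add: map_pmf_def bind_assoc_pmf bind_return_pmf)
 then show ?case using e \<nu>(3) by blast
qed

lemma evals_dispatch:
 fixes s :: store
 assumes B: "B > 0" and d: "s B = d"
  and cg: "\<And>s. s 0 = d ==> \<exists>\<mu>. evals cg s \<mu> tg \<and> map_pmf (%s. s 0) \<mu> = D \<and> (\<forall>s'\<in>set_pmf \<mu>. \<forall>v\<ge>B. s' v = s v)"
  and nv: "\<And>c. c \<in> set cs ==> com_vars c <= nv"
  and i: "s (B + 3) = enc_unary i" "i < length cs"
 shows "\<exists>\<mu>. evals (dispatch c0 cg B cs) s \<mu> (3 * length cs + tg + 7) \<and>
  map_pmf (%s'. (s' (B + 2), sim_store (B + 4) nv s')) \<mu> =
   map_pmf (%cs. (code c0 (fst cs), snd cs)) (step D (cs ! i) (sim_store (B + 4) nv s)) \<and>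
  (\<forall>s'\<in>set_pmf \<mu>. sim_frame B nv s s')"
 using d nv i
proof (induction cs arbitrary: i s)
 case (Cons c cs)
 show ?case
 proof (cases i)
  case 0
  obtain \<mu> where \<mu>: "evals (sim_step c0 cg B c id) s \<mu> (tg + 7)"
  "map_pmf (%s'. (s' (B + 2), sim_store (B + 4) nv s')) \<mu> =
   map_pmf (%cs. (code c0 (id (fst cs)), snd cs)) (step D c (sim_store (B + 4) nv s))"
  "\<forall>s'\<in>set_pmf \<mu>. sim_frame B nv s s'"
  proof -
   have "\<exists>\<mu>. evals (sim_step c0 cg B c id) s \<mu> (tg + 7) \<and>
    map_pmf (%s'. (s' (B + 2), sim_store (B + 4) nv s')) \<mu> =
     map_pmf (%cs. (code c0 (id (fst cs)), snd cs)) (step D c (sim_store (B + 4) nv s)) \<and>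
    (\<forall>s'\<in>set_pmf \<mu>. sim_frame B nv s s')"
    by (rule evals_sim_step[where s = s and d = d, OF B])
     (use Cons.prems(1,2) cg in auto)
   then show ?thesis using that by blast
  qed
  have "evals (dispatch c0 cg B (c # cs)) s \<mu> (Suc (tg + 7))"
   unfolding dispatch.simps by (rule evals_If) (use \<mu>(1) Cons.prems(3) 0 in simp)
  then have "evals (dispatch c0 cg B (c # cs)) s \<mu> (3 * length (c # cs) + tg + 7)" by (rule evals_mono) simp
  then show ?thesis using \<mu>(2,3) 0 by (intro exI[of _ \<mu>]) simp
 next
  case (Suc j)
  define s1 where "s1 = s(B + 3 := right (s (B + 3)))"
  have "\<exists>\<mu>. evals (dispatch c0 cg B cs) s1 \<mu> (3 * length cs + tg + 7) \<and>
   map_pmf (%s'. (s' (B + 2), sim_store (B + 4) nv s')) \<mu> =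
    map_pmf (%cs. (code c0 (fst cs), snd cs)) (step D (cs ! j) (sim_store (B + 4) nv s1)) \<and>
   (\<forall>s'\<in>set_pmf \<mu>. sim_frame B nv s1 s')"
   by (rule Cons.IH) (use Cons.prems Suc in \<open>auto simp: s1_def\<close>)
  then obtain \<mu> where \<mu>: "evals (dispatch c0 cg B cs) s1 \<mu> (3 * length cs + tg + 7)"
   "map_pmf (%s'. (s' (B + 2), sim_store (B + 4) nv s')) \<mu> =
    map_pmf (%cs. (code c0 (fst cs), snd cs)) (step D (cs ! j) (sim_store (B + 4) nv s1))"
   "\<forall>s'\<in>set_pmf \<mu>. sim_frame B nv s1 s'" by blast
  have "evals (Seq (Assign (B + 3) (RightE (Var (B + 3)))) (dispatch c0 cg B cs)) s \<mu> (3 * length cs + tg + 7 + 2)"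
   by (rule evals_Seq_Assign) (use \<mu>(1) in \<open>simp add: s1_def\<close>)
  then have "evals (dispatch c0 cg B (c # cs)) s \<mu> (Suc (3 * length cs + tg + 7 + 2))"
   unfolding dispatch.simps by (intro evals_If) (use Cons.prems(3) Suc in simp)
  then have "evals (dispatch c0 cg B (c # cs)) s \<mu> (3 * length (c # cs) + tg + 7)" by (rule evals_mono) simp
  moreover have "sim_store (B + 4) nv s1 = sim_store (B + 4) nv s" by (simp add: s1_def sim_store_upd)
  moreover have "sim_frame B nv s1 s' \<longleftrightarrow> sim_frame B nv s s'" for s' by (simp add: sim_frame_def s1_def)
  ultimately show ?thesis using \<mu>(2,3) Suc by (intro exI[of _ \<mu>]) simp
 qed
qed simp

definition sim_body :: "com => com => nat => com" where
 "sim_body c0 cg B = Seq (Assign (B + 1) (RightE (Var (B + 1))))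
  (Seq (Assign (B + 3) (Var (B + 2))) (dispatch c0 cg B (reachable c0)))"

text \<open>Each round performs one step and takes a cell off the clock. A program that halts
  earlier idles in \<open>Skip\<close>, so that \<open>n\<close> rounds always equal
  \<open>n\<close> steps of \<open>run\<close>.\<close>

lemma evals_sim_loop:
 fixes s :: store
 assumes B: "B > 0" and d: "s B = d"
  and cg: "\<And>s. s 0 = d ==> \<exists>\<mu>. evals cg s \<mu> tg \<and> map_pmf (%s. s 0) \<mu> = D \<and> (\<forall>s'\<in>set_pmf \<mu>. \<forall>v\<ge>B. s' v = s v)"
  and nv: "com_vars c0 <= nv"
  and s: "s (B + 1) = enc_unary n" "s (B + 2) = code c0 c" "c \<in> set (reachable c0)"
 shows "\<exists>\<mu>. evals (While (Var (B + 1)) (sim_body c0 cg B)) s \<mu> (n * (3 * length (reachable c0) + tg + 13) + 1) \<and>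
  map_pmf (%s'. (s' (B + 2), sim_store (B + 4) nv s')) \<mu> =
   map_pmf (%cs. (code c0 (fst cs), snd cs)) (run D (c, sim_store (B + 4) nv s) n) \<and>
  (\<forall>s'\<in>set_pmf \<mu>. \<forall>v\<ge>B + 4 + nv. s' v = s v)"
 using d s
proof (induction n arbitrary: s c)
 case 0
 have "evals (While (Var (B + 1)) (sim_body c0 cg B)) s (return_pmf s) 1"
  by (rule evals_While_False) (use 0 in simp)
 then show ?case using 0 by (intro exI[of _ "return_pmf s"]) simp
next
 case (Suc n)
 let ?W = "While (Var (B + 1)) (sim_body c0 cg B)"
 obtain i where i: "code c0 c = enc_unary i" "i < length (reachable c0)" "reachable c0 ! i = c" using code[OF Suc.prems(4)] .
 define s1 where "s1 = s(B + 1 := right (s (B + 1)))"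
 define s2 where "s2 = s1(B + 3 := s1 (B + 2))"
 have st2: "sim_store (B + 4) nv s2 = sim_store (B + 4) nv s" by (simp add: s1_def s2_def sim_store_upd)
 have "\<exists>\<mu>. evals (dispatch c0 cg B (reachable c0)) s2 \<mu> (3 * length (reachable c0) + tg + 7) \<and>
  map_pmf (%s'. (s' (B + 2), sim_store (B + 4) nv s')) \<mu> =
   map_pmf (%cs. (code c0 (fst cs), snd cs)) (step D (reachable c0 ! i) (sim_store (B + 4) nv s2)) \<and>
  (\<forall>s'\<in>set_pmf \<mu>. sim_frame B nv s2 s')"
 proof (rule evals_dispatch[OF B, where d = d])
  show "\<exists>\<mu>. evals cg s0 \<mu> tg \<and> map_pmf (%s. s 0) \<mu> = D \<and> (\<forall>s'\<in>set_pmf \<mu>. \<forall>v\<ge>B. s' v = s0 v)"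
   if "s0 0 = d" for s0 :: store using cg[of s0] that by blast
  show "com_vars c <= nv" if "c \<in> set (reachable c0)" for c using reachable_vars[OF that] nv by simp
 qed (use Suc.prems i in \<open>auto simp: s2_def s1_def\<close>)
 then obtain \<mu> where \<mu>: "evals (dispatch c0 cg B (reachable c0)) s2 \<mu> (3 * length (reachable c0) + tg + 7)"
  "map_pmf (%s'. (s' (B + 2), sim_store (B + 4) nv s')) \<mu> =
   map_pmf (%cs. (code c0 (fst cs), snd cs)) (step D c (sim_store (B + 4) nv s))"
  "\<forall>s'\<in>set_pmf \<mu>. sim_frame B nv s2 s'" unfolding i(3) st2 by blast
 have body: "evals (sim_body c0 cg B) s \<mu> (3 * length (reachable c0) + tg + 7 + 2 + 2)"
  unfolding sim_body_def
  by (rule evals_Seq_Assign, rule evals_Seq_Assign) (use \<mu>(1) in \<open>simp add: s2_def s1_def\<close>)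
 let ?t = "n * (3 * length (reachable c0) + tg + 13) + 1"
 let ?h = "%s'. (s' (B + 2), sim_store (B + 4) nv s')"
 let ?e = "%cs. (code c0 (fst cs), snd cs)"
 obtain N where N: "\<And>s'. s' \<in> set_pmf \<mu> ==> evals ?W s' (N s') ?t"
  "map_pmf ?h (bind_pmf \<mu> N) = map_pmf ?e (bind_pmf (step D c (sim_store (B + 4) nv s)) (%cs. run D cs n))"
  "\<forall>s''\<in>set_pmf (bind_pmf \<mu> N). \<forall>v\<ge>B + 4 + nv. s'' v = s v"
 proof (rule bind_obs[OF \<mu>(2), where ?c2.0 = ?W and ?t2.0 = ?t and h = ?h and ?e2.0 = ?e and
    g = "%cs. run D cs n" and P = "%s''. \<forall>v\<ge>B + 4 + nv. s'' v = s v"])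
  fix b s' assume b: "b \<in> set_pmf (step D c (sim_store (B + 4) nv s))" "s' \<in> set_pmf \<mu>"
   "(s' (B + 2), sim_store (B + 4) nv s') = (code c0 (fst b), snd b)"
  have fr: "s' B = d" "s' (B + 1) = enc_unary n" "\<forall>v\<ge>B + 4 + nv. s' v = s v"
   using \<mu>(3) b(2) Suc.prems by (auto simp: sim_frame_def s2_def s1_def)
  have "\<exists>\<nu>. evals ?W s' \<nu> ?t \<and> map_pmf ?h \<nu> = map_pmf ?e (run D (fst b, sim_store (B + 4) nv s') n) \<and>
   (\<forall>s''\<in>set_pmf \<nu>. \<forall>v\<ge>B + 4 + nv. s'' v = s' v)"
   by (rule Suc.IH) (use fr b reachable_step[OF Suc.prems(4) b(1)] in auto)
  then show "\<exists>\<nu>. evals ?W s' \<nu> ?t \<and> map_pmf ?h \<nu> = map_pmf ?e (run D b n) \<and>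
   (\<forall>s''\<in>set_pmf \<nu>. \<forall>v\<ge>B + 4 + nv. s'' v = s v)"
   using fr(3) b(3) by simp
 qed blast
 have "evals ?W s (bind_pmf \<mu> N) (3 * length (reachable c0) + tg + 7 + 2 + 2 + ?t + 2)"
  by (rule evals_While_True[OF _ body N(1)]) (use Suc.prems in auto)
 then show ?case using N(2,3) by (intro exI[of _ "bind_pmf \<mu> N"]) (simp add: algebra_simps)
qed

text \<open>The simulated program expects all variables but its input to be \<open>Leaf\<close>,
  whereas \<open>comp_by\<close> promises nothing about initial registers.\<close>

primrec clear :: "nat => nat => com => com" where
 "clear V 0 c = c"
| "clear V (Suc k) c = Seq (Assign (V + k) LeafE) (clear V k c)"

lemma evals_clear:
 assumes "evals c (%v. if V <= v \<and> v < V + k then Leaf else s v) \<mu> t"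
 shows "evals (clear V k c) s \<mu> (t + 2 * k)"
 using assms
proof (induction k arbitrary: s)
 case (Suc k)
 have "(%v. if V <= v \<and> v < V + Suc k then Leaf else s v) = (%v. if V <= v \<and> v < V + k then Leaf else (s(V + k := Leaf)) v)"
  by (auto simp: fun_eq_iff)
 then have "evals (clear V k c) (s(V + k := Leaf)) \<mu> (t + 2 * k)" using Suc by metis
 then have "evals (Seq (Assign (V + k) LeafE) (clear V k c)) s \<mu> (t + 2 * k + 2)"
  by (intro evals_Seq_Assign) simp
 then show ?case by simp
next
 case 0
 have "(%v. if V <= v \<and> v < V + 0 then Leaf else s v) = s" by (rule ext) auto
 then show ?case using 0 by simp
qed

text \<open>Equality with \<open>enc_bool True\<close> is decided by \<open>Leaf\<close> tests on
  the root and its two children.\<close>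

definition sim_out :: "nat => com" where
 "sim_out V = If (Var V) (If (LeftE (Var V)) (Assign 0 LeafE) (If (RightE (Var V)) (Assign 0 LeafE)
  (Assign 0 (NodeE LeafE LeafE)))) (Assign 0 LeafE)"

lemma evals_sim_out: "evals (sim_out V) s (return_pmf (s(0 := enc_bool (s V = enc_bool True)))) 4"
proof -
 have a: "evals (Assign 0 LeafE) s (return_pmf (s(0 := Leaf))) 1" "evals (Assign 0 (NodeE LeafE LeafE)) s (return_pmf (s(0 := Node Leaf Leaf))) 1"
  using evals_Assign[of 0 LeafE s] evals_Assign[of 0 "NodeE LeafE LeafE" s] by simp_all
 have "evals (If (RightE (Var V)) (Assign 0 LeafE) (Assign 0 (NodeE LeafE LeafE))) s
  (return_pmf (s(0 := if right (s V) ~= Leaf then Leaf else Node Leaf Leaf))) (Suc 1)"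
  by (rule evals_If) (use a in auto)
 then have "evals (If (LeftE (Var V)) (Assign 0 LeafE) (If (RightE (Var V)) (Assign 0 LeafE) (Assign 0 (NodeE LeafE LeafE)))) s
  (return_pmf (s(0 := if left (s V) ~= Leaf \<or> right (s V) ~= Leaf then Leaf else Node Leaf Leaf))) (Suc (Suc 1))"
  by (intro evals_If) (use evals_mono[OF a(1)] in auto)
 then have "evals (sim_out V) s
  (return_pmf (s(0 := if s V = Leaf \<or> left (s V) ~= Leaf \<or> right (s V) ~= Leaf then Leaf else Node Leaf Leaf))) (Suc (Suc (Suc 1)))"
  unfolding sim_out_def by (intro evals_If) (use evals_mono[OF a(1)] in auto)
 moreover have "(if s V = Leaf \<or> left (s V) ~= Leaf \<or> right (s V) ~= Leaf then Leaf else Node Leaf Leaf) = enc_bool (s V = enc_bool True)"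
  by (cases "s V") auto
 ultimately show ?thesis by (simp add: eval_nat_numeral)
qed

text \<open>The clock makes the simulation polynomial for every program and every polynomial-time
  generator. So the procedure is also defined on wrong guesses, where the tester carries no
  guarantee and may fail to halt.\<close>

lemma RT_sim:
 assumes gen: "RT E eg gen" and X: "PT E e1 X" and n: "PT E enc_unary n"
 shows "RT E enc_bool (%x. map_pmf (%cs. snd cs 0 = enc_bool True) (exec (map_pmf eg (gen x)) c0 (e1 (X x)) (n x)))"
proof -
 obtain cg B p where g: "comp_by cg B (%a. poly p (ms E a)) (snd \<circ> E) eg gen" "B > 0"
  "\<And>a b. b \<in> set_pmf (gen a) ==> size (eg b) <= poly p (ms E a)"
  by (rule RT_E[OF gen]) (rule that, auto)
 define nv where "nv = Suc (com_vars c0)"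
 let ?E = "env_pair (env_pair E e1) enc_unary"
 let ?W = "While (Var (B + 1)) (sim_body c0 cg B)"
 let ?f = "%z. map_pmf (%cs. snd cs 0 = enc_bool True) (exec (map_pmf eg (gen (fst (fst z)))) c0 (e1 (snd (fst z))) (snd z))"
 define c3 where "c3 = Seq ?W (sim_out (B + 4))"
 define c2 where "c2 = Seq (Assign (B + 4) (RightE (LeftE (Var 0)))) (Seq (Assign (B + 2) (datae (code c0 c0))) c3)"
 define c1 where "c1 = Seq (Assign B (LeftE (LeftE (Var 0)))) (Seq (Assign (B + 1) (RightE (Var 0))) (clear (B + 4) nv c2))"
 define T where "T z = snd z * (3 * length (reachable c0) + poly p (ms E (fst (fst z))) + 13) + 1 + 4 + 1 + 4 + 2 * nv + 4" for z :: "('a \<times> 'c) \<times> nat"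
 have "comp_by c1 (B + 4 + nv) T (snd \<circ> ?E) enc_bool ?f"
  unfolding comp_by_def
 proof (intro allI impI)
  fix z and s :: store assume s: "s 0 = (snd \<circ> ?E) z"
  obtain x y m where z: "z = ((x, y), m)" by (metis surj_pair)
  have s0: "s 0 = Node (Node (snd (E x)) (e1 y)) (enc_unary m)" using s by (simp add: z env_pair_def)
  define s1 where "s1 = s(B := snd (E x), B + 1 := enc_unary m)"
  define s2 where "s2 = (%v. if B + 4 <= v \<and> v < B + 4 + nv then Leaf else s1 v)"
  define s3 where "s3 = s2(B + 4 := e1 y, B + 2 := code c0 c0)"
  have s30: "s3 B = snd (E x)" "s3 (B + 1) = enc_unary m" "s3 (B + 2) = code c0 c0" "\<forall>v\<ge>B + 4 + nv. s3 v = s v"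
   by (auto simp: s3_def s2_def s1_def nv_def)
  have st: "sim_store (B + 4) nv s3 = (%_. Leaf)(0 := e1 y)"
   by (auto simp: sim_store_def s3_def s2_def nv_def fun_eq_iff)
  let ?t = "m * (3 * length (reachable c0) + poly p (ms E x) + 13) + 1"
  have "\<exists>\<mu>. evals ?W s3 \<mu> ?t \<and>
   map_pmf (%s'. (s' (B + 2), sim_store (B + 4) nv s')) \<mu> =
   map_pmf (%cs. (code c0 (fst cs), snd cs)) (run (map_pmf eg (gen x)) (c0, sim_store (B + 4) nv s3) m) \<and>
   (\<forall>s'\<in>set_pmf \<mu>. \<forall>v\<ge>B + 4 + nv. s' v = s3 v)"
  proof (rule evals_sim_loop[OF g(2), where d = "snd (E x)"])
   show "\<exists>\<mu>. evals cg s0 \<mu> (poly p (ms E x)) \<and> map_pmf (%s. s 0) \<mu> = map_pmf eg (gen x) \<and> (\<forall>s'\<in>set_pmf \<mu>. \<forall>v\<ge>B. s' v = s0 v)"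
    if "s0 0 = snd (E x)" for s0 :: store
    using comp_by_apply[OF g(1), where s = s0 and a = x] that by simp
  qed (use s30 reachable_self in \<open>auto simp: nv_def\<close>)
  then obtain \<mu> where \<mu>: "evals ?W s3 \<mu> ?t"
   "map_pmf (%s'. (s' (B + 2), sim_store (B + 4) nv s')) \<mu> =
   map_pmf (%cs. (code c0 (fst cs), snd cs)) (run (map_pmf eg (gen x)) (c0, (%_. Leaf)(0 := e1 y)) m)"
   "\<forall>s'\<in>set_pmf \<mu>. \<forall>v\<ge>B + 4 + nv. s' v = s3 v" unfolding st by blast
  let ?\<nu> = "bind_pmf \<mu> (%s. return_pmf (s(0 := enc_bool (s (B + 4) = enc_bool True))))"
  have "evals c3 s3 ?\<nu> (?t + 4 + 1)"
   unfolding c3_def by (rule evals_Seq[OF \<mu>(1)]) (rule evals_sim_out)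
  then have "evals c2 s2 ?\<nu> (?t + 4 + 1 + 2 + 2)"
   unfolding c2_def using g(2)
   by (intro evals_Seq_Assign) (simp add: s3_def s2_def s1_def s0)
  then have "evals (clear (B + 4) nv c2) s1 ?\<nu> (?t + 4 + 1 + 2 + 2 + 2 * nv)"
   unfolding s2_def by (rule evals_clear)
  then have "evals c1 s ?\<nu> (?t + 4 + 1 + 2 + 2 + 2 * nv + 2 + 2)"
   unfolding c1_def using g(2) by (intro evals_Seq_Assign) (simp add: s1_def s0)
  then have e: "evals c1 s ?\<nu> (T z)" by (rule evals_mono) (simp add: T_def z)
  have "map_pmf (%s. s 0) ?\<nu> = map_pmf (%s. enc_bool (s (B + 4) = enc_bool True)) \<mu>"
   by (simp add: map_pmf_def bind_assoc_pmf bind_return_pmf)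
  also have "\<dots> = map_pmf (%z. enc_bool (snd z 0 = enc_bool True)) (map_pmf (%s'. (s' (B + 2), sim_store (B + 4) nv s')) \<mu>)"
   by (simp add: map_pmf_comp sim_store_def nv_def)
  also have "\<dots> = map_pmf enc_bool (?f z)"
   unfolding \<mu>(2) exec_eq_run by (simp add: map_pmf_comp z)
  finally show "\<exists>\<mu>. evals c1 s \<mu> (T z) \<and> map_pmf (%s. s 0) \<mu> = map_pmf enc_bool (?f z) \<and>
   (\<forall>s'\<in>set_pmf \<mu>. \<forall>v\<ge>B + 4 + nv. s' v = s v)"
   using e \<mu>(3) s30(4) by (intro exI[of _ ?\<nu>]) auto
 qed
 then have "RT ?E enc_bool ?f"
 proof (rule RT_I[where p = "[:0, 1:] * ([:3 * length (reachable c0) + 13:] + p) + [:14 + 2 * nv:]" and q = 1])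
  fix z :: "('a \<times> 'c) \<times> nat"
  obtain x y m where z: "z = ((x, y), m)" by (metis surj_pair)
  have "poly p (ms E x) <= poly p (ms ?E z)" by (intro poly_nat_mono) (simp add: z ms_env_pair)
  then have "m * (3 * length (reachable c0) + poly p (ms E x) + 13) <= ms ?E z * (3 * length (reachable c0) + 13 + poly p (ms ?E z))"
   by (intro mult_mono) (auto simp: z ms_env_pair)
  then show "T z <= poly ([:0, 1:] * ([:3 * length (reachable c0) + 13:] + p) + [:14 + 2 * nv:]) (ms ?E z)"
   by (simp add: T_def z)
 qed (use size_enc_bool in simp)
 then have "RT (env_pair E e1) enc_bool (%z. map_pmf (%cs. snd cs 0 = enc_bool True)
  (exec (map_pmf eg (gen (fst z))) c0 (e1 (snd z)) (n (fst z))))"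
  by (rule PT_comp2[OF RT_env[OF n], where g = "%z m. map_pmf (%cs. snd cs 0 = enc_bool True)
  (exec (map_pmf eg (gen (fst z))) c0 (e1 (snd z)) m)"])
 then show ?thesis
  by (rule PT_comp2[OF X, where g = "%x y. map_pmf (%cs. snd cs 0 = enc_bool True)
  (exec (map_pmf eg (gen x)) c0 (e1 y) (n x))"])
qed

section \<open>Peierls argument on wires\<close>

lemma sum_Pow_power_card:
 fixes x :: real
 assumes "finite S"
 shows "(\<Sum>T\<in>Pow S. x ^ card T) = (1 + x) ^ card S"
 using assms
proof (induction S rule: finite_induct)
 case (insert a S)
 have fin: "finite T" if "T \<in> Pow S" for T using that insert.hyps(1) by (auto intro: finite_subset)
 have "(\<Sum>T\<in>Pow (insert a S). x ^ card T) = (\<Sum>T\<in>Pow S. x ^ card T) + (\<Sum>T\<in>insert a ` Pow S. x ^ card T)"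
  unfolding Pow_insert using insert.hyps by (intro sum.union_disjoint) auto
 also have "(\<Sum>T\<in>insert a ` Pow S. x ^ card T) = (\<Sum>T\<in>Pow S. x * x ^ card T)"
 proof (subst sum.reindex)
  show "inj_on (insert a) (Pow S)"
  proof (rule inj_onI)
   fix x y assume "x \<in> Pow S" "y \<in> Pow S" "insert a x = insert a y"
   then show "x = y" using insert.hyps(2) insert_ident[of a x y] by blast
  qed
  have "card (insert a T) = Suc (card T)" if "T \<in> Pow S" for T
   using fin[OF that] that insert.hyps(2) by (intro card_insert_disjoint) auto
  then show "sum ((%T. x ^ card T) \<circ> insert a) (Pow S) = (\<Sum>T\<in>Pow S. x * x ^ card T)"
   by (intro sum.cong) auto
 qed
 finally show ?case using insert by (simp add: sum_distrib_left[symmetric] algebra_simps)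
qed simp

text \<open>Here \<open>s\<close> and \<open>t\<close> count the spins 2 in two neighbouring blobs
  of size \<open>b\<close>, so the left side is the number of mismatched pairs. Flipping the spins
  of a blob replaces \<open>s\<close> by \<open>b - s\<close>; this reduces everything to minorities
  \<open>u\<close>, \<open>v\<close> of size at most \<open>b / 2\<close>, with equal majorities in
  \<open>agree\<close> and opposite ones in \<open>disagree\<close>.\<close>

lemma minority_bound:
 fixes s t b :: real
 assumes "0 <= s" "s <= b" "0 <= t" "t <= b"
 shows "s * (b - t) + t * (b - s) >=
  b / 4 * (min s (b - s) + min t (b - t)) + b\<^sup>2 / 4 * of_bool ((2 * s > b) ~= (2 * t > b))"
proof -
 have agree: "u * (b - v) + v * (b - u) >= b / 4 * (u + v)" if "0 <= u" "0 <= v" "2 * u <= b" "2 * v <= b" for u v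
 proof -
  have "u * v <= u * (b / 2)" "v * u <= v * (b / 2)" using that by (intro mult_left_mono; simp)+
  then have "2 * (u * v) <= (u * b + v * b) / 2" by (simp add: mult.commute)
  moreover have "0 <= u * b + v * b" using that assms by simp
  moreover have "u * (b - v) + v * (b - u) = u * b + v * b - 2 * (u * v)" by (simp add: algebra_simps)
  moreover have "b / 4 * (u + v) = (u * b + v * b) / 4" by (simp add: algebra_simps)
  moreover have "q / 4 <= q - p" if "p <= q / 2" "0 <= q" for p q :: real using that by linarith
  ultimately show ?thesis by presburger
 qed
 have disagree: "u * v + (b - u) * (b - v) >= b / 4 * (u + v) + b\<^sup>2 / 4" if "0 <= u" "0 <= v" "2 * u <= b" "2 * v <= b" for u v
 proof -
  have "0 <= (b / 2 - u) * (b / 2 - v)" using that by simp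
  then have 1: "u * v >= b / 2 * (u + v) - b\<^sup>2 / 4" by (simp add: algebra_simps power2_eq_square)
  have "b * (u + v) <= b\<^sup>2" using that assms unfolding power2_eq_square by (intro mult_left_mono) auto
  moreover have "2 * (u * v) >= b * (u + v) - b\<^sup>2 / 2" using 1 by simp
  moreover have "u * v + (b - u) * (b - v) = 2 * (u * v) + b\<^sup>2 - b * (u + v)" by (simp add: algebra_simps power2_eq_square)
  moreover have "b / 4 * (u + v) = b * (u + v) / 4" by simp
  moreover have "q / 4 + B / 4 <= p + B - q" if "q <= B" "p >= q - B / 2" for p q B :: real using that by linarith
  ultimately show ?thesis by presburger
 qed
 consider "2 * s <= b" "2 * t <= b" | "2 * s > b" "2 * t > b" | "2 * s <= b" "2 * t > b" | "2 * s > b" "2 * t <= b" by linarith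
 then show ?thesis
 proof cases
  case 1
  then have "min s (b - s) = s" "min t (b - t) = t" by auto
  then show ?thesis using agree[of s t] assms 1 by simp
 next
  case 2
  then have m: "min s (b - s) = b - s" "min t (b - t) = b - t" by auto
  have X: "(b - s) * (b - (b - t)) + (b - t) * (b - (b - s)) >= b / 4 * ((b - s) + (b - t))"
   by (rule agree) (use 2 assms in auto)
  have eq: "(b - s) * (b - (b - t)) + (b - t) * (b - (b - s)) = s * (b - t) + t * (b - s)" by (simp add: algebra_simps)
  have bb: "of_bool ((2 * s > b) ~= (2 * t > b)) = (0::real)" using 2 by simp
  show ?thesis unfolding m bb using X unfolding eq by (simp only: mult_zero_right add_0_right mult_1_right)
 next
  case 3
  then have m: "min s (b - s) = s" "min t (b - t) = b - t" by auto
  have X: "s * (b - t) + (b - s) * (b - (b - t)) >= b / 4 * (s + (b - t)) + b\<^sup>2 / 4"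
   by (rule disagree) (use 3 assms in auto)
  have eq: "s * (b - t) + (b - s) * (b - (b - t)) = s * (b - t) + t * (b - s)" by (simp add: algebra_simps)
  have bb: "of_bool ((2 * s > b) ~= (2 * t > b)) = (1::real)" using 3 by simp
  show ?thesis unfolding m bb using X unfolding eq by (simp only: mult_zero_right add_0_right mult_1_right)
 next
  case 4
  then have m: "min s (b - s) = b - s" "min t (b - t) = t" by auto
  have X: "(b - s) * t + (b - (b - s)) * (b - t) >= b / 4 * ((b - s) + t) + b\<^sup>2 / 4"
   by (rule disagree) (use 4 assms in auto)
  have eq: "(b - s) * t + (b - (b - s)) * (b - t) = s * (b - t) + t * (b - s)" by (simp add: algebra_simps)
  have bb: "of_bool ((2 * s > b) ~= (2 * t > b)) = (1::real)" using 4 by simp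
  show ?thesis unfolding m bb using X unfolding eq by (simp only: mult_zero_right add_0_right mult_1_right)
 qed
qed

definition blob_configs :: "nat => nat => (nat \<times> nat => nat) set" where
 "blob_configs L b = ({..<L} \<times> {..<b}) \<rightarrow>\<^sub>E {1..2}"

definition mismatches :: "nat => nat => (nat \<times> nat => nat) => (nat \<times> nat \<times> nat) set" where
 "mismatches L b s = {(j, a, a'). Suc j < L \<and> a < b \<and> a' < b \<and> s (j, a) ~= s (Suc j, a')}"

lemma finite_blob_configs [simp]: "finite (blob_configs L b)"
 unfolding blob_configs_def by (intro finite_PiE) auto

lemma blob_configs_12:
 assumes "s \<in> blob_configs L b" "j < L" "a < b"
 shows "s (j, a) = 1 \<or> s (j, a) = 2"
proof -
 have "s (j, a) \<in> {1..2}"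
  by (rule PiE_mem[OF assms(1)[unfolded blob_configs_def]]) (use assms in simp)
 then have "1 <= s (j, a)" "s (j, a) <= 2" by simp_all
 then show ?thesis by linarith
qed

lemma finite_mismatches: "finite (mismatches L b s)"
proof (rule finite_subset)
 show "mismatches L b s \<subseteq> {..<L} \<times> {..<b} \<times> {..<b}" by (auto simp: mismatches_def)
qed auto

definition ones :: "nat => (nat \<times> nat => nat) => nat => nat" where
 "ones b s j = card {a. a < b \<and> s (j, a) = 2}"

definition majority :: "nat => (nat \<times> nat => nat) => nat => nat" where
 "majority b s j = (if 2 * ones b s j > b then 2 else 1)"

text \<open>A configuration of a chain of \<open>L\<close> blobs is coded by the majority spin of the first blob, the places where the
 majority spin changes (marked by the extra column \<open>b\<close>) and the cells in the minority of their blob.\<close>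

definition blob_code :: "nat => nat => (nat \<times> nat => nat) => nat \<times> (nat \<times> nat) set" where
 "blob_code L b s = (majority b s 0,
  {(j, a). j < L \<and> a < b \<and> s (j, a) ~= majority b s j} \<union>
  (%j. (j, b)) ` {j. Suc j < L \<and> majority b s j ~= majority b s (Suc j)})"

lemma majority_12: "majority b s j = 1 \<or> majority b s j = 2"
 by (simp add: majority_def)

lemma two_valued:
 fixes x y x' y' :: nat
 assumes "x = 1 \<or> x = 2" "x' = 1 \<or> x' = 2" "y = 1 \<or> y = 2" "y' = 1 \<or> y' = 2"
  and "x = x'" "(x ~= y) = (x' ~= y')"
 shows "y = y'"
 using assms by auto

lemma blob_code_inj: "inj_on (blob_code L b) (blob_configs L b)"
proof (rule inj_onI)
 fix s t assume s: "s \<in> blob_configs L b" and t: "t \<in> blob_configs L b" and eq: "blob_code L b s = blob_code L b t"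
 have 0: "majority b s 0 = majority b t 0" using eq by (simp add: blob_code_def)
 have S: "snd (blob_code L b s) = snd (blob_code L b t)" using eq by simp
 have ch: "majority b s j ~= majority b s (Suc j) \<longleftrightarrow> majority b t j ~= majority b t (Suc j)" if "Suc j < L" for j
 proof -
  have "(j, b) \<in> snd (blob_code L b s) \<longleftrightarrow> (j, b) \<in> snd (blob_code L b t)" using S by simp
  then show ?thesis using that by (auto simp: blob_code_def)
 qed
 have mi: "s (j, a) ~= majority b s j \<longleftrightarrow> t (j, a) ~= majority b t j" if "j < L" "a < b" for j a
 proof -
  have "(j, a) \<in> snd (blob_code L b s) \<longleftrightarrow> (j, a) \<in> snd (blob_code L b t)" using S by simp
  then show ?thesis using that by (auto simp: blob_code_def)
 qed
 have maj: "majority b s j = majority b t j" if "j < L" for j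
  using that
 proof (induction j)
  case (Suc j)
  show ?case
   by (rule two_valued[OF majority_12[of b s j] majority_12[of b t j] majority_12 majority_12])
    (use Suc ch[of j] in auto)
 qed (use 0 in simp)
 show "s = t"
 proof (rule PiE_ext[OF s[unfolded blob_configs_def] t[unfolded blob_configs_def]])
  fix z assume "z \<in> {..<L} \<times> {..<b}"
  then obtain j a where z: "z = (j, a)" "j < L" "a < b" by auto
  show "s z = t z" unfolding z(1)
   by (rule two_valued[OF majority_12[of b s j] majority_12[of b t j] blob_configs_12[OF s z(2,3)] blob_configs_12[OF t z(2,3)]
     maj[OF z(2)]]) (use mi[OF z(2,3)] in auto)
 qed
qed

lemma card_minority:
 assumes "s \<in> blob_configs L b" "j < L"
 shows "real (card {a. a < b \<and> s (j, a) ~= majority b s j}) = min (real (ones b s j)) (real b - real (ones b s j))"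
  and "ones b s j <= b" and "card {a. a < b \<and> s (j, a) = 1} = b - ones b s j"
proof -
 have v12: "a < b ==> s (j, a) = 1 \<or> s (j, a) = 2" for a using blob_configs_12[OF assms] by blast
 then have un: "{a. a < b \<and> s (j, a) = 1} \<union> {a. a < b \<and> s (j, a) = 2} = {..<b}" by blast
 have "card ({a. a < b \<and> s (j, a) = 1} \<union> {a. a < b \<and> s (j, a) = 2}) = card {a. a < b \<and> s (j, a) = 1} + ones b s j"
  unfolding ones_def by (intro card_Un_disjoint) auto
 then have c: "card {a. a < b \<and> s (j, a) = 1} + ones b s j = b" unfolding un by simp
 then show o: "ones b s j <= b" and c1: "card {a. a < b \<and> s (j, a) = 1} = b - ones b s j" by auto
 show "real (card {a. a < b \<and> s (j, a) ~= majority b s j}) = min (real (ones b s j)) (real b - real (ones b s j))"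
 proof (cases "2 * ones b s j > b")
  case True
  then have "majority b s j = 2" by (simp add: majority_def)
  then have "{a. a < b \<and> s (j, a) ~= majority b s j} = {a. a < b \<and> s (j, a) = 1}"
   using v12 by (intro Collect_cong) auto
  then show ?thesis using c1 True o by (simp add: min_def of_nat_diff)
 next
  case False
  then have "majority b s j = 1" by (simp add: majority_def)
  then have "{a. a < b \<and> s (j, a) ~= majority b s j} = {a. a < b \<and> s (j, a) = 2}"
   using v12 by (intro Collect_cong) auto
  then show ?thesis using False by (simp add: min_def ones_def)
 qed
qed

lemma card_mismatches:
 assumes s: "s \<in> blob_configs L b"
 shows "real (card (mismatches L b s)) = (\<Sum>j<L - 1. real (ones b s j) * (real b - real (ones b s (Suc j))) +
   real (ones b s (Suc j)) * (real b - real (ones b s j)))"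
proof -
 define S1 where "S1 j v = {a. a < b \<and> s (j, a) = (v::nat)}" for j v
 have "mismatches L b s = Sigma {..<L - 1} (%j. S1 j 2 \<times> S1 (Suc j) 1 \<union> S1 j 1 \<times> S1 (Suc j) 2)" (is "_ = ?S")
 proof (rule set_eqI)
  fix z :: "nat \<times> nat \<times> nat"
  obtain j a a' where z: "z = (j, a, a')" by (metis surj_pair)
  show "z \<in> mismatches L b s \<longleftrightarrow> z \<in> ?S"
  proof (cases "Suc j < L \<and> a < b \<and> a' < b")
   case True
   have "s (j, a) = 1 \<or> s (j, a) = 2" "s (Suc j, a') = 1 \<or> s (Suc j, a') = 2"
    using True by (intro blob_configs_12[OF s]; simp)+
   then have "s (j, a) ~= s (Suc j, a') \<longleftrightarrow> (s (j, a) = 2 \<and> s (Suc j, a') = 1) \<or> (s (j, a) = 1 \<and> s (Suc j, a') = 2)" by auto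
   moreover have "j < L - 1" using True by (simp add: less_diff_conv)
   ultimately show ?thesis using True unfolding z
    by (simp add: mismatches_def S1_def)
  qed (auto simp: z mismatches_def S1_def)
 qed
 then have "card (mismatches L b s) = (\<Sum>j<L - 1. card (S1 j 2 \<times> S1 (Suc j) 1 \<union> S1 j 1 \<times> S1 (Suc j) 2))"
  by (simp add: card_SigmaI S1_def)
 then have "real (card (mismatches L b s)) = real (\<Sum>j<L - 1. card (S1 j 2 \<times> S1 (Suc j) 1 \<union> S1 j 1 \<times> S1 (Suc j) 2))" by simp
 also have "\<dots> = (\<Sum>j<L - 1. real (ones b s j) * (real b - real (ones b s (Suc j))) +
   real (ones b s (Suc j)) * (real b - real (ones b s j)))"
  unfolding of_nat_sum
 proof (intro sum.cong refl)
  fix j assume "j \<in> {..<L - 1}"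
  then have j: "j < L" "Suc j < L" by auto
  have "card (S1 j 2 \<times> S1 (Suc j) 1 \<union> S1 j 1 \<times> S1 (Suc j) 2) = card (S1 j 2 \<times> S1 (Suc j) 1) + card (S1 j 1 \<times> S1 (Suc j) 2)"
   by (intro card_Un_disjoint) (auto simp: S1_def)
  then show "real (card (S1 j 2 \<times> S1 (Suc j) 1 \<union> S1 j 1 \<times> S1 (Suc j) 2)) = real (ones b s j) * (real b - real (ones b s (Suc j))) +
   real (ones b s (Suc j)) * (real b - real (ones b s j))"
   using card_minority(2,3)[OF s j(1)] card_minority(2,3)[OF s j(2)]
   by (simp add: card_cartesian_product S1_def ones_def[symmetric] of_nat_diff)
 qed
 finally show ?thesis .
qed

text \<open>Summing \<open>minority_bound\<close> over neighbouring blobs charges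
  \<open>b / 4\<close> mismatches to every mark of the code: to a minority cell by the first term,
  to a change of majority by the second, since \<open>b\<^sup>2 / 4\<close> is at least
  \<open>b / 4\<close>.\<close>

lemma mismatches_ge_code:
 assumes s: "s \<in> blob_configs L b" and L: "L >= 2"
 shows "real (card (mismatches L b s)) >= real b / 4 * real (card (snd (blob_code L b s)))"
proof -
 define m where "m j = min (real (ones b s j)) (real b - real (ones b s j))" for j
 define Ch where "Ch = {j. Suc j < L \<and> majority b s j ~= majority b s (Suc j)}"
 define Mi where "Mi = {(j, a). j < L \<and> a < b \<and> s (j, a) ~= majority b s j}"
 have fCh: "finite Ch" by (rule finite_subset[of _ "{..<L}"]) (auto simp: Ch_def)
 have fMi: "finite Mi" by (rule finite_subset[of _ "{..<L} \<times> {..<b}"]) (auto simp: Mi_def)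
 have m0: "m j >= 0" if "j < L" for j using card_minority(2)[OF s that] by (simp add: m_def)
 have cMi: "real (card Mi) = (\<Sum>j<L. m j)"
 proof -
  have "Mi = Sigma {..<L} (%j. {a. a < b \<and> s (j, a) ~= majority b s j})" by (auto simp: Mi_def)
  then have "card Mi = (\<Sum>j<L. card {a. a < b \<and> s (j, a) ~= majority b s j})" by (simp add: card_SigmaI)
  then have "real (card Mi) = (\<Sum>j<L. real (card {a. a < b \<and> s (j, a) ~= majority b s j}))" by simp
  also have "\<dots> = (\<Sum>j<L. m j)"
   unfolding m_def by (intro sum.cong refl card_minority(1)[OF s]) simp
  finally show ?thesis .
 qed
 have cCh: "real (card Ch) = (\<Sum>j<L - 1. of_bool (majority b s j ~= majority b s (Suc j)))"
 proof -
  have "Ch = {j \<in> {..<L - 1}. majority b s j ~= majority b s (Suc j)}" by (auto simp: Ch_def)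
  then show ?thesis by (simp add: of_bool_def sum.If_cases Int_def)
 qed
 have code: "card (snd (blob_code L b s)) <= card Mi + card Ch"
 proof -
  have "snd (blob_code L b s) = Mi \<union> (%j. (j, b)) ` Ch" by (simp add: blob_code_def Mi_def Ch_def)
  then show ?thesis using card_Un_le[of Mi "(%j. (j, b)) ` Ch"] card_image_le[OF fCh, of "%j. (j, b)"] by simp
 qed
 \<comment> \<open>Every blob belongs to at least one neighbouring pair, because
   \<open>L >= 2\<close>.\<close>
 have sumL: "(\<Sum>j<L - 1. m j + m (Suc j)) >= (\<Sum>j<L. m j)"
 proof -
  obtain K where K: "L = Suc (Suc K)" using L by (metis add_2_eq_Suc le_Suc_ex)
  have "(\<Sum>j<L. m j) = m 0 + (\<Sum>j<L - 1. m (Suc j))" unfolding K by (subst sum.lessThan_Suc_shift) simp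
  moreover have "m 0 <= (\<Sum>j<L - 1. m j)"
   using sum_mono2[of "{..<L - 1}" "{0}" m] m0 K by auto
  ultimately show ?thesis by (simp add: sum.distrib)
 qed
 have bb: "real b <= (real b)\<^sup>2" by (cases "b = 0") (auto simp: power2_eq_square)
 have "real b / 4 * real (card (snd (blob_code L b s))) <= real b / 4 * (real (card Mi) + real (card Ch))"
  using code by (intro mult_left_mono) (auto simp flip: of_nat_add)
 also have "\<dots> <= real b / 4 * (\<Sum>j<L - 1. m j + m (Suc j)) + (real b)\<^sup>2 / 4 * (\<Sum>j<L - 1. of_bool (majority b s j ~= majority b s (Suc j)))"
  unfolding distrib_left cMi cCh using sumL bb by (intro add_mono mult_left_mono mult_right_mono sum_nonneg) auto
 also have "\<dots> = (\<Sum>j<L - 1. real b / 4 * (m j + m (Suc j)) + (real b)\<^sup>2 / 4 * of_bool (majority b s j ~= majority b s (Suc j)))"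
  by (simp only: sum_distrib_left[symmetric] sum.distrib)
 also have "\<dots> <= (\<Sum>j<L - 1. real (ones b s j) * (real b - real (ones b s (Suc j))) +
   real (ones b s (Suc j)) * (real b - real (ones b s j)))"
 proof (rule sum_mono)
  fix j assume "j \<in> {..<L - 1}"
  then have j: "j < L" "Suc j < L" by auto
  have "majority b s j ~= majority b s (Suc j) \<longleftrightarrow> (2 * real (ones b s j) > real b) ~= (2 * real (ones b s (Suc j)) > real b)"
   by (auto simp: majority_def)
  then show "real b / 4 * (m j + m (Suc j)) + (real b)\<^sup>2 / 4 * of_bool (majority b s j ~= majority b s (Suc j)) <=
   real (ones b s j) * (real b - real (ones b s (Suc j))) + real (ones b s (Suc j)) * (real b - real (ones b s j))"
   using minority_bound[of "real (ones b s j)" "real b" "real (ones b s (Suc j))"] card_minority(2)[OF s j(1)] card_minority(2)[OF s j(2)]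
   by (simp add: m_def)
 qed
 finally show ?thesis unfolding card_mismatches[OF s] .
qed

text \<open>Peierls bound: by injectivity of the code the sum runs over distinct sets of marks on
  \<open>L * (b + 1)\<close> positions, each mark weighing \<open>exp (- w * b / 4)\<close>. Summing
  over all sets gives the power, and 2 counts the majority spin of the first blob.\<close>

lemma blob_sum:
 fixes w :: real
 assumes L: "L >= 2" and w: "w > 0"
 shows "(\<Sum>s\<in>blob_configs L b. exp (- w * real (card (mismatches L b s)))) <= 2 * (1 + exp (- w * b / 4)) ^ (L * (b + 1))"
proof -
 define x where "x = exp (- w * b / 4)"
 let ?S = "{..<L} \<times> {..b}"
 have "(\<Sum>s\<in>blob_configs L b. exp (- w * real (card (mismatches L b s)))) <= (\<Sum>s\<in>blob_configs L b. x ^ card (snd (blob_code L b s)))"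
 proof (rule sum_mono)
  fix s assume s: "s \<in> blob_configs L b"
  have "w * (real b / 4 * real (card (snd (blob_code L b s)))) <= w * real (card (mismatches L b s))"
   using mismatches_ge_code[OF s L] w by (intro mult_left_mono) auto
  then show "exp (- w * real (card (mismatches L b s))) <= x ^ card (snd (blob_code L b s))"
   unfolding x_def by (simp add: exp_of_nat_mult[symmetric] algebra_simps)
 qed
 also have "\<dots> = (\<Sum>z\<in>blob_code L b ` blob_configs L b. x ^ card (snd z))"
  by (subst sum.reindex[OF blob_code_inj]) simp
 also have "\<dots> <= (\<Sum>z\<in>{1..2::nat} \<times> Pow ?S. x ^ card (snd z))"
 proof (rule sum_mono2)
  show "blob_code L b ` blob_configs L b \<subseteq> {1..2::nat} \<times> Pow ?S"
   by (auto simp: blob_code_def majority_def)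
 qed (auto simp: x_def)
 also have "\<dots> = (\<Sum>v\<in>{1..2::nat}. \<Sum>T\<in>Pow ?S. x ^ card T)"
  unfolding sum.cartesian_product by (intro sum.cong refl) (simp add: case_prod_beta)
 also have "\<dots> = 2 * (1 + x) ^ card ?S" by (simp add: sum_Pow_power_card)
 finally show ?thesis by (simp add: x_def card_cartesian_product)
qed

text \<open>The two constant configurations have no mismatch and account for exactly 2 of the sum in
  \<open>blob_sum\<close>.\<close>

lemma blob_sum_nonconst:
 fixes w :: real
 assumes L: "L >= 2" and w: "w > 0" and b: "b >= 1"
 shows "(\<Sum>s\<in>{s\<in>blob_configs L b. \<not> (\<exists>v. \<forall>j<L. \<forall>a<b. s (j, a) = v)}. exp (- w * real (card (mismatches L b s))))
  <= 2 * ((1 + exp (- w * b / 4)) ^ (L * (b + 1)) - 1)"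
proof -
 define k where "k v = (%z. if z \<in> {..<L} \<times> {..<b} then v else undefined)" for v :: nat
 have kb: "k v \<in> blob_configs L b" if "v \<in> {1..2}" for v
  using that by (auto simp: k_def blob_configs_def PiE_def extensional_def)
 have km: "mismatches L b (k v) = {}" for v by (auto simp: mismatches_def k_def)
 have k12: "k 1 ~= k 2"
 proof
  assume "k 1 = k 2"
  from fun_cong[OF this, of "(0, 0)"] show False using L b by (simp add: k_def)
 qed
 let ?N = "{s\<in>blob_configs L b. \<not> (\<exists>v. \<forall>j<L. \<forall>a<b. s (j, a) = v)}"
 let ?f = "%s. exp (- w * real (card (mismatches L b s)))"
 have kN: "k v \<notin> ?N" for v by (auto simp: k_def)
 have "sum ?f (?N \<union> {k 1, k 2}) <= sum ?f (blob_configs L b)"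
  using kb by (intro sum_mono2) auto
 moreover have "sum ?f (?N \<union> {k 1, k 2}) = sum ?f ?N + sum ?f {k 1, k 2}"
  using kN by (intro sum.union_disjoint) auto
 moreover have "sum ?f {k 1, k 2} = 2" using k12 km by simp
 ultimately show ?thesis using blob_sum[OF L w, of b] by simp
qed

section \<open>The RBM built from wires\<close>

definition wlen :: "nat => nat => nat => nat" where "wlen A C r = A * C * r"

text \<open>Vertices are numbered by wire, then position on the wire, then slot inside a blob. A
  blob owns \<open>bm\<close> slots but uses only the first \<open>b\<close>; the others are
  isolated vertices, so that the number of vertices does not depend on the guessed
  \<open>b\<close>.\<close>

definition vnum :: "nat => nat => nat => nat => nat" where "vnum A C r bm = (A + C) * wlen A C r * bm"

definition wi :: "nat => nat => nat => nat => nat => nat" where "wi A C r bm t = t div bm div wlen A C r"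

definition ps :: "nat => nat => nat => nat => nat => nat" where "ps A C r bm t = t div bm mod wlen A C r"

text \<open>The positions of a wire are divided into stretches of length \<open>r\<close>, one for
  each pair of a left and a right object. A pair is connected only within its own stretch, so a
  vertex meets at most one connecting edge.\<close>

definition sl :: "nat => nat => nat => nat" where "sl C r j = j div r div C"

definition sr :: "nat => nat => nat => nat" where "sr C r j = j div r mod C"

definition wire_edge :: "nat => nat => nat => nat => nat => nat => nat => bool" where
 "wire_edge A C r bm b t t' \<longleftrightarrow> wi A C r bm t = wi A C r bm t' \<and> ps A C r bm t' = Suc (ps A C r bm t) \<and>
  t mod bm < b \<and> t' mod bm < b"

definition left_end :: "nat => nat => nat => nat => nat => (nat => nat => bool) => nat => bool" where
 "left_end A C r bm b Rel t \<longleftrightarrow> t mod bm < b \<and> wi A C r bm t = sl C r (ps A C r bm t) \<and>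
  Rel (sl C r (ps A C r bm t)) (sr C r (ps A C r bm t))"

definition right_end :: "nat => nat => nat => nat => nat => (nat => nat => bool) => nat => bool" where
 "right_end A C r bm b Rel t \<longleftrightarrow> t mod bm < b \<and> wi A C r bm t = A + sr C r (ps A C r bm t) \<and>
  Rel (sl C r (ps A C r bm t)) (sr C r (ps A C r bm t))"

definition conn_edge :: "nat => nat => nat => nat => nat => (nat => nat => bool) => nat => nat => bool" where
 "conn_edge A C r bm b Rel t t' \<longleftrightarrow> left_end A C r bm b Rel t \<and> right_end A C r bm b Rel t' \<and>
  ps A C r bm t' = ps A C r bm t \<and> t' mod bm = t mod bm"

definition wire_pairs :: "nat => nat => nat => nat => nat => (nat \<times> nat) set" where
 "wire_pairs A C r bm b = {(t, t'). t < vnum A C r bm \<and> t' < vnum A C r bm \<and> wire_edge A C r bm b t t'}"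

definition conn_pairs :: "nat => nat => nat => nat => nat => (nat => nat => bool) => (nat \<times> nat) set" where
 "conn_pairs A C r bm b Rel = {(t, t'). t < vnum A C r bm \<and> t' < vnum A C r bm \<and> conn_edge A C r bm b Rel t t'}"

definition upair :: "nat \<times> nat => nat set" where "upair p = {fst p, snd p}"

text \<open>A connecting edge together with the fields at its ends contributes
  \<open>2 * \<phi>\<close> for the patterns (1,1), (1,2), (2,2) and 0 for (2,1), left spin first. A
  ferromagnetic edge alone cannot single out one pattern; the opposite fields at its ends do, and
  they make the model inconsistent.\<close>

definition wire_potts :: "nat => nat => nat => nat => nat => (nat => nat => bool) => real => real => potts" where
 "wire_potts A C r bm b Rel w \<phi> = \<lparr> vertices = {..<vnum A C r bm},
  edges = upair ` (wire_pairs A C r bm b \<union> conn_pairs A C r bm b Rel),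
  edge_weight = (%e. if e \<in> upair ` wire_pairs A C r bm b then w else \<phi>),
  ext_field = (%t i. if i = 1 then (if left_end A C r bm b Rel t then \<phi> else 0)
            else (if right_end A C r bm b Rel t then \<phi> else 0)) \<rparr>"

locale wire_model =
 fixes A C r bm b :: nat and Rel :: "nat => nat => bool" and w \<phi> :: real
 assumes pos: "A > 0" "C > 0" "r > 0" and len2: "A * C * r >= 2" and b1: "1 <= b" and bbm: "b <= bm"
  and w0: "w > 0" and \<phi>0: "\<phi> > 0"
begin

abbreviation "L \<equiv> wlen A C r"
abbreviation "n \<equiv> vnum A C r bm"
abbreviation "wr \<equiv> wi A C r bm"
abbreviation "po \<equiv> ps A C r bm"
abbreviation "WE \<equiv> wire_pairs A C r bm b"
abbreviation "CE \<equiv> conn_pairs A C r bm b Rel"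
abbreviation "M \<equiv> wire_potts A C r bm b Rel w \<phi>"

definition vid :: "nat => nat => nat => nat" where "vid i j a = (i * L + j) * bm + a"

lemma L2: "L >= 2" using len2 by (simp add: wlen_def)
lemma bm0: "bm > 0" using b1 bbm by simp

lemma vid_props:
 assumes "i < A + C" "j < L" "a < bm"
 shows "vid i j a < n" "wr (vid i j a) = i" "po (vid i j a) = j" "vid i j a mod bm = a"
proof -
 have d: "vid i j a div bm = i * L + j" using assms by (simp add: vid_def)
 show "wr (vid i j a) = i" "po (vid i j a) = j" unfolding wi_def ps_def d using assms by simp_all
 show "vid i j a mod bm = a" using assms by (simp add: vid_def)
 have "i * L + j + 1 <= (i + 1) * L" using assms by simp
 also have "\<dots> <= (A + C) * L" using assms by (intro mult_le_mono1) simp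
 finally have "(i * L + j + 1) * bm <= (A + C) * L * bm" by (rule mult_le_mono1)
 then show "vid i j a < n" using assms by (simp add: vid_def vnum_def)
qed

lemma vid_of: "t = vid (wr t) (po t) (t mod bm)"
 unfolding vid_def wi_def ps_def by simp

lemma coords:
 assumes "t < n"
 shows "wr t < A + C" "po t < L" "t mod bm < bm"
proof -
 show "t mod bm < bm" using bm0 by simp
 show "po t < L" using L2 by (simp add: ps_def)
 have "t div bm < (A + C) * L" using assms unfolding vnum_def by (rule less_mult_imp_div_less)
 then show "wr t < A + C" unfolding wi_def by (rule less_mult_imp_div_less)
qed

lemma coord_eqI: "wr t = wr s ==> po t = po s ==> t mod bm = s mod bm ==> t = s"
 using vid_of[of t] vid_of[of s] by simp

lemma sl_less: "j < L ==> sl C r j < A"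
proof -
 assume "j < L"
 then have "j div r < A * C" unfolding wlen_def by (rule less_mult_imp_div_less)
 then show ?thesis unfolding sl_def by (rule less_mult_imp_div_less)
qed

lemma sr_less: "sr C r j < C" using pos by (simp add: sr_def)

lemma WE_D: "(t, t') \<in> WE ==> t < n \<and> t' < n \<and> wr t = wr t' \<and> po t' = Suc (po t) \<and> t mod bm < b \<and> t' mod bm < b"
 by (simp add: wire_pairs_def wire_edge_def)

lemma CE_D:
 assumes "(t, t') \<in> CE"
 shows "t < n" "t' < n" "wr t = sl C r (po t)" "wr t' = A + sr C r (po t)" "po t' = po t" "t' mod bm = t mod bm"
  "t mod bm < b" "Rel (sl C r (po t)) (sr C r (po t))" "wr t < A" "left_end A C r bm b Rel t" "right_end A C r bm b Rel t'"
proof -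
 show 1: "t < n" "t' < n" "wr t = sl C r (po t)" "wr t' = A + sr C r (po t)" "po t' = po t" "t' mod bm = t mod bm"
  "t mod bm < b" "Rel (sl C r (po t)) (sr C r (po t))" "left_end A C r bm b Rel t" "right_end A C r bm b Rel t'"
  using assms by (auto simp: conn_pairs_def conn_edge_def left_end_def right_end_def)
 show "wr t < A" using 1 sl_less coords(2) by simp
qed

lemma finite_pairs [simp]: "finite WE" "finite CE"
 by (rule finite_subset[of _ "{..<n} \<times> {..<n}"], auto simp: wire_pairs_def conn_pairs_def)+

lemma upair_eq: "upair p = upair q \<longleftrightarrow> p = q \<or> (fst p = snd q \<and> snd p = fst q)"
 by (cases p; cases q) (auto simp: upair_def doubleton_eq_iff)

text \<open>The orientation of an edge can be recovered: wire edges raise the position, connecting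
  edges lead from a wire below \<open>A\<close> to one from \<open>A\<close> on.\<close>

lemma inj_upair: "inj_on upair (WE \<union> CE)"
proof (rule inj_onI)
 fix p q assume p: "p \<in> WE \<union> CE" and q: "q \<in> WE \<union> CE" and e: "upair p = upair q"
 obtain t t' where pt: "p = (t, t')" by (cases p)
 obtain s s' where qs: "q = (s, s')" by (cases q)
 show "p = q"
 proof (rule ccontr)
  assume "p ~= q"
  then have sw: "s = t'" "s' = t" using e by (auto simp: upair_eq pt qs)
  consider "(t, t') \<in> WE" "(t', t) \<in> WE" | "(t, t') \<in> CE" "(t', t) \<in> CE" | "(t, t') \<in> WE" "(t', t) \<in> CE" | "(t, t') \<in> CE" "(t', t) \<in> WE"
   using p q pt qs sw by auto
  then show False
  proof cases
   case 1 then show ?thesis using WE_D[OF 1(1)] WE_D[OF 1(2)] by simp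
  next
   case 2 then show ?thesis using CE_D(4,9)[OF 2(1)] CE_D(4,9)[OF 2(2)] by simp
  next
   case 3 then show ?thesis using WE_D[OF 3(1)] CE_D(4,9)[OF 3(2)] by simp
  next
   case 4 then show ?thesis using WE_D[OF 4(2)] CE_D(4,9)[OF 4(1)] by simp
  qed
 qed
qed

lemma WE_CE_disj: "WE \<inter> CE = {}"
proof -
 have False if "(t, t') \<in> WE" "(t, t') \<in> CE" for t t'
  using WE_D[OF that(1)] CE_D(4,9)[OF that(2)] by simp
 then show ?thesis by auto
qed

lemma upair_WE_iff: "p \<in> WE \<union> CE ==> upair p \<in> upair ` WE \<longleftrightarrow> p \<in> WE"
 by (rule inj_on_image_mem_iff[OF inj_upair]) auto

text \<open>Each vertex with a field for spin 1 is the left end of exactly one connecting edge, so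
  these fields can be charged to the edges.\<close>

lemma bij_fst_CE: "bij_betw fst CE {t. t < n \<and> left_end A C r bm b Rel t}"
proof (rule bij_betw_imageI)
 show "inj_on fst CE"
 proof (rule inj_onI)
  fix p q assume p: "p \<in> CE" and q: "q \<in> CE" and e: "fst p = fst q"
  obtain t t' where pt: "p = (t, t')" by (cases p)
  obtain s' where qs: "q = (t, s')" using e pt by (cases q) auto
  have 1: "(t, t') \<in> CE" and 2: "(t, s') \<in> CE" using p q pt qs by simp_all
  have "t' = s'"
   by (rule coord_eqI; simp only: CE_D(4)[OF 1] CE_D(5)[OF 1] CE_D(6)[OF 1] CE_D(4)[OF 2] CE_D(5)[OF 2] CE_D(6)[OF 2])
  then show "p = q" by (simp add: pt qs)
 qed
 show "fst ` CE = {t. t < n \<and> left_end A C r bm b Rel t}"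
 proof (rule set_eqI)
  fix t
  show "t \<in> fst ` CE \<longleftrightarrow> t \<in> {t. t < n \<and> left_end A C r bm b Rel t}"
  proof
   assume "t \<in> fst ` CE"
   then obtain t' where "(t, t') \<in> CE" by auto
   then show "t \<in> {t. t < n \<and> left_end A C r bm b Rel t}" using CE_D(1,10)[of t t'] by simp
  next
   assume t: "t \<in> {t. t < n \<and> left_end A C r bm b Rel t}"
   let ?t' = "vid (A + sr C r (po t)) (po t) (t mod bm)"
   have v: "A + sr C r (po t) < A + C" "po t < L" "t mod bm < bm" using sr_less coords t by auto
   have "(t, ?t') \<in> CE"
    using t vid_props[OF v] by (auto simp: conn_pairs_def conn_edge_def left_end_def right_end_def)
   then show "t \<in> fst ` CE" by force
  qed
 qed
qed

lemma bij_snd_CE: "bij_betw snd CE {t. t < n \<and> right_end A C r bm b Rel t}"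
proof (rule bij_betw_imageI)
 show "inj_on snd CE"
 proof (rule inj_onI)
  fix p q assume p: "p \<in> CE" and q: "q \<in> CE" and e: "snd p = snd q"
  obtain t t' where pt: "p = (t, t')" by (cases p)
  obtain s where qs: "q = (s, t')" using e pt by (cases q) auto
  have 1: "(t, t') \<in> CE" and 2: "(s, t') \<in> CE" using p q pt qs by simp_all
  have po: "po t = po s" using CE_D(5)[OF 1] CE_D(5)[OF 2] by simp
  have "t = s"
   by (rule coord_eqI) (simp_all only: CE_D(3)[OF 1] CE_D(3)[OF 2] po CE_D(6)[OF 1, symmetric] CE_D(6)[OF 2, symmetric])
  then show "p = q" by (simp add: pt qs)
 qed
 show "snd ` CE = {t. t < n \<and> right_end A C r bm b Rel t}"
 proof (rule set_eqI)
  fix t'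
  show "t' \<in> snd ` CE \<longleftrightarrow> t' \<in> {t. t < n \<and> right_end A C r bm b Rel t}"
  proof
   assume "t' \<in> snd ` CE"
   then obtain t where "(t, t') \<in> CE" by auto
   then show "t' \<in> {t. t < n \<and> right_end A C r bm b Rel t}" using CE_D(2,11)[of t t'] by simp
  next
   assume t: "t' \<in> {t. t < n \<and> right_end A C r bm b Rel t}"
   let ?t = "vid (sl C r (po t')) (po t') (t' mod bm)"
   have v: "sl C r (po t') < A + C" "po t' < L" "t' mod bm < bm" using sl_less[of "po t'"] coords[of t'] t by auto
   have "(?t, t') \<in> CE"
    using t vid_props[OF v] by (auto simp: conn_pairs_def conn_edge_def left_end_def right_end_def)
   then show "t' \<in> snd ` CE" by force
  qed
 qed
qed

lemma configs_M: "configs 2 M = {..<n} \<rightarrow>\<^sub>E {1..2}"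
 by (simp add: configs_def wire_potts_def)

lemma config_12:
 assumes "\<sigma> \<in> configs 2 M" "t < n"
 shows "\<sigma> t = 1 \<or> \<sigma> t = 2"
proof -
 have "\<sigma> t \<in> {1..2}" by (rule PiE_mem[OF assms(1)[unfolded configs_M]]) (use assms in simp)
 then have "1 <= \<sigma> t" "\<sigma> t <= 2" by simp_all
 then show ?thesis by linarith
qed

definition E0 :: real where "E0 = w * card WE + 2 * \<phi> * card CE"

definition defects :: "(nat => nat) => (nat \<times> nat) set" where "defects \<sigma> = {p \<in> WE. \<sigma> (fst p) ~= \<sigma> (snd p)}"

definition violated :: "(nat => nat) => (nat \<times> nat) set" where "violated \<sigma> = {p \<in> CE. \<sigma> (fst p) = 2 \<and> \<sigma> (snd p) = 1}"

lemma sum_of_bool_card: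
 fixes S :: "'a set"
 shows "finite S ==> (\<Sum>p\<in>S. of_bool (P p)) = real (card {p \<in> S. P p})"
 by (simp add: of_bool_def sum.If_cases Int_def)

lemma gibbs_weight_M:
 assumes \<sigma>: "\<sigma> \<in> configs 2 M"
 shows "gibbs_weight M \<sigma> = exp E0 * exp (- w * card (defects \<sigma>) - 2 * \<phi> * card (violated \<sigma>))"
proof -
 let ?eq = "%p. of_bool (\<sigma> (fst p) = \<sigma> (snd p)) :: real"
 have ub: "of_bool (\<forall>u\<in>upair p. \<forall>v\<in>upair p. \<sigma> u = \<sigma> v) = ?eq p" for p by (auto simp: upair_def)
 have "(\<Sum>e\<in>edges M. edge_weight M e * of_bool (\<forall>u\<in>e. \<forall>v\<in>e. \<sigma> u = \<sigma> v)) =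
   (\<Sum>p\<in>WE \<union> CE. (if upair p \<in> upair ` WE then w else \<phi>) * ?eq p)"
  using sum.reindex[OF inj_upair, of "%e. edge_weight M e * of_bool (\<forall>u\<in>e. \<forall>v\<in>e. \<sigma> u = \<sigma> v)"]
  by (simp add: wire_potts_def ub)
 also have "\<dots> = (\<Sum>p\<in>WE \<union> CE. (if p \<in> WE then w else \<phi>) * ?eq p)"
  by (rule sum.cong[OF refl]) (simp only: upair_WE_iff)
 also have "\<dots> = (\<Sum>p\<in>WE. (if p \<in> WE then w else \<phi>) * ?eq p) + (\<Sum>p\<in>CE. (if p \<in> WE then w else \<phi>) * ?eq p)"
  by (intro sum.union_disjoint finite_pairs WE_CE_disj)
 also have "(\<Sum>p\<in>CE. (if p \<in> WE then w else \<phi>) * ?eq p) = (\<Sum>p\<in>CE. \<phi> * ?eq p)"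
  using WE_CE_disj by (intro sum.cong) auto
 also have "(\<Sum>p\<in>WE. (if p \<in> WE then w else \<phi>) * ?eq p) = (\<Sum>p\<in>WE. w * ?eq p)"
  by (intro sum.cong) auto
 finally have 1: "(\<Sum>e\<in>edges M. edge_weight M e * of_bool (\<forall>u\<in>e. \<forall>v\<in>e. \<sigma> u = \<sigma> v)) = (\<Sum>p\<in>WE. w * ?eq p) + (\<Sum>p\<in>CE. \<phi> * ?eq p)" .
 have "(\<Sum>t\<in>vertices M. ext_field M t (\<sigma> t)) =
  (\<Sum>t<n. (if left_end A C r bm b Rel t then \<phi> * of_bool (\<sigma> t = 1) else 0) + (if right_end A C r bm b Rel t then \<phi> * of_bool (\<sigma> t = 2) else 0))"
 proof -
  have "ext_field M t (\<sigma> t) = (if left_end A C r bm b Rel t then \<phi> * of_bool (\<sigma> t = 1) else 0) + (if right_end A C r bm b Rel t then \<phi> * of_bool (\<sigma> t = 2) else 0)"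
   if "t < n" for t using config_12[OF \<sigma> that] by (auto simp: wire_potts_def)
  then show ?thesis by (intro sum.cong) (auto simp: wire_potts_def)
 qed
 also have "\<dots> = (\<Sum>t\<in>{t. t < n \<and> left_end A C r bm b Rel t}. \<phi> * of_bool (\<sigma> t = 1)) +
  (\<Sum>t\<in>{t. t < n \<and> right_end A C r bm b Rel t}. \<phi> * of_bool (\<sigma> t = 2))"
  unfolding sum.distrib by (simp add: sum.inter_filter[symmetric])
 also have "\<dots> = (\<Sum>p\<in>CE. \<phi> * of_bool (\<sigma> (fst p) = 1)) + (\<Sum>p\<in>CE. \<phi> * of_bool (\<sigma> (snd p) = 2))"
  unfolding sum.reindex_bij_betw[OF bij_fst_CE, symmetric] sum.reindex_bij_betw[OF bij_snd_CE, symmetric] ..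
 finally have 2: "(\<Sum>t\<in>vertices M. ext_field M t (\<sigma> t)) = (\<Sum>p\<in>CE. \<phi> * of_bool (\<sigma> (fst p) = 1)) + (\<Sum>p\<in>CE. \<phi> * of_bool (\<sigma> (snd p) = 2))" .
 have 3: "(\<Sum>p\<in>WE. w * ?eq p) = w * card WE - w * card (defects \<sigma>)"
 proof -
  have "(\<Sum>p\<in>WE. w * ?eq p) = (\<Sum>p\<in>WE. w - w * of_bool (\<sigma> (fst p) ~= \<sigma> (snd p)))" by (intro sum.cong) auto
  also have "\<dots> = w * card WE - w * (\<Sum>p\<in>WE. of_bool (\<sigma> (fst p) ~= \<sigma> (snd p)))"
   by (simp only: sum_subtractf sum_distrib_left[symmetric] sum_constant) (simp add: mult.commute)
  finally show ?thesis unfolding defects_def by (simp only: sum_of_bool_card[OF finite_pairs(1)])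
 qed
 have 4: "(\<Sum>p\<in>CE. \<phi> * ?eq p) + ((\<Sum>p\<in>CE. \<phi> * of_bool (\<sigma> (fst p) = 1)) + (\<Sum>p\<in>CE. \<phi> * of_bool (\<sigma> (snd p) = 2))) =
  2 * \<phi> * card CE - 2 * \<phi> * card (violated \<sigma>)"
 proof -
  have "\<phi> * ?eq p + (\<phi> * of_bool (\<sigma> (fst p) = 1) + \<phi> * of_bool (\<sigma> (snd p) = 2)) = 2 * \<phi> - 2 * \<phi> * of_bool (\<sigma> (fst p) = 2 \<and> \<sigma> (snd p) = 1)"
   if "p \<in> CE" for p
  proof -
   obtain t t' where p: "p = (t, t')" by (cases p)
   have "t < n" "t' < n" using CE_D(1,2) that p by auto
   then show ?thesis using config_12[OF \<sigma>, of t] config_12[OF \<sigma>, of t'] by (auto simp: p)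
  qed
  then have "(\<Sum>p\<in>CE. \<phi> * ?eq p + (\<phi> * of_bool (\<sigma> (fst p) = 1) + \<phi> * of_bool (\<sigma> (snd p) = 2))) =
    (\<Sum>p\<in>CE. 2 * \<phi> - 2 * \<phi> * of_bool (\<sigma> (fst p) = 2 \<and> \<sigma> (snd p) = 1))" by (intro sum.cong) auto
  also have "\<dots> = 2 * \<phi> * card CE - 2 * \<phi> * (\<Sum>p\<in>CE. of_bool (\<sigma> (fst p) = 2 \<and> \<sigma> (snd p) = 1))"
   by (simp only: sum_subtractf sum_distrib_left[symmetric] sum_constant) (simp add: mult.commute)
  finally show ?thesis unfolding violated_def by (simp only: sum.distrib sum_of_bool_card[OF finite_pairs(2)])
 qed
 have "(\<Sum>e\<in>edges M. edge_weight M e * of_bool (\<forall>u\<in>e. \<forall>v\<in>e. \<sigma> u = \<sigma> v)) + (\<Sum>t\<in>vertices M. ext_field M t (\<sigma> t)) =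
  E0 + (- w * card (defects \<sigma>) - 2 * \<phi> * card (violated \<sigma>))"
  unfolding 1 2 E0_def using 3 4 by linarith
 then show ?thesis unfolding gibbs_weight_def by (simp add: exp_add)
qed

end

section \<open>Good configurations and the repair map\<close>

context wire_model
begin

lemma vid_inj:
 assumes "vid i j a = vid i' j' a'" "i < A + C" "j < L" "a < bm" "i' < A + C" "j' < L" "a' < bm"
 shows "i = i'" "j = j'" "a = a'"
proof -
 have "wr (vid i j a) = i" "po (vid i j a) = j" "vid i j a mod bm = a" using vid_props[OF assms(2-4)] by blast+
 moreover have "wr (vid i j a) = i'" "po (vid i j a) = j'" "vid i j a mod bm = a'"
  unfolding assms(1) using vid_props[OF assms(5-7)] by blast+
 ultimately show "i = i'" "j = j'" "a = a'" by metis+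
qed

definition coh :: "(nat => nat) => nat => nat => bool" where
 "coh \<sigma> i v \<longleftrightarrow> (\<forall>j<L. \<forall>a<b. \<sigma> (vid i j a) = v)"

definition res :: "(nat => nat) => nat => nat \<times> nat => nat" where
 "res \<sigma> i = restrict (%z. \<sigma> (vid i (fst z) (snd z))) ({..<L} \<times> {..<b})"

definition good :: "(nat => nat) set" where
 "good = {\<sigma> \<in> configs 2 M. (\<forall>i<A + C. \<exists>v. coh \<sigma> i v) \<and>
  (\<forall>u<A. \<forall>v<C. Rel u v --> \<not> (coh \<sigma> u 2 \<and> coh \<sigma> (A + v) 1))}"

lemma L0: "0 < L" and b0: "0 < b" using L2 b1 by auto

lemma coh_unique: "coh \<sigma> i u ==> coh \<sigma> i v ==> u = v"
 using L0 b0 by (fastforce simp: coh_def)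

lemma coh_at: "coh \<sigma> (wr t) v ==> t < n ==> t mod bm < b ==> \<sigma> t = v"
 using vid_of[of t] coords(2)[of t] unfolding coh_def by metis

lemma finite_configs: "finite (configs 2 M)"
 unfolding configs_M by (intro finite_PiE) auto

lemma finite_good: "finite good"
 unfolding good_def using finite_configs by simp

lemma good_cfg: "\<sigma> \<in> good ==> \<sigma> \<in> configs 2 M" by (simp add: good_def)

lemma coh_12:
 assumes "\<sigma> \<in> configs 2 M" "coh \<sigma> i v" "i < A + C"
 shows "v = 1 \<or> v = 2"
proof -
 have "vid i 0 0 < n" using vid_props(1)[OF assms(3) L0, of 0] bm0 by simp
 moreover have "\<sigma> (vid i 0 0) = v" using assms(2) L0 b0 by (simp add: coh_def)
 ultimately show ?thesis using config_12[OF assms(1)] by metis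
qed

lemma good_weight:
 assumes "\<sigma> \<in> good"
 shows "defects \<sigma> = {}" "violated \<sigma> = {}"
proof -
 have c: "\<exists>v. coh \<sigma> i v" if "i < A + C" for i using assms that by (simp add: good_def)
 have "\<sigma> t = \<sigma> t'" if p: "(t, t') \<in> WE" for t t'
 proof -
  note d = WE_D[OF p]
  obtain v where v: "coh \<sigma> (wr t) v" using c coords(1) d by blast
  show ?thesis using coh_at[OF v] coh_at[of \<sigma> t' v] v d by simp
 qed
 then show "defects \<sigma> = {}" by (auto simp: defects_def)
 have False if p: "(t, t') \<in> CE" and e: "\<sigma> t = 2" "\<sigma> t' = 1" for t t'
 proof -
  note d = CE_D[OF p]
  obtain v where v: "coh \<sigma> (wr t) v" using c coords(1) d(1) by blast
  obtain v' where v': "coh \<sigma> (wr t') v'" using c coords(1) d(2) by blast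
  have "v = 2" using coh_at[OF v d(1,7)] e by simp
  moreover have "v' = 1" using coh_at[OF v' d(2)] d(6,7) e by simp
  ultimately have "coh \<sigma> (sl C r (po t)) 2" "coh \<sigma> (A + sr C r (po t)) 1" using v v' d(3,4) by simp_all
  then show False using assms d(8) sl_less[OF coords(2)[OF d(1)]] sr_less[of "po t"] unfolding good_def by blast
 qed
 then show "violated \<sigma> = {}" by (auto simp: violated_def)
qed

lemma res_blob: "\<sigma> \<in> configs 2 M ==> i < A + C ==> res \<sigma> i \<in> blob_configs L b"
 unfolding blob_configs_def res_def
proof (rule restrict_PiE_iff[THEN iffD2], intro ballI)
 fix z assume s: "\<sigma> \<in> configs 2 M" "i < A + C" and z: "z \<in> {..<L} \<times> {..<b}"
 have "vid i (fst z) (snd z) < n" using vid_props(1)[OF s(2), of "fst z" "snd z"] z bbm by auto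
 then show "\<sigma> (vid i (fst z) (snd z)) \<in> {1..2}" using config_12[OF s(1)] by fastforce
qed

lemma card_defects:
 assumes "\<sigma> \<in> configs 2 M"
 shows "card (defects \<sigma>) = (\<Sum>i<A + C. card (mismatches L b (res \<sigma> i)))"
proof -
 let ?S = "Sigma {..<A + C} (%i. mismatches L b (res \<sigma> i))"
 let ?f = "%(i, j, a, a'). (vid i j a, vid i (Suc j) a')"
 have S: "(i, j, a, a') \<in> ?S \<longleftrightarrow> i < A + C \<and> Suc j < L \<and> a < b \<and> a' < b \<and> \<sigma> (vid i j a) ~= \<sigma> (vid i (Suc j) a')" for i j a a'
  by (auto simp: mismatches_def res_def)
 have "bij_betw ?f ?S (defects \<sigma>)"
 proof (rule bij_betw_imageI)
  show "inj_on ?f ?S"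
  proof (rule inj_onI)
   fix x y assume x: "x \<in> ?S" and y: "y \<in> ?S" and e: "?f x = ?f y"
   obtain i j a a' where xx: "x = (i, j, a, a')" by (metis surj_pair)
   obtain k l c c' where yy: "y = (k, l, c, c')" by (metis surj_pair)
   have X: "i < A + C" "Suc j < L" "j < L" "a < bm" "a' < bm" using x bbm unfolding xx S by auto
   have Y: "k < A + C" "Suc l < L" "l < L" "c < bm" "c' < bm" using y bbm unfolding yy S by auto
   have e: "vid i j a = vid k l c" "vid i (Suc j) a' = vid k (Suc l) c'" using e by (simp_all add: xx yy)
   have "i = k" "j = l" "a = c" "a' = c'"
    using vid_inj[OF e(1) X(1,3,4) Y(1,3,4)] vid_inj[OF e(2) X(1,2,5) Y(1,2,5)] by blast+
   then show "x = y" by (simp add: xx yy)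
  qed
  show "?f ` ?S = defects \<sigma>"
  proof (intro set_eqI iffI)
   fix p assume "p \<in> ?f ` ?S"
   then obtain i j a a' where x: "(i, j, a, a') \<in> ?S" and p: "p = (vid i j a, vid i (Suc j) a')" by auto
   have X: "i < A + C" "Suc j < L" "j < L" "a < b" "a' < b" "a < bm" "a' < bm" "\<sigma> (vid i j a) ~= \<sigma> (vid i (Suc j) a')"
    using x bbm unfolding S by auto
   show "p \<in> defects \<sigma>" unfolding p defects_def wire_pairs_def wire_edge_def
    using X vid_props[OF X(1,3,6)] vid_props[OF X(1,2,7)] by simp
  next
   fix p assume p: "p \<in> defects \<sigma>"
   obtain t t' where pt: "p = (t, t')" by (cases p)
   have d: "t < n" "t' < n" "wr t = wr t'" "po t' = Suc (po t)" "t mod bm < b" "t' mod bm < b" "\<sigma> t ~= \<sigma> t'"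
    using p WE_D[of t t'] unfolding defects_def pt by auto
   have e: "t = vid (wr t) (po t) (t mod bm)" "t' = vid (wr t) (Suc (po t)) (t' mod bm)"
    using vid_of[of t] vid_of[of t'] d(3,4) by simp_all
   have "\<sigma> (vid (wr t) (po t) (t mod bm)) ~= \<sigma> (vid (wr t) (Suc (po t)) (t' mod bm))" using d(7) e by simp
   then have "(wr t, po t, t mod bm, t' mod bm) \<in> ?S" unfolding S using coords[OF d(1)] coords[OF d(2)] d by simp
   moreover have "p = ?f (wr t, po t, t mod bm, t' mod bm)" using e by (simp add: pt)
   ultimately show "p \<in> ?f ` ?S" by (rule rev_image_eqI)
  qed
 qed
 then have "card (defects \<sigma>) = card ?S" using bij_betw_same_card by fastforce
 also have "\<dots> = (\<Sum>i<A + C. card (mismatches L b (res \<sigma> i)))" by (simp add: finite_mismatches)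
 finally show ?thesis .
qed

text \<open>A doubtful right wire becomes 2 and a doubtful left wire becomes 1. Both values are
  harmless, as only left 2 against right 1 is penalised, so the repair never creates a violation. A
  coherent left wire keeps the spin 2 only if it is related to no right wire that is coherently
  1.\<close>

definition vl :: "(nat => nat) => nat => nat" where
 "vl \<sigma> i = (if i < A then (if coh \<sigma> i 2 \<and> (\<forall>v<C. Rel i v --> \<not> coh \<sigma> (A + v) 1) then 2 else 1)
      else (if coh \<sigma> i 1 then 1 else 2))"

definition repair :: "(nat => nat) => nat => nat" where
 "repair \<sigma> = restrict (%t. if t mod bm < b then vl \<sigma> (wr t) else \<sigma> t) {..<n}"

lemma coh_repair: "i < A + C ==> coh (repair \<sigma>) i v \<longleftrightarrow> v = vl \<sigma> i"
proof -
 assume i: "i < A + C"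
 have "repair \<sigma> (vid i j a) = vl \<sigma> i" if "j < L" "a < b" for j a
 proof -
  have "a < bm" using that bbm by simp
  then show ?thesis using vid_props[OF i that(1), of a] that by (simp add: repair_def)
 qed
 then show ?thesis using L0 b0 by (auto simp: coh_def)
qed

lemma repair_good:
 assumes "\<sigma> \<in> configs 2 M"
 shows "repair \<sigma> \<in> good"
proof -
 have "repair \<sigma> \<in> configs 2 M" unfolding configs_M repair_def
 proof (rule restrict_PiE_iff[THEN iffD2], intro ballI)
  fix t assume t: "t \<in> {..<n}"
  have "vl \<sigma> (wr t) = 1 \<or> vl \<sigma> (wr t) = 2" by (simp add: vl_def)
  moreover have "\<sigma> t = 1 \<or> \<sigma> t = 2" using config_12[OF assms] t by simp
  ultimately show "(if t mod bm < b then vl \<sigma> (wr t) else \<sigma> t) \<in> {1..2}" by auto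
 qed
 moreover have "\<not> (coh (repair \<sigma>) u 2 \<and> coh (repair \<sigma>) (A + v) 1)" if "u < A" "v < C" "Rel u v" for u v
 proof
  assume "coh (repair \<sigma>) u 2 \<and> coh (repair \<sigma>) (A + v) 1"
  then have "vl \<sigma> u = 2" "vl \<sigma> (A + v) = 1" using coh_repair[of u \<sigma>] coh_repair[of "A + v" \<sigma>] that by auto
  then show False using that unfolding vl_def by (auto split: if_splits)
 qed
 ultimately show ?thesis using coh_repair unfolding good_def by blast
qed

lemma coh_res: "coh \<sigma> i v \<longleftrightarrow> (\<forall>j<L. \<forall>a<b. res \<sigma> i (j, a) = v)"
 by (auto simp: coh_def res_def)

definition const_blob :: "nat => nat \<times> nat => nat" where
 "const_blob v = restrict (%_. v) ({..<L} \<times> {..<b})"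

lemma const_blob_iff:
 assumes "s \<in> blob_configs L b"
 shows "(\<forall>j<L. \<forall>a<b. s (j, a) = v) \<longleftrightarrow> s = const_blob v"
proof
 assume a: "\<forall>j<L. \<forall>a<b. s (j, a) = v"
 show "s = const_blob v"
 proof (rule ext)
  fix z
  show "s z = const_blob v z"
  proof (cases "z \<in> {..<L} \<times> {..<b}")
   case True
   then show ?thesis using a by (auto simp: const_blob_def)
  next
   case False
   then show ?thesis using PiE_arb[OF assms[unfolded blob_configs_def] False] by (simp only: const_blob_def restrict_apply if_False)
  qed
 qed
qed (simp add: const_blob_def)

lemma mismatches_const: "mismatches L b (const_blob v) = {}"
 by (auto simp: mismatches_def const_blob_def)

text \<open>Excess weight that a single wire can hide under the repair: its nonconstant
  configurations by the Peierls bound, plus the case of a coherent left wire reset from 2 to 1,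
  which pays for \<open>r * b\<close> violated edges.\<close>

definition delta :: real where "delta = 2 * ((1 + exp (- w * b / 4)) ^ (L * (b + 1)) - 1) + exp (- 2 * \<phi> * (r * b))"

text \<open>Weight charged to wire \<open>i\<close> with restriction \<open>s\<close> inside the
  fibre of \<open>\<tau>\<close>; the special case is a left wire that was constantly 2 and has been
  reset.\<close>

definition blob_cost :: "(nat => nat) => nat => (nat \<times> nat => nat) => real" where
 "blob_cost \<tau> i s = (if i < A \<and> \<not> coh \<tau> i 2 \<and> s = const_blob 2 then exp (- 2 * \<phi> * (r * b))
  else exp (- w * card (mismatches L b s)))"

text \<open>Contains all restrictions to wire \<open>i\<close> that occur in the fibre of
  \<open>\<tau>\<close>; independent choices over the wires then cover the fibre.\<close>

definition blob_space :: "(nat => nat) => nat => (nat \<times> nat => nat) set" where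
 "blob_space \<tau> i = {s \<in> blob_configs L b. if i < A then coh \<tau> i 2 --> s = const_blob 2
  else (if coh \<tau> i 1 then s = const_blob 1 else s ~= const_blob 1)}"

text \<open>In each of the four cases exactly one constant configuration has cost 1, and the rest is
  within \<open>delta\<close>.\<close>

lemma sum_blob_cost: "(\<Sum>s\<in>blob_space \<tau> i. blob_cost \<tau> i s) <= 1 + delta"
proof -
 let ?N = "{s\<in>blob_configs L b. \<not> (\<exists>v. \<forall>j<L. \<forall>a<b. s (j, a) = v)}"
 let ?f = "%s. exp (- w * real (card (mismatches L b s)))"
 have N: "sum ?f ?N <= 2 * ((1 + exp (- w * b / 4)) ^ (L * (b + 1)) - 1)" by (rule blob_sum_nonconst[OF L2 w0 b1])
 have N0: "0 <= sum ?f ?N" by (intro sum_nonneg) simp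
 have cases: "s \<in> ?N \<or> s = const_blob 1 \<or> s = const_blob 2" if s: "s \<in> blob_configs L b" for s
 proof (cases "s \<in> ?N")
  case False
  then obtain v where v: "\<forall>j<L. \<forall>a<b. s (j, a) = v" using s by auto
  then have "s (0, 0) = v" using L0 b0 by simp
  then have "v = 1 \<or> v = 2" using blob_configs_12[OF s L0 b0] by simp
  then show ?thesis using v const_blob_iff[OF s] by blast
 qed simp
 have nN: "const_blob v \<notin> ?N" for v by (auto simp: const_blob_def)
 have ne: "const_blob 1 ~= const_blob 2"
 proof
  assume "const_blob 1 = const_blob 2"
  from fun_cong[OF this, of "(0, 0)"] show False using L0 b0 by (simp add: const_blob_def)
 qed
 have fN: "finite ?N" by simp
 have costN: "blob_cost \<tau> i s = ?f s" if "s \<in> ?N" for s using nN[of 2] that by (auto simp: blob_cost_def)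
 have cost1: "blob_cost \<tau> i (const_blob 1) = 1" using ne by (simp add: blob_cost_def mismatches_const)
 have costN_sum: "sum (blob_cost \<tau> i) ?N = sum ?f ?N" by (intro sum.cong refl costN)
 have c0: "0 <= blob_cost \<tau> i s" for s by (simp add: blob_cost_def)
 have d0: "0 <= exp (- 2 * \<phi> * (r * b))" by simp
 consider (a) "i < A" "coh \<tau> i 2" | (b) "i < A" "\<not> coh \<tau> i 2" | (c) "\<not> i < A" "coh \<tau> i 1" | (d) "\<not> i < A" "\<not> coh \<tau> i 1" by blast
 then show ?thesis
 proof cases
  case a
  have "(\<Sum>s\<in>blob_space \<tau> i. blob_cost \<tau> i s) <= (\<Sum>s\<in>{const_blob 2}. blob_cost \<tau> i s)"
   by (rule sum_mono2) (use a c0 in \<open>auto simp: blob_space_def\<close>)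
  also have "\<dots> = 1" using a by (simp add: blob_cost_def mismatches_const)
  finally show ?thesis using N N0 d0 unfolding delta_def by linarith
 next
  case b
  have "(\<Sum>s\<in>blob_space \<tau> i. blob_cost \<tau> i s) <= (\<Sum>s\<in>insert (const_blob 1) (insert (const_blob 2) ?N). blob_cost \<tau> i s)"
  proof (rule sum_mono2)
   show "blob_space \<tau> i \<subseteq> insert (const_blob 1) (insert (const_blob 2) ?N)" using cases unfolding blob_space_def by blast
  qed (use c0 fN in auto)
  also have "\<dots> = blob_cost \<tau> i (const_blob 1) + (blob_cost \<tau> i (const_blob 2) + sum (blob_cost \<tau> i) ?N)"
   using ne nN fN by (simp del: mem_Collect_eq)
  also have "blob_cost \<tau> i (const_blob 2) = exp (- 2 * \<phi> * (r * b))" using b by (simp add: blob_cost_def)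
  finally show ?thesis using N cost1 costN_sum unfolding delta_def by linarith
 next
  case c
  have "(\<Sum>s\<in>blob_space \<tau> i. blob_cost \<tau> i s) <= (\<Sum>s\<in>{const_blob 1}. blob_cost \<tau> i s)"
   by (rule sum_mono2) (use c c0 in \<open>auto simp: blob_space_def\<close>)
  also have "\<dots> = 1" using cost1 by simp
  finally show ?thesis using N N0 d0 unfolding delta_def by linarith
 next
  case d
  have "(\<Sum>s\<in>blob_space \<tau> i. blob_cost \<tau> i s) <= (\<Sum>s\<in>insert (const_blob 2) ?N. blob_cost \<tau> i s)"
  proof (rule sum_mono2)
   show "blob_space \<tau> i \<subseteq> insert (const_blob 2) ?N"
   proof
    fix s assume "s \<in> blob_space \<tau> i"
    then have "s \<in> blob_configs L b" "s ~= const_blob 1" using d by (simp_all add: blob_space_def)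
    then show "s \<in> insert (const_blob 2) ?N" using cases by blast
   qed
  qed (use c0 fN in auto)
  also have "\<dots> = blob_cost \<tau> i (const_blob 2) + sum (blob_cost \<tau> i) ?N"
   using nN fN by (simp del: mem_Collect_eq)
  also have "blob_cost \<tau> i (const_blob 2) = 1" using d by (simp add: blob_cost_def mismatches_const)
  finally show ?thesis using N costN_sum d0 unfolding delta_def by linarith
 qed
qed

definition SW :: "(nat => nat) => real" where
 "SW \<sigma> = exp (- w * card (defects \<sigma>) - 2 * \<phi> * card (violated \<sigma>))"

text \<open>A coherent left wire loses the spin 2 only because of some related right wire coherently
  at 1. All \<open>r * b\<close> connections to one such partner are violated, and the connections
  of different left wires are disjoint.\<close>

lemma violated_ge:
 assumes \<sigma>: "\<sigma> \<in> configs 2 M" and V: "V = {i. i < A \<and> coh \<sigma> i 2 \<and> vl \<sigma> i = 1}"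
 shows "card (violated \<sigma>) >= card V * (r * b)"
proof -
 have "\<exists>v. v < C \<and> Rel i v \<and> coh \<sigma> (A + v) 1" if "i \<in> V" for i
 proof (rule ccontr)
  assume "\<nexists>v. v < C \<and> Rel i v \<and> coh \<sigma> (A + v) 1"
  then have "vl \<sigma> i = 2" using that unfolding V vl_def by auto
  then show False using that unfolding V by simp
 qed
 then obtain g where g: "\<And>i. i \<in> V ==> g i < C \<and> Rel i (g i) \<and> coh \<sigma> (A + g i) 1" by metis
 let ?S = "V \<times> {..<r} \<times> {..<b}"
 let ?j = "%i k. (i * C + g i) * r + k"
 let ?f = "%(i, k, a). (vid i (?j i k) a, vid (A + g i) (?j i k) a)"
 have J: "?j i k < L" "sl C r (?j i k) = i" "sr C r (?j i k) = g i" if "i \<in> V" "k < r" for i k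
 proof -
  have gi: "g i < C" using g[OF that(1)] by simp
  have iA: "i < A" using that V by simp
  have d: "?j i k div r = i * C + g i" using that by simp
  show "sl C r (?j i k) = i" "sr C r (?j i k) = g i" unfolding sl_def sr_def d using gi by simp_all
  have "i * C + g i + 1 <= (i + 1) * C" using gi by simp
  also have "\<dots> <= A * C" using iA by (intro mult_le_mono1) simp
  finally have "(i * C + g i + 1) * r <= A * C * r" by (rule mult_le_mono1)
  then show "?j i k < L" using that by (simp add: wlen_def)
 qed
 have fV: "finite V" unfolding V by simp
 have "card ?S <= card (violated \<sigma>)"
 proof (rule card_inj_on_le[where f = ?f])
  show "inj_on ?f ?S"
  proof (rule inj_onI)
   fix x y assume x: "x \<in> ?S" and y: "y \<in> ?S" and e: "?f x = ?f y"
   obtain i k a where xx: "x = (i, k, a)" by (metis surj_pair)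
   obtain i' k' a' where yy: "y = (i', k', a')" by (metis surj_pair)
   have X: "i \<in> V" "k < r" "a < bm" "i < A + C" using x bbm V by (auto simp: xx)
   have Y: "i' \<in> V" "k' < r" "a' < bm" "i' < A + C" using y bbm V by (auto simp: yy)
   have "vid i (?j i k) a = vid i' (?j i' k') a'" using e by (simp add: xx yy)
   from vid_inj[OF this X(4) J(1)[OF X(1,2)] X(3) Y(4) J(1)[OF Y(1,2)] Y(3)] have "i = i'" "?j i k = ?j i' k'" "a = a'" .
   then show "x = y" by (simp add: xx yy)
  qed
  show "?f ` ?S \<subseteq> violated \<sigma>"
  proof
   fix p assume "p \<in> ?f ` ?S"
   then obtain i k a where X: "i \<in> V" "k < r" "a < b" and p: "p = (vid i (?j i k) a, vid (A + g i) (?j i k) a)" by auto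
   have i: "i < A + C" "A + g i < A + C" and a: "a < bm" using X V g bbm by auto
   note J = J[OF X(1,2)]
   note v1 = vid_props[OF i(1) J(1) a] and v2 = vid_props[OF i(2) J(1) a]
   have "p \<in> CE" unfolding p conn_pairs_def conn_edge_def left_end_def right_end_def
    using v1 v2 J X(3) g[OF X(1)] by simp
   moreover have "\<sigma> (vid i (?j i k) a) = 2" "\<sigma> (vid (A + g i) (?j i k) a) = 1"
    using X V g[OF X(1)] J(1) unfolding coh_def by auto
   ultimately show "p \<in> violated \<sigma>" unfolding violated_def p by simp
  qed
  show "finite (violated \<sigma>)" unfolding violated_def by simp
 qed
 then show ?thesis using fV by (simp add: card_cartesian_product)
qed

text \<open>Of the violated edges only those guaranteed by \<open>violated_ge\<close> are kept. What
  remains depends on one wire at a time, so the weight is bounded by a product over wires.\<close>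

lemma SW_le:
 assumes \<sigma>: "\<sigma> \<in> configs 2 M" and \<tau>: "repair \<sigma> = \<tau>"
 shows "SW \<sigma> <= (\<Prod>i<A + C. blob_cost \<tau> i (res \<sigma> i))"
proof -
 define V where "V = {i. i < A \<and> coh \<sigma> i 2 \<and> vl \<sigma> i = 1}"
 have fV: "finite V" and VA: "V \<subseteq> {..<A + C}" by (auto simp: V_def)
 let ?d = "exp (- 2 * \<phi> * (r * b))"
 have c2: "coh \<sigma> i 2 \<longleftrightarrow> res \<sigma> i = const_blob 2" if "i < A + C" for i
  unfolding coh_res using const_blob_iff[OF res_blob[OF \<sigma> that]] .
 have iV: "i < A \<and> \<not> coh \<tau> i 2 \<and> res \<sigma> i = const_blob 2 \<longleftrightarrow> i \<in> V" if "i < A + C" for i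
 proof -
  have "coh \<tau> i 2 \<longleftrightarrow> 2 = vl \<sigma> i" using coh_repair[OF that] \<tau> by blast
  moreover have "vl \<sigma> i = 1 \<or> vl \<sigma> i = 2" by (simp add: vl_def)
  ultimately show ?thesis using c2[OF that] by (auto simp: V_def)
 qed
 have "(\<Prod>i<A + C. blob_cost \<tau> i (res \<sigma> i)) = (\<Prod>i<A + C. (if i \<in> V then ?d else 1) * exp (- w * card (mismatches L b (res \<sigma> i))))"
 proof (rule prod.cong[OF refl])
  fix i assume "i \<in> {..<A + C}"
  then have i: "i < A + C" by simp
  show "blob_cost \<tau> i (res \<sigma> i) = (if i \<in> V then ?d else 1) * exp (- w * card (mismatches L b (res \<sigma> i)))"
  proof (cases "i \<in> V")
   case True
   then have "res \<sigma> i = const_blob 2" using iV[OF i] by blast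
   then show ?thesis using True iV[OF i] by (simp add: blob_cost_def mismatches_const)
  next
   case False
   then show ?thesis using iV[OF i] unfolding blob_cost_def by (simp only: if_False mult_1_left)
  qed
 qed
 also have "\<dots> = ?d ^ card V * exp (- w * card (defects \<sigma>))"
 proof -
  have "(\<Prod>i<A + C. if i \<in> V then ?d else 1) = ?d ^ card V"
   using VA by (simp add: prod.If_cases Int_absorb1)
  moreover have "(\<Prod>i<A + C. exp (- w * card (mismatches L b (res \<sigma> i)))) = exp (- w * card (defects \<sigma>))"
   by (simp add: exp_sum[symmetric] card_defects[OF \<sigma>] sum_distrib_left sum_negf)
  ultimately show ?thesis by (simp only: prod.distrib)
 qed
 finally have P: "(\<Prod>i<A + C. blob_cost \<tau> i (res \<sigma> i)) = ?d ^ card V * exp (- w * card (defects \<sigma>))" .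
 have "real (card V * (r * b)) <= real (card (violated \<sigma>))"
  using violated_ge[OF \<sigma> V_def] by (simp only: of_nat_le_iff)
 then have "2 * \<phi> * real (card V * (r * b)) <= 2 * \<phi> * real (card (violated \<sigma>))" using \<phi>0 by (intro mult_left_mono) auto
 then have "exp (- 2 * \<phi> * card (violated \<sigma>)) <= exp (real (card V) * (- 2 * \<phi> * (r * b)))" by (simp add: algebra_simps)
 also have "\<dots> = ?d ^ card V" by (rule exp_of_nat_mult)
 finally have "exp (- w * card (defects \<sigma>)) * exp (- 2 * \<phi> * card (violated \<sigma>)) <= exp (- w * card (defects \<sigma>)) * ?d ^ card V"
  by (rule mult_left_mono) simp
 moreover have "SW \<sigma> = exp (- w * card (defects \<sigma>)) * exp (- 2 * \<phi> * card (violated \<sigma>))"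
  unfolding SW_def by (simp add: exp_add[symmetric])
 ultimately show ?thesis unfolding P by (simp only: mult.commute)
qed

text \<open>Isolated vertices keep their spin under \<open>repair\<close>, hence within a fibre a
  configuration is determined by its restrictions to the wires. The sum of products is then at most
  the product of the sums in \<open>sum_blob_cost\<close>.\<close>

lemma sum_fiber:
 assumes \<tau>: "\<tau> \<in> good"
 shows "(\<Sum>\<sigma>\<in>{\<sigma> \<in> configs 2 M. repair \<sigma> = \<tau>}. SW \<sigma>) <= (1 + delta) ^ (A + C)"
proof -
 let ?F = "{\<sigma> \<in> configs 2 M. repair \<sigma> = \<tau>}"
 let ?g = "%\<sigma>. restrict (res \<sigma>) {..<A + C}"
 have inj: "inj_on ?g ?F"
 proof (rule inj_onI)
  fix \<sigma> \<rho> assume s: "\<sigma> \<in> ?F" and t: "\<rho> \<in> ?F" and e: "?g \<sigma> = ?g \<rho>"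
  have sc: "\<sigma> \<in> {..<n} \<rightarrow>\<^sub>E {1..2}" and tc: "\<rho> \<in> {..<n} \<rightarrow>\<^sub>E {1..2}" using s t configs_M by auto
  show "\<sigma> = \<rho>"
  proof (rule PiE_ext[OF sc tc])
   fix t assume "t \<in> {..<n}"
   then have tn: "t < n" by simp
   note co = coords[OF tn]
   show "\<sigma> t = \<rho> t"
   proof (cases "t mod bm < b")
    case True
    have "res \<sigma> (wr t) = res \<rho> (wr t)" using fun_cong[OF e, of "wr t"] co by simp
    from fun_cong[OF this, of "(po t, t mod bm)"] show ?thesis
     using True co vid_of[of t] by (simp add: res_def)
   next
    case False
    have "repair \<sigma> t = repair \<rho> t" using s t by simp
    then show ?thesis using False tn by (simp add: repair_def)
   qed
  qed
 qed
 have "(\<Sum>\<sigma>\<in>?F. SW \<sigma>) <= (\<Sum>\<sigma>\<in>?F. \<Prod>i<A + C. blob_cost \<tau> i (?g \<sigma> i))"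
 proof (rule sum_mono)
  fix \<sigma> assume "\<sigma> \<in> ?F"
  then have "SW \<sigma> <= (\<Prod>i<A + C. blob_cost \<tau> i (res \<sigma> i))" by (intro SW_le) auto
  also have "\<dots> = (\<Prod>i<A + C. blob_cost \<tau> i (?g \<sigma> i))" by (intro prod.cong) auto
  finally show "SW \<sigma> <= (\<Prod>i<A + C. blob_cost \<tau> i (?g \<sigma> i))" .
 qed
 also have "\<dots> = (\<Sum>h\<in>?g ` ?F. \<Prod>i<A + C. blob_cost \<tau> i (h i))"
  by (subst sum.reindex[OF inj]) simp
 also have "\<dots> <= (\<Sum>h\<in>PiE {..<A + C} (blob_space \<tau>). \<Prod>i<A + C. blob_cost \<tau> i (h i))"
 proof (rule sum_mono2)
  show "finite (PiE {..<A + C} (blob_space \<tau>))" by (intro finite_PiE) (auto simp: blob_space_def)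
  show "?g ` ?F \<subseteq> PiE {..<A + C} (blob_space \<tau>)"
  proof
   fix h assume "h \<in> ?g ` ?F"
   then obtain \<sigma> where s: "\<sigma> \<in> configs 2 M" "repair \<sigma> = \<tau>" and h: "h = ?g \<sigma>" by auto
   show "h \<in> PiE {..<A + C} (blob_space \<tau>)" unfolding h
   proof (rule restrict_PiE_iff[THEN iffD2], intro ballI)
    fix i assume "i \<in> {..<A + C}"
    then have i: "i < A + C" by simp
    note rb = res_blob[OF s(1) i]
    have cv: "coh \<sigma> i v \<longleftrightarrow> res \<sigma> i = const_blob v" for v unfolding coh_res using const_blob_iff[OF rb] .
    have ct: "coh \<tau> i v \<longleftrightarrow> v = vl \<sigma> i" for v using coh_repair[OF i] s(2) by blast
    show "res \<sigma> i \<in> blob_space \<tau> i"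
    proof (cases "i < A")
     case True
     have "coh \<sigma> i 2" if "coh \<tau> i 2" using that True unfolding ct vl_def by (auto split: if_splits)
     then show ?thesis using rb cv[of 2] True by (simp add: blob_space_def)
    next
     case False
     have "coh \<sigma> i 1 \<longleftrightarrow> coh \<tau> i 1" using False unfolding ct vl_def by auto
     then show ?thesis using rb cv[of 1] False by (simp add: blob_space_def)
    qed
   qed
  qed
  show "0 <= (\<Prod>i<A + C. blob_cost \<tau> i (h i))" for h by (intro prod_nonneg) (simp add: blob_cost_def)
 qed
 also have "\<dots> = (\<Prod>i<A + C. \<Sum>s\<in>blob_space \<tau> i. blob_cost \<tau> i s)"
  by (rule prod_sum_PiE[symmetric]) (auto simp: blob_space_def)
 also have "\<dots> <= (\<Prod>i<A + C. 1 + delta)"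
  by (intro prod_mono conjI sum_nonneg sum_blob_cost) (auto simp: blob_cost_def)
 finally show ?thesis by simp
qed

lemma delta0: "delta >= 0"
proof -
 have "(1 + exp (- w * b / 4)) ^ (L * (b + 1)) >= 1" by (intro one_le_power) simp
 then show ?thesis by (simp add: delta_def)
qed

lemma partition_bounds:
 "partition_function 2 M >= exp E0 * card good"
 "partition_function 2 M <= exp E0 * card good * (1 + delta) ^ (A + C)"
proof -
 have Z: "partition_function 2 M = (\<Sum>\<sigma>\<in>configs 2 M. exp E0 * SW \<sigma>)"
  unfolding partition_function_def SW_def by (intro sum.cong refl gibbs_weight_M)
 have g1: "SW \<sigma> = 1" if "\<sigma> \<in> good" for \<sigma> using good_weight[OF that] by (simp add: SW_def)
 have "(\<Sum>\<sigma>\<in>good. exp E0 * SW \<sigma>) <= (\<Sum>\<sigma>\<in>configs 2 M. exp E0 * SW \<sigma>)"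
  by (rule sum_mono2[OF finite_configs]) (auto simp: good_def SW_def)
 moreover have "(\<Sum>\<sigma>\<in>good. exp E0 * SW \<sigma>) = exp E0 * card good" using g1 by simp
 ultimately show "partition_function 2 M >= exp E0 * card good" unfolding Z by simp
 have "(\<Sum>\<sigma>\<in>configs 2 M. SW \<sigma>) = (\<Sum>\<tau>\<in>good. \<Sum>\<sigma>\<in>{\<sigma> \<in> configs 2 M. repair \<sigma> = \<tau>}. SW \<sigma>)"
  by (rule sum.group[symmetric, OF finite_configs finite_good]) (use repair_good in auto)
 also have "\<dots> <= (\<Sum>\<tau>\<in>good. (1 + delta) ^ (A + C))" by (intro sum_mono sum_fiber)
 finally have "exp E0 * (\<Sum>\<sigma>\<in>configs 2 M. SW \<sigma>) <= exp E0 * (card good * (1 + delta) ^ (A + C))"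
  by (intro mult_left_mono) auto
 then show "partition_function 2 M <= exp E0 * card good * (1 + delta) ^ (A + C)"
  unfolding Z by (simp add: sum_distrib_left mult.assoc)
qed

end

section \<open>Counting the phases, and membership in the family\<close>

definition rel_pairs :: "nat => nat => (nat => nat => bool) => (nat set \<times> nat set) set" where
 "rel_pairs A C Rel = {(X, Y). X \<subseteq> {..<A} \<and> Y \<subseteq> {..<C} \<and> (\<forall>u\<in>X. \<forall>v\<in>Y. \<not> Rel u v)}"

context wire_model
begin

text \<open>The trivial phase: no left object is chosen, so that the right objects are
  unconstrained.\<close>

definition goodL :: "(nat => nat) set" where
 "goodL = {\<sigma> \<in> {..<n} \<rightarrow>\<^sub>E {1..2}. (\<forall>u<A. coh \<sigma> u 1) \<and> (\<forall>i<A + C. \<exists>v. coh \<sigma> i v)}"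

definition iso :: "(nat => nat) set" where
 "iso = {t. t < n \<and> \<not> t mod bm < b} \<rightarrow>\<^sub>E {1..2}"

text \<open>Coordinates of a good configuration: the left wires at spin 2, the right wires at spin
  1, and the free spins of the isolated vertices. The first two form an independent set of the
  bipartite graph \<open>Rel\<close>.\<close>

definition psi :: "(nat => nat) => (nat set \<times> nat set) \<times> (nat => nat)" where
 "psi \<sigma> = (({u. u < A \<and> coh \<sigma> u 2}, {v. v < C \<and> coh \<sigma> (A + v) 1}), restrict \<sigma> {t. t < n \<and> \<not> t mod bm < b})"

lemma inj_psi: "inj_on psi good"
proof (rule inj_onI)
 fix \<sigma> \<rho> assume s: "\<sigma> \<in> good" and q: "\<rho> \<in> good" and e: "psi \<sigma> = psi \<rho>"
 have E1: "{u. u < A \<and> coh \<sigma> u 2} = {u. u < A \<and> coh \<rho> u 2}" and E2: "{v. v < C \<and> coh \<sigma> (A + v) 1} = {v. v < C \<and> coh \<rho> (A + v) 1}"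
  and E3: "restrict \<sigma> {t. t < n \<and> \<not> t mod bm < b} = restrict \<rho> {t. t < n \<and> \<not> t mod bm < b}" using e by (simp_all add: psi_def)
 note sc = good_cfg[OF s] and qc = good_cfg[OF q]
 show "\<sigma> = \<rho>"
 proof (rule PiE_ext[OF sc[unfolded configs_M] qc[unfolded configs_M]])
  fix t assume "t \<in> {..<n}"
  then have tn: "t < n" by simp
  show "\<sigma> t = \<rho> t"
  proof (cases "t mod bm < b")
   case True
   have wr: "wr t < A + C" by (rule coords[OF tn])
   obtain v where v: "coh \<sigma> (wr t) v" using s wr by (auto simp: good_def)
   obtain u where u: "coh \<rho> (wr t) u" using q wr by (auto simp: good_def)
   have st: "\<sigma> t = v" "\<rho> t = u" using coh_at[OF v tn True] coh_at[OF u tn True] by simp_all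
   have vu: "v = 1 \<or> v = 2" "u = 1 \<or> u = 2" using coh_12[OF sc v wr] coh_12[OF qc u wr] by simp_all
   show ?thesis
   proof (cases "wr t < A")
    case True
    have "coh \<sigma> (wr t) 2 \<longleftrightarrow> coh \<rho> (wr t) 2" using E1 True by blast
    then have "v = 2 \<longleftrightarrow> u = 2" using coh_unique v u by metis
    then show ?thesis using st vu by auto
   next
    case False
    then have "wr t - A < C" "A + (wr t - A) = wr t" using wr by simp_all
    then have "coh \<sigma> (wr t) 1 \<longleftrightarrow> coh \<rho> (wr t) 1" using E2 by (metis (mono_tags, lifting) mem_Collect_eq)
    then have "v = 1 \<longleftrightarrow> u = 1" using coh_unique v u by metis
    then show ?thesis using st vu by auto
   qed
  next
   case False
   then show ?thesis using fun_cong[OF E3, of t] tn by simp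
  qed
 qed
qed

lemma psi_surj:
 assumes XY: "(X, Y) \<in> rel_pairs A C Rel" and \<iota>: "\<iota> \<in> iso"
 shows "\<exists>\<sigma>\<in>good. psi \<sigma> = ((X, Y), \<iota>)"
proof -
 define vl' where "vl' i = (if i < A then (if i \<in> X then 2 else 1) else (if i - A \<in> Y then 1 else (2::nat)))" for i
 define \<sigma> where "\<sigma> = restrict (%t. if t mod bm < b then vl' (wr t) else \<iota> t) {..<n}"
 have vl12: "vl' i \<in> {1..2}" for i by (simp add: vl'_def)
 have coh: "coh \<sigma> i v \<longleftrightarrow> v = vl' i" if i: "i < A + C" for i v
 proof -
  have "\<sigma> (vid i j a) = vl' i" if "j < L" "a < b" for j a
  proof -
   have "a < bm" using that bbm by simp
   then show ?thesis using vid_props[OF i that(1), of a] that by (simp add: \<sigma>_def)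
  qed
  then show ?thesis using L0 b0 by (auto simp: coh_def)
 qed
 have X: "X \<subseteq> {..<A}" "Y \<subseteq> {..<C}" "\<forall>u\<in>X. \<forall>v\<in>Y. \<not> Rel u v" using XY by (auto simp: rel_pairs_def)
 have cfg: "\<sigma> \<in> configs 2 M" unfolding configs_M \<sigma>_def
 proof (rule restrict_PiE_iff[THEN iffD2], intro ballI)
  fix t assume t: "t \<in> {..<n}"
  have "\<iota> t \<in> {1..2}" if "\<not> t mod bm < b" by (rule PiE_mem[OF \<iota>[unfolded iso_def]]) (use t that in simp)
  then show "(if t mod bm < b then vl' (wr t) else \<iota> t) \<in> {1..2}" using vl12 by simp
 qed
 have c2: "coh \<sigma> u 2 \<longleftrightarrow> u \<in> X" if "u < A" for u using coh[of u 2] that by (simp add: vl'_def)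
 have c1: "coh \<sigma> (A + v) 1 \<longleftrightarrow> v \<in> Y" if "v < C" for v using coh[of "A + v" 1] that by (simp add: vl'_def)
 have "\<sigma> \<in> good" unfolding good_def
 proof (intro CollectI conjI cfg allI impI notI)
  show "\<exists>v. coh \<sigma> i v" if "i < A + C" for i using coh[OF that] by blast
  show False if "u < A" "v < C" "Rel u v" "coh \<sigma> u 2 \<and> coh \<sigma> (A + v) 1" for u v
   using that c2[of u] c1[of v] X(3) by blast
 qed
 moreover have "psi \<sigma> = ((X, Y), \<iota>)"
 proof -
  have "{u. u < A \<and> coh \<sigma> u 2} = X" using c2 X(1) by blast
  moreover have "{v. v < C \<and> coh \<sigma> (A + v) 1} = Y" using c1 X(2) by blast
  moreover have "restrict \<sigma> {t. t < n \<and> \<not> t mod bm < b} = \<iota>"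
  proof (rule ext)
   fix t
   show "restrict \<sigma> {t. t < n \<and> \<not> t mod bm < b} t = \<iota> t"
    using PiE_arb[OF \<iota>[unfolded iso_def], of t] by (auto simp: \<sigma>_def restrict_def)
  qed
  ultimately show ?thesis by (simp add: psi_def)
 qed
 ultimately show ?thesis by blast
qed

lemma psi_image: "psi ` good = rel_pairs A C Rel \<times> iso"
proof (intro set_eqI iffI)
 fix z assume "z \<in> psi ` good"
 then obtain \<sigma> where s: "\<sigma> \<in> good" and z: "z = psi \<sigma>" by blast
 have "restrict \<sigma> {t. t < n \<and> \<not> t mod bm < b} \<in> iso" unfolding iso_def
 proof (rule restrict_PiE_iff[THEN iffD2], intro ballI)
  fix t assume "t \<in> {t. t < n \<and> \<not> t mod bm < b}"
  then have "\<sigma> t = 1 \<or> \<sigma> t = 2" using config_12[OF good_cfg[OF s]] by simp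
  then show "\<sigma> t \<in> {1..2}" by auto
 qed
 moreover have "({u. u < A \<and> coh \<sigma> u 2}, {v. v < C \<and> coh \<sigma> (A + v) 1}) \<in> rel_pairs A C Rel"
  using s unfolding good_def rel_pairs_def by blast
 ultimately show "z \<in> rel_pairs A C Rel \<times> iso" by (simp add: z psi_def)
next
 fix z assume "z \<in> rel_pairs A C Rel \<times> iso"
 then obtain X Y \<iota> where "z = ((X, Y), \<iota>)" "(X, Y) \<in> rel_pairs A C Rel" "\<iota> \<in> iso" by auto
 then show "z \<in> psi ` good" using psi_surj by force
qed

lemma card_good: "card good = card (rel_pairs A C Rel) * card iso"
 using card_image[OF inj_psi] unfolding psi_image by (simp add: card_cartesian_product)

lemma goodL_good: "goodL \<subseteq> good"
proof
 fix \<sigma> assume s: "\<sigma> \<in> goodL"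
 have "\<not> coh \<sigma> u 2" if "u < A" for u using s that coh_unique[of \<sigma> u 1 2] by (auto simp: goodL_def)
 then show "\<sigma> \<in> good" using s by (simp add: goodL_def good_def configs_M)
qed

lemma psi_image_goodL: "psi ` goodL = ({{}} \<times> Pow {..<C}) \<times> iso"
proof (intro set_eqI iffI)
 fix z assume "z \<in> psi ` goodL"
 then obtain \<sigma> where s: "\<sigma> \<in> goodL" and z: "z = psi \<sigma>" by blast
 have "psi \<sigma> \<in> rel_pairs A C Rel \<times> iso" using psi_image goodL_good s by blast
 moreover have "\<not> coh \<sigma> u 2" if "u < A" for u using s that coh_unique[of \<sigma> u 1 2] by (auto simp: goodL_def)
 ultimately show "z \<in> ({{}} \<times> Pow {..<C}) \<times> iso" unfolding z psi_def rel_pairs_def by auto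
next
 fix z :: "(nat set \<times> nat set) \<times> (nat => nat)" assume "z \<in> ({{}} \<times> Pow {..<C}) \<times> iso"
 then obtain Y \<iota> where z: "z = (({}, Y), \<iota>)" "Y \<subseteq> {..<C}" "\<iota> \<in> iso" by auto
 have "({}, Y) \<in> rel_pairs A C Rel" using z by (simp add: rel_pairs_def)
 from psi_surj[OF this z(3)] obtain \<sigma> where s: "\<sigma> \<in> good" "psi \<sigma> = (({}, Y), \<iota>)" by blast
 have "coh \<sigma> u 1" if u: "u < A" for u
 proof -
  have "u < A + C" using u by simp
  then obtain v where v: "coh \<sigma> u v" using s(1) by (auto simp: good_def)
  have "v = 1 \<or> v = 2" using coh_12[OF good_cfg[OF s(1)] v] u by simp
  moreover have "\<not> coh \<sigma> u 2" using s(2) u unfolding psi_def by auto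
  ultimately show ?thesis using v by auto
 qed
 then have "\<sigma> \<in> goodL" using s(1) by (simp add: goodL_def good_def configs_M)
 then show "z \<in> psi ` goodL" using s(2) z by force
qed

lemma card_goodL: "card goodL = 2 ^ C * card iso"
 using card_image[OF inj_on_subset[OF inj_psi goodL_good]] unfolding psi_image_goodL
 by (simp add: card_cartesian_product card_Pow)

lemma finite_iso: "finite iso" unfolding iso_def by (intro finite_PiE) auto

lemma iso_pos: "card iso > 0"
proof -
 have "iso ~= {}" unfolding iso_def by (simp add: PiE_eq_empty_iff)
 then show ?thesis using finite_iso by (simp add: card_gt_0_iff)
qed

lemma finite_rel_pairs: "finite (rel_pairs A C Rel)"
 by (rule finite_subset[of _ "Pow {..<A} \<times> Pow {..<C}"]) (auto simp: rel_pairs_def)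

lemma rel_pairs_pos: "card (rel_pairs A C Rel) > 0"
proof -
 have "({}, {}) \<in> rel_pairs A C Rel" by (simp add: rel_pairs_def)
 then show ?thesis using finite_rel_pairs by (auto simp: card_gt_0_iff)
qed

lemma pmf_good:
 assumes "\<sigma> \<in> good"
 shows "pmf (ising_gibbs M) \<sigma> = exp E0 / partition_function 2 M"
proof -
 have "pmf (ising_gibbs M) \<sigma> = of_bool (\<sigma> \<in> configs 2 M) * gibbs_weight M \<sigma> / partition_function 2 M"
  by (rule pmf_gibbs) (auto simp: wire_potts_def)
 then show ?thesis using good_cfg[OF assms] gibbs_weight_M[OF good_cfg[OF assms]] good_weight[OF assms] by simp
qed

lemma good_pos: "card good > 0" using card_good rel_pairs_pos iso_pos by simp

lemma delta_power_pos: "(1 + delta) ^ (A + C) > 0" using delta0 by simp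

lemma Z_pos: "partition_function 2 M > 0"
proof -
 have "card good > 0" using card_good rel_pairs_pos iso_pos by simp
 then have "0 < exp E0 * real (card good)" by simp
 then show ?thesis using partition_bounds(1) by linarith
qed

lemma pmf_goodL:
 assumes "\<sigma> \<in> goodL"
 shows "pmf (ising_gibbs M) \<sigma> >= 1 / (card (rel_pairs A C Rel) * card iso * (1 + delta) ^ (A + C))"
proof -
 have g: "\<sigma> \<in> good" using assms goodL_good by blast
 have "1 / (card (rel_pairs A C Rel) * card iso * (1 + delta) ^ (A + C)) = exp E0 / (exp E0 * card good * (1 + delta) ^ (A + C))"
  by (simp add: card_good)
 also have "\<dots> <= exp E0 / partition_function 2 M"
  by (rule divide_left_mono[OF partition_bounds(2)]) (use Z_pos good_pos delta_power_pos in simp_all)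
 finally show ?thesis using pmf_good[OF g] by simp
qed

lemma finite_goodL: "finite goodL" using finite_subset[OF goodL_good finite_good] .

lemma prob_goodL: "measure_pmf.prob (ising_gibbs M) goodL = 2 ^ C * card iso * exp E0 / partition_function 2 M"
proof -
 have "measure_pmf.prob (ising_gibbs M) goodL = (\<Sum>\<sigma>\<in>goodL. exp E0 / partition_function 2 M)"
  unfolding measure_measure_pmf_finite[OF finite_goodL] using pmf_good goodL_good by (intro sum.cong) auto
 then show ?thesis by (simp add: card_goodL)
qed

lemma prob_goodL_upper: "measure_pmf.prob (ising_gibbs M) goodL <= 2 ^ C / card (rel_pairs A C Rel)"
proof -
 have p: "exp E0 * card good > 0" using card_good rel_pairs_pos iso_pos by simp
 have "measure_pmf.prob (ising_gibbs M) goodL <= 2 ^ C * card iso * exp E0 / (exp E0 * card good)"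
  unfolding prob_goodL
  by (rule divide_left_mono[OF partition_bounds(1)]) (use Z_pos p in simp_all)
 also have "\<dots> = 2 ^ C / card (rel_pairs A C Rel)" using iso_pos by (simp add: card_good)
 finally show ?thesis .
qed

lemma prob_goodL_lower: "measure_pmf.prob (ising_gibbs M) goodL >= 2 ^ C / (card (rel_pairs A C Rel) * (1 + delta) ^ (A + C))"
proof -
 have "2 ^ C / (card (rel_pairs A C Rel) * (1 + delta) ^ (A + C)) =
   2 ^ C * card iso * exp E0 / (exp E0 * card good * (1 + delta) ^ (A + C))"
  using iso_pos by (simp add: card_good)
 also have "\<dots> <= 2 ^ C * card iso * exp E0 / partition_function 2 M"
  by (rule divide_left_mono[OF partition_bounds(2)]) (use Z_pos good_pos delta_power_pos in simp_all)
 finally show ?thesis unfolding prob_goodL .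
qed

lemma edge_cases:
 assumes "e \<in> edges M"
 obtains t t' where "e = {t, t'}" "(t, t') \<in> WE" | t t' where "e = {t, t'}" "(t, t') \<in> CE"
 using assms unfolding wire_potts_def upair_def by force

lemma M_RBM: "is_RBM M"
 unfolding is_RBM_def simple_graph_def bipartite_def
proof (intro conjI)
 show "finite (vertices M)" by (simp add: wire_potts_def)
 show "edges M \<subseteq> [vertices M]\<^bsup>2\<^esup>"
 proof
  fix e assume e: "e \<in> edges M"
  have 1: "t < n \<and> t' < n \<and> t ~= t'" if "(t, t') \<in> WE" for t t' using WE_D[OF that] by auto
  have 2: "t < n \<and> t' < n \<and> t ~= t'" if "(t, t') \<in> CE" for t t' using CE_D(1,2,4,9)[OF that] by auto
  obtain t t' where "e = {t, t'}" "t < n \<and> t' < n \<and> t ~= t'"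
   by (rule edge_cases[OF e]; rule that; use 1 2 in blast)
  then show "e \<in> [vertices M]\<^bsup>2\<^esup>" by (simp add: nsets_def wire_potts_def)
 qed
 \<comment> \<open>Positions are coloured by parity, with the colours exchanged on right wires: a
   wire edge changes the position by one, a connecting edge keeps the position and changes
   sides.\<close>
 let ?P = "%t. even (po t) = (wr t < A)"
 let ?A = "{t. t < n \<and> ?P t}"
 let ?B = "{t. t < n \<and> \<not> ?P t}"
 have "\<exists>a\<in>?A. \<exists>b\<in>?B. e = {a, b}" if e: "e \<in> edges M" for e
 proof -
  have 1: "t < n \<and> t' < n \<and> (?P t ~= ?P t')" if "(t, t') \<in> WE" for t t' using WE_D[OF that] by auto
  have 2: "t < n \<and> t' < n \<and> (?P t ~= ?P t')" if "(t, t') \<in> CE" for t t' using CE_D(1,2,4,5,9)[OF that] by auto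
  obtain t t' where t0: "e = {t, t'}" "t < n \<and> t' < n \<and> (?P t ~= ?P t')"
   by (rule edge_cases[OF e]; rule that; use 1 2 in blast)
  then have t: "e = {t, t'}" "t < n" "t' < n" "?P t ~= ?P t'" by blast+
  show ?thesis
  proof (cases "?P t")
   case True
   then show ?thesis using t by (intro bexI[of _ t] bexI[of _ t']) simp_all
  next
   case False
   then show ?thesis using t by (intro bexI[of _ t'] bexI[of _ t]) auto
  qed
 qed
 then show "\<exists>Aa B. Aa \<union> B = vertices M \<and> Aa \<inter> B = {} \<and> (\<forall>e\<in>edges M. \<exists>a\<in>Aa. \<exists>b\<in>B. e = {a, b})"
  by (intro exI[of _ ?A] exI[of _ ?B]) (auto simp: wire_potts_def)
qed

text \<open>There are \<open>b\<close> neighbours in each of the two adjacent blobs and at most one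
  connecting edge.\<close>

lemma M_degree:
 assumes t: "t < n"
 shows "degree_in (edges M) t <= 2 * b + 1"
proof -
 let ?S1 = "(%a. {t, vid (wr t) (Suc (po t)) a}) ` {..<b}"
 let ?S2 = "(%a. {t, vid (wr t) (po t - 1) a}) ` {..<b}"
 let ?p = "if wr t < A then vid (A + sr C r (po t)) (po t) (t mod bm) else vid (sl C r (po t)) (po t) (t mod bm)"
 have "{e \<in> edges M. t \<in> e} \<subseteq> ?S1 \<union> ?S2 \<union> {{t, ?p}}"
 proof
  fix e assume "e \<in> {e \<in> edges M. t \<in> e}"
  then have e: "e \<in> edges M" "t \<in> e" by auto
  from e(1) show "e \<in> ?S1 \<union> ?S2 \<union> {{t, ?p}}"
  proof (cases rule: edge_cases)
   case (1 u u')
   note d = WE_D[OF 1(2)]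
   consider "t = u" | "t = u'" using e(2) 1(1) by auto
   then show ?thesis
   proof cases
    case 1
    have "u' = vid (wr t) (Suc (po t)) (u' mod bm)" using vid_of[of u'] d 1 by simp
    then have "e \<in> ?S1" using d 1 \<open>e = {u, u'}\<close> by (intro image_eqI[of _ _ "u' mod bm"]) auto
    then show ?thesis by blast
   next
    case 2
    have "u = vid (wr t) (po t - 1) (u mod bm)" using vid_of[of u] d 2 by simp
    then have "e \<in> ?S2" using d 2 \<open>e = {u, u'}\<close> by (intro image_eqI[of _ _ "u mod bm"]) auto
    then show ?thesis by blast
   qed
  next
   case (2 u u')
   note d = CE_D[OF 2(2)]
   consider "t = u" | "t = u'" using e(2) 2(1) by auto
   then show ?thesis
   proof cases
    case 1
    have "u' = ?p" using vid_of[of u'] d 1 by simp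
    then show ?thesis using 1 \<open>e = {u, u'}\<close> by blast
   next
    case 2
    have "u = ?p" using vid_of[of u] d 2 by simp
    then show ?thesis using 2 \<open>e = {u, u'}\<close> by blast
   qed
  qed
 qed
 then have "card {e \<in> edges M. t \<in> e} <= card (?S1 \<union> ?S2 \<union> {{t, ?p}})" by (intro card_mono) auto
 also have "\<dots> <= card ?S1 + card ?S2 + card {{t, ?p}}" using card_Un_le[of "?S1 \<union> ?S2" "{{t, ?p}}"] card_Un_le[of ?S1 ?S2] by linarith
 also have "\<dots> <= b + b + 1" using card_image_le[of "{..<b}" "%a. {t, vid (wr t) (Suc (po t)) a}"]
  card_image_le[of "{..<b}" "%a. {t, vid (wr t) (po t - 1) a}"] by simp
 finally show ?thesis by (simp add: degree_in_def)
qed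

text \<open>The two ends of a connecting edge carry nonzero fields for different spins, and a single
  related pair provides such an edge.\<close>

lemma M_inconsistent:
 assumes "u < A" "v < C" "Rel u v"
 shows "\<not> consistent_field M"
proof -
 let ?j = "(u * C + v) * r"
 have d: "?j div r = u * C + v" using pos by simp
 have s: "sl C r ?j = u" "sr C r ?j = v" unfolding sl_def sr_def d using assms by simp_all
 have "u * C + v + 1 <= (u + 1) * C" using assms by simp
 also have "\<dots> <= A * C" using assms by (intro mult_le_mono1) simp
 finally have le: "(u * C + v + 1) * r <= A * C * r" by (rule mult_le_mono1)
 have "?j < (u * C + v + 1) * r" using pos(3) by simp
 then have j: "?j < L" using le unfolding wlen_def by (rule less_le_trans)
 have uv: "u < A + C" "A + v < A + C" using assms by simp_all
 note p1 = vid_props[OF uv(1) j bm0] and p2 = vid_props[OF uv(2) j bm0]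
 have "left_end A C r bm b Rel (vid u ?j 0)" unfolding left_end_def using p1 s assms b0 by simp
 then have 1: "ext_field M (vid u ?j 0) 1 ~= 0" using \<phi>0 by (simp add: wire_potts_def)
 have "right_end A C r bm b Rel (vid (A + v) ?j 0)" unfolding right_end_def using p2 s assms b0 by simp
 then have 2: "ext_field M (vid (A + v) ?j 0) 2 ~= 0" using \<phi>0 by (simp add: wire_potts_def)
 have "vid u ?j 0 \<in> vertices M" "vid (A + v) ?j 0 \<in> vertices M" using p1(1) p2(1) by (simp_all add: wire_potts_def)
 then show ?thesis using 1 2 unfolding consistent_field_def by blast
qed

lemma M_in_family:
 assumes "u < A" "v < C" "Rel u v" "2 * b + 1 <= d" "w <= \<beta>" "\<phi> <= \<beta>" "\<phi> <= 1"
 shows "M \<in> inconsistent_ferro_RBMs n d \<beta> 1"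
proof -
 have "M \<in> ferro_RBMs n d \<beta> 1" unfolding ferro_RBMs_def
 proof (intro CollectI conjI ballI)
  show "ferromagnetic M" unfolding ferromagnetic_def using w0 \<phi>0 by (simp add: wire_potts_def)
  show "degree_in (edges M) t <= d" if "t \<in> vertices M" for t
   using M_degree[of t] that assms(4) by (simp add: wire_potts_def)
  show "\<bar>edge_weight M e\<bar> <= \<beta>" for e using w0 \<phi>0 assms by (simp add: wire_potts_def)
  show "\<bar>ext_field M t i\<bar> <= 1" for t i using \<phi>0 assms by (simp add: wire_potts_def)
 qed (use M_RBM in \<open>simp_all add: wire_potts_def\<close>)
 then show ?thesis using M_inconsistent[OF assms(1-3)] by (simp add: inconsistent_ferro_RBMs_def)
qed

end

section \<open>The explicit description of the model\<close>

definition wire_desc :: "nat => nat => nat => nat => nat => (nat => nat => bool) => rat => rat => ising_desc" where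
 "wire_desc A C r bm b Rel w \<phi> = (vnum A C r bm,
  concat (map (%t. concat (map (%t'. if wire_edge A C r bm b t t' then [(t, t', w)]
    else if conn_edge A C r bm b Rel t t' then [(t, t', \<phi>)] else []) [0..<vnum A C r bm])) [0..<vnum A C r bm]),
  map (%t. (if left_end A C r bm b Rel t then \<phi> else 0, if right_end A C r bm b Rel t then \<phi> else 0)) [0..<vnum A C r bm])"

text \<open>Without its weights the edge list is a filtered product list; distinctness, the edge set
  and the bound on its length all come from this form.\<close>

lemma map_concat_pairs:
 "map (%(u, v, w). (u, v)) (concat (map (%t. concat (map (%t'. if P t t' then [(t, t', w)]
   else if Q t t' then [(t, t', \<phi>)] else []) ys)) xs)) = filter (%(t, t'). P t t' \<or> Q t t') (List.product xs ys)"
proof (induction xs)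
 case (Cons x xs)
 have "map (%(u, v, w). (u, v)) (concat (map (%t'. if P x t' then [(x, t', w)] else if Q x t' then [(x, t', \<phi>)] else []) ys)) =
  filter (%(t, t'). P t t' \<or> Q t t') (map (Pair x) ys)"
  by (induction ys) auto
 then show ?case using Cons by simp
qed simp

lemma describes_wire:
 assumes "wire_model A C r bm b (real_of_rat w) (real_of_rat \<phi>)"
 shows "describes (wire_desc A C r bm b Rel w \<phi>) (wire_potts A C r bm b Rel (real_of_rat w) (real_of_rat \<phi>))"
proof -
 interpret wire_model A C r bm b Rel "real_of_rat w" "real_of_rat \<phi>" by (rule assms)
 define es where "es = concat (map (%t. concat (map (%t'. if wire_edge A C r bm b t t' then [(t, t', w)]
    else if conn_edge A C r bm b Rel t t' then [(t, t', \<phi>)] else []) [0..<n])) [0..<n])"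
 define ps where "ps = map (%(u, v, w::rat). (u, v)) es"
 have ps: "ps = filter (%(t, t'). wire_edge A C r bm b t t' \<or> conn_edge A C r bm b Rel t t') (List.product [0..<n] [0..<n])"
  unfolding ps_def es_def by (rule map_concat_pairs)
 have sps: "set ps = WE \<union> CE" unfolding ps by (auto simp: wire_pairs_def conn_pairs_def)
 have eq: "map (%(u, v, w). {u, v}) es = map upair ps" unfolding ps_def by (auto simp: upair_def)
 have "distinct ps" unfolding ps by (intro distinct_filter distinct_product) auto
 then have dist: "distinct (map (%(u, v, w). {u, v}) es)" unfolding eq distinct_map sps using inj_upair by blast
 have "(%(u, v, w). {u, v}) ` set es = set (map (%(u, v, w). {u, v}) es)" by simp
 also have "\<dots> = upair ` (WE \<union> CE)" unfolding eq using sps by simp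
 finally have ed: "edges M = (%(u, v, w). {u, v}) ` set es" by (simp add: wire_potts_def)
 have wt: "edge_weight M {u, v} = real_of_rat x" if m: "(u, v, x) \<in> set es" for u v x
 proof -
  have uv: "(u, v) \<in> WE \<union> CE" using m sps unfolding ps_def by force
  have x: "x = (if wire_edge A C r bm b u v then w else \<phi>)" "u < n" "v < n"
   using m unfolding es_def by (auto split: if_splits)
  have "{u, v} \<in> upair ` WE \<longleftrightarrow> (u, v) \<in> WE" using upair_WE_iff[OF uv] by (simp add: upair_def)
  then show ?thesis using x by (simp add: wire_potts_def wire_pairs_def)
 qed
 show ?thesis unfolding describes_def wire_desc_def es_def[symmetric]
  using dist ed wt by (auto simp: wire_potts_def)
qed

section \<open>The reduction as a program\<close>

lemma foldM_size_add:
 assumes "\<And>y acc acc'. y \<in> set ys ==> acc' \<in> set_pmf (g y acc) ==> size (e2 acc') <= size (e2 acc) + (c::nat)"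
  and "acc \<in> set_pmf (foldM g ys a)"
 shows "size (e2 acc) <= size (e2 a) + length ys * c"
 using assms
proof (induction ys arbitrary: a)
 case (Cons y ys)
 obtain a' where a': "a' \<in> set_pmf (g y a)" "acc \<in> set_pmf (foldM g ys a')" using Cons.prems(2) by auto
 have "size (e2 acc) <= size (e2 a') + length ys * c"
  by (rule Cons.IH[OF _ a'(2)], rule Cons.prems(1)) simp_all
 moreover have "size (e2 a') <= size (e2 a) + c" by (rule Cons.prems(1)[OF _ a'(1)]) simp
 ultimately show ?case by simp
qed simp

lemma RT_foldM_add:
 assumes F: "PT E (enc_list e1) F" and A: "PT E e2 A"
  and g: "RT (env_pair (env_pair E e1) e2) e2 (%z. g (fst (fst z)) (snd (fst z)) (snd z))"
  and b: "\<And>x y acc acc'. acc' \<in> set_pmf (g x y acc) ==> size (e2 acc') <= size (e2 acc) + poly q (ms (env_pair E e1) (x, y))"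
 shows "RT E e2 (%x. foldM (g x) (F x) (A x))"
proof -
 obtain pF where pF: "\<And>x. size (enc_list e1 (F x)) <= poly pF (ms E x)" by (rule PT_bound[OF F], rule that, auto)
 obtain pA where pA: "\<And>x. size (e2 (A x)) <= poly pA (ms E x)" by (rule PT_bound[OF A], rule that, auto)
 define r where "r = pcompose q ([:1, 1:] + pF)"
 show ?thesis
 proof (rule RT_foldM[OF F A g, where q = "pA + pF * r"])
  fix x i acc assume a: "acc \<in> set_pmf (foldM (g x) (take i (F x)) (A x))"
  have "size (e2 acc) <= size (e2 (A x)) + length (take i (F x)) * poly r (ms E x)"
  proof (rule foldM_size_add[OF _ a])
   fix y acc acc' assume y: "y \<in> set (take i (F x))" and acc': "acc' \<in> set_pmf (g x y acc)"
   have "size (e1 y) <= poly pF (ms E x)"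
    using size_enc_list_mem[OF in_set_takeD[OF y], of e1] pF[of x] by simp
   then have "poly q (ms (env_pair E e1) (x, y)) <= poly r (ms E x)"
    unfolding r_def poly_pcompose by (intro poly_nat_mono) (simp add: ms_env_pair)
   then show "size (e2 acc') <= size (e2 acc) + poly r (ms E x)" using b[OF acc'] by simp
  qed
  also have "\<dots> <= poly pA (ms E x) + poly pF (ms E x) * poly r (ms E x)"
   using pA[of x] pF[of x] length_le_size_enc_list[of "F x" e1] by (intro add_mono mult_mono) auto
  finally show "size (e2 acc) <= poly (pA + pF * r) (ms E x)" by simp
 qed
qed

lemma RT_lift:
 assumes "RT (env_pair (env_pair E e1) e2) e (%z. f (fst (fst z)) (snd (fst z)) (snd z))"
 shows "RT (env_pair (env_pair (env_pair E e3) e1) e2) e (%z. f (fst (fst (fst z))) (snd (fst z)) (snd z))"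
 using RT_pre[OF assms, where h = "%z. ((fst (fst (fst z)), snd (fst z)), snd z)" and E' = "env_pair (env_pair (env_pair E e3) e1) e2"
   and x = "NodeE (NodeE (LeftE (LeftE (LeftE (Var 0)))) (RightE (LeftE (Var 0)))) (RightE (Var 0))"]
 by (auto simp: env_pair_def ms_def)

lemma PT_app2:
 assumes R: "RT (env_pair (env_pair E e1) e2) e (%z. f (fst (fst z)) (snd (fst z)) (snd z))"
  and F: "PT E e1 F" and G: "PT E e2 G"
 shows "RT E e (%x. f x (F x) (G x))"
proof -
 have "RT (env_pair E e1) e (%z. f (fst z) (snd z) (G (fst z)))"
  by (rule PT_comp2[OF RT_env[OF G], where g = "%z y. f (fst z) (snd z) y"]) (rule R)
 then show ?thesis by (rule PT_comp2[OF F, where g = "%x y. f x y (G x)"])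
qed

lemma PT_wlen: "PT E enc_unary A ==> PT E enc_unary C ==> PT E enc_unary r ==> PT E enc_unary (%x. wlen (A x) (C x) (r x))"
 unfolding wlen_def by (intro PT_mult)

lemma PT_vnum: "PT E enc_unary A ==> PT E enc_unary C ==> PT E enc_unary r ==> PT E enc_unary bm ==>
  PT E enc_unary (%x. vnum (A x) (C x) (r x) (bm x))"
 unfolding vnum_def by (intro PT_mult PT_add PT_wlen)

lemma PT_wi: "PT E enc_unary A ==> PT E enc_unary C ==> PT E enc_unary r ==> PT E enc_unary bm ==> PT E enc_unary t ==>
  PT E enc_unary (%x. wi (A x) (C x) (r x) (bm x) (t x))"
 unfolding wi_def by (intro PT_div PT_wlen)

lemma PT_ps: "PT E enc_unary A ==> PT E enc_unary C ==> PT E enc_unary r ==> PT E enc_unary bm ==> PT E enc_unary t ==>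
  PT E enc_unary (%x. ps (A x) (C x) (r x) (bm x) (t x))"
 unfolding ps_def by (intro PT_div PT_mod PT_wlen)

lemma PT_sl: "PT E enc_unary C ==> PT E enc_unary r ==> PT E enc_unary j ==> PT E enc_unary (%x. sl (C x) (r x) (j x))"
 unfolding sl_def by (intro PT_div)

lemma PT_sr: "PT E enc_unary C ==> PT E enc_unary r ==> PT E enc_unary j ==> PT E enc_unary (%x. sr (C x) (r x) (j x))"
 unfolding sr_def by (intro PT_div PT_mod)

lemma PT_wire_edge: "PT E enc_unary A ==> PT E enc_unary C ==> PT E enc_unary r ==> PT E enc_unary bm ==> PT E enc_unary b ==>
  PT E enc_unary t ==> PT E enc_unary t' ==> PT E enc_bool (%x. wire_edge (A x) (C x) (r x) (bm x) (b x) (t x) (t' x))"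
 unfolding wire_edge_def by (intro PT_conj PT_eq PT_less PT_mod PT_Suc PT_wi PT_ps)

lemma PT_left_end:
 assumes "PT E enc_unary A" "PT E enc_unary C" "PT E enc_unary r" "PT E enc_unary bm" "PT E enc_unary b" "PT E enc_unary t"
  and R: "PT (env_pair (env_pair E enc_unary) enc_unary) enc_bool (%z. Rel (fst (fst z)) (snd (fst z)) (snd z))"
 shows "PT E enc_bool (%x. left_end (A x) (C x) (r x) (bm x) (b x) (Rel x) (t x))"
 unfolding left_end_def
 by (intro PT_conj PT_eq PT_less PT_mod PT_wi PT_ps PT_sl assms PT_app2[where f = "%x y z. return_pmf (Rel x y z)", OF R] PT_sr)

lemma PT_right_end:
 assumes "PT E enc_unary A" "PT E enc_unary C" "PT E enc_unary r" "PT E enc_unary bm" "PT E enc_unary b" "PT E enc_unary t"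
  and R: "PT (env_pair (env_pair E enc_unary) enc_unary) enc_bool (%z. Rel (fst (fst z)) (snd (fst z)) (snd z))"
 shows "PT E enc_bool (%x. right_end (A x) (C x) (r x) (bm x) (b x) (Rel x) (t x))"
 unfolding right_end_def
 by (intro PT_conj PT_eq PT_less PT_mod PT_wi PT_ps PT_sl PT_add assms PT_app2[where f = "%x y z. return_pmf (Rel x y z)", OF R] PT_sr)

lemma enc_ising_pairs: "enc_ising = enc_pair enc_unary (enc_pair (enc_list (enc_pair enc_nat (enc_pair enc_nat enc_rat)))
  (enc_list (enc_pair enc_rat enc_rat)))"
proof -
 have "(%(u, v, w). Node (enc_nat u) (Node (enc_nat v) (enc_rat w))) = enc_pair enc_nat (enc_pair enc_nat enc_rat)"
  "(%(a, b). Node (enc_rat a) (enc_rat b)) = enc_pair enc_rat enc_rat"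
  by (auto simp: enc_pair_def)
 then show ?thesis by (intro ext) (simp add: enc_ising_def enc_pair_def case_prod_beta)
qed

lemma PT_wire_desc:
 assumes A: "PT E enc_unary A" and C: "PT E enc_unary C" and r: "PT E enc_unary r" and bm: "PT E enc_unary bm"
  and b: "PT E enc_unary b" and w: "PT E enc_rat w" and \<phi>: "PT E enc_rat \<phi>"
  and R: "PT (env_pair (env_pair E enc_unary) enc_unary) enc_bool (%z. Rel (fst (fst z)) (snd (fst z)) (snd z))"
 shows "PT E enc_ising (%x. wire_desc (A x) (C x) (r x) (bm x) (b x) (Rel x) (w x) (\<phi> x))"
proof -
 let ?E1 = "env_pair E enc_unary"
 let ?E2 = "env_pair ?E1 enc_unary"
 have R1: "PT (env_pair (env_pair ?E1 enc_unary) enc_unary) enc_bool (%z. Rel (fst (fst (fst z))) (snd (fst z)) (snd z))"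
  using RT_lift[where f = "%x y z. return_pmf (Rel x y z)", OF R] .
 have R2: "PT (env_pair (env_pair ?E2 enc_unary) enc_unary) enc_bool (%z. Rel (fst (fst (fst (fst z)))) (snd (fst z)) (snd z))"
  using RT_lift[where f = "%x y z. return_pmf (Rel (fst x) y z)", OF R1] .
 have n: "PT E enc_unary (%x. vnum (A x) (C x) (r x) (bm x))" by (intro PT_vnum A C r bm)
 note up = PT_upt[OF n]
 note l1 = RT_env[OF A, where ?e1.0 = enc_unary] RT_env[OF C, where ?e1.0 = enc_unary] RT_env[OF r, where ?e1.0 = enc_unary]
  RT_env[OF bm, where ?e1.0 = enc_unary] RT_env[OF b, where ?e1.0 = enc_unary]
 note l2 = l1[THEN RT_env[where ?e1.0 = enc_unary]]
 have we: "PT ?E2 enc_bool (%z. wire_edge (A (fst (fst z))) (C (fst (fst z))) (r (fst (fst z))) (bm (fst (fst z))) (b (fst (fst z))) (snd (fst z)) (snd z))"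
  by (intro PT_wire_edge l2 PT_id RT_env[OF PT_id])
 have le2: "PT ?E2 enc_bool (%z. left_end (A (fst (fst z))) (C (fst (fst z))) (r (fst (fst z))) (bm (fst (fst z))) (b (fst (fst z))) (Rel (fst (fst z))) (snd (fst z)))"
  by (rule PT_left_end[OF l2 _ R2]) (rule RT_env[OF PT_id])
 have re2: "PT ?E2 enc_bool (%z. right_end (A (fst (fst z))) (C (fst (fst z))) (r (fst (fst z))) (bm (fst (fst z))) (b (fst (fst z))) (Rel (fst (fst z))) (snd z))"
  by (rule PT_right_end[OF l2 PT_id R2])
 have ce: "PT ?E2 enc_bool (%z. conn_edge (A (fst (fst z))) (C (fst (fst z))) (r (fst (fst z))) (bm (fst (fst z))) (b (fst (fst z))) (Rel (fst (fst z))) (snd (fst z)) (snd z))"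
  unfolding conn_edge_def
  by (intro PT_conj le2 re2 PT_eq PT_ps PT_mod l2 PT_id RT_env[OF PT_id])
 let ?ed = "enc_pair enc_nat (enc_pair enc_nat enc_rat)"
 have inner: "PT ?E2 (enc_list ?ed) (%z. if wire_edge (A (fst (fst z))) (C (fst (fst z))) (r (fst (fst z))) (bm (fst (fst z))) (b (fst (fst z))) (snd (fst z)) (snd z)
   then [(snd (fst z), snd z, w (fst (fst z)))]
   else if conn_edge (A (fst (fst z))) (C (fst (fst z))) (r (fst (fst z))) (bm (fst (fst z))) (b (fst (fst z))) (Rel (fst (fst z))) (snd (fst z)) (snd z)
   then [(snd (fst z), snd z, \<phi> (fst (fst z)))] else [])"
  by (intro PT_if we ce PT_Cons PT_const PT_pair PT_of_unary PT_id RT_env[OF PT_id] w[THEN RT_env, THEN RT_env] \<phi>[THEN RT_env, THEN RT_env])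
 have es: "PT E (enc_list ?ed) (%x. concat (map (%t. concat (map (%t'. if wire_edge (A x) (C x) (r x) (bm x) (b x) t t' then [(t, t', w x)]
    else if conn_edge (A x) (C x) (r x) (bm x) (b x) (Rel x) t t' then [(t, t', \<phi> x)] else []) [0..<vnum (A x) (C x) (r x) (bm x)])) [0..<vnum (A x) (C x) (r x) (bm x)]))"
  by (rule PT_concat_map[OF up], rule PT_concat_map[OF RT_env[OF up]], rule inner)
 have le1: "PT ?E1 enc_bool (%z. left_end (A (fst z)) (C (fst z)) (r (fst z)) (bm (fst z)) (b (fst z)) (Rel (fst z)) (snd z))"
  by (rule PT_left_end[OF l1 PT_id R1])
 have re1: "PT ?E1 enc_bool (%z. right_end (A (fst z)) (C (fst z)) (r (fst z)) (bm (fst z)) (b (fst z)) (Rel (fst z)) (snd z))"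
  by (rule PT_right_end[OF l1 PT_id R1])
 have fs: "PT E (enc_list (enc_pair enc_rat enc_rat)) (%x. map (%t. (if left_end (A x) (C x) (r x) (bm x) (b x) (Rel x) t then \<phi> x else 0,
   if right_end (A x) (C x) (r x) (bm x) (b x) (Rel x) t then \<phi> x else 0)) [0..<vnum (A x) (C x) (r x) (bm x)])"
  by (rule PT_map[OF up]) (intro PT_pair PT_if le1 re1 PT_const \<phi>[THEN RT_env])
 show ?thesis unfolding enc_ising_pairs wire_desc_def by (intro PT_pair n es fs)
qed

section \<open>The randomised counting procedure\<close>

definition rsub :: "nat => nat list pmf" where
 "rsub k = foldM (%v l. bind_pmf (bernoulli_pmf (1/2)) (%b. return_pmf (if b then v # l else l))) [0..<k] []"

lemma RT_rsub: "PT E enc_unary k ==> RT E (enc_list enc_unary) (%x. rsub (k x))"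
 unfolding rsub_def
proof (rule RT_foldM_add[where ?e1.0 = enc_unary and q = "[:1, 1:]"])
 show "RT (env_pair (env_pair E enc_unary) (enc_list enc_unary)) (enc_list enc_unary)
   (%z. bind_pmf (bernoulli_pmf (1/2)) (%b. return_pmf (if b then snd (fst z) # snd z else snd z)))"
  by (rule RT_bind[OF PT_flip, where g = "%z b. return_pmf (if b then snd (fst z) # snd z else snd z)"])
   (intro PT_if PT_Cons PT_id RT_env[OF PT_id] RT_env[OF RT_env[OF PT_id]])
qed (auto intro: PT_upt PT_const simp: ms_env_pair split: if_splits)

text \<open>A uniform element of the trivial phase: left wires at spin 1, fair independent spins on
  right wires and isolated vertices. It depends only on the size parameters, so the same fakes serve
  all relations.\<close>

definition gen :: "nat => nat => nat => nat => nat => nat list pmf" where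
 "gen A C r bm b = bind_pmf (rsub C) (%Y. bind_pmf (rsub (vnum A C r bm)) (%Z. return_pmf
  (map (%t. if t mod bm < b then (if wi A C r bm t < A then 1 else if \<exists>y\<in>set Y. y = wi A C r bm t - A then 1 else 2)
       else if \<exists>y\<in>set Z. y = t then 1 else 2) [0..<vnum A C r bm])))"

lemma RT_gen:
 assumes A: "PT E enc_unary A" and C: "PT E enc_unary C" and r: "PT E enc_unary r" and bm: "PT E enc_unary bm" and b: "PT E enc_unary b"
 shows "RT E (enc_list enc_nat) (%x. gen (A x) (C x) (r x) (bm x) (b x))"
proof -
 let ?E1 = "env_pair E (enc_list enc_unary)"
 let ?E2 = "env_pair ?E1 (enc_list enc_unary)"
 let ?E3 = "env_pair ?E2 enc_unary"
 let ?E4 = "env_pair ?E3 enc_unary"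
 have n: "PT E enc_unary (%x. vnum (A x) (C x) (r x) (bm x))" by (intro PT_vnum A C r bm)
 note l3 = A[THEN RT_env, THEN RT_env, THEN RT_env] C[THEN RT_env, THEN RT_env, THEN RT_env] r[THEN RT_env, THEN RT_env, THEN RT_env]
  bm[THEN RT_env, THEN RT_env, THEN RT_env] b[THEN RT_env, THEN RT_env, THEN RT_env]
 have w3: "PT ?E3 enc_unary (%z. wi (A (fst (fst (fst z)))) (C (fst (fst (fst z)))) (r (fst (fst (fst z)))) (bm (fst (fst (fst z)))) (snd z))"
  by (intro PT_wi l3 PT_id)
 have y3: "PT ?E3 (enc_list enc_unary) (%z. snd (fst (fst z)))" by (rule RT_env, rule RT_env, rule PT_id)
 have z3: "PT ?E3 (enc_list enc_unary) (%z. snd (fst z))" by (rule RT_env, rule PT_id)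
 have ex1: "PT ?E3 enc_bool (%z. \<exists>y\<in>set (snd (fst (fst z))). y = wi (A (fst (fst (fst z)))) (C (fst (fst (fst z)))) (r (fst (fst (fst z)))) (bm (fst (fst (fst z)))) (snd z) - A (fst (fst (fst z))))"
  by (rule PT_bex[OF y3]) (intro PT_eq PT_diff PT_id RT_env[OF w3] RT_env[OF l3(1)])
 have ex2: "PT ?E3 enc_bool (%z. \<exists>y\<in>set (snd (fst z)). y = snd z)"
  by (rule PT_bex[OF z3]) (intro PT_eq PT_id RT_env[OF PT_id])
 have body: "PT ?E3 enc_nat (%z. if snd z mod bm (fst (fst (fst z))) < b (fst (fst (fst z)))
   then (if wi (A (fst (fst (fst z)))) (C (fst (fst (fst z)))) (r (fst (fst (fst z)))) (bm (fst (fst (fst z)))) (snd z) < A (fst (fst (fst z))) then 1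
    else if \<exists>y\<in>set (snd (fst (fst z))). y = wi (A (fst (fst (fst z)))) (C (fst (fst (fst z)))) (r (fst (fst (fst z)))) (bm (fst (fst (fst z)))) (snd z) - A (fst (fst (fst z))) then 1 else 2)
   else if \<exists>y\<in>set (snd (fst z)). y = snd z then 1 else 2)"
  by (intro PT_if PT_less PT_mod PT_id l3 w3 ex1 ex2 PT_const)
 have 2: "RT ?E2 (enc_list enc_nat) (%z. return_pmf (map (%t. if t mod bm (fst (fst z)) < b (fst (fst z))
   then (if wi (A (fst (fst z))) (C (fst (fst z))) (r (fst (fst z))) (bm (fst (fst z))) t < A (fst (fst z)) then 1
    else if \<exists>y\<in>set (snd (fst z)). y = wi (A (fst (fst z))) (C (fst (fst z))) (r (fst (fst z))) (bm (fst (fst z))) t - A (fst (fst z)) then 1 else 2)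
   else if \<exists>y\<in>set (snd z). y = t then 1 else 2) [0..<vnum (A (fst (fst z))) (C (fst (fst z))) (r (fst (fst z))) (bm (fst (fst z)))]))"
  by (rule PT_map[OF PT_upt[OF n[THEN RT_env, THEN RT_env]] body])
 show ?thesis unfolding gen_def
  by (rule RT_bind[OF RT_rsub[OF C]], rule RT_bind[OF RT_rsub[OF RT_env[OF n]]], rule 2)
qed

definition adjG :: "(nat \<times> nat) list => nat => nat => bool" where
 "adjG es u v \<longleftrightarrow> (\<exists>p\<in>set es. (fst p = u \<and> snd p = v) \<or> (fst p = v \<and> snd p = u))"

text \<open>Index \<open>x\<close> stands for vertex \<open>x mod S\<close> in copy
  \<open>x div S\<close>. Restriction to a sublist \<open>H\<close> drops edges and leaves the other
  vertices free; likewise the right indices from \<open>k * S + m\<close> on are related to nothing.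
  So the size of the model is the same for all \<open>H\<close> and \<open>m\<close>.\<close>

definition relG :: "nat => nat => (nat \<times> nat) list => nat list => nat => nat => nat => bool" where
 "relG S k es H m x y = (if y < k * S
  then x div S = y div S \<and> (\<exists>h\<in>set H. h = x mod S) \<and> (\<exists>h\<in>set H. h = y mod S) \<and> adjG es (x mod S) (y mod S)
  else y - k * S < m)"

abbreviation "enc_edge \<equiv> enc_pair enc_nat enc_nat"

lemma PT_adjG:
 assumes es: "PT E (enc_list enc_edge) es" and u: "PT E enc_nat u" and v: "PT E enc_nat v"
 shows "PT E enc_bool (%x. adjG (es x) (u x) (v x))"
 unfolding adjG_def
 by (rule PT_bex[OF es]) (intro PT_disj PT_conj PT_eq_bin PT_fst[OF PT_id] PT_snd[OF PT_id] RT_env[OF u] RT_env[OF v])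

lemma PT_relG:
 assumes S: "PT E enc_unary S" and k: "PT E enc_unary k" and es: "PT E (enc_list enc_edge) es"
  and H: "PT E (enc_list enc_nat) H" and m: "PT E enc_unary m" and x: "PT E enc_unary x" and y: "PT E enc_unary y"
 shows "PT E enc_bool (%z. relG (S z) (k z) (es z) (H z) (m z) (x z) (y z))"
 unfolding relG_def
proof (intro PT_if PT_conj PT_less PT_mult PT_eq PT_div PT_diff S k m x y)
 show "PT E enc_bool (%z. \<exists>h\<in>set (H z). h = x z mod S z)"
  by (rule PT_bex[OF H]) (intro PT_eq_bin PT_id RT_env PT_of_unary PT_mod x S)
 show "PT E enc_bool (%z. \<exists>h\<in>set (H z). h = y z mod S z)"
  by (rule PT_bex[OF H]) (intro PT_eq_bin PT_id RT_env PT_of_unary PT_mod y S)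
 show "PT E enc_bool (%z. adjG (es z) (x z mod S z) (y z mod S z))"
  by (intro PT_adjG es PT_of_unary PT_mod x y S)
qed

type_synonym guess = "bool \<times> nat \<times> nat"
abbreviation "enc_guess \<equiv> enc_pair enc_bool (enc_pair enc_unary enc_unary)"

text \<open>Weights are guessed up to powers of two, with positive or negative exponents, so that
  few guesses suffice. The companion \<open>phG\<close> is the weight cut off at 1, which respects
  both the bound 1 on the fields and the bound on the edge weights.\<close>

definition wtG :: "guess => rat" where "wtG g = (if fst g then 2 ^ fst (snd g) else 1 / 2 ^ fst (snd g))"
definition phG :: "guess => rat" where "phG g = (if fst g then 1 else 1 / 2 ^ fst (snd g))"
text \<open>With the fourth power, \<open>2 * kk S\<close> times 1/S^3 is 2 S, and exp(2 S)
  eventually exceeds every fixed power of S.\<close>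

definition kk :: "nat => nat" where "kk S = S ^ 4"
definition AA :: "nat => nat" where "AA S = kk S * S"
definition CC :: "nat => nat" where "CC S = 2 * (kk S * S)"
definition n1 :: "nat => nat" where "n1 S = (AA S + CC S) * wlen (AA S) (CC S) S"
text \<open>The model has \<open>n1 S ^ (q + 1)\<close> vertices, so blobs of size up to
  \<open>n1 S ^ q\<close> suffice for all degrees up to n^\<theta> with \<theta> <= q/(q+1).\<close>

definition bmx :: "nat => nat => nat" where "bmx q S = n1 S ^ q"
definition sQ :: "nat => nat" where "sQ S = length (bits (S ^ 4))"
text \<open>A power of two, so that fair coins give exactly uniform numbers below it, and larger
  than S^4, so that one unit is a probability below 1/S^4.\<close>

definition QQ :: "nat => nat" where "QQ S = 2 ^ sQ S"

definition descG :: "nat => nat => (nat \<times> nat) list => guess => nat list => nat => ising_desc" where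
 "descG q S es g H m = wire_desc (AA S) (CC S) S (bmx q S) (snd (snd g)) (relG S (kk S) es H m) (wtG g) (phG g)"

definition genG :: "nat => nat => guess => nat list pmf" where
 "genG q S g = gen (AA S) (CC S) S (bmx q S) (snd (snd g))"

definition simG :: "com => nat => nat => nat => (nat \<times> nat) list => guess => nat list => nat => bool pmf" where
 "simG c q e S es g H m = map_pmf (%cs. snd cs 0 = enc_bool True)
  (exec (map_pmf (enc_list enc_nat) (genG q S g)) c (enc_ising (descG q S es g H m)) (S ^ e))"

definition maj :: "nat => bool pmf => bool pmf" where
 "maj R p = bind_pmf (foldM (%_ cnt. bind_pmf p (%b. return_pmf (if b then Suc cnt else cnt))) (replicate R ()) 0)
  (%cnt. return_pmf (R < 2 * cnt))"

text \<open>The number of rejected values of \<open>m\<close>. Counting, unlike a search for the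
  switch, tolerates arbitrary answers in the range where neither phase is negligible.\<close>

definition FG :: "com => nat => nat => nat => (nat \<times> nat) list => guess => nat list => nat pmf" where
 "FG c q e S es g H = foldM (%m cnt. bind_pmf (maj S (simG c q e S es g H (Suc m)))
  (%b. return_pmf (if b then cnt else Suc cnt))) [0..<AA S] 0"

text \<open>Roughly 2^(ex/k): the largest \<open>j <= Q\<close> with \<open>j ^ k < 2 ^ ex\<close>,
  or 0 if there is none, found by looking at digit lengths.\<close>

definition jsel :: "nat => nat => nat => nat" where
 "jsel k Q ex = fold (%_ j. if length (bits (Suc j ^ k)) <= ex then Suc j else j) (replicate Q ()) 0"

text \<open>A count \<open>F\<close> makes \<open>2 ^ (AA S + F)\<close> close to the
  \<open>2 * kk S\<close>-th power of \<open>2 ^ (S - length H) * ZH es H\<close>. So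
  \<open>F + 2 * kk S * length H\<close> is, up to a constant, the binary logarithm of the same
  power of \<open>ZH es H\<close>, and the expression belongs to that power of \<open>QQ S\<close>
  times a ratio of two counts.\<close>

definition expo :: "nat => nat => nat => nat => nat => nat" where
 "expo S F1 h1 F0 h0 = 2 * kk S * sQ S + F1 + 2 * kk S * h1 - (F0 + 2 * kk S * h0)"

abbreviation "bits_onto \<equiv> foldM (%_::unit. %u::nat. bind_pmf (bernoulli_pmf (1/2)) (%b. return_pmf (if b then Suc (u + u) else u + u)))"

definition unif :: "nat => nat pmf" where
 "unif s = bits_onto (replicate s ()) 0"

definition nbrs_out :: "(nat \<times> nat) list => nat => nat list => nat list" where
 "nbrs_out es v H = filter (%u. \<not> adjG es v u) H"

definition pickG :: "nat => (nat \<times> nat) list => nat => nat list => nat => nat => nat => nat => nat list \<times> nat" where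
 "pickG S es v H J F1 F0 u =
  (if u < jsel (2 * kk S) (QQ S) (expo S F1 (length (nbrs_out es v H)) F0 (length (v # H)))
   then (nbrs_out es v H, jsel (2 * kk S) (QQ S) (expo S F1 (length (nbrs_out es v H)) F0 (length (v # H))) * J)
   else (H, (QQ S - jsel (2 * kk S) (QQ S) (expo S F1 (length (nbrs_out es v H)) F0 (length (v # H)))) * J))"

text \<open>Once no vertex is left, a factor \<open>QQ S\<close> is still multiplied in. Thus every
  run makes exactly N steps and the fixed numerator \<open>QQ S ^ N\<close> fits all of them,
  however many neighbours were removed on the way.\<close>

definition stepG :: "com => nat => nat => nat => (nat \<times> nat) list => guess => nat list \<times> nat => (nat list \<times> nat) pmf" where
 "stepG c q e S es g a = (case fst a of [] => return_pmf ([], QQ S * snd a)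
  | v # H => bind_pmf (FG c q e S es g (nbrs_out es v H)) (%F1. bind_pmf (FG c q e S es g (v # H)) (%F0.
     bind_pmf (unif (sQ S)) (%u. return_pmf (pickG S es v H (snd a) F1 F0 u)))))"

definition repG :: "com => nat => nat => nat => nat => (nat \<times> nat) list => guess => nat pmf" where
 "repG c q e S N es g = map_pmf snd (foldM (%_. stepG c q e S es g) (replicate N ()) ([0..<N], 1))"

text \<open>The estimate is \<open>QQ S ^ N / J\<close>, so the largest \<open>J\<close> is the
  smallest estimate. Markov only bounds the chance that one run overestimates by exp(-\<rho>), which
  may be close to 1; that all S^3 runs do so is exponentially unlikely.\<close>

definition worstG :: "com => nat => nat => nat => nat => (nat \<times> nat) list => guess => nat pmf" where
 "worstG c q e S N es g = foldM (%_ w. bind_pmf (repG c q e S N es g) (%J. return_pmf (if w < J then J else w)))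
  (replicate (S ^ 3) ()) 0"

definition guesses :: "nat => nat => guess list" where
 "guesses q S = concat (map (%kd. concat (map (%x. map (%b. (kd, x, Suc b)) [0..<bmx q S]) [0..<S])) [False, True])"

text \<open>The minimum over guesses of these maxima: with high probability a wrong guess errs only
  towards large \<open>J\<close>. The initial 0 stands for "no value yet"; genuine values are
  positive.\<close>

definition bestG :: "com => nat => nat => nat => nat => (nat \<times> nat) list => nat pmf" where
 "bestG c q e S N es = foldM (%g bst. bind_pmf (worstG c q e S N es g)
  (%J. return_pmf (if bst = 0 \<or> J < bst then J else bst))) (guesses q S) 0"

lemma PT_kk: "PT E enc_unary S ==> PT E enc_unary (%x. kk (S x))" unfolding kk_def by (rule PT_power)
lemma PT_AA: "PT E enc_unary S ==> PT E enc_unary (%x. AA (S x))" unfolding AA_def by (intro PT_mult PT_kk)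
lemma PT_CC: "PT E enc_unary S ==> PT E enc_unary (%x. CC (S x))" unfolding CC_def by (intro PT_mult PT_kk PT_const)
lemma PT_n1: "PT E enc_unary S ==> PT E enc_unary (%x. n1 (S x))" unfolding n1_def by (intro PT_mult PT_add PT_AA PT_CC PT_wlen)
lemma PT_bmx: "PT E enc_unary S ==> PT E enc_unary (%x. bmx q (S x))" unfolding bmx_def by (intro PT_power PT_n1)
lemma PT_sQ: "PT E enc_unary S ==> PT E enc_unary (%x. sQ (S x))" unfolding sQ_def by (intro PT_length[OF PT_bits] PT_of_unary PT_power)

lemma two_power_bits: "2 ^ length (bits n) <= 2 * n + 1"
proof (cases "length (bits n)")
 case (Suc l)
 have "\<not> n < 2 ^ l" using length_bits[of n l] Suc by simp
 then show ?thesis using Suc by simp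
qed simp

lemma PT_QQ:
 assumes S: "PT E enc_unary S"
 shows "PT E enc_unary (%x. QQ (S x))"
proof -
 have P: "PT E enc_unary (%x. S x ^ 4)" by (rule PT_power[OF S])
 obtain p where p: "\<And>a. size (enc_unary (S a ^ 4)) <= poly p (ms E a)" by (rule PT_bound[OF P], rule that, auto)
 show ?thesis unfolding QQ_def sQ_def
 proof (rule PT_power2[OF PT_bits[OF PT_of_unary[OF P]], where p = "2 * p + 1"])
  fix x
  have "2 ^ length (bits (S x ^ 4)) <= 2 * S x ^ 4 + 1" by (rule two_power_bits)
  also have "\<dots> <= poly (2 * p + 1) (ms E x)" using p[of x] by simp
  finally show "2 ^ length (bits (S x ^ 4)) <= poly (2 * p + 1) (ms E x)" .
 qed
qed

lemma PT_wtG: "PT E enc_guess g ==> PT E enc_rat (%x. wtG (g x))"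
 unfolding wtG_def by (intro PT_if PT_rat_power2 PT_rat_inverse_power2 PT_fst[of E enc_bool] PT_fst[OF PT_snd])

lemma PT_phG: "PT E enc_guess g ==> PT E enc_rat (%x. phG (g x))"
 unfolding phG_def by (intro PT_if PT_const PT_rat_inverse_power2 PT_fst[of E enc_bool] PT_fst[OF PT_snd])

lemma PT_descG:
 assumes S: "PT E enc_unary S" and es: "PT E (enc_list enc_edge) es" and g: "PT E enc_guess g"
  and H: "PT E (enc_list enc_nat) H" and m: "PT E enc_unary m"
 shows "PT E enc_ising (%x. descG q (S x) (es x) (g x) (H x) (m x))"
 unfolding descG_def
proof (rule PT_wire_desc[OF PT_AA[OF S] PT_CC[OF S] S PT_bmx[OF S] PT_snd[OF PT_snd[OF g]] PT_wtG[OF g] PT_phG[OF g]])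
 show "PT (env_pair (env_pair E enc_unary) enc_unary) enc_bool
  (%z. relG (S (fst (fst z))) (kk (S (fst (fst z)))) (es (fst (fst z))) (H (fst (fst z))) (m (fst (fst z))) (snd (fst z)) (snd z))"
  by (rule PT_relG[OF S[THEN RT_env, THEN RT_env] PT_kk[OF S, THEN RT_env, THEN RT_env] es[THEN RT_env, THEN RT_env]
     H[THEN RT_env, THEN RT_env] m[THEN RT_env, THEN RT_env] RT_env[OF PT_id] PT_id])
qed

lemma RT_simG:
 assumes "PT E enc_unary S" "PT E (enc_list enc_edge) es" "PT E enc_guess g" "PT E (enc_list enc_nat) H" "PT E enc_unary m"
 shows "RT E enc_bool (%x. simG c q e (S x) (es x) (g x) (H x) (m x))"
 unfolding simG_def genG_def
 by (rule RT_sim[OF RT_gen[OF PT_AA PT_CC _ PT_bmx PT_snd[OF PT_snd]] PT_descG PT_power]) (rule assms)+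

lemma RT_maj:
 assumes R: "PT E enc_unary R" and p: "RT E enc_bool p"
 shows "RT E enc_bool (%x. maj (R x) (p x))"
 unfolding maj_def
proof (rule RT_bind[where ?e1.0 = enc_unary])
 show "RT E enc_unary (%x. foldM (%_ cnt. bind_pmf (p x) (%b. return_pmf (if b then Suc cnt else cnt))) (replicate (R x) ()) 0)"
 proof (rule RT_foldM_add[OF PT_units[OF R] PT_const, where q = 1])
  show "RT (env_pair (env_pair E enc_unit) enc_unary) enc_unary (%z. bind_pmf (p (fst (fst z))) (%b. return_pmf (if b then Suc (snd z) else snd z)))"
   by (rule RT_bind[OF p[THEN RT_env, THEN RT_env], where g = "%z b. return_pmf (if b then Suc (snd z) else snd z)"])
    (intro PT_if PT_Suc PT_id RT_env[OF PT_id])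
 qed (auto split: if_splits)
 show "RT (env_pair E enc_unary) enc_bool (%z. return_pmf (R (fst z) < 2 * snd z))"
  by (intro PT_less PT_mult PT_const PT_id RT_env[OF R])
qed

lemma RT_FG:
 assumes S: "PT E enc_unary S" and es: "PT E (enc_list enc_edge) es" and g: "PT E enc_guess g" and H: "PT E (enc_list enc_nat) H"
 shows "RT E enc_unary (%x. FG c q e (S x) (es x) (g x) (H x))"
 unfolding FG_def
proof (rule RT_foldM_add[OF PT_upt[OF PT_AA[OF S]] PT_const, where q = 1])
 have "RT (env_pair (env_pair E enc_unary) enc_unary) enc_bool (%z. maj (S (fst (fst z)))
   (simG c q e (S (fst (fst z))) (es (fst (fst z))) (g (fst (fst z))) (H (fst (fst z))) (Suc (snd (fst z)))))"
  by (intro RT_maj RT_simG S[THEN RT_env, THEN RT_env] es[THEN RT_env, THEN RT_env] g[THEN RT_env, THEN RT_env]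
    H[THEN RT_env, THEN RT_env] PT_Suc RT_env[OF PT_id])
 then show "RT (env_pair (env_pair E enc_unary) enc_unary) enc_unary (%z. bind_pmf (maj (S (fst (fst z)))
   (simG c q e (S (fst (fst z))) (es (fst (fst z))) (g (fst (fst z))) (H (fst (fst z))) (Suc (snd (fst z)))))
   (%b. return_pmf (if b then snd z else Suc (snd z))))"
  by (rule RT_bind[where g = "%z b. return_pmf (if b then snd z else Suc (snd z))"])
   (intro PT_if PT_Suc PT_id RT_env[OF PT_id])
qed (auto split: if_splits)

lemma PT_jsel:
 assumes k: "PT E enc_unary k" and Q: "PT E enc_unary Q" and ex: "PT E enc_unary ex"
 shows "PT E enc_unary (%x. jsel (k x) (Q x) (ex x))"
 unfolding jsel_def
proof (rule PT_fold_add[OF PT_units[OF Q] PT_const, where q = 1])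
 show "PT (env_pair (env_pair E enc_unit) enc_unary) enc_unary
   (%z. if length (bits (Suc (snd z) ^ k (fst (fst z)))) <= ex (fst (fst z)) then Suc (snd z) else snd z)"
  by (intro PT_if PT_le PT_length[OF PT_bits] PT_power_bin PT_Suc PT_id k[THEN RT_env, THEN RT_env] ex[THEN RT_env, THEN RT_env])
qed auto

lemma PT_expo:
 assumes "PT E enc_unary S" "PT E enc_unary F1" "PT E enc_unary h1" "PT E enc_unary F0" "PT E enc_unary h0"
 shows "PT E enc_unary (%x. expo (S x) (F1 x) (h1 x) (F0 x) (h0 x))"
 unfolding expo_def by (intro PT_diff PT_add PT_mult PT_const PT_kk PT_sQ assms)

lemma unif_less: "u \<in> set_pmf (bits_onto l a) ==>
 u < 2 ^ length l * Suc a"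
proof (induction l arbitrary: a)
 case (Cons y l)
 then obtain b where "u \<in> set_pmf (bits_onto l (if b then Suc (a + a) else a + a))"
  by auto
 from Cons.IH[OF this] have "u < 2 ^ length l * Suc (if b then Suc (a + a) else a + a)" .
 also have "\<dots> <= 2 ^ length l * (2 * Suc a)" by (intro mult_left_mono) auto
 finally show ?case by (simp add: mult.assoc mult.commute)
qed simp

lemma RT_unif:
 assumes S: "PT E enc_unary S"
 shows "RT E enc_unary (%x. unif (sQ (S x)))"
proof -
 obtain p where p: "\<And>a. size (enc_unary (QQ (S a))) <= poly p (ms E a)" by (rule PT_bound[OF PT_QQ[OF S]], rule that, auto)
 show ?thesis unfolding unif_def
 proof (rule RT_foldM[OF PT_units[OF PT_sQ[OF S]] PT_const, where q = p])
  show "RT (env_pair (env_pair E enc_unit) enc_unary) enc_unary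
   (%z. bind_pmf (bernoulli_pmf (1/2)) (%b. return_pmf (if b then Suc (snd z + snd z) else snd z + snd z)))"
   by (rule RT_bind[OF PT_flip, where g = "%z b. return_pmf (if b then Suc (snd z + snd z) else snd z + snd z)"])
    (intro PT_if PT_Suc PT_add PT_id RT_env[OF PT_id])
  fix x i acc
  assume "acc \<in> set_pmf (bits_onto
   (take i (replicate (sQ (S x)) ())) 0)"
  from unif_less[OF this] have "acc < 2 ^ min i (sQ (S x))" by (simp add: min.commute)
  also have "\<dots> <= 2 ^ sQ (S x)" by (intro power_increasing) auto
  finally show "size (enc_unary acc) <= poly p (ms E x)" using p[of x] by (simp add: QQ_def)
 qed
qed

lemma PT_nbrs_out:
 assumes es: "PT E (enc_list enc_edge) es" and v: "PT E enc_nat v" and H: "PT E (enc_list enc_nat) H"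
 shows "PT E (enc_list enc_nat) (%x. nbrs_out (es x) (v x) (H x))"
 unfolding nbrs_out_def
 by (rule PT_filter[OF H]) (intro PT_not PT_adjG PT_id RT_env[OF es] RT_env[OF v])

lemma PT_pickG:
 assumes S: "PT E enc_unary S" and es: "PT E (enc_list enc_edge) es" and v: "PT E enc_nat v" and H: "PT E (enc_list enc_nat) H"
  and J: "PT E enc_nat J" and F1: "PT E enc_unary F1" and F0: "PT E enc_unary F0" and u: "PT E enc_unary u"
 shows "PT E (enc_pair (enc_list enc_nat) enc_nat) (%x. pickG (S x) (es x) (v x) (H x) (J x) (F1 x) (F0 x) (u x))"
proof -
 note nb = PT_nbrs_out[OF es v H]
 have j: "PT E enc_unary (%x. jsel (2 * kk (S x)) (QQ (S x)) (expo (S x) (F1 x) (length (nbrs_out (es x) (v x) (H x))) (F0 x) (length (v x # H x))))"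
  by (intro PT_jsel PT_mult PT_const PT_kk PT_QQ PT_expo S F1 F0 PT_length[OF nb] PT_length[OF PT_Cons[OF v H]])
 show ?thesis unfolding pickG_def
  by (intro PT_if PT_less PT_pair PT_mult_bin PT_diff PT_QQ j u nb J S H)
qed

lemma RT_stepG:
 assumes S: "PT E enc_unary S" and es: "PT E (enc_list enc_edge) es" and g: "PT E enc_guess g"
  and a: "PT E (enc_pair (enc_list enc_nat) enc_nat) a"
 shows "RT E (enc_pair (enc_list enc_nat) enc_nat) (%x. stepG c q e (S x) (es x) (g x) (a x))"
 unfolding stepG_def
proof (rule RT_case_list[OF PT_fst[OF a]])
 show "PT E (enc_pair (enc_list enc_nat) enc_nat) (%x. ([], QQ (S x) * snd (a x)))"
  by (intro PT_pair PT_const PT_mult_bin PT_QQ S PT_snd[OF a])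
 let ?E2 = "env_pair (env_pair E enc_nat) (enc_list enc_nat)"
 note l2 = S[THEN RT_env, THEN RT_env] es[THEN RT_env, THEN RT_env] g[THEN RT_env, THEN RT_env] PT_snd[OF a, THEN RT_env, THEN RT_env]
 have v: "PT ?E2 enc_nat (%z. snd (fst z))" by (rule RT_env[OF PT_id])
 have H: "PT ?E2 (enc_list enc_nat) snd" by (rule PT_id)
 have F1: "RT ?E2 enc_unary (%z. FG c q e (S (fst (fst z))) (es (fst (fst z))) (g (fst (fst z))) (nbrs_out (es (fst (fst z))) (snd (fst z)) (snd z)))"
  by (intro RT_FG l2 PT_nbrs_out v H)
 have F0: "RT ?E2 enc_unary (%z. FG c q e (S (fst (fst z))) (es (fst (fst z))) (g (fst (fst z))) (snd (fst z) # snd z))"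
  by (intro RT_FG l2 PT_Cons v H)
 have U: "RT ?E2 enc_unary (%z. unif (sQ (S (fst (fst z)))))" by (rule RT_unif[OF l2(1)])
 show "RT ?E2 (enc_pair (enc_list enc_nat) enc_nat)
  (%z. bind_pmf (FG c q e (S (fst (fst z))) (es (fst (fst z))) (g (fst (fst z))) (nbrs_out (es (fst (fst z))) (snd (fst z)) (snd z)))
    (%F1. bind_pmf (FG c q e (S (fst (fst z))) (es (fst (fst z))) (g (fst (fst z))) (snd (fst z) # snd z))
    (%F0. bind_pmf (unif (sQ (S (fst (fst z))))) (%u. return_pmf (pickG (S (fst (fst z))) (es (fst (fst z))) (snd (fst z)) (snd z) (snd (a (fst (fst z)))) F1 F0 u)))))"
  by (rule RT_bind[OF F1], rule RT_bind[OF RT_env[OF F0]], rule RT_bind[OF RT_env[OF RT_env[OF U]]])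
   (rule PT_pickG[OF l2(1)[THEN RT_env, THEN RT_env, THEN RT_env] l2(2)[THEN RT_env, THEN RT_env, THEN RT_env]
     v[THEN RT_env, THEN RT_env, THEN RT_env] H[THEN RT_env, THEN RT_env, THEN RT_env]
     l2(4)[THEN RT_env, THEN RT_env, THEN RT_env] RT_env[OF RT_env[OF PT_id]] RT_env[OF PT_id] PT_id])
qed

lemma foldM_inv:
 assumes "\<And>i y acc acc'. P i acc ==> acc' \<in> set_pmf (g y acc) ==> P (Suc i) acc'"
  and "P i a" and "acc \<in> set_pmf (foldM g ys a)"
 shows "P (i + length ys) acc"
 using assms(2,3)
proof (induction ys arbitrary: a i)
 case (Cons y ys)
 obtain a' where a': "a' \<in> set_pmf (g y a)" "acc \<in> set_pmf (foldM g ys a')" using Cons.prems(2) by auto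
 have "P (Suc i + length ys) acc" by (rule Cons.IH[OF assms(1)[OF Cons.prems(1) a'(1)] a'(2)])
 then show ?case by simp
qed simp

lemma jsel_le: "jsel k Q ex <= Q"
proof -
 have "fold (%_ j. if length (bits (Suc j ^ k)) <= ex then Suc j else j) l a <= length l + a" for l :: "unit list" and a
 proof (induction l arbitrary: a)
  case (Cons y l)
  show ?case using Cons[of "Suc a"] Cons[of a] by (simp split: if_splits)
 qed simp
 from this[of "replicate Q ()" 0] show ?thesis by (simp add: jsel_def)
qed

lemma stepG_inv:
 assumes "a' \<in> set_pmf (stepG c q e S es g a)"
 shows "length (fst a') <= length (fst a)" "set (fst a') \<subseteq> set (fst a)" "snd a' <= QQ S * snd a"
proof -
 have "length (fst a') <= length (fst a) \<and> set (fst a') \<subseteq> set (fst a) \<and> snd a' <= QQ S * snd a"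
 proof (cases "fst a")
  case Nil
  then show ?thesis using assms by (simp add: stepG_def)
 next
  case (Cons v H)
  obtain F1 F0 u where a': "a' = pickG S es v H (snd a) F1 F0 u" using assms by (auto simp: stepG_def Cons)
  have len: "length (nbrs_out es v H) <= length H" "set (nbrs_out es v H) \<subseteq> set H" by (auto simp: nbrs_out_def)
  have "snd a' <= QQ S * snd a"
   unfolding a' pickG_def by (simp add: jsel_le mult_le_mono1)
  then show ?thesis using len by (auto simp: a' pickG_def Cons)
 qed
 then show "length (fst a') <= length (fst a)" "set (fst a') \<subseteq> set (fst a)" "snd a' <= QQ S * snd a" by blast+
qed

lemma size_enc_nats: "set H \<subseteq> {..<N} ==> size (enc_list enc_nat H) <= length H * (2 * N + 1)"
proof (induction H)
 case (Cons h H)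
 have "size (enc_nat h) <= 2 * N" using size_enc_nat_le[of h] Cons.prems by simp
 then show ?case using Cons by simp
qed simp

definition rep_state :: "com => nat => nat => nat => nat => (nat \<times> nat) list => guess => nat => (nat list \<times> nat) pmf" where
 "rep_state c q e S N es g i = foldM (%_. stepG c q e S es g) (replicate i ()) ([0..<N], 1)"

lemma rep_state_inv:
 assumes "a \<in> set_pmf (rep_state c q e S N es g i)"
 shows "length (fst a) <= N" "set (fst a) \<subseteq> {..<N}" "snd a <= QQ S ^ i"
proof -
 have "length (fst a) <= N \<and> set (fst a) \<subseteq> {..<N} \<and> snd a <= QQ S ^ (0 + length (replicate i ()))"
 proof (rule foldM_inv[where P = "%i a. length (fst a) <= N \<and> set (fst a) \<subseteq> {..<N} \<and> snd a <= QQ S ^ i", OF _ _ assms[unfolded rep_state_def]])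
  fix i and y :: unit and acc acc'
  assume P: "length (fst acc) <= N \<and> set (fst acc) \<subseteq> {..<N} \<and> snd acc <= QQ S ^ i" and "acc' \<in> set_pmf (stepG c q e S es g acc)"
  note st = stepG_inv[OF this(2)]
  have "snd acc' <= QQ S * QQ S ^ i" using st(3) P by (meson mult_le_mono2 order_trans)
  then show "length (fst acc') <= N \<and> set (fst acc') \<subseteq> {..<N} \<and> snd acc' <= QQ S ^ Suc i"
   using st(1,2) P by auto
 qed auto
 then show "length (fst a) <= N" "set (fst a) \<subseteq> {..<N}" "snd a <= QQ S ^ i" by auto
qed

lemma size_enc_nat_QQ: "J <= QQ S ^ i ==> size (enc_nat J) <= 2 * (sQ S * i + 1)"
proof (rule size_enc_nat)
 assume "J <= QQ S ^ i"
 also have "QQ S ^ i = 2 ^ (sQ S * i)" by (simp add: QQ_def power_mult)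
 also have "\<dots> < 2 ^ (sQ S * i + 1)" by simp
 finally show "J < 2 ^ (sQ S * i + 1)" .
qed

lemma RT_map_snd:
 assumes "RT E (enc_pair e1 e2) f"
 shows "RT E e2 (%x. map_pmf snd (f x))"
 unfolding map_pmf_def by (rule RT_bind[OF assms]) (rule PT_snd[OF PT_id])

lemma RT_repG:
 assumes S: "PT E enc_unary S" and N: "PT E enc_unary N" and es: "PT E (enc_list enc_edge) es" and g: "PT E enc_guess g"
 shows "RT E enc_nat (%x. repG c q e (S x) (N x) (es x) (g x))"
 unfolding repG_def
proof (rule RT_map_snd)
 obtain pN where pN: "\<And>a. size (enc_unary (N a)) <= poly pN (ms E a)" by (rule PT_bound[OF N], rule that, auto)
 obtain pS where pS: "\<And>a. size (enc_unary (sQ (S a))) <= poly pS (ms E a)" by (rule PT_bound[OF PT_sQ[OF S]], rule that, auto)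
 have up: "PT E (enc_list enc_nat) (%x. [0..<N x])"
  by (rule PT_cong[OF PT_map[OF PT_upt[OF N], where g = "%_ t. t", OF PT_of_unary[OF PT_id]]]) simp
 show "RT E (enc_pair (enc_list enc_nat) enc_nat) (%x. foldM (%_. stepG c q e (S x) (es x) (g x)) (replicate (N x) ()) ([0..<N x], 1))"
 proof (rule RT_foldM[OF PT_units[OF N] PT_pair[OF up PT_const], where q = "pN * (2 * pN + 1) + 2 * (pS * pN + 1) + 1"])
  show "RT (env_pair (env_pair E enc_unit) (enc_pair (enc_list enc_nat) enc_nat)) (enc_pair (enc_list enc_nat) enc_nat)
   (%z. stepG c q e (S (fst (fst z))) (es (fst (fst z))) (g (fst (fst z))) (snd z))"
   by (rule RT_stepG[OF S[THEN RT_env, THEN RT_env] es[THEN RT_env, THEN RT_env] g[THEN RT_env, THEN RT_env] PT_id])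
  fix x i acc assume a: "acc \<in> set_pmf (foldM (%_. stepG c q e (S x) (es x) (g x)) (take i (replicate (N x) ())) ([0..<N x], 1))"
  let ?i = "min i (N x)"
  have "acc \<in> set_pmf (rep_state c q e (S x) (N x) (es x) (g x) ?i)" using a by (simp add: rep_state_def)
  note inv = rep_state_inv[OF this]
  have n: "N x <= poly pN (ms E x)" and sq: "sQ (S x) <= poly pS (ms E x)" using pN[of x] pS[of x] by simp_all
  have "size (enc_list enc_nat (fst acc)) <= length (fst acc) * (2 * N x + 1)" by (rule size_enc_nats[OF inv(2)])
  also have "\<dots> <= poly pN (ms E x) * (2 * poly pN (ms E x) + 1)" using inv(1) n by (intro mult_mono) auto
  finally have 1: "size (enc_list enc_nat (fst acc)) <= poly pN (ms E x) * (2 * poly pN (ms E x) + 1)" .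
  have "size (enc_nat (snd acc)) <= 2 * (sQ (S x) * ?i + 1)" by (rule size_enc_nat_QQ[OF inv(3)])
  also have "\<dots> <= 2 * (poly pS (ms E x) * poly pN (ms E x) + 1)" using n sq by (intro mult_mono add_mono) auto
  finally show "size (enc_pair (enc_list enc_nat) enc_nat acc) <= poly (pN * (2 * pN + 1) + 2 * (pS * pN + 1) + 1) (ms E x)"
   using 1 by (simp add: enc_pair_def)
 qed
qed

lemma repG_le: "J \<in> set_pmf (repG c q e S N es g) ==> J <= QQ S ^ N"
 using rep_state_inv(3)[of _ c q e S N es g N] unfolding repG_def rep_state_def by auto

lemma RT_worstG:
 assumes S: "PT E enc_unary S" and N: "PT E enc_unary N" and es: "PT E (enc_list enc_edge) es" and g: "PT E enc_guess g"
 shows "RT E enc_nat (%x. worstG c q e (S x) (N x) (es x) (g x))"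
proof -
 obtain pN where pN: "\<And>a. size (enc_unary (N a)) <= poly pN (ms E a)" by (rule PT_bound[OF N], rule that, auto)
 obtain pS where pS: "\<And>a. size (enc_unary (sQ (S a))) <= poly pS (ms E a)" by (rule PT_bound[OF PT_sQ[OF S]], rule that, auto)
 show ?thesis unfolding worstG_def
 proof (rule RT_foldM[OF PT_units[OF PT_power[OF S]] PT_const, where q = "2 * (pS * pN + 1)"])
  show "RT (env_pair (env_pair E enc_unit) enc_nat) enc_nat (%z. bind_pmf (repG c q e (S (fst (fst z))) (N (fst (fst z))) (es (fst (fst z))) (g (fst (fst z))))
   (%J. return_pmf (if snd z < J then J else snd z)))"
   by (rule RT_bind[OF RT_repG[OF S N es g, THEN RT_env, THEN RT_env], where g = "%z J. return_pmf (if snd z < J then J else snd z)"])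
    (intro PT_if PT_less_bin PT_id RT_env[OF PT_id])
  fix x i acc
  assume a: "acc \<in> set_pmf (foldM (%_ w. bind_pmf (repG c q e (S x) (N x) (es x) (g x)) (%J. return_pmf (if w < J then J else w)))
   (take i (replicate (S x ^ 3) ())) 0)"
  have "acc <= QQ (S x) ^ N x"
   by (rule foldM_inv[where P = "%_ w. w <= QQ (S x) ^ N x", OF _ _ a]) (use repG_le[of _ c q e "S x" "N x" "es x" "g x"] in \<open>auto split: if_splits\<close>)
  then have "size (enc_nat acc) <= 2 * (sQ (S x) * N x + 1)" by (rule size_enc_nat_QQ)
  also have "\<dots> <= 2 * (poly pS (ms E x) * poly pN (ms E x) + 1)" using pN[of x] pS[of x] by (intro mult_mono add_mono) auto
  finally show "size (enc_nat acc) <= poly (2 * (pS * pN + 1)) (ms E x)" by simp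
 qed
qed

lemma worstG_le: "J \<in> set_pmf (worstG c q e S N es g) ==> J <= QQ S ^ N"
 unfolding worstG_def
 by (erule foldM_inv[where P = "%_ w. w <= QQ S ^ N", rotated -1]) (use repG_le[of _ c q e S N es g] in \<open>auto split: if_splits\<close>)

lemma PT_guesses:
 assumes S: "PT E enc_unary S"
 shows "PT E (enc_list enc_guess) (%x. guesses q (S x))"
 unfolding guesses_def
proof (rule PT_concat_map[OF PT_const[where e' = "enc_list enc_bool"]], rule PT_concat_map[OF PT_upt[OF RT_env[OF S]]])
 show "PT (env_pair (env_pair E enc_bool) enc_unary) (enc_list enc_guess) (%z. map (%b. (snd (fst z), snd z, Suc b)) [0..<bmx q (S (fst (fst z)))])"
  by (rule PT_map[OF PT_upt[OF PT_bmx[OF S[THEN RT_env, THEN RT_env]]], where g = "%z b. (snd (fst z), snd z, Suc b)"])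
   (intro PT_pair PT_Suc PT_id RT_env[OF PT_id] RT_env[OF RT_env[OF PT_id]])
qed

lemma RT_bestG:
 assumes S: "PT E enc_unary S" and N: "PT E enc_unary N" and es: "PT E (enc_list enc_edge) es"
 shows "RT E enc_nat (%x. bestG c q e (S x) (N x) (es x))"
proof -
 obtain pN where pN: "\<And>a. size (enc_unary (N a)) <= poly pN (ms E a)" by (rule PT_bound[OF N], rule that, auto)
 obtain pS where pS: "\<And>a. size (enc_unary (sQ (S a))) <= poly pS (ms E a)" by (rule PT_bound[OF PT_sQ[OF S]], rule that, auto)
 show ?thesis unfolding bestG_def
 proof (rule RT_foldM[OF PT_guesses[OF S] PT_const, where q = "2 * (pS * pN + 1)"])
  have "RT (env_pair (env_pair E enc_guess) enc_nat) enc_nat (%z. worstG c q e (S (fst (fst z))) (N (fst (fst z))) (es (fst (fst z))) (snd (fst z)))"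
   by (rule RT_worstG[OF S[THEN RT_env, THEN RT_env] N[THEN RT_env, THEN RT_env] es[THEN RT_env, THEN RT_env] RT_env[OF PT_id]])
  then show "RT (env_pair (env_pair E enc_guess) enc_nat) enc_nat (%z. bind_pmf (worstG c q e (S (fst (fst z))) (N (fst (fst z))) (es (fst (fst z))) (snd (fst z)))
   (%J. return_pmf (if snd z = 0 \<or> J < snd z then J else snd z)))"
   by (rule RT_bind[where g = "%z J. return_pmf (if snd z = 0 \<or> J < snd z then J else snd z)"])
    (intro PT_if PT_disj PT_is_zero_bin PT_less_bin PT_id RT_env[OF PT_id])
  fix x i acc
  assume a: "acc \<in> set_pmf (foldM (%g bst. bind_pmf (worstG c q e (S x) (N x) (es x) g) (%J. return_pmf (if bst = 0 \<or> J < bst then J else bst)))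
   (take i (guesses q (S x))) 0)"
  have "acc <= QQ (S x) ^ N x"
   by (rule foldM_inv[where P = "%_ w. w <= QQ (S x) ^ N x", OF _ _ a]) (use worstG_le in \<open>auto split: if_splits\<close>)
  then have "size (enc_nat acc) <= 2 * (sQ (S x) * N x + 1)" by (rule size_enc_nat_QQ)
  also have "\<dots> <= 2 * (poly pS (ms E x) * poly pN (ms E x) + 1)" using pN[of x] pS[of x] by (intro mult_mono add_mono) auto
  finally show "size (enc_nat acc) <= poly (2 * (pS * pN + 1)) (ms E x)" by simp
 qed
qed

section \<open>Inputs, scale parameter and running time of the FPRAS\<close>

definition numR :: "rat => nat" where "numR \<rho> = nat \<bar>fst (quotient_of \<rho>)\<bar>"
definition denR :: "rat => nat" where "denR \<rho> = nat (snd (quotient_of \<rho>))"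
text \<open>A power of two within constant factors of max(1, 1/\<rho>), read off the digit lengths
  of numerator and denominator, which avoids a binary division.\<close>

definition UU :: "rat => nat" where "UU \<rho> = 2 ^ (length (bits (denR \<rho>)) - length (bits (numR \<rho>)))"

text \<open>The allowance \<open>UU\<close> pays for the running time in 1/\<rho>, for which the
  binary input is too short.\<close>

definition E0 :: "graph_desc \<times> rat => nat \<times> data" where
 "E0 x = (UU (snd x), Node (enc_graph (fst x)) (enc_rat (snd x)))"

text \<open>The one scale of the whole construction: at least the number of vertices, at least
  1/\<rho>, and beyond the constant \<open>cc\<close> from which on all asymptotic estimates
  hold.\<close>

definition SS :: "nat => graph_desc \<times> rat => nat" where "SS cc x = fst (fst x) + 2 * UU (snd x) + cc"

lemma enc_graph_pair: "enc_graph = enc_pair enc_unary (enc_list enc_edge)"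
proof -
 have "(%(u, v). Node (enc_nat u) (enc_nat v)) = enc_edge" by (auto simp: enc_pair_def)
 then show ?thesis by (intro ext) (simp add: enc_graph_def enc_pair_def)
qed

lemma enc_rat_code: "enc_rat \<rho> = Node (enc_bool (fst (quotient_of \<rho>) < 0)) (Node (enc_nat (numR \<rho>)) (enc_nat (denR \<rho>)))"
 by (simp add: enc_rat_def numR_def denR_def case_prod_beta)

lemma PT_inputs:
 "PT E0 enc_unary (%x. fst (fst x))" "PT E0 (enc_list enc_edge) (%x. snd (fst x))"
 "PT E0 enc_nat (%x. numR (snd x))" "PT E0 enc_nat (%x. denR (snd x))"
proof -
 show "PT E0 enc_unary (%x. fst (fst x))"
  by (rule PT_expr[where x = "LeftE (LeftE (Var 0))" and p = "[:0, 1:]"]) (auto simp: E0_def enc_graph_pair enc_pair_def ms_def)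
 show "PT E0 (enc_list enc_edge) (%x. snd (fst x))"
  by (rule PT_expr[where x = "RightE (LeftE (Var 0))" and p = "[:0, 1:]"]) (auto simp: E0_def enc_graph_pair enc_pair_def ms_def)
 show "PT E0 enc_nat (%x. numR (snd x))"
  by (rule PT_expr[where x = "LeftE (RightE (RightE (Var 0)))" and p = "[:0, 1:]"]) (auto simp: E0_def enc_rat_code ms_def)
 show "PT E0 enc_nat (%x. denR (snd x))"
  by (rule PT_expr[where x = "RightE (RightE (RightE (Var 0)))" and p = "[:0, 1:]"]) (auto simp: E0_def enc_rat_code ms_def)
qed

lemma PT_SS: "PT E0 enc_unary (SS cc)"
proof -
 have L: "PT E0 (enc_list enc_unit) (%x. replicate (length (bits (denR (snd x))) - length (bits (numR (snd x)))) ())"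
  by (intro PT_units PT_diff PT_length[OF PT_bits] PT_inputs)
 have "PT E0 enc_unary (%x. 2 ^ length (replicate (length (bits (denR (snd x))) - length (bits (numR (snd x)))) ()))"
  by (rule PT_power2[OF L, where p = "[:0, 1:]"]) (simp add: ms_def E0_def UU_def)
 then have "PT E0 enc_unary (%x. UU (snd x))" by (simp add: UU_def)
 then show ?thesis unfolding SS_def by (intro PT_add PT_mult PT_const PT_inputs)
qed

definition fprasG :: "com => nat => nat => nat => graph_desc \<times> rat => (nat \<times> nat) pmf" where
 "fprasG c q e cc x = bind_pmf (bestG c q e (SS cc x) (fst (fst x)) (snd (fst x)))
  (%J. return_pmf (QQ (SS cc x) ^ fst (fst x), J))"

lemma RT_fprasG: "RT E0 (enc_pair enc_nat enc_nat) (fprasG c q e cc)"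
 unfolding fprasG_def
 by (rule RT_bind[OF RT_bestG[OF PT_SS PT_inputs(1,2)], where g = "%x J. return_pmf (QQ (SS cc x) ^ fst (fst x), J)"])
  (intro PT_pair PT_power_bin PT_QQ RT_env[OF PT_SS] RT_env[OF PT_inputs(1)] PT_id)

lemma numR_denR:
 assumes "\<rho> > 0"
 shows "numR \<rho> > 0" "denR \<rho> > 0" "real_of_rat \<rho> = real (numR \<rho>) / real (denR \<rho>)"
proof -
 obtain a b where q: "quotient_of \<rho> = (a, b)" by (cases "quotient_of \<rho>")
 have b: "b > 0" using quotient_of_denom_pos[OF q] .
 have r: "\<rho> = of_int a / of_int b" by (rule quotient_of_div[OF q])
 have a: "a > 0" using assms b unfolding r by (simp add: zero_less_divide_iff)
 show "numR \<rho> > 0" "denR \<rho> > 0" using a b by (simp_all add: numR_def denR_def q)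
 show "real_of_rat \<rho> = real (numR \<rho>) / real (denR \<rho>)"
 proof -
  have "real_of_rat \<rho> = real_of_int a / real_of_int b" by (simp add: r of_rat_divide)
  moreover have "real (numR \<rho>) = real_of_int a" "real (denR \<rho>) = real_of_int b" using a b by (simp_all add: numR_def denR_def q)
  ultimately show ?thesis by simp
 qed
qed

lemma bits_bounds: "n > 0 ==> 2 ^ (length (bits n) - 1) <= n \<and> n < 2 ^ length (bits n)"
 using length_bits[of n "length (bits n)"] length_bits[of n "length (bits n) - 1"]
 by (cases "length (bits n)") (auto simp: length_bits[of n 0, simplified])

lemma UU_bounds:
 assumes "\<rho> > 0"
 shows "1 / real_of_rat \<rho> <= 2 * real (UU \<rho>)" "UU \<rho> <= 2 * nat \<lceil>1 / \<rho>\<rceil> + 1"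
proof -
 note nd = numR_denR[OF assms]
 define a b la lb where "a = numR \<rho>" and "b = denR \<rho>" and "la = length (bits a)" and "lb = length (bits b)"
 have a: "2 ^ (la - 1) <= a" "a < 2 ^ la" "a > 0" and b: "2 ^ (lb - 1) <= b" "b < 2 ^ lb" "b > 0"
  using bits_bounds[OF nd(1)] bits_bounds[OF nd(2)] nd by (auto simp: a_def b_def la_def lb_def)
 have U: "UU \<rho> = 2 ^ (lb - la)" by (simp add: UU_def a_def b_def la_def lb_def)
 have inv: "1 / real_of_rat \<rho> = real b / real a" using nd(3) by (simp add: a_def b_def)
 have la: "la >= 1" using a by (cases la) auto
 have "b <= 2 * 2 ^ (lb - la) * a"
 proof -
  have "b <= 2 ^ lb" using b by simp
  also have "\<dots> <= 2 ^ (1 + (lb - la) + (la - 1))" using la by (intro power_increasing) auto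
  also have "\<dots> = 2 * 2 ^ (lb - la) * 2 ^ (la - 1)" by (simp add: power_add)
  also have "\<dots> <= 2 * 2 ^ (lb - la) * a" using a by (intro mult_left_mono) auto
  finally show ?thesis .
 qed
 then have "real b <= real (2 * 2 ^ (lb - la) * a)" by (rule of_nat_mono)
 then show "1 / real_of_rat \<rho> <= 2 * real (UU \<rho>)" unfolding inv U using a(3) by (simp add: divide_le_eq)
 show "UU \<rho> <= 2 * nat \<lceil>1 / \<rho>\<rceil> + 1"
 proof (cases "lb <= la")
  case True
  then show ?thesis by (simp add: U)
 next
  case False
  have "2 ^ (lb - la) * a <= 2 ^ (lb - la) * 2 ^ la" using a by (intro mult_left_mono) auto
  also have "\<dots> = 2 * 2 ^ (lb - 1)" using False by (simp add: power_add[symmetric] power_Suc[symmetric] del: power_Suc)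
  also have "\<dots> <= 2 * b" using b by simp
  finally have "real (2 ^ (lb - la) * a) <= real (2 * b)" by (rule of_nat_mono)
  then have "real (UU \<rho>) <= 2 * (1 / real_of_rat \<rho>)" unfolding inv U using a(3) by (simp add: field_simps)
  also have "1 / real_of_rat \<rho> = real_of_rat (1 / \<rho>)" by (simp add: of_rat_divide)
  also have "real_of_rat (1 / \<rho>) <= real_of_int \<lceil>1 / \<rho>\<rceil>"
   by (metis le_of_int_ceiling of_rat_less_eq of_rat_of_int_eq)
  also have "\<dots> <= real (nat \<lceil>1 / \<rho>\<rceil>)" by simp
  finally show ?thesis by linarith
 qed
qed

lemma FPRAS_I:
 assumes "\<And>G \<rho>. G \<in> BIS_instances ==> \<rho> > 0 ==>
  measure_pmf.prob (fprasG c q e cc (G, \<rho>)) {(a, b). b > 0 \<and>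
    exp (- real_of_rat \<rho>) * real (num_indep_sets G) <= real a / real b \<and>
    real a / real b <= exp (real_of_rat \<rho>) * real (num_indep_sets G)} >= 3/4"
 shows BIS_admits_FPRAS
proof -
 obtain p0 B p where p: "comp_by p0 B (%a. poly p (ms E0 a)) (snd \<circ> E0) (enc_pair enc_nat enc_nat) (fprasG c q e cc)"
  using RT_fprasG[of c q e cc] unfolding RT_def by blast
 \<comment> \<open>By \<open>UU_bounds\<close> the allowance is at most twice the ceiling of
   1/\<rho> plus 1.\<close>
 define P where "P = pcompose p [:1, 2:]"
 show ?thesis unfolding BIS_admits_FPRAS_def admits_FPRAS_def Let_def
 proof (intro exI[of _ p0] exI[of _ P] ballI allI impI)
  fix G and \<rho> :: rat assume G: "G \<in> BIS_instances" and \<rho>: "\<rho> > 0"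
  let ?inp = "Node (enc_graph G) (enc_rat \<rho>)"
  let ?t = "poly P (size ?inp + nat \<lceil>1 / \<rho>\<rceil>)"
  let ?s = "(%_. Leaf)(0 := ?inp) :: store"
  have s0: "?s 0 = (snd \<circ> E0) (G, \<rho>)" by (simp add: E0_def)
  obtain \<mu> where \<mu>: "evals p0 ?s \<mu> (poly p (ms E0 (G, \<rho>)))" "map_pmf (%s. s 0) \<mu> = map_pmf (enc_pair enc_nat enc_nat) (fprasG c q e cc (G, \<rho>))"
   using comp_by_apply[OF p, where s = ?s, OF s0] by blast
  have "ms E0 (G, \<rho>) <= 1 + 2 * (size ?inp + nat \<lceil>1 / \<rho>\<rceil>)" using UU_bounds(2)[OF \<rho>] by (simp add: ms_def E0_def)
  then have "poly p (ms E0 (G, \<rho>)) <= ?t" unfolding P_def poly_pcompose by (intro poly_nat_mono) simp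
  from evals_mono[OF \<mu>(1) this] have ex: "exec (return_pmf Leaf) p0 ?inp ?t = map_pmf (Pair Skip) \<mu>"
   by (simp add: evals_def exec_eq_run)
  have out: "output_dist (return_pmf Leaf) p0 ?inp ?t = map_pmf (enc_pair enc_nat enc_nat) (fprasG c q e cc (G, \<rho>))"
   unfolding output_dist_def ex \<mu>(2)[symmetric] by (simp add: map_pmf_comp)
  have "halts_within (return_pmf Leaf) p0 ?inp ?t" unfolding halts_within_def ex by auto
  moreover have "measure_pmf.prob (output_dist (return_pmf Leaf) p0 ?inp ?t)
       {y. \<exists>a b. b > 0 \<and> y = Node (enc_nat a) (enc_nat b) \<and>
          exp (- real_of_rat \<rho>) * real (num_indep_sets G) <= real a / real b \<and>
          real a / real b <= exp (real_of_rat \<rho>) * real (num_indep_sets G)} >= 3/4"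
  proof -
   have "3/4 <= measure_pmf.prob (fprasG c q e cc (G, \<rho>)) {(a, b). b > 0 \<and>
    exp (- real_of_rat \<rho>) * real (num_indep_sets G) <= real a / real b \<and>
    real a / real b <= exp (real_of_rat \<rho>) * real (num_indep_sets G)}" by (rule assms[OF G \<rho>])
   also have "\<dots> <= measure_pmf.prob (fprasG c q e cc (G, \<rho>)) (enc_pair enc_nat enc_nat -`
      {y. \<exists>a b. b > 0 \<and> y = Node (enc_nat a) (enc_nat b) \<and>
          exp (- real_of_rat \<rho>) * real (num_indep_sets G) <= real a / real b \<and>
          real a / real b <= exp (real_of_rat \<rho>) * real (num_indep_sets G)})"
    by (intro measure_pmf.finite_measure_mono) (auto simp: enc_pair_def, blast)
   finally show ?thesis unfolding out by simp
  qed
  ultimately show "halts_within (return_pmf Leaf) p0 ?inp ?t \<and>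
   3/4 <= measure_pmf.prob (output_dist (return_pmf Leaf) p0 ?inp ?t)
       {y. \<exists>a b. b > 0 \<and> y = Node (enc_nat a) (enc_nat b) \<and>
          exp (- real_of_rat \<rho>) * real (num_indep_sets G) <= real a / real b \<and>
          real a / real b <= exp (real_of_rat \<rho>) * real (num_indep_sets G)}" by blast
 qed
qed

section \<open>Fake samples\<close>

abbreviation "Pr p \<equiv> measure (measure_pmf p)"

lemma prob_bind_le:
 assumes a: "Pr p {x. bad x} <= a" and b0: "0 <= b"
  and b: "\<And>x. x \<in> set_pmf p ==> \<not> bad x ==> Pr (f x) B <= b"
 shows "Pr (bind_pmf p f) B <= a + b"
proof -
 have a0: "0 <= a" using a measure_nonneg order_trans by blast
 have "emeasure (measure_pmf (bind_pmf p f)) B = (\<integral>\<^sup>+x. emeasure (measure_pmf (f x)) B \<partial>measure_pmf p)"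
  by (rule emeasure_bind_pmf)
 also have "\<dots> <= (\<integral>\<^sup>+x. indicator {x. bad x} x + ennreal b \<partial>measure_pmf p)"
 proof (rule nn_integral_mono_AE, rule AE_pmfI)
  fix x assume x: "x \<in> set_pmf p"
  show "emeasure (measure_pmf (f x)) B <= indicator {x. bad x} x + ennreal b"
  proof (cases "bad x")
   case True
   have "emeasure (measure_pmf (f x)) B <= 1" by (rule measure_pmf.emeasure_le_1)
   also have "\<dots> <= indicator {x. bad x} x + ennreal b" using True by simp
   finally show ?thesis .
  next
   case False
   then show ?thesis using b[OF x False] by (simp add: measure_pmf.emeasure_eq_measure ennreal_leI)
  qed
 qed
 also have "\<dots> = emeasure (measure_pmf p) {x. bad x} + ennreal b"
  by (subst nn_integral_add) auto
 also have "\<dots> = ennreal (Pr p {x. bad x} + b)"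
  using b0 by (simp add: measure_pmf.emeasure_eq_measure ennreal_plus)
 also have "\<dots> <= ennreal (a + b)" using a by (intro ennreal_leI) simp
 finally show ?thesis using a0 b0 by (simp add: measure_pmf.emeasure_eq_measure del: ennreal_plus)
qed

lemma prob_bind_le0:
 assumes "0 <= b" "\<And>x. x \<in> set_pmf p ==> Pr (f x) B <= b"
 shows "Pr (bind_pmf p f) B <= b"
 using prob_bind_le[of p "%_. False" 0 b f B] assms by simp

text \<open>For \<kappa> between 0 and 1, \<open>p\<close> is a mixture that contains
  \<open>q\<close> with weight \<kappa>. The relation multiplies along sequential composition and
  transfers small probabilities and supports from \<open>p\<close> to \<open>q\<close>.\<close>

definition dom :: "real => 'a pmf => 'a pmf => bool" where
 "dom \<kappa> q p \<longleftrightarrow> (\<forall>x. \<kappa> * pmf q x <= pmf p x)"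

lemma dom_refl:
 assumes "\<kappa> <= 1"
 shows "dom \<kappa> p p"
 unfolding dom_def
proof
 fix x
 from assms have "\<kappa> * pmf p x <= 1 * pmf p x" by (rule mult_right_mono) simp
 then show "\<kappa> * pmf p x <= pmf p x" by simp
qed

lemma dom_bind:
 assumes d1: "dom \<kappa>1 q p" and d2: "\<And>x. dom \<kappa>2 (f x) (g x)" and nn: "0 <= \<kappa>1" "0 <= \<kappa>2"
 shows "dom (\<kappa>1 * \<kappa>2) (bind_pmf q f) (bind_pmf p g)"
 unfolding dom_def
proof
 fix y
 have "ennreal (\<kappa>1 * \<kappa>2 * pmf (bind_pmf q f) y) = ennreal (\<kappa>1 * \<kappa>2) * (\<integral>\<^sup>+x. ennreal (pmf q x) * ennreal (pmf (f x) y) \<partial>count_space UNIV)"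
  using nn by (simp add: ennreal_mult ennreal_pmf_bind nn_integral_measure_pmf)
 also have "\<dots> = (\<integral>\<^sup>+x. ennreal (\<kappa>1 * \<kappa>2) * (ennreal (pmf q x) * ennreal (pmf (f x) y)) \<partial>count_space UNIV)"
  by (rule nn_integral_cmult[symmetric]) simp
 also have "\<dots> <= (\<integral>\<^sup>+x. ennreal (pmf p x) * ennreal (pmf (g x) y) \<partial>count_space UNIV)"
 proof (rule nn_integral_mono)
  fix x
  have "(\<kappa>1 * pmf q x) * (\<kappa>2 * pmf (f x) y) <= pmf p x * pmf (g x) y"
   using d1 d2[of x] nn unfolding dom_def by (intro mult_mono) auto
  then have "ennreal (\<kappa>1 * \<kappa>2 * (pmf q x * pmf (f x) y)) <= ennreal (pmf p x * pmf (g x) y)"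
   by (intro ennreal_leI) (simp add: mult_ac)
  then show "ennreal (\<kappa>1 * \<kappa>2) * (ennreal (pmf q x) * ennreal (pmf (f x) y)) <= ennreal (pmf p x) * ennreal (pmf (g x) y)"
   using nn by (simp add: ennreal_mult)
 qed
 also have "\<dots> = ennreal (pmf (bind_pmf p g) y)" by (simp add: ennreal_pmf_bind nn_integral_measure_pmf)
 finally show "\<kappa>1 * \<kappa>2 * pmf (bind_pmf q f) y <= pmf (bind_pmf p g) y" by simp
qed

lemma dom_map: "dom \<kappa> q p ==> 0 <= \<kappa> ==> dom \<kappa> (map_pmf f q) (map_pmf f p)"
 unfolding map_pmf_def using dom_bind[of \<kappa> q p 1 "%x. return_pmf (f x)" "%x. return_pmf (f x)"] dom_refl[of 1 "return_pmf (f _)"] by simp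

text \<open>A step draws at most one sample, so it loses at most one factor \<kappa>.\<close>

lemma dom_step: "dom \<kappa> D' D ==> 0 <= \<kappa> ==> \<kappa> <= 1 ==> dom \<kappa> (step D' c s) (step D c s)"
 by (induction c) (auto intro: dom_refl dom_map)

lemma dom_exec: "dom \<kappa> D' D ==> 0 <= \<kappa> ==> \<kappa> <= 1 ==> dom (\<kappa> ^ t) (exec D' c inp t) (exec D c inp t)"
proof (induction t)
 case (Suc t)
 have "dom (\<kappa> ^ t * \<kappa>) (exec D' c inp (Suc t)) (exec D c inp (Suc t))"
  unfolding exec.simps by (rule dom_bind) (use Suc dom_step in auto)
 then show ?case by (simp add: mult.commute)
qed (simp add: dom_refl)

lemma dom_prob:
 assumes "dom \<kappa> q p" "0 <= \<kappa>"
 shows "\<kappa> * Pr q B <= Pr p B"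
proof -
 have e: "pmf (map_pmf (%x. x \<in> B) r) True = Pr r B" for r :: "'a pmf"
  unfolding pmf_map by (rule arg_cong[where f = "Pr r"]) auto
 show ?thesis using dom_map[OF assms, of "%x. x \<in> B"] unfolding dom_def by (metis e)
qed

lemma dom_set: "dom \<kappa> q p ==> 0 < \<kappa> ==> set_pmf q \<subseteq> set_pmf p"
proof
 fix x assume "dom \<kappa> q p" "0 < \<kappa>" "x \<in> set_pmf q"
 then have "0 < \<kappa> * pmf q x" by (simp add: pmf_positive)
 also have "\<dots> <= pmf p x" using \<open>dom \<kappa> q p\<close> by (simp add: dom_def)
 finally show "x \<in> set_pmf p" by (simp add: set_pmf_iff)
qed

lemma exec_mono_halts:
 assumes h: "halts_within D c inp t" and "t <= T"
 shows "exec D c inp T = exec D c inp t"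
proof -
 have "exec D c inp T = bind_pmf (exec D c inp t) (%cs. run D cs (T - t))"
  using run_add[of D "(c, (%_. Leaf)(0 := inp))" t "T - t"] assms(2) by (simp add: exec_eq_run)
 also have "\<dots> = bind_pmf (exec D c inp t) return_pmf"
 proof (rule bind_pmf_cong[OF refl])
  fix cs assume "cs \<in> set_pmf (exec D c inp t)"
  then have "fst cs = Skip" using h unfolding halts_within_def by (auto simp: case_prod_beta)
  then show "run D cs (T - t) = return_pmf cs" by (cases cs) simp
 qed
 finally show ?thesis by (simp add: bind_return_pmf')
qed

text \<open>The tester errs with probability at most 1/4 on true samples, hence at most (1/4) /
  (4/5) = 5/16 on fake ones. Supports shrink under domination, so it also halts in time on the
  fakes, and the longer clock \<open>T\<close> gives the same output.\<close>

lemma tester_bound: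
 assumes d: "dom \<kappa> D' D" and \<kappa>: "0 < \<kappa>" "\<kappa> <= 1" "\<kappa> ^ t >= 4/5" and h: "halts_within D c inp t" and tT: "t <= T"
  and p: "Pr (output_dist D c inp t) {enc_bool v} >= 3/4"
 shows "Pr (map_pmf (%cs. snd cs 0 = enc_bool True) (exec D' c inp T)) {b. b ~= v} <= 5/16"
proof -
 have de: "dom (\<kappa> ^ t) (exec D' c inp t) (exec D c inp t)" by (rule dom_exec[OF d]) (use \<kappa> in auto)
 have "set_pmf (exec D' c inp t) \<subseteq> set_pmf (exec D c inp t)" by (rule dom_set[OF de]) (use \<kappa> in simp)
 then have h': "halts_within D' c inp t" using h unfolding halts_within_def by blast
 let ?B = "{cs. snd cs 0 ~= enc_bool v}"
 have "Pr (exec D c inp t) {cs. snd cs 0 = enc_bool v} = Pr (output_dist D c inp t) {enc_bool v}"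
  unfolding output_dist_def by (simp add: vimage_def case_prod_beta)
 moreover have "Pr (exec D c inp t) ?B = 1 - Pr (exec D c inp t) {cs. snd cs 0 = enc_bool v}"
 proof -
  have e: "?B = space (measure_pmf (exec D c inp t)) - {cs. snd cs 0 = enc_bool v}" by auto
  show ?thesis unfolding e by (rule measure_pmf.prob_compl) simp
 qed
 ultimately have "Pr (exec D c inp t) ?B <= 1/4" using p by simp
 moreover have "\<kappa> ^ t * Pr (exec D' c inp t) ?B <= Pr (exec D c inp t) ?B"
  by (rule dom_prob[OF de]) (use \<kappa> in simp)
 moreover have "4/5 * Pr (exec D' c inp t) ?B <= \<kappa> ^ t * Pr (exec D' c inp t) ?B"
  using \<kappa> by (intro mult_right_mono) auto
 ultimately have B: "Pr (exec D' c inp t) ?B <= 5/16" by linarith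
 have "Pr (map_pmf (%cs. snd cs 0 = enc_bool True) (exec D' c inp T)) {b. b ~= v} =
  Pr (exec D' c inp t) {cs. (snd cs 0 = enc_bool True) ~= v}"
  unfolding exec_mono_halts[OF h' tT] by (simp add: vimage_def)
 also have "\<dots> <= Pr (exec D' c inp t) ?B"
  by (intro measure_pmf.finite_measure_mono) (cases v; auto)+
 finally show ?thesis using B by simp
qed

section \<open>The fakes against the Gibbs measure\<close>

lemma pmf_bind_flip: "pmf (bind_pmf (bernoulli_pmf (1/2)) f) x = (pmf (f True) x + pmf (f False) x) / 2"
 unfolding pmf_bind by simp

abbreviation rsub_step :: "'a => 'a list => 'a list pmf" where
 "rsub_step v l \<equiv> bind_pmf (bernoulli_pmf (1/2)) (%b. return_pmf (if b then v # l else l))"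

lemma rsub_support: "l \<in> set_pmf (foldM rsub_step ys a) ==> set a \<subseteq> set l \<and> set l \<subseteq> set a \<union> set ys"
proof (induction ys arbitrary: a)
 case (Cons y ys)
 then obtain b where "l \<in> set_pmf (foldM rsub_step ys (if b then y # a else a))" by auto
 from Cons.IH[OF this] show ?case by (auto split: if_splits)
qed simp

text \<open>An element of \<open>I\<close> leaves at most one of the two coin outcomes compatible
  with \<open>Z\<close> and so halves the bound; an element outside \<open>I\<close> averages two
  equal bounds.\<close>

lemma rsub_law_aux:
 assumes "distinct ys" "set ys \<inter> set a = {}"
 shows "pmf (map_pmf (%l. set l \<inter> I) (foldM rsub_step ys a)) Z <= (1/2) ^ card (set ys \<inter> I)"
 using assms
proof (induction ys arbitrary: a)
 case Nil
 then show ?case by (simp add: pmf_le_1)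
next
 case (Cons y ys)
 let ?T = "pmf (map_pmf (%l. set l \<inter> I) (foldM rsub_step ys (y # a))) Z"
 let ?F = "pmf (map_pmf (%l. set l \<inter> I) (foldM rsub_step ys a)) Z"
 have y: "y \<notin> set ys" "y \<notin> set a" "distinct ys" using Cons.prems by auto
 have T: "?T <= (1/2) ^ card (set ys \<inter> I)" using Cons.IH[of "y # a"] Cons.prems y by simp
 have F: "?F <= (1/2) ^ card (set ys \<inter> I)" using Cons.IH[of a] Cons.prems y by simp
 have e: "pmf (map_pmf (%l. set l \<inter> I) (foldM rsub_step (y # ys) a)) Z = (?T + ?F) / 2"
  by (simp add: map_bind_pmf bind_assoc_pmf bind_return_pmf pmf_bind_flip)
 show ?case
 proof (cases "y \<in> I")
  case True
  have c: "card (set (y # ys) \<inter> I) = Suc (card (set ys \<inter> I))" using True y by simp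
  have "?T = 0 \<or> ?F = 0"
  proof (cases "y \<in> Z")
   case yZ: True
   have "Z \<notin> set_pmf (map_pmf (%l. set l \<inter> I) (foldM rsub_step ys a))"
   proof
    assume "Z \<in> set_pmf (map_pmf (%l. set l \<inter> I) (foldM rsub_step ys a))"
    then obtain l where l: "l \<in> set_pmf (foldM rsub_step ys a)" "Z = set l \<inter> I" by auto
    show False using rsub_support[OF l(1)] l(2) yZ y by auto
   qed
   then show ?thesis unfolding set_pmf_iff by blast
  next
   case yZ: False
   have "Z \<notin> set_pmf (map_pmf (%l. set l \<inter> I) (foldM rsub_step ys (y # a)))"
   proof
    assume "Z \<in> set_pmf (map_pmf (%l. set l \<inter> I) (foldM rsub_step ys (y # a)))"
    then obtain l where l: "l \<in> set_pmf (foldM rsub_step ys (y # a))" "Z = set l \<inter> I" by auto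
    show False using rsub_support[OF l(1)] l(2) yZ True by auto
   qed
   then show ?thesis unfolding set_pmf_iff by blast
  qed
  then have "(?T + ?F) / 2 <= (1/2) ^ card (set ys \<inter> I) / 2" using T F by auto
  then show ?thesis unfolding e c by simp
 next
  case False
  then have c: "set (y # ys) \<inter> I = set ys \<inter> I" by auto
  have "(t + f) / 2 <= c" if "t <= c" "f <= c" for t f c :: real using that by simp
  from this[OF T F] show ?thesis unfolding e c .
 qed
qed

lemma rsub_law: "Pr (rsub k) {l. set l \<inter> I = Z} <= (1/2) ^ card ({..<k} \<inter> I)"
proof -
 have "Pr (rsub k) {l. set l \<inter> I = Z} = pmf (map_pmf (%l. set l \<inter> I) (rsub k)) Z"
  unfolding pmf_map by (simp add: vimage_def)
 also have "\<dots> <= (1/2) ^ card (set [0..<k] \<inter> I)" unfolding rsub_def by (rule rsub_law_aux) auto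
 finally show ?thesis by (simp add: atLeast0LessThan)
qed

context wire_model
begin

definition gen_cfg :: "nat list => nat list => nat => nat" where
 "gen_cfg Y Z t = (if t mod bm < b then (if wr t < A then 1 else if \<exists>y\<in>set Y. y = wr t - A then 1 else 2)
       else if \<exists>y\<in>set Z. y = t then 1 else 2)"

lemma gen_eq: "gen A C r bm b = bind_pmf (rsub C) (%Y. bind_pmf (rsub n) (%Z. return_pmf (map (gen_cfg Y Z) [0..<n])))"
 unfolding gen_def gen_cfg_def ..

lemma gen_cfg_goodL: "restrict (gen_cfg Y Z) {..<n} \<in> goodL"
proof -
 let ?\<sigma> = "restrict (gen_cfg Y Z) {..<n}"
 have v: "?\<sigma> (vid i j a) = (if i < A then 1 else if \<exists>y\<in>set Y. y = i - A then 1 else 2)" if "i < A + C" "j < L" "a < b" for i j a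
 proof -
  have "a < bm" using that bbm by simp
  then show ?thesis using vid_props[OF that(1,2), of a] that(3) by (simp add: gen_cfg_def)
 qed
 have "?\<sigma> \<in> {..<n} \<rightarrow>\<^sub>E {1..2}" by (rule restrict_PiE_iff[THEN iffD2]) (auto simp: gen_cfg_def)
 moreover have "coh ?\<sigma> u 1" if "u < A" for u unfolding coh_def using v[of u] that by simp
 moreover have "\<exists>w. coh ?\<sigma> i w" if "i < A + C" for i unfolding coh_def using v[of i] that by blast
 ultimately show ?thesis unfolding goodL_def by blast
qed

lemma card_iso: "card iso = 2 ^ card {t. t < n \<and> \<not> t mod bm < b}"
 unfolding iso_def by (simp add: card_PiE)

text \<open>The list \<open>l\<close> determines which of the \<open>C\<close> right objects and
  which isolated vertices were selected, and each of these bits is a fair coin.\<close>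

lemma pmf_gen: "pmf (gen A C r bm b) l <= 1 / (2 ^ C * card iso)"
proof -
 define I where "I = {t. t < n \<and> \<not> t mod bm < b}"
 define Y0 where "Y0 = {y. y < C \<and> l ! vid (A + y) 0 0 = 1}"
 define Z0 where "Z0 = {t \<in> I. l ! t = 1}"
 have Ysub: "set Y \<inter> {..<C} = Y0" if "map (gen_cfg Y Z) [0..<n] = l" for Y Z
 proof -
  have "l ! vid (A + y) 0 0 = (if y \<in> set Y then 1 else 2)" if y: "y < C" for y
  proof -
   have i: "A + y < A + C" using y by simp
   note v = vid_props[OF i L0 bm0]
   have "l ! vid (A + y) 0 0 = gen_cfg Y Z (vid (A + y) 0 0)" using \<open>map _ _ = l\<close> v(1) by (metis add.left_neutral nth_map_upt diff_zero)
   then show ?thesis using v b0 by (simp add: gen_cfg_def)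
  qed
  then show ?thesis unfolding Y0_def by (auto split: if_splits)
 qed
 have Zsub: "set Z \<inter> I = Z0" if "map (gen_cfg Y Z) [0..<n] = l" for Y Z
 proof -
  have "l ! t = (if t \<in> set Z then 1 else 2)" if t: "t \<in> I" for t
  proof -
   have "t < n" using t by (simp add: I_def)
   then have "l ! t = gen_cfg Y Z t" using \<open>map _ _ = l\<close> by (metis add.left_neutral nth_map_upt diff_zero)
   then show ?thesis using t by (simp add: gen_cfg_def I_def)
  qed
  then show ?thesis unfolding Z0_def by (auto split: if_splits)
 qed
 let ?c = "(1/2::real) ^ card I"
 have Zp: "Pr (bind_pmf (rsub n) (%Z. return_pmf (map (gen_cfg Y Z) [0..<n]))) {l} <= ?c" for Y
 proof -
  have "Pr (bind_pmf (rsub n) (%Z. return_pmf (map (gen_cfg Y Z) [0..<n]))) {l} =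
   Pr (rsub n) {Z. map (gen_cfg Y Z) [0..<n] = l}"
   unfolding map_pmf_def[symmetric] by (simp add: vimage_def)
  also have "\<dots> <= Pr (rsub n) {Z. set Z \<inter> I = Z0}"
   using Zsub by (intro measure_pmf.finite_measure_mono) auto
  also have "\<dots> <= (1/2) ^ card ({..<n} \<inter> I)" by (rule rsub_law)
  also have "{..<n} \<inter> I = I" by (auto simp: I_def)
  finally show ?thesis .
 qed
 have Z00: "Pr (bind_pmf (rsub n) (%Z. return_pmf (map (gen_cfg Y Z) [0..<n]))) {l} = 0" if "set Y \<inter> {..<C} ~= Y0" for Y
 proof -
  have "Pr (bind_pmf (rsub n) (%Z. return_pmf (map (gen_cfg Y Z) [0..<n]))) {l} =
   Pr (rsub n) {Z. map (gen_cfg Y Z) [0..<n] = l}"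
   unfolding map_pmf_def[symmetric] by (simp add: vimage_def)
  also have "{Z. map (gen_cfg Y Z) [0..<n] = l} = {}" using Ysub that by blast
  finally show ?thesis by simp
 qed
 have "ennreal (pmf (gen A C r bm b) l) = emeasure (measure_pmf (gen A C r bm b)) {l}" by (simp add: emeasure_pmf_single)
 also have "\<dots> = (\<integral>\<^sup>+Y. emeasure (measure_pmf (bind_pmf (rsub n) (%Z. return_pmf (map (gen_cfg Y Z) [0..<n])))) {l} \<partial>measure_pmf (rsub C))"
  unfolding gen_eq by (rule emeasure_bind_pmf)
 also have "\<dots> <= (\<integral>\<^sup>+Y. ennreal ?c * indicator {Y. set Y \<inter> {..<C} = Y0} Y \<partial>measure_pmf (rsub C))"
 proof (rule nn_integral_mono)
  fix Y
  show "emeasure (measure_pmf (bind_pmf (rsub n) (%Z. return_pmf (map (gen_cfg Y Z) [0..<n])))) {l} <= ennreal ?c * indicator {Y. set Y \<inter> {..<C} = Y0} Y"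
  proof (cases "set Y \<inter> {..<C} = Y0")
   case True
   have "emeasure (measure_pmf (bind_pmf (rsub n) (%Z. return_pmf (map (gen_cfg Y Z) [0..<n])))) {l} <= ennreal ?c"
    unfolding measure_pmf.emeasure_eq_measure by (rule ennreal_leI[OF Zp])
   then show ?thesis using True by simp
  next
   case False
   then show ?thesis unfolding measure_pmf.emeasure_eq_measure Z00[OF False] by simp
  qed
 qed
 also have "\<dots> = ennreal ?c * emeasure (measure_pmf (rsub C)) {Y. set Y \<inter> {..<C} = Y0}"
  by (rule nn_integral_cmult_indicator) simp
 also have "\<dots> = ennreal (?c * Pr (rsub C) {Y. set Y \<inter> {..<C} = Y0})"
  by (simp add: measure_pmf.emeasure_eq_measure ennreal_mult)
 also have "\<dots> <= ennreal (?c * (1/2) ^ C)"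
  using rsub_law[of C "{..<C}" Y0] by (intro ennreal_leI mult_left_mono) auto
 finally have "pmf (gen A C r bm b) l <= ?c * (1/2) ^ C" by simp
 then show ?thesis unfolding card_iso I_def[symmetric] by (simp add: power_one_over field_simps)
qed

text \<open>The fakes put mass at most \<open>1 / (2 ^ C * card iso)\<close> on each configuration
  of \<open>goodL\<close>, and on \<open>good\<close> the Gibbs measure is constant. The factor is
  the lower bound for the Gibbs mass of \<open>goodL\<close>.\<close>

lemma dom_gen:
 shows "dom (2 ^ C / (card (rel_pairs A C Rel) * (1 + delta) ^ (A + C)))
  (map_pmf (enc_list enc_nat) (gen A C r bm b)) (map_pmf (enc_config n) (ising_gibbs M))"
proof -
 define \<kappa> where "\<kappa> = 2 ^ C / (card (rel_pairs A C Rel) * (1 + delta) ^ (A + C))"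
 have \<kappa>0: "\<kappa> >= 0" unfolding \<kappa>_def using delta_power_pos by simp
 let ?f = "%\<sigma>. map \<sigma> [0..<n]"
 have "dom \<kappa> (gen A C r bm b) (map_pmf ?f (ising_gibbs M))"
  unfolding dom_def
 proof
  fix l
  show "\<kappa> * pmf (gen A C r bm b) l <= pmf (map_pmf ?f (ising_gibbs M)) l"
  proof (cases "l \<in> set_pmf (gen A C r bm b)")
   case False
   then have "pmf (gen A C r bm b) l = 0" unfolding set_pmf_iff by blast
   then show ?thesis by simp
  next
   case True
   then obtain Y Z where l: "l = map (gen_cfg Y Z) [0..<n]" unfolding gen_eq by auto
   let ?\<sigma> = "restrict (gen_cfg Y Z) {..<n}"
   have ls: "l = ?f ?\<sigma>" unfolding l by simp
   have "\<kappa> * pmf (gen A C r bm b) l <= \<kappa> * (1 / (2 ^ C * card iso))" by (rule mult_left_mono[OF pmf_gen \<kappa>0])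
   also have "\<dots> = 1 / (card (rel_pairs A C Rel) * card iso * (1 + delta) ^ (A + C))" by (simp add: \<kappa>_def)
   also have "\<dots> <= pmf (ising_gibbs M) ?\<sigma>" by (rule pmf_goodL[OF gen_cfg_goodL])
   also have "\<dots> = Pr (ising_gibbs M) {?\<sigma>}" by (simp add: measure_pmf_single)
   also have "\<dots> <= Pr (ising_gibbs M) (?f -` {l})"
    by (intro measure_pmf.finite_measure_mono) (auto simp: ls)
   also have "\<dots> = pmf (map_pmf ?f (ising_gibbs M)) l" by (simp add: pmf_map)
   finally show ?thesis .
  qed
 qed
 from dom_map[OF this \<kappa>0, of "enc_list enc_nat"] show ?thesis
  unfolding \<kappa>_def[symmetric] by (simp add: map_pmf_comp enc_config_def[abs_def] enc_list_def foldr_map comp_def)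
qed

end

section \<open>Counting\<close>

definition indG :: "(nat \<times> nat) list => nat set => nat set set" where
 "indG es H = {I. I \<subseteq> H \<and> (\<forall>u\<in>I. \<forall>v\<in>I. \<not> adjG es u v)}"

definition ZH :: "(nat \<times> nat) list => nat list => nat" where
 "ZH es H = card (indG es (set H))"

definition bipG :: "(nat \<times> nat) list => bool" where
 "bipG es \<longleftrightarrow> (\<exists>P. \<forall>u v. adjG es u v --> (u \<in> P) ~= (v \<in> P))"

lemma adjG_sym: "adjG es u v = adjG es v u" by (auto simp: adjG_def)

lemma bipG_irrefl: "bipG es ==> \<not> adjG es u u" by (auto simp: bipG_def)

lemma finite_indG: "finite H ==> finite (indG es H)"
 by (rule finite_subset[of _ "Pow H"]) (auto simp: indG_def)

lemma ZH_pos: "ZH es H > 0"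
proof -
 have "{} \<in> indG es (set H)" by (simp add: indG_def)
 then show ?thesis unfolding ZH_def using finite_indG[of "set H" es] by (auto simp: card_gt_0_iff)
qed

lemma ZH_Nil: "ZH es [] = 1"
proof -
 have "indG es {} = {{}}" by (auto simp: indG_def)
 then show ?thesis by (simp add: ZH_def)
qed

text \<open>Split by whether \<open>v\<close> is chosen; a chosen \<open>v\<close> excludes its
  neighbours, and bipartiteness excludes loops.\<close>

lemma ZH_Cons:
 assumes b: "bipG es" and v: "v \<notin> set H"
 shows "ZH es (v # H) = ZH es (nbrs_out es v H) + ZH es H"
proof -
 let ?N = "set (nbrs_out es v H)"
 have N: "?N = {u \<in> set H. \<not> adjG es v u}" by (auto simp: nbrs_out_def)
 have "indG es (set (v # H)) = insert v ` indG es ?N \<union> indG es (set H)"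
 proof (intro equalityI subsetI)
  fix I assume I: "I \<in> indG es (set (v # H))"
  show "I \<in> insert v ` indG es ?N \<union> indG es (set H)"
  proof (cases "v \<in> I")
   case True
   then have "I - {v} \<in> indG es ?N" "I = insert v (I - {v})" using I by (auto simp: indG_def N)
   then show ?thesis by blast
  next
   case False
   then show ?thesis using I by (auto simp: indG_def)
  qed
 next
  fix I assume "I \<in> insert v ` indG es ?N \<union> indG es (set H)"
  then show "I \<in> indG es (set (v # H))"
  proof
   assume "I \<in> insert v ` indG es ?N"
   then obtain I' where I': "I = insert v I'" "I' \<subseteq> ?N" "\<And>x y. x \<in> I' ==> y \<in> I' ==> \<not> adjG es x y"
    by (auto simp: indG_def)
   have "\<not> adjG es v x" "\<not> adjG es x v" if "x \<in> I'" for x using that I'(2) N adjG_sym[of es x v] by auto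
   then have "\<not> adjG es x y" if "x \<in> I" "y \<in> I" for x y
    using that I'(1,3) bipG_irrefl[OF b, of v] by blast
   moreover have "I \<subseteq> set (v # H)" using I'(1,2) N by auto
   ultimately show ?thesis unfolding indG_def by blast
  next
   assume "I \<in> indG es (set H)"
   then show ?thesis unfolding indG_def by auto
  qed
 qed
 moreover have "insert v ` indG es ?N \<inter> indG es (set H) = {}" using v by (auto simp: indG_def)
 moreover have "inj_on (insert v) (indG es ?N)"
 proof (rule inj_onI)
  fix I I' assume "I \<in> indG es ?N" "I' \<in> indG es ?N" and e: "insert v I = insert v I'"
  then have "v \<notin> I" "v \<notin> I'" using v by (auto simp: indG_def N)
  then show "I = I'" using e by (metis insert_ident)
 qed
 ultimately show ?thesis unfolding ZH_def by (simp add: card_Un_disjoint finite_indG card_image)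
qed

lemma ZH_mono: "set H' \<subseteq> set H ==> ZH es H' <= ZH es H"
 unfolding ZH_def by (intro card_mono finite_indG) (auto simp: indG_def)

lemma BIS_instance:
 assumes "G \<in> BIS_instances"
 shows "bipG (snd G)" "ZH (snd G) [0..<fst G] = num_indep_sets G"
proof -
 obtain P Q where P: "P \<union> Q = {..<fst G}" "P \<inter> Q = {}" "\<forall>e\<in>desc_edges G. \<exists>a\<in>P. \<exists>b\<in>Q. e = {a, b}"
  using assms unfolding BIS_instances_def bipartite_def by blast
 have ad: "adjG (snd G) u v \<longleftrightarrow> {u, v} \<in> desc_edges G" for u v
 proof -
  have e: "(fst p = u \<and> snd p = v \<or> fst p = v \<and> snd p = u) \<longleftrightarrow> {u, v} = {fst p, snd p}" for p :: "nat \<times> nat"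
   unfolding doubleton_eq_iff by metis
  show ?thesis unfolding adjG_def desc_edges_def e image_iff case_prod_beta ..
 qed
 have "(u \<in> P) ~= (v \<in> P)" if uv: "adjG (snd G) u v" for u v
 proof -
  obtain a b where ab: "a \<in> P" "b \<in> Q" "{u, v} = {a, b}" using bspec[OF P(3), of "{u, v}"] uv[unfolded ad] by metis
  have "b \<notin> P" using P(2) ab(2) by blast
  moreover have "u = a \<and> v = b \<or> u = b \<and> v = a" using ab(3) unfolding doubleton_eq_iff .
  ultimately show ?thesis using ab(1) by metis
 qed
 then show "bipG (snd G)" unfolding bipG_def by blast
 have "indG (snd G) {..<fst G} = {I. I \<subseteq> {..<fst G} \<and> indep I (desc_edges G)}"
  unfolding indG_def
 proof (rule Collect_cong, rule conj_cong[OF refl])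
  fix I
  show "(\<forall>u\<in>I. \<forall>v\<in>I. \<not> adjG (snd G) u v) = indep I (desc_edges G)"
  proof
   assume a: "\<forall>u\<in>I. \<forall>v\<in>I. \<not> adjG (snd G) u v"
   show "indep I (desc_edges G)" unfolding indep_def using a unfolding ad by simp
  next
   assume a: "indep I (desc_edges G)"
   have "\<not> {u, v} \<in> desc_edges G" if "u \<in> I" "v \<in> I" for u v
   proof
    assume e: "{u, v} \<in> desc_edges G"
    then have "u ~= v" using bipG_irrefl[OF \<open>bipG (snd G)\<close>, of u] unfolding ad by auto
    then show False using a e that unfolding indep_def by blast
   qed
   then show "\<forall>u\<in>I. \<forall>v\<in>I. \<not> adjG (snd G) u v" unfolding ad by blast
  qed
 qed
 then show "ZH (snd G) [0..<fst G] = num_indep_sets G"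
  by (simp add: ZH_def num_indep_sets_def atLeast0LessThan)
qed

text \<open>The independent sets of the bipartite double cover, which has two copies of every index
  and joins \<open>x\<close> on the left to \<open>y\<close> on the right whenever
  \<open>R x y\<close>.\<close>

definition cross :: "nat => (nat => nat => bool) => (nat set \<times> nat set) set" where
 "cross n R = {(X, Y). X \<subseteq> {..<n} \<and> Y \<subseteq> {..<n} \<and> (\<forall>x\<in>X. \<forall>y\<in>Y. \<not> R x y)}"

lemma finite_cross: "finite (cross n R)"
 by (rule finite_subset[of _ "Pow {..<n} \<times> Pow {..<n}"]) (auto simp: cross_def)

definition relH :: "(nat \<times> nat) list => nat set => nat => nat => bool" where
 "relH es H x y \<longleftrightarrow> x \<in> H \<and> y \<in> H \<and> adjG es x y"

text \<open>The bipartite double cover of a bipartite graph consists of two disjoint copies of it.\<close>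

lemma card_cross_relH:
 assumes b: "bipG es" and H: "set H \<subseteq> {..<S}" "distinct H"
 shows "card (cross S (relH es (set H))) = (2 ^ (S - length H) * ZH es H) ^ 2"
proof -
 obtain P where P: "\<And>u v. adjG es u v ==> (u \<in> P) ~= (v \<in> P)" using b unfolding bipG_def by blast
 define D where "D = {I. I \<subseteq> {..<S} \<and> (\<forall>u\<in>I. \<forall>v\<in>I. \<not> relH es (set H) u v)}"
 \<comment> \<open>Exchange the two sides outside \<open>P\<close>. Since every edge has exactly one
   end in \<open>P\<close>, the two components then obey separate constraints.\<close>
 define f where "f z = (case z of (X, Y) => ((X \<inter> P) \<union> (Y - P), (X - P) \<union> (Y \<inter> P)))" for z :: "nat set \<times> nat set"
 have ff: "f (f z) = z" for z by (cases z) (auto simp: f_def)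
 have R: "relH es (set H) u v ==> (u \<in> P) ~= (v \<in> P)" for u v using P by (auto simp: relH_def)
 have sy: "relH es (set H) u v = relH es (set H) v u" for u v using adjG_sym[of es u v] by (auto simp: relH_def)
 have "bij_betw f (cross S (relH es (set H))) (D \<times> D)"
 proof (rule bij_betw_byWitness[where f' = f])
  show "f ` cross S (relH es (set H)) \<subseteq> D \<times> D"
  proof
   fix w assume "w \<in> f ` cross S (relH es (set H))"
   then obtain X Y where xy: "X \<subseteq> {..<S}" "Y \<subseteq> {..<S}" "\<And>x y. x \<in> X ==> y \<in> Y ==> \<not> relH es (set H) x y" "w = f (X, Y)"
    by (auto simp: cross_def)
   have 1: "\<not> relH es (set H) u v" if "u \<in> (X \<inter> P) \<union> (Y - P)" "v \<in> (X \<inter> P) \<union> (Y - P)" for u v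
    using that xy(3)[of u v] xy(3)[of v u] R[of u v] sy[of u v] by blast
   have 2: "\<not> relH es (set H) u v" if "u \<in> (X - P) \<union> (Y \<inter> P)" "v \<in> (X - P) \<union> (Y \<inter> P)" for u v
    using that xy(3)[of u v] xy(3)[of v u] R[of u v] sy[of u v] by blast
   show "w \<in> D \<times> D" unfolding xy(4) f_def D_def using xy(1,2) 1 2 by auto
  qed
  show "f ` (D \<times> D) \<subseteq> cross S (relH es (set H))"
  proof
   fix w assume "w \<in> f ` (D \<times> D)"
   then obtain X Y where xy: "X \<subseteq> {..<S}" "Y \<subseteq> {..<S}" "\<And>x y. x \<in> X ==> y \<in> X ==> \<not> relH es (set H) x y"
    "\<And>x y. x \<in> Y ==> y \<in> Y ==> \<not> relH es (set H) x y" "w = f (X, Y)" by (auto simp: D_def)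
   have 1: "\<not> relH es (set H) u v" if "u \<in> (X \<inter> P) \<union> (Y - P)" "v \<in> (X - P) \<union> (Y \<inter> P)" for u v
    using that xy(3)[of u v] xy(4)[of u v] R[of u v] by blast
   show "w \<in> cross S (relH es (set H))" unfolding xy(5) f_def cross_def using xy(1,2) 1 by auto
  qed
 qed (simp_all add: ff)
 then have "card (cross S (relH es (set H))) = card (D \<times> D)" by (rule bij_betw_same_card)
 also have "\<dots> = card D ^ 2" by (simp add: card_cartesian_product power2_eq_square)
 also have "bij_betw (%I. (I - set H, I \<inter> set H)) D (Pow ({..<S} - set H) \<times> indG es (set H))"
  by (rule bij_betw_byWitness[where f' = "%(a, b). a \<union> b"]) (use H in \<open>auto simp: D_def indG_def relH_def\<close>)
 then have "card D = card (Pow ({..<S} - set H) \<times> indG es (set H))" by (rule bij_betw_same_card)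
 also have "\<dots> = 2 ^ (S - length H) * ZH es H"
  using H by (simp add: card_cartesian_product card_Pow card_Diff_subset distinct_card ZH_def)
 finally show ?thesis .
qed

text \<open>Take the left set arbitrary and the right set outside \<open>H\<close>; the strict
  inequality provides at least one index outside. The factor 2 ensures later that pairs with empty
  left part are at most half of all.\<close>

lemma card_cross_relH_ge:
 assumes H: "set H \<subseteq> {..<S}" "distinct H" "length H < S"
 shows "2 * 2 ^ S <= card (cross S (relH es (set H)))"
proof -
 have "2 ^ S * 2 ^ 1 <= (2 ^ S * 2 ^ (S - length H) :: nat)" using H by (intro mult_left_mono power_increasing) auto
 also have "\<dots> = card (Pow {..<S} \<times> Pow ({..<S} - set H))"
  using H by (simp add: card_cartesian_product card_Pow card_Diff_subset distinct_card)
 also have "\<dots> <= card (cross S (relH es (set H)))"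
  by (rule card_mono[OF finite_cross]) (auto simp: cross_def relH_def)
 finally show ?thesis by simp
qed

definition copies :: "nat => (nat => nat => bool) => nat => nat => bool" where
 "copies S R x y \<longleftrightarrow> x div S = y div S \<and> R (x mod S) (y mod S)"

text \<open>The copies are independent; the induction splits off the indices from
  \<open>k * S\<close> on.\<close>

lemma card_cross_copies:
 assumes S: "S > 0"
 shows "card (cross (k * S) (copies S R)) = card (cross S R) ^ k"
proof (induction k)
 case 0
 have "cross 0 (copies S R) = {({}, {})}" by (auto simp: cross_def)
 then show ?case by simp
next
 case (Suc k)
 let ?K = "k * S"
 let ?lo = "%X. X \<inter> {..<?K}" and ?hi = "%X. {x. x < S \<and> ?K + x \<in> X}"
 have lt: "x < Suc k * S \<longleftrightarrow> x < ?K \<or> (\<exists>x'<S. x = ?K + x')" for x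
 proof
  assume x: "x < Suc k * S"
  show "x < ?K \<or> (\<exists>x'<S. x = ?K + x')"
  proof (cases "x < ?K")
   case False
   then show ?thesis using x by (intro disjI2 exI[of _ "x - ?K"]) auto
  qed simp
 qed auto
 have dk: "(?K + x) div S = k" "(?K + x) mod S = x" if "x < S" for x using that S by simp_all
 have dl: "x div S < k" if "x < ?K" for x using that S by (simp add: div_less_iff_less_mult)
 have "bij_betw (%(X, Y). ((?lo X, ?lo Y), (?hi X, ?hi Y))) (cross (Suc k * S) (copies S R))
   (cross ?K (copies S R) \<times> cross S R)"
 proof (rule bij_betw_byWitness[where f' = "%((X, Y), (X', Y')). (X \<union> (+) ?K ` X', Y \<union> (+) ?K ` Y')"])
  show "\<forall>a\<in>cross (Suc k * S) (copies S R). (%((X, Y), (X', Y')). (X \<union> (+) ?K ` X', Y \<union> (+) ?K ` Y'))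
    ((%(X, Y). ((?lo X, ?lo Y), (?hi X, ?hi Y))) a) = a"
  proof
   fix a assume "a \<in> cross (Suc k * S) (copies S R)"
   then obtain X Y where a: "a = (X, Y)" "X \<subseteq> {..<Suc k * S}" "Y \<subseteq> {..<Suc k * S}" by (auto simp: cross_def)
   have "?lo Z \<union> (+) ?K ` ?hi Z = Z" if "Z \<subseteq> {..<Suc k * S}" for Z
   proof
    show "Z \<subseteq> ?lo Z \<union> (+) ?K ` ?hi Z"
    proof
     fix z assume z: "z \<in> Z"
     then have "z < Suc k * S" using that by auto
     then show "z \<in> ?lo Z \<union> (+) ?K ` ?hi Z" using z unfolding lt by auto
    qed
   qed auto
   then show "(%((X, Y), (X', Y')). (X \<union> (+) ?K ` X', Y \<union> (+) ?K ` Y'))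
    ((%(X, Y). ((?lo X, ?lo Y), (?hi X, ?hi Y))) a) = a" using a by simp
  qed
  show "\<forall>a'\<in>cross ?K (copies S R) \<times> cross S R. (%(X, Y). ((?lo X, ?lo Y), (?hi X, ?hi Y)))
    ((%((X, Y), (X', Y')). (X \<union> (+) ?K ` X', Y \<union> (+) ?K ` Y')) a') = a'"
   by (auto simp: cross_def)
  show "(%(X, Y). ((?lo X, ?lo Y), (?hi X, ?hi Y))) ` cross (Suc k * S) (copies S R) \<subseteq> cross ?K (copies S R) \<times> cross S R"
  proof
   fix w assume "w \<in> (%(X, Y). ((?lo X, ?lo Y), (?hi X, ?hi Y))) ` cross (Suc k * S) (copies S R)"
   then obtain X Y where w: "w = ((?lo X, ?lo Y), (?hi X, ?hi Y))"
    and xy: "\<And>x y. x \<in> X ==> y \<in> Y ==> \<not> copies S R x y" by (auto simp: cross_def)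
   have "\<not> R x y" if "x < S" "?K + x \<in> X" "y < S" "?K + y \<in> Y" for x y
    using xy[OF that(2,4)] dk that unfolding copies_def by simp
   then show "w \<in> cross ?K (copies S R) \<times> cross S R" unfolding w cross_def using xy by auto
  qed
  show "(%((X, Y), (X', Y')). (X \<union> (+) ?K ` X', Y \<union> (+) ?K ` Y')) ` (cross ?K (copies S R) \<times> cross S R) \<subseteq> cross (Suc k * S) (copies S R)"
  proof
   fix w assume "w \<in> (%((X, Y), (X', Y')). (X \<union> (+) ?K ` X', Y \<union> (+) ?K ` Y')) ` (cross ?K (copies S R) \<times> cross S R)"
   then obtain X Y X' Y' where w: "w = (X \<union> (+) ?K ` X', Y \<union> (+) ?K ` Y')"
    and s: "X \<subseteq> {..<?K}" "Y \<subseteq> {..<?K}" "X' \<subseteq> {..<S}" "Y' \<subseteq> {..<S}"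
    and r: "\<And>x y. x \<in> X ==> y \<in> Y ==> \<not> copies S R x y" "\<And>x y. x \<in> X' ==> y \<in> Y' ==> \<not> R x y"
    by (auto simp: cross_def)
   have "\<not> copies S R x y" if "x \<in> X \<union> (+) ?K ` X'" "y \<in> Y \<union> (+) ?K ` Y'" for x y
   proof -
    consider "x \<in> X" "y \<in> Y" | y' where "x \<in> X" "y' \<in> Y'" "y = ?K + y'" | x' where "x' \<in> X'" "x = ?K + x'" "y \<in> Y"
     | x' y' where "x' \<in> X'" "x = ?K + x'" "y' \<in> Y'" "y = ?K + y'" using \<open>x \<in> _\<close> \<open>y \<in> _\<close> by blast
    then show ?thesis
    proof cases
     case 1
     then show ?thesis by (rule r(1))
    next
     case 2
     have "x div S < k" "y div S = k" using dl[of x] dk(1)[of y'] s 2 by auto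
     then show ?thesis by (simp add: copies_def)
    next
     case 3
     have "x div S = k" "y div S < k" using dl[of y] dk(1)[of x'] s 3 by auto
     then show ?thesis by (simp add: copies_def)
    next
     case 4
     have "x mod S = x'" "y mod S = y'" using dk(2) s 4 by auto
     then show ?thesis using r(2)[of x' y'] 4 by (simp add: copies_def)
    qed
   qed
   moreover have "X \<union> (+) ?K ` X' \<subseteq> {..<Suc k * S}" "Y \<union> (+) ?K ` Y' \<subseteq> {..<Suc k * S}" using s by (auto simp: subset_iff)
   ultimately show "w \<in> cross (Suc k * S) (copies S R)" unfolding w cross_def by blast
  qed
 qed
 then have "card (cross (Suc k * S) (copies S R)) = card (cross ?K (copies S R) \<times> cross S R)" by (rule bij_betw_same_card)
 then show ?case by (simp add: card_cartesian_product Suc)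
qed

section \<open>Sizes of the two phases\<close>

lemma relG_alt: "relG S k es H m x y \<longleftrightarrow> (if y < k * S then copies S (relH es (set H)) x y else y - k * S < m)"
 by (auto simp: relG_def copies_def relH_def)

text \<open>An empty left part allows every right part, which is the trivial phase. A nonempty left
  part blocks the \<open>m\<close> extra right objects and leaves an independent set of the copies
  together with \<open>k * S - m\<close> free objects. Thus each unit of \<open>m\<close> tilts the
  balance by a factor 2.\<close>

lemma rel_pairs_upper:
 assumes m: "m <= k * S"
 shows "card (rel_pairs (k * S) (2 * (k * S)) (relG S k es H m))
  <= 2 ^ (2 * (k * S)) + card (cross (k * S) (copies S (relH es (set H)))) * 2 ^ (k * S - m)"
proof -
 let ?K = "k * S" let ?G = "cross ?K (copies S (relH es (set H)))"
 let ?g = "%((X, Y), Z). (X, Y \<union> (+) ?K ` Z)"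
 have "rel_pairs ?K (2 * ?K) (relG S k es H m) \<subseteq> Pair {} ` Pow {..<2 * ?K} \<union> ?g ` (?G \<times> Pow {m..<?K})"
 proof
  fix z assume "z \<in> rel_pairs ?K (2 * ?K) (relG S k es H m)"
  then obtain X Y where z: "z = (X, Y)" "X \<subseteq> {..<?K}" "Y \<subseteq> {..<2 * ?K}"
   and r: "\<And>x y. x \<in> X ==> y \<in> Y ==> \<not> relG S k es H m x y" by (auto simp: rel_pairs_def)
  show "z \<in> Pair {} ` Pow {..<2 * ?K} \<union> ?g ` (?G \<times> Pow {m..<?K})"
  proof (cases "X = {}")
   case False
   then obtain x where x: "x \<in> X" by blast
   let ?Z = "{y. y < ?K \<and> ?K + y \<in> Y}"
   have "\<not> copies S (relH es (set H)) x y" if "x \<in> X" "y \<in> Y" "y < ?K" for x y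
    using r[OF that(1,2)] that(3) unfolding relG_alt by simp
   then have "(X, Y \<inter> {..<?K}) \<in> ?G" using z unfolding cross_def by auto
   moreover have "?Z \<subseteq> {m..<?K}" using r[OF x] unfolding relG_alt by fastforce
   moreover have "Y = (Y \<inter> {..<?K}) \<union> (+) ?K ` ?Z"
   proof
    show "Y \<subseteq> (Y \<inter> {..<?K}) \<union> (+) ?K ` ?Z"
    proof
     fix y assume y: "y \<in> Y"
     show "y \<in> (Y \<inter> {..<?K}) \<union> (+) ?K ` ?Z"
     proof (cases "y < ?K")
      case False
      have "y < 2 * ?K" using y z by auto
      then have "y - ?K \<in> ?Z" "y = ?K + (y - ?K)" using y False by auto
      then show ?thesis by blast
     qed (use y in simp)
    qed
   qed auto
   then have "z = ?g ((X, Y \<inter> {..<?K}), ?Z)" using z(1) by simp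
   ultimately show ?thesis by blast
  qed (use z in auto)
 qed
 then have "card (rel_pairs ?K (2 * ?K) (relG S k es H m)) <= card (Pair {} ` Pow {..<2 * ?K} \<union> ?g ` (?G \<times> Pow {m..<?K}))"
  by (intro card_mono) (auto simp: finite_cross)
 also have "\<dots> <= card (Pair ({}::nat set) ` Pow {..<2 * ?K}) + card (?g ` (?G \<times> Pow {m..<?K}))" by (rule card_Un_le)
 also have "\<dots> <= card (Pow {..<2 * ?K}) + card (?G \<times> Pow {m..<?K})"
  by (intro add_mono card_image_le) (auto simp: finite_cross)
 finally show ?thesis by (simp add: card_cartesian_product card_Pow)
qed

text \<open>Only nonempty left parts are counted; at most \<open>2 ^ (k * S)\<close> pairs of the
  cross have an empty one.\<close>

lemma rel_pairs_lower:
 assumes m: "m <= k * S"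
 shows "(card (cross (k * S) (copies S (relH es (set H)))) - 2 ^ (k * S)) * 2 ^ (k * S - m)
  <= card (rel_pairs (k * S) (2 * (k * S)) (relG S k es H m))"
proof -
 let ?K = "k * S" let ?G = "cross ?K (copies S (relH es (set H)))"
 let ?E = "Pair ({}::nat set) ` Pow {..<?K}"
 let ?g = "%((X, Y), Z). (X, Y \<union> (+) ?K ` Z)"
 have "card ?E <= 2 ^ ?K" using card_image_le[of "Pow {..<?K}" "Pair ({}::nat set)"] by (simp add: card_Pow)
 then have "card ?G - 2 ^ ?K <= card ?G - card ?E" by simp
 also have "\<dots> <= card (?G - ?E)" by (rule diff_card_le_card_Diff) simp
 finally have "(card ?G - 2 ^ ?K) * 2 ^ (?K - m) <= card (?G - ?E) * 2 ^ (?K - m)" by (rule mult_le_mono1)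
 also have "\<dots> = card ((?G - ?E) \<times> Pow {m..<?K})" by (simp add: card_cartesian_product card_Pow)
 also have "\<dots> = card (?g ` ((?G - ?E) \<times> Pow {m..<?K}))"
 proof (rule card_image[symmetric], rule inj_on_inverseI[where g = "%(X, Y). ((X, Y \<inter> {..<?K}), {y. ?K + y \<in> Y})"])
  fix a assume "a \<in> (?G - ?E) \<times> Pow {m..<?K}"
  then obtain X Y Z where a: "a = ((X, Y), Z)" "Y \<subseteq> {..<?K}" "Z \<subseteq> {m..<?K}" by (cases a) (auto simp: cross_def)
  have "(Y \<union> (+) ?K ` Z) \<inter> {..<?K} = Y" "{y. ?K + y \<in> Y \<union> (+) ?K ` Z} = Z" using a by auto
  then show "(%(X, Y). ((X, Y \<inter> {..<?K}), {y. ?K + y \<in> Y})) (?g a) = a" using a(1) by simp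
 qed
 also have "\<dots> <= card (rel_pairs ?K (2 * ?K) (relG S k es H m))"
 proof (rule card_mono)
  show "finite (rel_pairs ?K (2 * ?K) (relG S k es H m))"
   by (rule finite_subset[of _ "Pow {..<?K} \<times> Pow {..<2 * ?K}"]) (auto simp: rel_pairs_def)
  show "?g ` ((?G - ?E) \<times> Pow {m..<?K}) \<subseteq> rel_pairs ?K (2 * ?K) (relG S k es H m)"
  proof
   fix w assume "w \<in> ?g ` ((?G - ?E) \<times> Pow {m..<?K})"
   then obtain X Y Z where w: "w = (X, Y \<union> (+) ?K ` Z)" and s: "X \<subseteq> {..<?K}" "Y \<subseteq> {..<?K}" "Z \<subseteq> {m..<?K}"
    and r: "\<And>x y. x \<in> X ==> y \<in> Y ==> \<not> copies S (relH es (set H)) x y" by (auto simp: cross_def)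
   have "\<not> relG S k es H m x y" if "x \<in> X" "y \<in> Y \<union> (+) ?K ` Z" for x y
    using that s r[of x y] unfolding relG_alt by auto
   moreover have "Y \<union> (+) ?K ` Z \<subseteq> {..<2 * ?K}" using s by (auto simp: subset_iff mult.commute)
   ultimately show "w \<in> rel_pairs ?K (2 * ?K) (relG S k es H m)" unfolding w rel_pairs_def using s(1) by blast
  qed
 qed
 finally show ?thesis .
qed

text \<open>If all pairs are related, one of the two parts is empty. In the application
  \<open>C\<close> is twice \<open>A\<close>, so the trivial phase has almost all the mass and this
  model can play the hidden one.\<close>

lemma rel_pairs_full: "card (rel_pairs A C (%_ _. True)) <= 2 ^ C + 2 ^ A"
proof -
 have "rel_pairs A C (%_ _. True) \<subseteq> Pair {} ` Pow {..<C} \<union> (%X. (X, {})) ` Pow {..<A}" by (auto simp: rel_pairs_def)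
 then have "card (rel_pairs A C (%_ _. True)) <= card (Pair {} ` Pow {..<C} \<union> (%X. (X, {})) ` Pow {..<A})" by (intro card_mono) auto
 also have "\<dots> <= card (Pair ({}::nat set) ` Pow {..<C}) + card ((%X. (X, {}::nat set)) ` Pow {..<A})" by (rule card_Un_le)
 also have "\<dots> <= card (Pow {..<C}) + card (Pow {..<A})" by (intro add_mono card_image_le) auto
 finally show ?thesis by (simp add: card_Pow)
qed

definition gG :: "nat => (nat \<times> nat) list => nat list => nat" where
 "gG S es H = card (cross (AA S) (copies S (relH es (set H))))"

lemma gG_eq:
 assumes "bipG es" "set H \<subseteq> {..<S}" "distinct H" "S > 0"
 shows "gG S es H = (2 ^ (S - length H) * ZH es H) ^ (2 * kk S)"
 unfolding gG_def AA_def card_cross_copies[OF assms(4)] card_cross_relH[OF assms(1-3)] by (simp add: power_mult)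

lemma gG_ge:
 assumes "set H \<subseteq> {..<S}" "distinct H" "length H < S"
 shows "2 * 2 ^ AA S <= gG S es H"
proof -
 have S: "S > 0" using assms by simp
 then have k: "kk S > 0" by (simp add: kk_def)
 have "2 * 2 ^ AA S = 2 ^ 1 * ((2::nat) ^ S) ^ kk S" by (simp add: AA_def power_mult[symmetric] mult.commute[of S])
 also have "\<dots> <= 2 ^ kk S * (2 ^ S) ^ kk S" using k by (intro mult_right_mono power_increasing) auto
 also have "\<dots> = (2 * 2 ^ S) ^ kk S" by (simp add: power_mult_distrib)
 also have "\<dots> <= card (cross S (relH es (set H))) ^ kk S" by (intro power_mono card_cross_relH_ge assms) simp
 finally show ?thesis unfolding gG_def AA_def card_cross_copies[OF S] .
qed

lemma gG_le: "gG S es H <= 2 ^ (2 * AA S)"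
proof -
 have "gG S es H <= card (Pow {..<AA S} \<times> Pow {..<AA S})" unfolding gG_def by (intro card_mono) (auto simp: cross_def)
 then show ?thesis by (simp add: card_cartesian_product card_Pow mult_2 power_add)
qed

section \<open>Correctness of the sampler\<close>

text \<open>Union bound over the rounds, with an invariant that may depend on the elements still to
  be processed.\<close>

lemma foldM_bad:
 fixes \<eta> :: real
 assumes step: "\<And>y ys acc. P (y # ys) acc ==> Pr (g y acc) {acc'. \<not> P ys acc'} <= \<eta>"
  and \<eta>: "0 <= \<eta>" and P: "P ys a"
 shows "Pr (foldM g ys a) {acc. \<not> P [] acc} <= length ys * \<eta>"
 using P
proof (induction ys arbitrary: a)
 case Nil
 then show ?case by simp
next
 case (Cons y ys)
 have "Pr (bind_pmf (g y a) (foldM g ys)) {acc. \<not> P [] acc} <= \<eta> + length ys * \<eta>"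
  by (rule prob_bind_le[where bad = "%acc. \<not> P ys acc"]) (use step[OF Cons.prems] Cons.IH \<eta> in auto)
 then show ?case by (simp add: algebra_simps)
qed

lemma prob_in: "Pr r B = pmf (map_pmf (%x. x \<in> B) r) True"
 unfolding pmf_map by (rule arg_cong[where f = "Pr r"]) auto

lemma prob_bind_bool:
 "Pr (bind_pmf p f) B = pmf p True * Pr (f True) B + (1 - pmf p True) * Pr (f False) B"
proof -
 have "pmf p False = 1 - pmf p True" by (rule pmf_False_conv_True)
 moreover have "Pr (bind_pmf p f) B = (\<Sum>x\<in>UNIV. Pr (f x) B * pmf p x)"
  unfolding prob_in[of _ B] map_bind_pmf pmf_bind by (rule integral_measure_pmf_real[of UNIV]) auto
 ultimately show ?thesis by (simp add: UNIV_bool mult.commute)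
qed

text \<open>Chernoff bound: Markov's inequality for \<open>x ^ cnt\<close>, whose expectation gains
  at most the factor \<mu> per trial. A base \<open>x\<close> below 1 gives the lower tail.\<close>

lemma count_tail:
 fixes x \<mu> thr :: real
 assumes x: "x > 0" and thr: "thr > 0" and \<mu>: "pmf p True * x + (1 - pmf p True) <= \<mu>"
 shows "Pr (foldM (%_ cnt. bind_pmf p (%b. return_pmf (if b then Suc cnt else cnt))) ys a) {cnt. thr <= x ^ cnt}
  <= \<mu> ^ length ys * x ^ a / thr"
proof (induction ys arbitrary: a)
 case Nil
 show ?case
 proof (cases "thr <= x ^ a")
  case True
  then show ?thesis using thr by (simp add: field_simps)
 next
  case False
  then show ?thesis using thr x by simp
 qed
next
 case (Cons y ys)
 let ?F = "foldM (%_ cnt. bind_pmf p (%b. return_pmf (if b then Suc cnt else cnt))) ys"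
 let ?B = "{cnt. thr <= x ^ cnt}"
 have \<mu>0: "0 <= \<mu>"
 proof -
  have "0 <= pmf p True * x + (1 - pmf p True)" using x pmf_le_1[of p True] by simp
  then show ?thesis using \<mu> by linarith
 qed
 have "Pr (foldM (%_ cnt. bind_pmf p (%b. return_pmf (if b then Suc cnt else cnt))) (y # ys) a) ?B =
  pmf p True * Pr (?F (Suc a)) ?B + (1 - pmf p True) * Pr (?F a) ?B"
  by (simp add: bind_assoc_pmf bind_return_pmf prob_bind_bool)
 also have "\<dots> <= pmf p True * (\<mu> ^ length ys * x ^ Suc a / thr) + (1 - pmf p True) * (\<mu> ^ length ys * x ^ a / thr)"
  by (intro add_mono mult_left_mono Cons.IH) (simp_all add: pmf_le_1)
 also have "\<dots> = (pmf p True * x + (1 - pmf p True)) * (\<mu> ^ length ys * x ^ a / thr)" by (simp add: algebra_simps add_divide_distrib diff_divide_distrib)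
 also have "\<dots> <= \<mu> * (\<mu> ^ length ys * x ^ a / thr)" using \<mu> \<mu>0 x thr by (intro mult_right_mono) auto
 finally show ?case by simp
qed

text \<open>The bases 4/9 and 9/4 are squares because the threshold is half of the trials. Both
  tails have the same rate: 11/16 * 4/9 + 5/16 = 89/144 divided by 2/3, and 5/16 * 9/4 + 11/16 =
  89/64 divided by 3/2, are both 89/96.\<close>

lemma maj_bound:
 assumes p: "Pr p {b. b ~= v} <= 5/16"
 shows "Pr (maj R p) {b. b ~= v} <= (89/96) ^ R"
proof -
 let ?F = "foldM (%_ cnt. bind_pmf p (%b. return_pmf (if b then Suc cnt else cnt))) (replicate R ()) 0"
 have m: "Pr (maj R p) {b. b ~= v} = Pr ?F {cnt. (R < 2 * cnt) ~= v}"
  unfolding maj_def map_pmf_def[symmetric] by (simp add: vimage_def)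
 show ?thesis
 proof (cases v)
  case True
  then have e: "{b. b ~= v} = {False}" by auto
  have "pmf p False <= 5/16" using p unfolding e by (simp add: measure_pmf_single)
  then have T: "pmf p True >= 11/16" by (simp add: pmf_False_conv_True)
  have "Pr ?F {cnt. (R < 2 * cnt) ~= v} <= Pr ?F {cnt. (2/3) ^ R <= (4/9::real) ^ cnt}"
  proof (intro measure_pmf.finite_measure_mono subsetI)
   fix cnt assume "cnt \<in> {cnt. (R < 2 * cnt) ~= v}"
   then have "2 * cnt <= R" using True by simp
   then have "(2/3::real) ^ R <= (2/3) ^ (2 * cnt)" by (intro power_decreasing) auto
   also have "\<dots> = (4/9) ^ cnt" by (simp add: power_mult power2_eq_square)
   finally show "cnt \<in> {cnt. (2/3) ^ R <= (4/9::real) ^ cnt}" by simp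
  qed simp
  also have "\<dots> <= (89/144) ^ length (replicate R ()) * (4/9) ^ 0 / (2/3) ^ R"
   by (rule count_tail) (use T in simp_all)
  also have "\<dots> = (89/96) ^ R" by (simp add: power_divide[symmetric])
  finally show ?thesis unfolding m .
 next
  case False
  then have e: "{b. b ~= v} = {True}" by auto
  have T: "pmf p True <= 5/16" using p unfolding e by (simp add: measure_pmf_single)
  have "Pr ?F {cnt. (R < 2 * cnt) ~= v} <= Pr ?F {cnt. (3/2) ^ R <= (9/4::real) ^ cnt}"
  proof (intro measure_pmf.finite_measure_mono subsetI)
   fix cnt assume "cnt \<in> {cnt. (R < 2 * cnt) ~= v}"
   then have "R <= 2 * cnt" using False by simp
   then have "(3/2::real) ^ R <= (3/2) ^ (2 * cnt)" by (intro power_increasing) auto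
   also have "\<dots> = (9/4) ^ cnt" by (simp add: power_mult power2_eq_square)
   finally show "cnt \<in> {cnt. (3/2) ^ R <= (9/4::real) ^ cnt}" by simp
  qed simp
  also have "\<dots> <= (89/64) ^ length (replicate R ()) * (9/4) ^ 0 / (3/2) ^ R"
   by (rule count_tail) (use T in simp_all)
  also have "\<dots> = (89/96) ^ R" by (simp add: power_divide[symmetric])
  finally show ?thesis unfolding m .
 qed
qed

text \<open>Answers are reliable up to \<open>Mlo\<close> and beyond \<open>Mhi\<close>; in between
  both answers keep the count inside the window. After \<open>i\<close> values the count lies
  between \<open>min i Mlo\<close> and \<open>min i Mhi\<close> unless one of the reliable answers
  failed.\<close>

lemma FG_bound:
 assumes no: "\<And>m. 1 <= m ==> m <= Mlo ==> Pr (simG c q e S es g H m) {b. b ~= False} <= 5/16"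
  and yes: "\<And>m. Mhi < m ==> m <= AA S ==> Pr (simG c q e S es g H m) {b. b ~= True} <= 5/16"
  and M: "Mlo <= Mhi" "Mlo <= AA S"
 shows "Pr (FG c q e S es g H) {F. \<not> (Mlo <= F \<and> F <= Mhi)} <= AA S * (89/96) ^ S"
proof -
 define P where "P ys (F::nat) \<longleftrightarrow> (\<exists>i\<le>AA S. ys = [i..<AA S] \<and> min i Mlo <= F \<and> F <= min i Mhi)" for ys F
 let ?g = "%m cnt. bind_pmf (maj S (simG c q e S es g H (Suc m))) (%b. return_pmf (if b then cnt else Suc cnt))"
 have "Pr (foldM ?g [0..<AA S] 0) {F. \<not> P [] F} <= length [0..<AA S] * (89/96) ^ S"
 proof (rule foldM_bad[where P = P])
  show "P [0..<AA S] 0" unfolding P_def by (intro exI[of _ 0]) simp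
  fix y ys acc assume "P (y # ys) acc"
  then obtain i where i: "i <= AA S" "y # ys = [i..<AA S]" "min i Mlo <= acc" "acc <= min i Mhi" unfolding P_def by blast
  have lt: "i < AA S"
  proof (rule ccontr)
   assume "\<not> i < AA S"
   then show False using i(2) by simp
  qed
  then have y: "y = i" "ys = [Suc i..<AA S]" using i(2) by (simp_all add: upt_conv_Cons)
  have PI: "P ys F" if "min (Suc i) Mlo <= F" "F <= min (Suc i) Mhi" for F
   unfolding P_def using that y(2) lt by (intro exI[of _ "Suc i"]) simp
  have gm: "Pr (?g y acc) {F. \<not> P ys F} = Pr (maj S (simG c q e S es g H (Suc i))) {b. \<not> P ys (if b then acc else Suc acc)}"
   unfolding map_pmf_def[symmetric] y(1) by (simp add: vimage_def)
  consider "Suc i <= Mlo" | "Mhi < Suc i" | "Mlo < Suc i" "Suc i <= Mhi" using M by linarith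
  then show "Pr (?g y acc) {F. \<not> P ys F} <= (89/96) ^ S"
  proof cases
   case 1
   have "P ys (Suc acc)" by (rule PI) (use i 1 M in auto)
   then have "{b. \<not> P ys (if b then acc else Suc acc)} \<subseteq> {b. b ~= False}" by auto
   then have "Pr (maj S (simG c q e S es g H (Suc i))) {b. \<not> P ys (if b then acc else Suc acc)} <=
     Pr (maj S (simG c q e S es g H (Suc i))) {b. b ~= False}" by (intro measure_pmf.finite_measure_mono) auto
   also have "\<dots> <= (89/96) ^ S" by (rule maj_bound[OF no]) (use 1 in auto)
   finally show ?thesis unfolding gm .
  next
   case 2
   have "P ys acc" by (rule PI) (use i 2 M in auto)
   then have "{b. \<not> P ys (if b then acc else Suc acc)} \<subseteq> {b. b ~= True}" by auto
   then have "Pr (maj S (simG c q e S es g H (Suc i))) {b. \<not> P ys (if b then acc else Suc acc)} <=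
     Pr (maj S (simG c q e S es g H (Suc i))) {b. b ~= True}" by (intro measure_pmf.finite_measure_mono) auto
   also have "\<dots> <= (89/96) ^ S" by (rule maj_bound[OF yes]) (use 2 lt in auto)
   finally show ?thesis unfolding gm .
  next
   case 3
   have "P ys acc" "P ys (Suc acc)" by (rule PI; use i 3 M in auto)+
   then have "{b. \<not> P ys (if b then acc else Suc acc)} = {}" by auto
   then show ?thesis unfolding gm by simp
  qed
 qed simp
 moreover have "Pr (FG c q e S es g H) {F. \<not> (Mlo <= F \<and> F <= Mhi)} <= Pr (foldM ?g [0..<AA S] 0) {F. \<not> P [] F}"
  unfolding FG_def
 proof (intro measure_pmf.finite_measure_mono subsetI CollectI notI)
  fix F assume F: "F \<in> {F. \<not> (Mlo <= F \<and> F <= Mhi)}" and "P [] F"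
  then obtain i where "i <= AA S" "[] = [i..<AA S]" "min i Mlo <= F" "F <= min i Mhi" unfolding P_def by blast
  then have "i = AA S" using upt_eq_Nil_conv[of i "AA S"] by auto
  then show False using F M \<open>min i Mlo <= F\<close> \<open>F <= min i Mhi\<close> by auto
 qed simp
 ultimately show ?thesis by simp
qed

section \<open>From phase counts to branching probabilities\<close>

lemma jsel_props:
 "jsel k Q ex = 0 \<or> jsel k Q ex ^ k < 2 ^ ex" "jsel k Q ex = Q \<or> 2 ^ ex <= Suc (jsel k Q ex) ^ k"
proof -
 have stay: "fold (%_ j. if T (Suc j) then Suc j else j) l a = a" if "\<not> T (Suc a)" for T :: "nat => bool" and l :: "unit list" and a
  using that by (induction l) auto
 have gen: "(fold (%_ j. if T (Suc j) then Suc j else j) l a = a \<or> T (fold (%_ j. if T (Suc j) then Suc j else j) l a)) \<and>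
  (fold (%_ j. if T (Suc j) then Suc j else j) l a = a + length l \<or> \<not> T (Suc (fold (%_ j. if T (Suc j) then Suc j else j) l a)))"
  for T :: "nat => bool" and l :: "unit list" and a
 proof (induction l arbitrary: a)
  case (Cons y l)
  show ?case
  proof (cases "T (Suc a)")
   case True
   then show ?thesis using Cons[of "Suc a"] by auto
  next
   case False
   then show ?thesis using stay[of T a l] by simp
  qed
 qed simp
 have "(jsel k Q ex = 0 \<or> length (bits (jsel k Q ex ^ k)) <= ex) \<and>
   (jsel k Q ex = 0 + length (replicate Q ()) \<or> \<not> length (bits (Suc (jsel k Q ex) ^ k)) <= ex)"
  unfolding jsel_def by (rule gen[of "%j. length (bits (j ^ k)) <= ex" "replicate Q ()" 0])
 then show "jsel k Q ex = 0 \<or> jsel k Q ex ^ k < 2 ^ ex" "jsel k Q ex = Q \<or> 2 ^ ex <= Suc (jsel k Q ex) ^ k"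
  unfolding length_bits by (auto simp: not_less)
qed

text \<open>How well a rejection count locates the switch: the factor S on one side covers the
  constant 8/\<epsilon>, the factor S^(e+1) on the other the precision that a clock of S^e
  demands.\<close>

definition accG :: "nat => nat => (nat \<times> nat) list => nat list => nat => bool" where
 "accG S e es H F \<longleftrightarrow> real (gG S es H) <= real S * 2 ^ (AA S + F) \<and> 2 ^ (AA S + F) <= real S ^ (e + 1) * real (gG S es H)"

lemma QQ_pos: "QQ S > 0" by (simp add: QQ_def)

text \<open>Everything is compared in \<open>2 * kk S\<close>-th powers. The polynomial errors of
  the two counts combine to \<open>real S ^ (e + 2)\<close>, which the assumption on \<kappa> turns
  into a single factor \<kappa> after taking roots.\<close>

lemma jsel_accurate:
 fixes \<kappa> :: real
 assumes b: "bipG es" and H0: "set H0 \<subseteq> {..<S}" "distinct H0" and H1: "set H1 \<subseteq> {..<S}" "distinct H1"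
  and S: "S > 0" and \<kappa>: "1 <= \<kappa>" "real S ^ (e + 2) <= \<kappa> ^ (2 * kk S)"
  and F: "accG S e es H1 F1" "accG S e es H0 F0"
  and j: "j = jsel (2 * kk S) (QQ S) (expo S F1 (length H1) F0 (length H0))"
 shows "real j * ZH es H0 <= \<kappa> * QQ S * ZH es H1" "j = QQ S \<or> real (QQ S) * ZH es H1 <= \<kappa> * (real j + 1) * ZH es H0"
proof -
 let ?K = "2 * kk S" and ?Q = "real (QQ S)" and ?Z0 = "real (ZH es H0)" and ?Z1 = "real (ZH es H1)"
 let ?a = "?K * sQ S + F1 + ?K * length H1" and ?b = "F0 + ?K * length H0"
 define ex where "ex = expo S F1 (length H1) F0 (length H0)"
 have ex: "ex = ?a - ?b" by (simp add: ex_def expo_def)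
 have K: "?K > 0" using S by (simp add: kk_def)
 have len: "length H <= S" if "set H \<subseteq> {..<S}" "distinct H" for H
  using card_mono[OF _ that(1)] distinct_card[OF that(2)] by simp
 have g: "real (gG S es H) * 2 ^ (?K * length H) = (2 ^ S * real (ZH es H)) ^ ?K" if "set H \<subseteq> {..<S}" "distinct H" for H
 proof -
  have "gG S es H * 2 ^ (?K * length H) = (2 ^ (S - length H) * ZH es H) ^ ?K * (2 ^ length H) ^ ?K"
   unfolding gG_eq[OF b that S] by (simp add: power_mult[symmetric] mult.commute)
  also have "\<dots> = (2 ^ (S - length H) * 2 ^ length H * ZH es H) ^ ?K" by (simp add: power_mult_distrib mult_ac)
  also have "(2::nat) ^ (S - length H) * 2 ^ length H = 2 ^ S" using len[OF that] by (simp add: power_add[symmetric])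
  finally have "gG S es H * 2 ^ (?K * length H) = (2 ^ S * ZH es H) ^ ?K" .
  then have "real (gG S es H * 2 ^ (?K * length H)) = real ((2 ^ S * ZH es H) ^ ?K)" by (rule arg_cong)
  then show ?thesis by simp
 qed
 have a: "2 ^ AA S * (2::real) ^ ?a = ?Q ^ ?K * (2 ^ (AA S + F1) * 2 ^ (?K * length H1))"
  by (simp add: QQ_def power_add power_mult[symmetric] mult_ac)
 have bb: "2 ^ AA S * (2::real) ^ ?b = 2 ^ (AA S + F0) * 2 ^ (?K * length H0)" by (simp add: power_add)
 have Spos: "real S > 0" using S by simp
 have a_up: "2 ^ AA S * (2::real) ^ ?a <= real S ^ (e + 1) * (?Q * (2 ^ S * ?Z1)) ^ ?K"
 proof -
  have "2 ^ (AA S + F1) * 2 ^ (?K * length H1) <= real S ^ (e + 1) * real (gG S es H1) * 2 ^ (?K * length H1)"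
   using F(1) by (intro mult_right_mono) (simp_all add: accG_def)
  then have "2 ^ (AA S + F1) * 2 ^ (?K * length H1) <= real S ^ (e + 1) * (2 ^ S * ?Z1) ^ ?K" using g[OF H1] by (simp only: mult.assoc)
  then have "?Q ^ ?K * (2 ^ (AA S + F1) * 2 ^ (?K * length H1)) <= ?Q ^ ?K * (real S ^ (e + 1) * (2 ^ S * ?Z1) ^ ?K)" by (intro mult_left_mono) auto
  then show ?thesis unfolding a by (simp only: power_mult_distrib mult_ac)
 qed
 have a_lo: "(?Q * (2 ^ S * ?Z1)) ^ ?K <= real S * (2 ^ AA S * (2::real) ^ ?a)"
 proof -
  have "real (gG S es H1) * 2 ^ (?K * length H1) <= real S * 2 ^ (AA S + F1) * 2 ^ (?K * length H1)"
   using F(1) by (intro mult_right_mono) (simp_all add: accG_def)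
  then have "(2 ^ S * ?Z1) ^ ?K <= real S * (2 ^ (AA S + F1) * 2 ^ (?K * length H1))" using g[OF H1] by (simp only: mult.assoc)
  then have "?Q ^ ?K * (2 ^ S * ?Z1) ^ ?K <= ?Q ^ ?K * (real S * (2 ^ (AA S + F1) * 2 ^ (?K * length H1)))" by (intro mult_left_mono) auto
  then show ?thesis unfolding a by (simp only: power_mult_distrib mult_ac)
 qed
 have b_up: "2 ^ AA S * (2::real) ^ ?b <= real S ^ (e + 1) * (2 ^ S * ?Z0) ^ ?K"
 proof -
  have "2 ^ (AA S + F0) * 2 ^ (?K * length H0) <= real S ^ (e + 1) * real (gG S es H0) * 2 ^ (?K * length H0)"
   using F(2) by (intro mult_right_mono) (simp_all add: accG_def)
  then show ?thesis unfolding bb using g[OF H0] by (simp only: mult.assoc)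
 qed
 have b_lo: "(2 ^ S * ?Z0) ^ ?K <= real S * (2 ^ AA S * (2::real) ^ ?b)"
 proof -
  have "real (gG S es H0) * 2 ^ (?K * length H0) <= real S * 2 ^ (AA S + F0) * 2 ^ (?K * length H0)"
   using F(2) by (intro mult_right_mono) (simp_all add: accG_def)
  then show ?thesis unfolding bb using g[OF H0] by (simp only: mult.assoc)
 qed
 have S2: "real S * (real S ^ (e + 1) * y) <= \<kappa> ^ ?K * y" if "y >= 0" for y
  using mult_right_mono[OF \<kappa>(2) that] by (simp add: mult_ac)
 show "real j * ?Z0 <= \<kappa> * ?Q * ?Z1"
 proof (cases "j = 0")
  case False
  then have jk: "j ^ ?K < 2 ^ ex" using jsel_props(1)[of ?K "QQ S" ex] by (simp add: j ex_def)
  \<comment> \<open>A positive exponent means that the natural subtraction in \<open>expo\<close>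
    was not truncated.\<close>
  have "ex ~= 0"
  proof
   assume "ex = 0"
   then show False using jk False by simp
  qed
  then have eab: "ex + ?b = ?a" using ex by simp
  have "real (j ^ ?K) <= real (2 ^ ex)" using jk by (intro of_nat_mono) simp
  then have jk': "real j ^ ?K <= 2 ^ ex" by simp
  have "real j ^ ?K * (2 ^ S * ?Z0) ^ ?K <= 2 ^ ex * (real S * (2 ^ AA S * 2 ^ ?b))"
   by (intro mult_mono jk' b_lo) simp_all
  also have "\<dots> = real S * (2 ^ AA S * 2 ^ (ex + ?b))" by (simp only: power_add mult_ac)
  also have "\<dots> <= real S * (real S ^ (e + 1) * (?Q * (2 ^ S * ?Z1)) ^ ?K)" unfolding eab by (intro mult_left_mono a_up) simp
  also have "\<dots> <= \<kappa> ^ ?K * (?Q * (2 ^ S * ?Z1)) ^ ?K" by (rule S2) simp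
  finally have "(real j * (2 ^ S * ?Z0)) ^ ?K <= (\<kappa> * (?Q * (2 ^ S * ?Z1))) ^ ?K" by (simp only: power_mult_distrib)
  then have "real j * (2 ^ S * ?Z0) <= \<kappa> * (?Q * (2 ^ S * ?Z1))"
   by (rule power_le_imp_le_base[where n = "?K - 1", simplified Suc_diff_1[OF K]]) (use \<kappa>(1) in simp)
  then have "2 ^ S * (real j * ?Z0) <= 2 ^ S * (\<kappa> * ?Q * ?Z1)" by (simp only: mult_ac)
  then show ?thesis by simp
 qed (use \<kappa>(1) in simp)
 show "j = QQ S \<or> ?Q * ?Z1 <= \<kappa> * (real j + 1) * ?Z0"
 proof (cases "j = QQ S")
  case False
  then have jk: "2 ^ ex <= Suc j ^ ?K" using jsel_props(2)[of ?K "QQ S" ex] by (simp add: j ex_def)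
  have "real (2 ^ ex) <= real (Suc j ^ ?K)" using jk by (rule of_nat_mono)
  then have jk': "2 ^ ex <= (real j + 1) ^ ?K" by (simp add: add.commute)
  \<comment> \<open>In this direction a truncated subtraction does no harm.\<close>
  have le: "?a <= ex + ?b" using ex by simp
  have "(?Q * (2 ^ S * ?Z1)) ^ ?K <= real S * (2 ^ AA S * 2 ^ ?a)" by (rule a_lo)
  also have "\<dots> <= real S * (2 ^ AA S * 2 ^ (ex + ?b))" by (intro mult_left_mono power_increasing le) simp_all
  also have "\<dots> = 2 ^ ex * (real S * (2 ^ AA S * 2 ^ ?b))" by (simp only: power_add mult_ac)
  also have "\<dots> <= (real j + 1) ^ ?K * (real S * (real S ^ (e + 1) * (2 ^ S * ?Z0) ^ ?K))"
   by (intro mult_mono jk' b_up order_refl) simp_all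
  also have "\<dots> <= (real j + 1) ^ ?K * (\<kappa> ^ ?K * (2 ^ S * ?Z0) ^ ?K)" by (intro mult_left_mono S2) simp_all
  finally have "(?Q * (2 ^ S * ?Z1)) ^ ?K <= ((real j + 1) * (\<kappa> * (2 ^ S * ?Z0))) ^ ?K" by (simp only: power_mult_distrib)
  then have "?Q * (2 ^ S * ?Z1) <= (real j + 1) * (\<kappa> * (2 ^ S * ?Z0))"
   by (rule power_le_imp_le_base[where n = "?K - 1", simplified Suc_diff_1[OF K]]) (use \<kappa>(1) in simp)
  then have "2 ^ S * (?Q * ?Z1) <= 2 ^ S * (\<kappa> * (real j + 1) * ?Z0)" by (simp only: mult_ac)
  then show ?thesis by simp
 qed simp
qed

text \<open>The probability of leaving \<open>v\<close> out is a complement, so an absolute error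
  has to become a relative one. This works because at least half of the independent sets avoid
  \<open>v\<close>, that is \<open>Z1 <= Z0\<close>. The term \<open>2 / Q\<close> covers the
  rounding of \<open>j\<close>, and \<open>2 - \<kappa> <= 1 / \<kappa>\<close> makes the bound
  linear.\<close>

lemma complement_accurate:
 fixes \<kappa> Q j Z1 Z0 :: real
 assumes "1 <= \<kappa>" "0 < Q" "0 < Z1" "Z1 <= Z0" "j = Q \<or> Q * Z1 <= \<kappa> * (j + 1) * (Z1 + Z0)"
 shows "(Q - j) * (Z1 + Z0) <= (\<kappa> + 2 / Q) * Q * Z0"
proof (cases "j = Q")
 case False
 then have "Q * Z1 / \<kappa> <= (j + 1) * (Z1 + Z0)" using assms by (simp add: divide_le_eq mult_ac)
 moreover have "Q * Z1 * (2 - \<kappa>) <= Q * Z1 / \<kappa>"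
 proof -
  have "0 <= (\<kappa> - 1)\<^sup>2" by simp
  then have "(2 - \<kappa>) * \<kappa> <= 1" by (simp add: power2_eq_square algebra_simps)
  then have "2 - \<kappa> <= 1 / \<kappa>" using assms(1) by (simp add: le_divide_eq)
  then have "Q * Z1 * (2 - \<kappa>) <= Q * Z1 * (1 / \<kappa>)" using assms by (intro mult_left_mono) auto
  then show ?thesis by simp
 qed
 ultimately have 1: "Q * Z1 * (2 - \<kappa>) <= (j + 1) * (Z1 + Z0)" by linarith
 have 2: "Q * (\<kappa> - 1) * Z1 <= Q * (\<kappa> - 1) * Z0" using assms by (intro mult_left_mono) auto
 have 3: "(\<kappa> + 2 / Q) * Q * Z0 = \<kappa> * Q * Z0 + 2 * Z0" using assms by (simp add: field_simps)
 show ?thesis unfolding 3 using 1 2 assms(4) by (simp add: algebra_simps)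
qed (use assms in simp)

lemma nbrs_out_props: "distinct H ==> distinct (nbrs_out es v H)" "set (nbrs_out es v H) \<subseteq> set H" "length (nbrs_out es v H) <= length H"
 by (auto simp: nbrs_out_def)

lemma unif_div: "u \<in> set_pmf (bits_onto l a) ==>
 u div 2 ^ length l = a"
proof (induction l arbitrary: a)
 case (Cons y l)
 then obtain b where "u \<in> set_pmf (bits_onto l (if b then Suc (a + a) else a + a))"
  by auto
 from Cons.IH[OF this] have "u div 2 ^ length l = (if b then Suc (a + a) else a + a)" .
 then have "u div 2 ^ length l div 2 = a" by (auto split: if_splits)
 then show ?case by (simp add: div_mult2_eq[symmetric] mult.commute)
qed simp

text \<open>By \<open>unif_div\<close> the final number determines the first coin, so only one
  branch contributes.\<close>

lemma pmf_unif_aux: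
 "pmf (bits_onto l a) u <= (1/2) ^ length l"
proof (induction l arbitrary: a)
 case Nil
 show ?case by (simp add: pmf_le_1)
next
 case (Cons y l)
 let ?f = "%a. pmf (bits_onto l a) u"
 have "?f (Suc (a + a)) = 0 \<or> ?f (a + a) = 0"
 proof (rule ccontr)
  assume "\<not> (?f (Suc (a + a)) = 0 \<or> ?f (a + a) = 0)"
  then have "u div 2 ^ length l = Suc (a + a)" "u div 2 ^ length l = a + a"
   by (auto intro!: unif_div simp only: set_pmf_iff)
  then show False by simp
 qed
 then have "(?f (Suc (a + a)) + ?f (a + a)) / 2 <= (1/2) ^ length l / 2"
  using Cons[of "Suc (a + a)"] Cons[of "a + a"] by auto
 then show ?case by (simp add: bind_assoc_pmf bind_return_pmf pmf_bind_flip)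
qed

lemma pmf_unif: "pmf (unif s) u <= 1 / 2 ^ s"
 using pmf_unif_aux[of "replicate s ()" 0 u] by (simp add: unif_def power_one_over)

lemma unif_lt: "u \<in> set_pmf (unif s) ==> u < 2 ^ s"
 using unif_less[of u "replicate s ()" 0] by (simp add: unif_def)

lemma prob_unif_less: "Pr (unif s) {u. u < j} <= j / 2 ^ s"
proof -
 have "Pr (unif s) {u. u < j} = (\<Sum>u\<in>{..<j}. pmf (unif s) u)"
  unfolding measure_measure_pmf_finite[of "{..<j}", symmetric, simplified] by (simp add: lessThan_def)
 also have "\<dots> <= (\<Sum>u\<in>{..<j}. 1 / 2 ^ s)" by (intro sum_mono pmf_unif)
 finally show ?thesis by simp
qed

lemma prob_unif_ge: "j <= 2 ^ s ==> Pr (unif s) {u. \<not> u < j} <= (2 ^ s - real j) / 2 ^ s"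
proof -
 assume j: "j <= 2 ^ s"
 have "Pr (unif s) {u. \<not> u < j} = Pr (unif s) ({u. \<not> u < j} \<inter> set_pmf (unif s))"
  by (rule measure_Int_set_pmf[symmetric])
 also have "\<dots> <= Pr (unif s) {j..<2 ^ s}"
  by (intro measure_pmf.finite_measure_mono) (auto dest: unif_lt)
 also have "\<dots> = (\<Sum>u\<in>{j..<2 ^ s}. pmf (unif s) u)" by (rule measure_measure_pmf_finite) simp
 also have "\<dots> <= (\<Sum>u\<in>{j..<2 ^ s}. 1 / 2 ^ s)" by (intro sum_mono pmf_unif)
 finally show ?thesis using j by (simp add: of_nat_diff)
qed

section \<open>The estimate as a supermartingale\<close>

definition jG :: "nat => (nat \<times> nat) list => nat => nat list => nat => nat => nat" where
 "jG S es v H F1 F0 = jsel (2 * kk S) (QQ S) (expo S F1 (length (nbrs_out es v H)) F0 (length (v # H)))"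

lemma pickG_eq: "pickG S es v H J F1 F0 u = (if u < jG S es v H F1 F0 then (nbrs_out es v H, jG S es v H F1 F0 * J)
 else (H, (QQ S - jG S es v H F1 F0) * J))"
 by (simp add: pickG_def jG_def)

lemma jG_le: "jG S es v H F1 F0 <= QQ S" by (simp add: jG_def jsel_le)

definition okS :: "nat list \<times> nat => bool" where "okS a \<longleftrightarrow> distinct (fst a) \<and> snd a > 0"

lemma stepG_okS:
 assumes a: "okS a" and a': "a' \<in> set_pmf (stepG c q e S es g a)"
 shows "okS a'"
proof (cases "fst a")
 case Nil
 then show ?thesis using assms QQ_pos by (simp add: stepG_def okS_def)
next
 case (Cons v H)
 obtain F1 F0 u where u: "u \<in> set_pmf (unif (sQ S))" and e: "a' = pickG S es v H (snd a) F1 F0 u"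
  using a' by (auto simp: stepG_def Cons)
 have "u < QQ S" using unif_lt[OF u] by (simp add: QQ_def)
 then show ?thesis using a nbrs_out_props(1)[of H es v] unfolding e pickG_eq okS_def by (auto simp: Cons)
qed

definition VS :: "nat => (nat \<times> nat) list => nat list \<times> nat => real" where
 "VS S es a = real (ZH es (fst a)) / real (snd a)"

lemma VS_nonneg: "0 <= VS S es a" by (simp add: VS_def)

text \<open>The branch of probability \<open>j / QQ S\<close> multiplies \<open>J\<close> by
  \<open>j\<close>, so the factors cancel and the branches add up to
  \<open>ZH es (nbrs_out es v H) + ZH es H\<close>, the count for \<open>v # H\<close>. This holds
  for any \<open>j\<close>, hence for any answers of the tester; a branch with factor 0 is lost,
  whence only an inequality.\<close>

lemma stepG_super:
 assumes b: "bipG es" and a: "okS a"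
 shows "(\<integral>\<^sup>+a'. ennreal (QQ S * VS S es a') \<partial>measure_pmf (stepG c q e S es g a)) <= ennreal (VS S es a)"
proof (cases "fst a")
 case Nil
 then show ?thesis using a QQ_pos[of S] by (simp add: stepG_def VS_def okS_def)
next
 case (Cons v H)
 let ?Q = "real (QQ S)" and ?J = "snd a"
 have J: "?J > 0" and vH: "v \<notin> set H" using a by (auto simp: okS_def Cons)
 have main: "(\<integral>\<^sup>+u. ennreal (?Q * VS S es (pickG S es v H ?J F1 F0 u)) \<partial>measure_pmf (unif (sQ S))) <= ennreal (VS S es a)" for F1 F0
 proof -
  define j where "j = jG S es v H F1 F0"
  have j: "j <= QQ S" by (simp add: j_def jG_le)
  define x where "x = ?Q * VS S es (nbrs_out es v H, j * ?J)"
  define y where "y = ?Q * VS S es (H, (QQ S - j) * ?J)"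
  have nn: "x >= 0" "y >= 0" by (simp_all add: x_def y_def VS_def)
  have "(\<integral>\<^sup>+u. ennreal (?Q * VS S es (pickG S es v H ?J F1 F0 u)) \<partial>measure_pmf (unif (sQ S))) =
   (\<integral>\<^sup>+u. ennreal x * indicator {u. u < j} u + ennreal y * indicator {u. \<not> u < j} u \<partial>measure_pmf (unif (sQ S)))"
   by (rule nn_integral_cong) (simp add: pickG_eq j_def[symmetric] x_def y_def indicator_def)
  also have "\<dots> = ennreal x * emeasure (measure_pmf (unif (sQ S))) {u. u < j} + ennreal y * emeasure (measure_pmf (unif (sQ S))) {u. \<not> u < j}"
   by (subst nn_integral_add) (simp_all add: nn_integral_cmult)
  also have "\<dots> = ennreal (x * Pr (unif (sQ S)) {u. u < j} + y * Pr (unif (sQ S)) {u. \<not> u < j})"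
   using nn by (simp add: measure_pmf.emeasure_eq_measure ennreal_mult)
  also have "\<dots> <= ennreal (x * (j / ?Q) + y * ((?Q - j) / ?Q))"
   using prob_unif_less[of "sQ S" j] prob_unif_ge[of j "sQ S"] j nn
   by (intro ennreal_leI add_mono mult_left_mono) (simp_all add: QQ_def)
  also have "\<dots> <= ennreal (VS S es a)"
  proof (rule ennreal_leI)
   have "x * (j / ?Q) <= ZH es (nbrs_out es v H) / ?J"
    using QQ_pos[of S] J by (cases "j = 0") (simp_all add: x_def VS_def)
   moreover have "y * ((?Q - j) / ?Q) <= ZH es H / ?J"
    using QQ_pos[of S] J j by (cases "j = QQ S") (simp_all add: y_def VS_def of_nat_diff)
   moreover have "VS S es a = ZH es (nbrs_out es v H) / ?J + ZH es H / ?J"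
    by (simp add: VS_def Cons ZH_Cons[OF b vH] add_divide_distrib)
   ultimately show "x * (j / ?Q) + y * ((?Q - j) / ?Q) <= VS S es a" by linarith
  qed
  finally show ?thesis .
 qed
 have const: "(\<integral>\<^sup>+x. f x \<partial>measure_pmf p) <= C" if "\<And>x. f x <= C" for f and p :: "nat pmf" and C :: ennreal
 proof -
  have "(\<integral>\<^sup>+x. f x \<partial>measure_pmf p) <= (\<integral>\<^sup>+x. C \<partial>measure_pmf p)" by (intro nn_integral_mono that)
  then show ?thesis by (simp add: measure_pmf.emeasure_space_1)
 qed
 have "(\<integral>\<^sup>+a'. ennreal (?Q * VS S es a') \<partial>measure_pmf (stepG c q e S es g a)) =
  (\<integral>\<^sup>+F1. (\<integral>\<^sup>+F0. (\<integral>\<^sup>+u. ennreal (?Q * VS S es (pickG S es v H ?J F1 F0 u)) \<partial>measure_pmf (unif (sQ S)))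
    \<partial>measure_pmf (FG c q e S es g (v # H))) \<partial>measure_pmf (FG c q e S es g (nbrs_out es v H)))"
  by (simp add: stepG_def Cons)
 also have "\<dots> <= ennreal (VS S es a)" by (intro const main)
 finally show ?thesis .
qed

lemma foldM_super:
 assumes b: "bipG es"
 shows "okS a ==> (\<integral>\<^sup>+a'. ennreal (QQ S ^ i * VS S es a') \<partial>measure_pmf (foldM (%_. stepG c q e S es g) (replicate i ()) a)) <= ennreal (VS S es a)"
proof (induction i arbitrary: a)
 case (Suc i)
 let ?F = "%a. foldM (%_. stepG c q e S es g) (replicate i ()) a"
 have "(\<integral>\<^sup>+a'. ennreal (QQ S ^ Suc i * VS S es a') \<partial>measure_pmf (foldM (%_. stepG c q e S es g) (replicate (Suc i) ()) a)) =
  (\<integral>\<^sup>+a1. (\<integral>\<^sup>+a'. ennreal (QQ S) * ennreal (QQ S ^ i * VS S es a') \<partial>measure_pmf (?F a1)) \<partial>measure_pmf (stepG c q e S es g a))"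
  by (simp add: ennreal_mult[symmetric] VS_def mult.assoc)
 also have "\<dots> = (\<integral>\<^sup>+a1. ennreal (QQ S) * (\<integral>\<^sup>+a'. ennreal (QQ S ^ i * VS S es a') \<partial>measure_pmf (?F a1)) \<partial>measure_pmf (stepG c q e S es g a))"
  by (simp add: nn_integral_cmult)
 also have "\<dots> <= (\<integral>\<^sup>+a1. ennreal (QQ S * VS S es a1) \<partial>measure_pmf (stepG c q e S es g a))"
 proof (rule nn_integral_mono_AE, rule AE_pmfI)
  fix a1 assume "a1 \<in> set_pmf (stepG c q e S es g a)"
  then have "okS a1" by (rule stepG_okS[OF Suc.prems])
  from mult_left_mono[OF Suc.IH[OF this], of "ennreal (QQ S)"]
  show "ennreal (QQ S) * (\<integral>\<^sup>+a'. ennreal (QQ S ^ i * VS S es a') \<partial>measure_pmf (?F a1)) <= ennreal (QQ S * VS S es a1)"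
   by (simp add: ennreal_mult VS_nonneg)
 qed
 also have "\<dots> <= ennreal (VS S es a)" by (rule stepG_super[OF b Suc.prems])
 finally show ?case .
qed simp

lemma okS_init: "okS ([0..<N], 1)" by (simp add: okS_def)

lemma rep_okS: "a \<in> set_pmf (foldM (%_. stepG c q e S es g) (replicate i ()) ([0..<N], 1)) ==> okS a"
 by (rule foldM_inv[where P = "%_. okS", OF _ okS_init]) (auto intro: stepG_okS)

lemma repG_pos: "J \<in> set_pmf (repG c q e S N es g) ==> J > 0"
 using rep_okS[of _ c q e S es g N N] unfolding repG_def by (auto simp: okS_def)

text \<open>Markov's inequality for the supermartingale \<open>Q\<^sup>i Z(H) / J\<close>.\<close>

lemma repG_lower:
 assumes b: "bipG es"
 shows "Pr (repG c q e S N es g) {J. real J < exp (- \<rho>) * QQ S ^ N / ZH es [0..<N]} <= exp (- \<rho>)"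
proof -
 let ?F = "foldM (%_. stepG c q e S es g) (replicate N ()) ([0..<N], 1)" and ?Z = "real (ZH es [0..<N])"
 let ?B = "{J. real J < exp (- \<rho>) * QQ S ^ N / ?Z}" and ?c = "exp (- \<rho>) / ?Z"
 have Z: "?Z > 0" using ZH_pos by simp
 have "emeasure (measure_pmf (repG c q e S N es g)) ?B = emeasure (measure_pmf ?F) (snd -` ?B)"
  unfolding repG_def by simp
 also have "\<dots> = (\<integral>\<^sup>+a. indicator (snd -` ?B) a \<partial>measure_pmf ?F)" by simp
 also have "\<dots> <= (\<integral>\<^sup>+a. ennreal ?c * ennreal (QQ S ^ N * VS S es a) \<partial>measure_pmf ?F)"
 proof (rule nn_integral_mono_AE, rule AE_pmfI)
  fix a assume "a \<in> set_pmf ?F"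
  then have J: "snd a > 0" using rep_okS[of a] by (simp add: okS_def)
  show "indicator (snd -` ?B) a <= ennreal ?c * ennreal (QQ S ^ N * VS S es a)"
  proof (cases "snd a \<in> ?B")
   case True
   have "1 <= ?c * (QQ S ^ N / real (snd a))" using True J Z by (simp add: field_simps)
   also have "\<dots> <= ?c * (QQ S ^ N * VS S es a)"
   proof (rule mult_left_mono)
    have "1 <= real (ZH es (fst a))" using ZH_pos[of es "fst a"] by simp
    then have "real (QQ S) ^ N * 1 <= real (QQ S) ^ N * real (ZH es (fst a))" by (rule mult_left_mono) simp
    then have "real (QQ S) ^ N * 1 / real (snd a) <= real (QQ S) ^ N * real (ZH es (fst a)) / real (snd a)"
     by (rule divide_right_mono) simp
    then show "QQ S ^ N / real (snd a) <= QQ S ^ N * VS S es a" by (simp only: VS_def mult_1_right times_divide_eq_right of_nat_power)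
   qed (use Z in simp)
   finally have "ennreal 1 <= ennreal (?c * (QQ S ^ N * VS S es a))" by (rule ennreal_leI)
   also have "\<dots> = ennreal ?c * ennreal (QQ S ^ N * VS S es a)" by (rule ennreal_mult) (use Z VS_nonneg in auto)
   finally show ?thesis using True by simp
  qed simp
 qed
 also have "\<dots> = ennreal ?c * (\<integral>\<^sup>+a. ennreal (QQ S ^ N * VS S es a) \<partial>measure_pmf ?F)" by (rule nn_integral_cmult) simp
 also have "\<dots> <= ennreal ?c * ennreal (VS S es ([0..<N], 1))" by (intro mult_left_mono foldM_super[OF b okS_init]) simp
 also have "\<dots> = ennreal (exp (- \<rho>))" using Z by (simp add: ennreal_mult[symmetric] VS_def)
 finally show ?thesis by (simp add: measure_pmf.emeasure_eq_measure)
qed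

lemma max_tail:
 fixes lo \<tau> :: real
 assumes p: "Pr p {J. real J < lo} <= \<tau>"
 shows "Pr (foldM (%_ w. bind_pmf p (%J. return_pmf (if w < J then J else w))) ys a) {w. real w < lo} <= \<tau> ^ length ys"
proof (induction ys arbitrary: a)
 case (Cons y ys)
 let ?F = "foldM (%_ w. bind_pmf p (%J. return_pmf (if w < J then J else w))) ys" and ?B = "{w. real w < lo}"
 have t0: "0 <= \<tau>" using p measure_nonneg order_trans by blast
 have big: "Pr (?F a) ?B = 0" if "\<not> real a < lo" for a
 proof -
  have "\<not> real w < lo" if "w \<in> set_pmf (?F a)" for w
   by (rule foldM_inv[where P = "%_ w. \<not> real w < lo" and g = "%_ w. bind_pmf p (%J. return_pmf (if w < J then J else w))", OF _ _ that])
    (use \<open>\<not> real a < lo\<close> in \<open>auto split: if_splits\<close>)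
  then show ?thesis by (auto simp: measure_pmf_zero_iff)
 qed
 have "emeasure (measure_pmf (bind_pmf p (%J. ?F (if a < J then J else a)))) ?B = (\<integral>\<^sup>+J. emeasure (measure_pmf (?F (if a < J then J else a))) ?B \<partial>measure_pmf p)"
  by (rule emeasure_bind_pmf)
 also have "\<dots> <= (\<integral>\<^sup>+J. ennreal (\<tau> ^ length ys) * indicator ?B J \<partial>measure_pmf p)"
 proof (rule nn_integral_mono)
  fix J
  show "emeasure (measure_pmf (?F (if a < J then J else a))) ?B <= ennreal (\<tau> ^ length ys) * indicator ?B J"
  proof (cases "real J < lo")
   case True
   then show ?thesis using Cons.IH by (simp add: measure_pmf.emeasure_eq_measure ennreal_leI)
  next
   case False
   then have "\<not> real (if a < J then J else a) < lo" by (auto split: if_splits)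
   then show ?thesis using big by (simp add: measure_pmf.emeasure_eq_measure)
  qed
 qed
 also have "\<dots> = ennreal (\<tau> ^ length ys) * emeasure (measure_pmf p) ?B" by (rule nn_integral_cmult_indicator) simp
 also have "\<dots> = ennreal (\<tau> ^ length ys * Pr p ?B)" using t0 by (simp add: measure_pmf.emeasure_eq_measure ennreal_mult)
 also have "\<dots> <= ennreal (\<tau> ^ length ys * \<tau>)" using p t0 by (intro ennreal_leI mult_left_mono) auto
 finally have "Pr (bind_pmf p (%J. ?F (if a < J then J else a))) ?B <= \<tau> ^ length ys * \<tau>"
  using t0 by (simp add: measure_pmf.emeasure_eq_measure)
 then show ?case by (simp add: bind_assoc_pmf bind_return_pmf mult.commute)
qed simp

lemma worstG_pos: "S > 0 ==> J \<in> set_pmf (worstG c q e S N es g) ==> J > 0"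
proof -
 assume S: "S > 0" and J: "J \<in> set_pmf (worstG c q e S N es g)"
 have "0 + length (replicate (S ^ 3) ()) > 0 --> J > 0"
 proof (rule foldM_inv[where P = "%i w. i > 0 --> w > 0", OF _ _ J[unfolded worstG_def]])
  fix i :: nat and y :: unit and w w' assume "w' \<in> set_pmf (bind_pmf (repG c q e S N es g) (%J. return_pmf (if w < J then J else w)))"
  then obtain J where J: "J \<in> set_pmf (repG c q e S N es g)" "w' = (if w < J then J else w)" by auto
  then show "0 < Suc i --> 0 < w'" using repG_pos[OF J(1)] by auto
 qed simp
 then show ?thesis using S by simp
qed

section \<open>The correct guess does not underestimate the count\<close>

context
 fixes c q e S N es g and \<eta> \<kappa> :: real
 assumes bip: "bipG es" and NS: "N < S" and \<kappa>: "1 <= \<kappa>" "real S ^ (e + 2) <= \<kappa> ^ (2 * kk S)"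
  and acc: "\<And>H. distinct H ==> set H \<subseteq> {..<N} ==> Pr (FG c q e S es g H) {F. \<not> accG S e es H F} <= \<eta>"
begin

abbreviation "LQ \<equiv> (\<kappa> + 2 / QQ S) * QQ S"

text \<open>With \<open>r\<close> steps left, J times the full count is at most
  \<open>LQ ^ (N - r)\<close> times the count of the current list, multiplied out to avoid the
  subtraction. At the end the list is empty and its count is 1.\<close>

definition invG :: "nat => nat list \<times> nat => bool" where
 "invG r a \<longleftrightarrow> distinct (fst a) \<and> set (fst a) \<subseteq> {..<N} \<and> length (fst a) <= r \<and>
  real (snd a) * real (ZH es [0..<N]) * LQ ^ r <= LQ ^ N * real (ZH es (fst a))"

lemma eta_nonneg: "0 <= \<eta>"
proof -
 have "Pr (FG c q e S es g []) {F. \<not> accG S e es [] F} <= \<eta>" by (rule acc) simp_all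
 then show ?thesis by (rule order_trans[OF measure_nonneg])
qed

lemma LQ_ge: "real (QQ S) <= LQ" "0 < LQ"
proof -
 have "1 * real (QQ S) <= LQ" using \<kappa>(1) by (intro mult_right_mono) (simp_all add: add_increasing2)
 then show "real (QQ S) <= LQ" by simp
 then show "0 < LQ" using QQ_pos[of S] by (meson less_le_trans of_nat_0_less_iff)
qed

lemma pick_inv:
 assumes a: "invG (Suc r) (v # H, J)" and F: "accG S e es (nbrs_out es v H) F1" "accG S e es (v # H) F0"
 shows "invG r (pickG S es v H J F1 F0 u)"
proof -
 let ?H1 = "nbrs_out es v H" and ?ZG = "real (ZH es [0..<N])" and ?Q = "real (QQ S)"
 define j where "j = jG S es v H F1 F0"
 have d: "distinct (v # H)" "set (v # H) \<subseteq> {..<N}" "length H <= r" and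
  I: "J * ?ZG * LQ ^ Suc r <= LQ ^ N * ZH es (v # H)" using a by (auto simp: invG_def)
 have d1: "distinct ?H1" "set ?H1 \<subseteq> {..<N}" "length ?H1 <= r" using d nbrs_out_props(1)[of H es v] nbrs_out_props(2,3)[of es v H] by auto
 have sub: "set (v # H) \<subseteq> {..<S}" "set ?H1 \<subseteq> {..<S}" using d(2) d1(2) NS by auto
 have S: "S > 0" using NS by simp
 note ja = jsel_accurate[OF bip sub(1) d(1) sub(2) d1(1) S \<kappa> F j_def[unfolded jG_def]]
 have Zc: "real (ZH es (v # H)) = real (ZH es ?H1) + real (ZH es H)" using ZH_Cons[OF bip, of v H] d by simp
 have Z1: "real (ZH es ?H1) > 0" "real (ZH es ?H1) <= ZH es H" using ZH_pos ZH_mono[OF nbrs_out_props(2)] by simp_all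
 have Z0: "real (ZH es (v # H)) > 0" using ZH_pos by simp
 have u1: "real j * ZH es (v # H) <= LQ * ZH es ?H1"
 proof -
  have "\<kappa> * ?Q * ZH es ?H1 <= LQ * ZH es ?H1" using QQ_pos[of S] by (intro mult_right_mono) auto
  then show ?thesis using ja(1) by linarith
 qed
 have u2: "(?Q - j) * ZH es (v # H) <= LQ * ZH es H"
  unfolding Zc by (rule complement_accurate[OF \<kappa>(1) _ Z1]) (use ja(2) QQ_pos[of S] Zc in auto)
 \<comment> \<open>The common form of both branches: combine a branch estimate with the invariant
   and cancel the positive count of \<open>v # H\<close>.\<close>
 have step: "x * J * ?ZG * LQ ^ r <= LQ ^ N * z" if x: "x * ZH es (v # H) <= LQ * z" "z >= 0" for x z :: real
 proof -
  have "(x * J * ?ZG * LQ ^ r) * ZH es (v # H) = (x * ZH es (v # H)) * (J * ?ZG * LQ ^ r)" by (simp only: mult_ac)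
  also have "\<dots> <= (LQ * z) * (J * ?ZG * LQ ^ r)" using x(1) LQ_ge(2) by (intro mult_right_mono) auto
  also have "\<dots> = z * (J * ?ZG * LQ ^ Suc r)" by (simp only: power_Suc mult_ac)
  also have "\<dots> <= z * (LQ ^ N * ZH es (v # H))" by (rule mult_left_mono[OF I x(2)])
  also have "\<dots> = (LQ ^ N * z) * ZH es (v # H)" by (simp only: mult_ac)
  finally show ?thesis using Z0 by (rule mult_right_le_imp_le)
 qed
 show ?thesis
 proof (cases "u < j")
  case True
  have "real (j * J) * ?ZG * LQ ^ r <= LQ ^ N * ZH es ?H1" unfolding of_nat_mult by (rule step[OF u1]) simp
  then show ?thesis using True d1 unfolding pickG_eq j_def[symmetric] invG_def by simp
 next
  case False
  have "real ((QQ S - j) * J) * ?ZG * LQ ^ r <= LQ ^ N * ZH es H"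
   using step[OF u2] jG_le[of S es v H F1 F0] unfolding of_nat_mult j_def[symmetric] by (simp add: of_nat_diff)
  then show ?thesis using False d unfolding pickG_eq j_def[symmetric] invG_def by simp
 qed
qed

text \<open>A step calls \<open>FG\<close> twice, hence \<open>2 * \<eta>\<close>; once both counts
  are accurate, every random number \<open>u\<close> preserves the invariant.\<close>

lemma stepG_bad:
 assumes a: "invG (Suc r) a"
 shows "Pr (stepG c q e S es g a) {a'. \<not> invG r a'} <= 2 * \<eta>"
proof (cases "fst a")
 case Nil
 have "invG r ([], QQ S * snd a)"
 proof -
  have "real (QQ S * snd a) * ZH es [0..<N] * LQ ^ r = QQ S * (real (snd a) * real (ZH es [0..<N]) * LQ ^ r)" by (simp only: of_nat_mult mult_ac)
  also have "\<dots> <= LQ * (real (snd a) * real (ZH es [0..<N]) * LQ ^ r)" using LQ_ge by (intro mult_right_mono) auto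
  also have "\<dots> = real (snd a) * real (ZH es [0..<N]) * LQ ^ Suc r" by (simp only: power_Suc mult_ac)
  also have "\<dots> <= LQ ^ N * ZH es []" using a by (simp add: invG_def Nil)
  finally show ?thesis by (simp add: invG_def)
 qed
 then show ?thesis using eta_nonneg by (simp add: stepG_def Nil)
next
 case (Cons v H)
 have ac: "a = (v # H, snd a)" using Cons by (metis prod.collapse)
 have d: "distinct (v # H)" "set (v # H) \<subseteq> {..<N}" using a Cons by (auto simp: invG_def)
 have d1: "distinct (nbrs_out es v H)" "set (nbrs_out es v H) \<subseteq> {..<N}" using d nbrs_out_props(1)[of H es v] nbrs_out_props(2,3)[of es v H] by auto
 have "Pr (stepG c q e S es g a) {a'. \<not> invG r a'} <= \<eta> + (\<eta> + 0)"
  unfolding stepG_def Cons list.case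
 proof (rule prob_bind_le[where bad = "%F. \<not> accG S e es (nbrs_out es v H) F"], rule acc[OF d1], simp add: eta_nonneg)
  fix F1 assume F1: "\<not> \<not> accG S e es (nbrs_out es v H) F1"
  show "Pr (bind_pmf (FG c q e S es g (v # H)) (%F0. bind_pmf (unif (sQ S)) (%u. return_pmf (pickG S es v H (snd a) F1 F0 u)))) {a'. \<not> invG r a'} <= \<eta> + 0"
  proof (rule prob_bind_le[where bad = "%F. \<not> accG S e es (v # H) F"], rule acc[OF d], simp)
   fix F0 assume F0: "\<not> \<not> accG S e es (v # H) F0"
   have "invG r (pickG S es v H (snd a) F1 F0 u)" for u by (rule pick_inv) (use a ac F1 F0 in simp_all)
   then show "Pr (bind_pmf (unif (sQ S)) (%u. return_pmf (pickG S es v H (snd a) F1 F0 u))) {a'. \<not> invG r a'} <= 0"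
    by (intro prob_bind_le0) simp_all
  qed
 qed
 then show ?thesis by simp
qed

lemma repG_upper:
 "Pr (repG c q e S N es g) {J. \<not> real J * ZH es [0..<N] <= LQ ^ N} <= N * (2 * \<eta>)"
proof -
 let ?F = "foldM (%_. stepG c q e S es g) (replicate N ()) ([0..<N], 1)"
 have "Pr ?F {a. \<not> invG (length ([]::unit list)) a} <= length (replicate N ()) * (2 * \<eta>)"
 proof (rule foldM_bad[where P = "%ys. invG (length ys)"])
  show "invG (length (replicate N ())) ([0..<N], 1)" by (auto simp: invG_def)
 qed (use stepG_bad eta_nonneg in simp_all)
 moreover have "real (snd a) * ZH es [0..<N] <= LQ ^ N" if "invG 0 a" for a
  using that by (auto simp: invG_def ZH_Nil)
 then have "Pr (repG c q e S N es g) {J. \<not> real J * ZH es [0..<N] <= LQ ^ N} <= Pr ?F {a. \<not> invG 0 a}"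
  unfolding repG_def measure_map_pmf by (intro measure_pmf.finite_measure_mono) auto
 ultimately show ?thesis by simp
qed

lemma worstG_upper:
 "Pr (worstG c q e S N es g) {J. \<not> real J * ZH es [0..<N] <= LQ ^ N} <= real (S ^ 3) * (N * (2 * \<eta>))"
proof -
 let ?P = "%ys J. real J * ZH es [0..<N] <= LQ ^ N"
 have "Pr (worstG c q e S N es g) {J. \<not> ?P [] J} <= length (replicate (S ^ 3) ()) * (N * (2 * \<eta>))"
  unfolding worstG_def
 proof (rule foldM_bad[where P = ?P])
  fix w :: nat assume w: "real w * ZH es [0..<N] <= LQ ^ N"
  show "Pr (bind_pmf (repG c q e S N es g) (%J. return_pmf (if w < J then J else w))) {w. \<not> real w * ZH es [0..<N] <= LQ ^ N} <= N * (2 * \<eta>)"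
  proof (rule order_trans[OF prob_bind_le[OF repG_upper, where b = 0]])
   fix J assume "\<not> \<not> real J * ZH es [0..<N] <= LQ ^ N"
   then show "Pr (return_pmf (if w < J then J else w)) {w. \<not> real w * ZH es [0..<N] <= LQ ^ N} <= 0" using w by auto
  qed simp_all
 next
  show "real 0 * ZH es [0..<N] <= LQ ^ N" using LQ_ge(2) by simp
 qed (use eta_nonneg in simp)
 then show ?thesis by simp
qed

text \<open>The lower bound on \<open>J\<close> must hold for all guesses and is paid by a union
  bound. The upper bound rests on the guess \<open>g\<close> alone: it holds right after
  \<open>g\<close> is processed, and taking minima keeps it. Each part may fail with probability
  1/8.\<close>

lemma bestG_ok:
 assumes g: "g \<in> set (guesses q S)" and L\<rho>: "(\<kappa> + 2 / QQ S) ^ N <= exp \<rho>" and \<eta>8: "real (S ^ 3) * (N * (2 * \<eta>)) <= 1/8"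
  and gs: "length (guesses q S) * exp (- \<rho>) ^ (S ^ 3) <= 1/8"
 shows "Pr (bestG c q e S N es) {J. J > 0 \<and> exp (- \<rho>) * ZH es [0..<N] <= real (QQ S ^ N) / real J \<and>
  real (QQ S ^ N) / real J <= exp \<rho> * ZH es [0..<N]} >= 3/4"
proof -
 let ?Z = "real (ZH es [0..<N])" and ?Q = "real (QQ S)"
 let ?g = "%g bst. bind_pmf (worstG c q e S N es g) (%J. return_pmf (if bst = 0 \<or> J < bst then J else bst))"
 have S: "S > 0" using NS by simp
 have Z: "?Z > 0" using ZH_pos by simp
 define lo where "lo = exp (- \<rho>) * ?Q ^ N / ?Z"
 define hi where "hi J \<longleftrightarrow> J > 0 \<and> real J * ?Z <= LQ ^ N" for J :: nat
 have "Pr (worstG c q e S N es g') {J. real J < lo} <= exp (- \<rho>) ^ (S ^ 3)" for g'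
  using max_tail[OF repG_lower[OF bip, of c q e S N g' \<rho>], of "replicate (S ^ 3) ()" 0] by (simp add: worstG_def lo_def)
 then have low1: "Pr (?g g' bst) {J. \<not> (J = 0 \<or> lo <= real J)} <= exp (- \<rho>) ^ (S ^ 3)" if "bst = 0 \<or> lo <= real bst" for g' bst
  by (rule order_trans[OF prob_bind_le[where b = 0 and bad = "%J. real J < lo"]]) (use that in auto)
 have "Pr (bestG c q e S N es) {J. \<not> (J = 0 \<or> lo <= real J)} <= length (guesses q S) * exp (- \<rho>) ^ (S ^ 3)"
  unfolding bestG_def by (rule foldM_bad[where P = "%_ J. J = 0 \<or> lo <= real J"]) (use low1 in auto)
 then have low: "Pr (bestG c q e S N es) {J. \<not> (J = 0 \<or> lo <= real J)} <= 1/8" using gs by linarith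
 obtain xs ys where xy: "guesses q S = xs @ g # ys" using g by (meson split_list)
 have keep: "Pr (foldM ?g ys a) {J. \<not> hi J} <= 0" if "hi a" for a
 proof -
  have "hi J" if "J \<in> set_pmf (foldM ?g ys a)" for J
  proof (rule foldM_inv[where P = "%_. hi", OF _ \<open>hi a\<close> that])
   fix i :: nat and y bst J' assume b: "hi bst" and "J' \<in> set_pmf (?g y bst)"
   then obtain J where J: "J \<in> set_pmf (worstG c q e S N es y)" "J' = (if bst = 0 \<or> J < bst then J else bst)" by auto
   have "J > 0" by (rule worstG_pos[OF S J(1)])
   moreover have "real J * ?Z <= real bst * ?Z" if "J < bst" using that by (intro mult_right_mono) auto
   ultimately show "hi J'" using b unfolding J(2) hi_def by auto
  qed
  then have "set_pmf (foldM ?g ys a) \<inter> {J. \<not> hi J} = {}" by blast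
  then have "Pr (foldM ?g ys a) {J. \<not> hi J} = 0" unfolding measure_pmf_zero_iff .
  then show ?thesis by simp
 qed
 have hit: "Pr (?g g a) {J. \<not> hi J} <= 1/8" for a
 proof -
  have "Pr (worstG c q e S N es g) {J. \<not> real J * ?Z <= LQ ^ N} <= 1/8" using worstG_upper \<eta>8 by linarith
  from prob_bind_le[OF this, where b = 0 and f = "%J. return_pmf (if a = 0 \<or> J < a then J else a)" and B = "{J. \<not> hi J}"]
  have "(\<And>J. J \<in> set_pmf (worstG c q e S N es g) ==> \<not> \<not> real J * ?Z <= LQ ^ N ==>
   Pr (return_pmf (if a = 0 \<or> J < a then J else a)) {J. \<not> hi J} <= 0) ==> ?thesis" by simp
  moreover have "Pr (return_pmf (if a = 0 \<or> J < a then J else a)) {J. \<not> hi J} <= 0"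
   if "J \<in> set_pmf (worstG c q e S N es g)" "\<not> \<not> real J * ?Z <= LQ ^ N" for J
  proof -
   have "J > 0" by (rule worstG_pos[OF S that(1)])
   moreover have "real a * ?Z <= real J * ?Z" if "\<not> J < a" using that by (intro mult_right_mono) auto
   ultimately have "hi (if a = 0 \<or> J < a then J else a)" using that(2) unfolding hi_def by auto
   then show ?thesis by simp
  qed
  ultimately show ?thesis by blast
 qed
 have fa: "foldM f (us @ vs) a = bind_pmf (foldM f us a) (foldM f vs)" for f :: "guess => nat => nat pmf" and us vs a
  by (induction us arbitrary: a) (auto simp: bind_return_pmf bind_assoc_pmf intro!: bind_pmf_cong)
 have "Pr (bestG c q e S N es) {J. \<not> hi J} <= 1/8 + 0"
  unfolding bestG_def xy fa
 proof (rule prob_bind_le0)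
  fix a
  have "Pr (bind_pmf (?g g a) (foldM ?g ys)) {J. \<not> hi J} <= 1/8 + 0"
   by (rule prob_bind_le[OF hit]) (use keep in auto)
  then show "Pr (foldM ?g (g # ys) a) {J. \<not> hi J} <= 1/8 + 0" by simp
 qed simp
 then have up: "Pr (bestG c q e S N es) {J. \<not> hi J} <= 1/8" by simp
 let ?G = "{J. J > 0 \<and> exp (- \<rho>) * ?Z <= real (QQ S ^ N) / real J \<and> real (QQ S ^ N) / real J <= exp \<rho> * ?Z}"
 have ee: "exp (- \<rho>) * (exp \<rho> * x) = x" "exp \<rho> * (exp (- \<rho>) * x) = x" for x :: real
  using exp_minus_inverse[of \<rho>] by (simp_all add: mult.assoc[symmetric] mult.commute[of "exp (- \<rho>)"])
 have "- ?G \<subseteq> {J. \<not> (J = 0 \<or> lo <= real J)} \<union> {J. \<not> hi J}"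
 proof
  fix J assume J: "J \<in> - ?G"
  show "J \<in> {J. \<not> (J = 0 \<or> lo <= real J)} \<union> {J. \<not> hi J}"
  proof (rule ccontr)
   assume "J \<notin> {J. \<not> (J = 0 \<or> lo <= real J)} \<union> {J. \<not> hi J}"
   then have h: "J > 0" "real J * ?Z <= LQ ^ N" "lo <= real J" by (auto simp: hi_def)
   have "real J * ?Z <= exp \<rho> * ?Q ^ N"
   proof -
    have "LQ ^ N <= exp \<rho> * ?Q ^ N" unfolding power_mult_distrib by (rule mult_right_mono[OF L\<rho>]) simp
    then show ?thesis using h(2) by linarith
   qed
   then have "exp (- \<rho>) * (real J * ?Z) <= exp (- \<rho>) * (exp \<rho> * ?Q ^ N)" by (rule mult_left_mono) simp
   then have "exp (- \<rho>) * ?Z * real J <= ?Q ^ N" unfolding ee by (simp only: mult_ac)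
   then have 1: "exp (- \<rho>) * ?Z <= real (QQ S ^ N) / real J" using h(1) by (simp add: le_divide_eq)
   have "exp (- \<rho>) * ?Q ^ N <= real J * ?Z" using h(3) Z by (simp add: lo_def divide_le_eq)
   then have "exp \<rho> * (exp (- \<rho>) * ?Q ^ N) <= exp \<rho> * (real J * ?Z)" by (rule mult_left_mono) simp
   then have "?Q ^ N <= exp \<rho> * ?Z * real J" unfolding ee by (simp only: mult_ac)
   then have 2: "real (QQ S ^ N) / real J <= exp \<rho> * ?Z" using h(1) by (simp add: divide_le_eq)
   show False using J h(1) 1 2 by blast
  qed
 qed
 then have "Pr (bestG c q e S N es) (- ?G) <= Pr (bestG c q e S N es) ({J. \<not> (J = 0 \<or> lo <= real J)} \<union> {J. \<not> hi J})"
  by (intro measure_pmf.finite_measure_mono) auto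
 also have "\<dots> <= Pr (bestG c q e S N es) {J. \<not> (J = 0 \<or> lo <= real J)} + Pr (bestG c q e S N es) {J. \<not> hi J}"
  by (rule measure_Un_le) auto
 finally have "Pr (bestG c q e S N es) (- ?G) <= 1/4" using low up by linarith
 moreover have "Pr (bestG c q e S N es) (- ?G) = 1 - Pr (bestG c q e S N es) ?G"
  using measure_pmf.prob_compl[of ?G "bestG c q e S N es"] by (simp add: Compl_eq_Diff_UNIV)
 ultimately show ?thesis by linarith
qed

end

section \<open>The tester on the correct guess\<close>

text \<open>With u = 1/(10 T) this is (1 - 2 u) (1 + u)^2 = 1 - 3 u^2 - 2 u^3 <= 1; one factor 1 + u
  stands for the nontrivial phase, the other for the Peierls error.\<close>

lemma domination_bound:
 fixes c D T P :: real
 assumes T: "1 <= T" and c: "0 < c" "c <= P * (1 + 1 / (10 * T))" and D: "0 < D" "D <= 1 + 1 / (10 * T)" and P: "0 < P"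
 shows "1 - 1 / (5 * T) <= P / (c * D)"
proof -
 define u where "u = 1 / (10 * T)"
 have u: "0 < u" "2 * u <= 1" "1 / (5 * T) = 2 * u" using T by (auto simp: u_def field_simps)
 have "c * D <= (P * (1 + u)) * (1 + u)" using c D P u unfolding u_def[symmetric] by (intro mult_mono) auto
 then have "(1 - 2 * u) * (c * D) <= (1 - 2 * u) * ((P * (1 + u)) * (1 + u))" using u by (intro mult_left_mono) auto
 also have "\<dots> = P * (1 - (3 * u ^ 2 + 2 * u ^ 3))" by (simp add: power2_eq_square power3_eq_cube algebra_simps)
 also have "\<dots> <= P * 1"
 proof (rule mult_left_mono)
  have "0 <= 3 * u ^ 2 + 2 * u ^ 3" using u(1) by (intro add_nonneg_nonneg) auto
  then show "1 - (3 * u ^ 2 + 2 * u ^ 3) <= 1" by linarith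
 qed (use P in simp)
 finally show ?thesis unfolding u(3) using c D by (simp add: le_divide_eq)
qed

text \<open>Bernoulli: (1 - 1/(5 T))^t >= 1 - t/(5 T) >= 4/5.\<close>

lemma domination_power:
 fixes T \<kappa> :: real
 assumes "1 - 1 / (5 * T) <= \<kappa>" "real t <= T" "1 <= T"
 shows "4/5 <= \<kappa> ^ t"
proof -
 have "4/5 <= 1 + real t * (- 1 / (5 * T))" using assms by (simp add: field_simps)
 also have "\<dots> <= (1 + - 1 / (5 * T)) ^ t" by (rule Bernoulli_inequality) (use assms in \<open>simp add: field_simps\<close>)
 also have "\<dots> <= \<kappa> ^ t" using assms by (intro power_mono) (simp_all add: field_simps)
 finally show ?thesis .
qed

lemma ex_prefix: "\<exists>M\<le>A. (\<forall>m. 1 <= m --> m <= M --> T m) \<and> (M = A \<or> \<not> T (Suc M))" for A :: nat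
proof (induction A)
 case (Suc A)
 then obtain M where M: "M <= A" "\<And>m. 1 <= m ==> m <= M ==> T m" "M = A \<or> \<not> T (Suc M)" by blast
 show ?case
 proof (cases "M = A \<and> T (Suc A)")
  case True
  then have "T m" if "1 <= m" "m <= Suc A" for m using M(2)[of m] that by (cases "m = Suc A") auto
  then show ?thesis by (intro exI[of _ "Suc A"]) simp
 next
  case False
  then show ?thesis using M by (intro exI[of _ M]) auto
 qed
qed simp

lemma tv_dist_ge: "tv_dist \<mu> \<nu> >= Pr \<nu> B - Pr \<mu> B"
proof -
 have "\<bar>Pr \<mu> B - Pr \<nu> B\<bar> <= tv_dist \<mu> \<nu>" unfolding tv_dist_def
 proof (rule cSUP_upper)
  show "bdd_above (range (%A. \<bar>Pr \<mu> A - Pr \<nu> A\<bar>))"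
  proof (rule bdd_aboveI2[of _ _ 1])
   fix A
   have "0 <= Pr \<mu> A" "Pr \<mu> A <= 1" "0 <= Pr \<nu> A" "Pr \<nu> A <= 1" by simp_all
   then show "\<bar>Pr \<mu> A - Pr \<nu> A\<bar> <= 1" by linarith
  qed
 qed simp
 then show ?thesis by linarith
qed

section \<open>Answers of the tester to fake samples\<close>

definition nS :: "nat => nat => nat" where "nS q S = vnum (AA S) (CC S) S (bmx q S)"

definition mdl :: "nat => nat => guess => (nat => nat => bool) => potts" where
 "mdl q S g Rel = wire_potts (AA S) (CC S) S (bmx q S) (snd (snd g)) Rel (real_of_rat (wtG g)) (real_of_rat (phG g))"

definition deltaG :: "nat => guess => real" where
 "deltaG S g = wire_model.delta (AA S) (CC S) S (snd (snd g)) (real_of_rat (wtG g)) (real_of_rat (phG g))"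

lemma wtG_props: "0 < real_of_rat (wtG g)" "0 < real_of_rat (phG g)" "real_of_rat (phG g) <= 1" "real_of_rat (phG g) <= real_of_rat (wtG g)"
 by (auto simp: wtG_def phG_def)

context
 fixes c p q e S es g d and \<epsilon> \<beta> :: real
 assumes S10: "10 <= S" and \<epsilon>: "0 < \<epsilon>" "8 / \<epsilon> <= S" and \<epsilon>1: "\<epsilon> < 1" and e1: "1 <= e"
  and b1: "1 <= snd (snd g)" and bb: "snd (snd g) <= bmx q S" and bd: "2 * snd (snd g) + 1 <= d"
  and w\<beta>: "real_of_rat (wtG g) <= \<beta>"
  and dl: "(1 + deltaG S g) ^ (AA S + CC S) <= 1 + 1 / (10 * real S ^ e)"
  and A2: "10 * real S ^ e <= 2 ^ AA S"
  and tester: "\<forall>M\<in>inconsistent_ferro_RBMs (nS q S) d \<beta> 1. \<forall>M'\<in>inconsistent_ferro_RBMs (nS q S) d \<beta> 1. \<forall>X. describes X M -->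
    (let inp = enc_ising X;
      t = poly p (size inp);
      D = map_pmf (enc_config (nS q S)) (ising_gibbs M')
    in halts_within D c inp t \<and>
      (ising_gibbs M = ising_gibbs M' -->
       Pr (output_dist D c inp t) {enc_bool True} >= 3/4) \<and>
      (tv_dist (ising_gibbs M) (ising_gibbs M') >= 1 - \<epsilon> -->
       Pr (output_dist D c inp t) {enc_bool False} >= 3/4))"
  and clock: "\<And>H m. poly p (size (enc_ising (descG q S es g H m))) <= S ^ e"
begin

lemma wm: "wire_model (AA S) (CC S) S (bmx q S) (snd (snd g)) (real_of_rat (wtG g)) (real_of_rat (phG g))"
proof
 show A: "0 < AA S" "0 < CC S" "0 < S" using S10 by (simp_all add: AA_def CC_def kk_def)
 have "2 <= CC S * S" using S10 A unfolding CC_def AA_def by simp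
 then have "1 * 2 <= AA S * (CC S * S)" using A by (intro mult_mono) auto
 then show "2 <= AA S * CC S * S" by (simp add: mult.assoc)
qed (use b1 bb wtG_props in auto)

lemma Se: "1 <= real S ^ e" "10 <= real S ^ e"
proof -
 have "real S <= real S ^ e" using power_increasing[of 1 e "real S"] S10 e1 by simp
 moreover have "10 <= real S" using S10 by simp
 ultimately show "10 <= real S ^ e" by linarith
 then show "1 <= real S ^ e" by simp
qed

lemma family:
 assumes "u < AA S" "v < CC S" "Rel u v"
 shows "mdl q S g Rel \<in> inconsistent_ferro_RBMs (nS q S) d \<beta> 1"
 unfolding mdl_def nS_def
 by (rule wire_model.M_in_family[where u = u and v = v and Rel = Rel, OF wm assms bd w\<beta>])
  (use wtG_props[of g] w\<beta> in linarith)+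

lemma D_bounds: "0 < (1 + deltaG S g) ^ (AA S + CC S)"
 unfolding deltaG_def by (rule wire_model.delta_power_pos[OF wm])

lemma few_rel_pairs:
 assumes "real (card (rel_pairs (AA S) (CC S) Rel)) <= 2 ^ CC S * (1 + 1 / (10 * real S ^ e))"
 shows "1 - 1 / (5 * real S ^ e) <= 2 ^ CC S / (card (rel_pairs (AA S) (CC S) Rel) * (1 + deltaG S g) ^ (AA S + CC S))"
 by (rule domination_bound[OF Se(1) _ assms D_bounds dl]) (use wire_model.rel_pairs_pos[OF wm] in simp_all)

text \<open>The fakes pass for samples of any hidden model whose relation leaves the nontrivial
  phase small. The lemma is applied with the visible relation as the hidden one for acceptance, and
  with the relation of all pairs for rejection.\<close>

lemma sim_correct:
 assumes M: "mdl q S g (relG S (kk S) es H m) \<in> inconsistent_ferro_RBMs (nS q S) d \<beta> 1"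
  and M': "mdl q S g Rel \<in> inconsistent_ferro_RBMs (nS q S) d \<beta> 1"
  and few: "real (card (rel_pairs (AA S) (CC S) Rel)) <= 2 ^ CC S * (1 + 1 / (10 * real S ^ e))"
  and v: "v \<and> ising_gibbs (mdl q S g (relG S (kk S) es H m)) = ising_gibbs (mdl q S g Rel) \<or>
   \<not> v \<and> tv_dist (ising_gibbs (mdl q S g (relG S (kk S) es H m))) (ising_gibbs (mdl q S g Rel)) >= 1 - \<epsilon>"
 shows "Pr (simG c q e S es g H m) {b. b ~= v} <= 5/16"
proof -
 define \<kappa> where "\<kappa> = 2 ^ CC S / (card (rel_pairs (AA S) (CC S) Rel) * (1 + deltaG S g) ^ (AA S + CC S))"
 define inp where "inp = enc_ising (descG q S es g H m)"
 define t where "t = poly p (size inp)"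
 define D where "D = map_pmf (enc_config (nS q S)) (ising_gibbs (mdl q S g Rel))"
 define D' where "D' = map_pmf (enc_list enc_nat) (genG q S g)"
 have k1: "1 - 1 / (5 * real S ^ e) <= \<kappa>" unfolding \<kappa>_def by (rule few_rel_pairs[OF few])
 have k0: "0 < \<kappa>"
 proof -
  have "1 / (5 * real S ^ e) < 1" using Se(1) by (simp add: divide_less_eq)
  then show ?thesis using k1 by linarith
 qed
 have dm: "dom \<kappa> D' D" unfolding \<kappa>_def D'_def D_def genG_def mdl_def nS_def deltaG_def by (rule wire_model.dom_gen[OF wm])
 have kle: "\<kappa> <= 1" using dom_prob[OF dm, of UNIV] k0 by simp
 have tS: "t <= S ^ e" unfolding t_def inp_def by (rule clock)
 then have "real t <= real (S ^ e)" by (rule of_nat_mono)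
 then have kt: "4/5 <= \<kappa> ^ t" using domination_power[OF k1 _ Se(1), of t] by simp
 have ds: "describes (descG q S es g H m) (mdl q S g (relG S (kk S) es H m))"
  unfolding descG_def mdl_def by (rule describes_wire[OF wm])
 have T: "halts_within D c inp t \<and>
   (ising_gibbs (mdl q S g (relG S (kk S) es H m)) = ising_gibbs (mdl q S g Rel) --> Pr (output_dist D c inp t) {enc_bool True} >= 3/4) \<and>
   (tv_dist (ising_gibbs (mdl q S g (relG S (kk S) es H m))) (ising_gibbs (mdl q S g Rel)) >= 1 - \<epsilon> -->
    Pr (output_dist D c inp t) {enc_bool False} >= 3/4)"
  using tester[THEN bspec, OF M, THEN bspec, OF M', THEN spec, THEN mp, OF ds]
  unfolding Let_def inp_def[symmetric] t_def[symmetric] D_def[symmetric] .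
 have pv: "Pr (output_dist D c inp t) {enc_bool v} >= 3/4" using T v by (cases v) auto
 show ?thesis unfolding simG_def D'_def[symmetric] inp_def[symmetric]
  by (rule tester_bound[OF dm k0 kle kt _ tS pv]) (use T in blast)
qed

context
 fixes H assumes H: "distinct H" "set H \<subseteq> {..<S}" "length H < S"
begin

text \<open>For large \<open>m\<close> the visible model is itself almost entirely in the trivial
  phase, so the fakes look like its own samples.\<close>

lemma yes_case:
 assumes m: "1 <= m" "m <= AA S" and big: "10 * real S ^ e * gG S es H <= 2 ^ (AA S + m)"
 shows "Pr (simG c q e S es g H m) {b. b ~= True} <= 5/16"
proof -
 let ?R = "relG S (kk S) es H m"
 have "?R 0 (AA S)" using m by (simp add: relG_def AA_def)
 moreover have "0 < AA S" "AA S < CC S" using S10 by (simp_all add: AA_def CC_def kk_def)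
 ultimately have f: "mdl q S g ?R \<in> inconsistent_ferro_RBMs (nS q S) d \<beta> 1" by (intro family)
 have "card (rel_pairs (AA S) (CC S) ?R) <= 2 ^ CC S + gG S es H * 2 ^ (AA S - m)"
  using rel_pairs_upper[of m "kk S" S es H] m by (simp add: gG_def AA_def CC_def)
 then have "real (card (rel_pairs (AA S) (CC S) ?R)) <= real (2 ^ CC S + gG S es H * 2 ^ (AA S - m))" by (rule of_nat_mono)
 also have "\<dots> = 2 ^ CC S + real (gG S es H) * 2 ^ (AA S - m)" by simp
 also have "real (gG S es H) * 2 ^ (AA S - m) <= 2 ^ CC S / (10 * real S ^ e)"
 proof -
  have "10 * real S ^ e * gG S es H * 2 ^ (AA S - m) <= 2 ^ (AA S + m) * 2 ^ (AA S - m)" using big by (rule mult_right_mono) simp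
  also have "\<dots> = (2::real) ^ CC S" using m by (simp add: power_add[symmetric] CC_def AA_def mult_2)
  finally show ?thesis using S10 by (simp add: le_divide_eq mult_ac)
 qed
 finally have "real (card (rel_pairs (AA S) (CC S) ?R)) <= 2 ^ CC S * (1 + 1 / (10 * real S ^ e))" by (simp add: algebra_simps)
 from sim_correct[OF f f this, of True] show ?thesis by simp
qed

text \<open>For small \<open>m\<close> the trivial phase has mass at most
  \<open>\<epsilon> / 2\<close> in the visible model but nearly 1 in the hidden one, and this event
  witnesses the required distance in total variation.\<close>

lemma no_case:
 assumes m: "1 <= m" "m <= AA S" and small: "2 ^ (AA S + m) <= \<epsilon> / 4 * gG S es H"
 shows "Pr (simG c q e S es g H m) {b. b ~= False} <= 5/16"
proof -
 let ?R = "relG S (kk S) es H m" and ?F = "%_ _ :: nat. True"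
 let ?gL = "wire_model.goodL (AA S) (CC S) S (bmx q S) (snd (snd g))"
 have A: "0 < AA S" "AA S < CC S" using S10 by (simp_all add: AA_def CC_def kk_def)
 have "?R 0 (AA S)" using m by (simp add: relG_def AA_def)
 then have f: "mdl q S g ?R \<in> inconsistent_ferro_RBMs (nS q S) d \<beta> 1" using A by (intro family)
 have f': "mdl q S g ?F \<in> inconsistent_ferro_RBMs (nS q S) d \<beta> 1" using A by (intro family[of 0 0]) auto
 have C2: "CC S = AA S + AA S" by (simp add: CC_def AA_def)
 have few: "real (card (rel_pairs (AA S) (CC S) ?F)) <= 2 ^ CC S * (1 + 1 / (10 * real S ^ e))"
 proof -
  have "real (card (rel_pairs (AA S) (CC S) ?F)) <= real (2 ^ CC S + 2 ^ AA S)" by (rule of_nat_mono[OF rel_pairs_full])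
  also have "\<dots> = 2 ^ CC S + 2 ^ AA S" by simp
  also have "(2::real) ^ AA S <= 2 ^ CC S / (10 * real S ^ e)"
   using mult_right_mono[OF A2, of "2 ^ AA S"] S10 by (simp add: le_divide_eq C2 power_add mult_ac)
  finally show ?thesis by (simp add: algebra_simps)
 qed
 have p1: "1 - 1 / (5 * real S ^ e) <= Pr (ising_gibbs (mdl q S g ?F)) ?gL"
  using few_rel_pairs[OF few] wire_model.prob_goodL_lower[OF wm, of ?F] unfolding mdl_def deltaG_def by linarith
 have p2: "Pr (ising_gibbs (mdl q S g ?R)) ?gL <= \<epsilon> / 2"
 proof -
  let ?c = "real (card (rel_pairs (AA S) (CC S) ?R))"
  have g2: "2 * 2 ^ AA S <= gG S es H" by (rule gG_ge[OF H(2,1,3)])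
  have "(gG S es H - 2 ^ AA S) * 2 ^ (AA S - m) <= card (rel_pairs (AA S) (CC S) ?R)"
   using rel_pairs_lower[of m "kk S" S es H] m by (simp add: gG_def AA_def CC_def)
  then have "real ((gG S es H - 2 ^ AA S) * 2 ^ (AA S - m)) <= ?c" by (rule of_nat_mono)
  moreover have "real (gG S es H - 2 ^ AA S) = real (gG S es H) - 2 ^ AA S" using g2 by (simp add: of_nat_diff)
  ultimately have "(real (gG S es H) - 2 ^ AA S) * 2 ^ (AA S - m) <= ?c" by simp
  moreover have "real (gG S es H) / 2 <= real (gG S es H) - 2 ^ AA S"
  proof -
   have "real (2 * 2 ^ AA S) <= real (gG S es H)" using g2 by (rule of_nat_mono)
   then show ?thesis by simp
  qed
  then have "real (gG S es H) / 2 * 2 ^ (AA S - m) <= (real (gG S es H) - 2 ^ AA S) * 2 ^ (AA S - m)" by (rule mult_right_mono) simp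
  ultimately have c: "real (gG S es H) / 2 * 2 ^ (AA S - m) <= ?c" by linarith
  have "(2::real) ^ CC S = 2 ^ (AA S + m) * 2 ^ (AA S - m)" using m by (simp add: power_add[symmetric] C2)
  also have "\<dots> <= \<epsilon> / 4 * gG S es H * 2 ^ (AA S - m)" by (rule mult_right_mono[OF small]) simp
  also have "\<dots> = \<epsilon> / 2 * (real (gG S es H) / 2 * 2 ^ (AA S - m))" by simp
  also have "\<dots> <= \<epsilon> / 2 * ?c" using c \<epsilon>(1) by (intro mult_left_mono) auto
  finally have "2 ^ CC S / ?c <= \<epsilon> / 2" using wire_model.rel_pairs_pos[OF wm, of ?R] by (simp add: divide_le_eq)
  then show ?thesis using wire_model.prob_goodL_upper[OF wm, of ?R] unfolding mdl_def by linarith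
 qed
 have "1 / (5 * real S ^ e) <= \<epsilon> / 2"
 proof -
  have "real S <= real S ^ e" using power_increasing[of 1 e "real S"] S10 e1 by simp
  then have "8 / \<epsilon> <= real S ^ e" using \<epsilon>(2) by linarith
  then have "8 <= \<epsilon> * real S ^ e" using \<epsilon>(1) by (simp add: divide_le_eq mult.commute)
  moreover have "\<epsilon> / 2 * (5 * real S ^ e) = 5 / 2 * (\<epsilon> * real S ^ e)" by simp
  ultimately have "1 <= \<epsilon> / 2 * (5 * real S ^ e)" by linarith
  then show ?thesis by (subst pos_divide_le_eq) (use Se(1) in linarith)+
 qed
 then have "tv_dist (ising_gibbs (mdl q S g ?R)) (ising_gibbs (mdl q S g ?F)) >= 1 - \<epsilon>"
  using tv_dist_ge[of "ising_gibbs (mdl q S g ?F)" ?gL "ising_gibbs (mdl q S g ?R)"] p1 p2 by linarith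
 then show ?thesis using sim_correct[OF f f' few, of False] by simp
qed

text \<open>\<open>Mlo\<close> is where the condition of \<open>no_case\<close> ends and
  \<open>Mhi\<close> where that of \<open>yes_case\<close> begins. In the window between them
  \<open>2 ^ (AA S + F)\<close> and \<open>gG\<close> differ by at most 8/\<epsilon> one way and 10
  S^e the other; one more power of S absorbs these constants.\<close>

lemma FG_accurate: "Pr (FG c q e S es g H) {F. \<not> accG S e es H F} <= AA S * (89/96) ^ S"
proof -
 let ?g = "real (gG S es H)"
 have g: "2 ^ AA S <= ?g" "?g <= 2 ^ (AA S + AA S)" "?g > 0"
 proof -
  have "2 ^ AA S <= gG S es H" using gG_ge[OF H(2,1,3), of es] by simp
  then have "real (2 ^ AA S) <= ?g" by (rule of_nat_mono)
  then show "2 ^ AA S <= ?g" by simp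
  then show "?g > 0" by (rule less_le_trans[rotated]) simp
  have "?g <= real (2 ^ (2 * AA S))" by (rule of_nat_mono[OF gG_le])
  then show "?g <= 2 ^ (AA S + AA S)" by (simp add: mult_2)
 qed
 obtain Mlo where lo: "Mlo <= AA S" "\<And>m. 1 <= m ==> m <= Mlo ==> 2 ^ (AA S + m) <= \<epsilon> / 4 * ?g"
  "Mlo = AA S \<or> \<not> 2 ^ (AA S + Suc Mlo) <= \<epsilon> / 4 * ?g"
  using ex_prefix[of "AA S" "%m. 2 ^ (AA S + m) <= \<epsilon> / 4 * ?g"] by blast
 obtain Mhi where hi: "Mhi <= AA S" "\<And>m. 1 <= m ==> m <= Mhi ==> 2 ^ (AA S + m) < 10 * real S ^ e * ?g"
  "Mhi = AA S \<or> \<not> 2 ^ (AA S + Suc Mhi) < 10 * real S ^ e * ?g"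
  using ex_prefix[of "AA S" "%m. 2 ^ (AA S + m) < 10 * real S ^ e * ?g"] by blast
 have lh: "x < 10 * real S ^ e * ?g" if "x <= \<epsilon> / 4 * ?g" "\<epsilon> / 4 < 10 * real S ^ e" for x
  using that(1) mult_strict_right_mono[OF that(2) g(3)] by linarith
 show ?thesis
 proof (cases "\<epsilon> / 4 < 10 * real S ^ e")
  case True
  have "Mlo <= Mhi"
  proof (rule ccontr)
   assume n: "\<not> Mlo <= Mhi"
   then have "2 ^ (AA S + Suc Mhi) < 10 * real S ^ e * ?g" by (intro lh[OF lo(2) True]) auto
   then show False using hi(3) lo(1) n by auto
  qed
  moreover have "10 * real S ^ e * ?g <= 2 ^ (AA S + m)" if "Mhi < m" "m <= AA S" for m
  proof -
   have "10 * real S ^ e * ?g <= 2 ^ (AA S + Suc Mhi)" using hi(3) that by auto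
   also have "\<dots> <= 2 ^ (AA S + m)" using that by (intro power_increasing) auto
   finally show ?thesis .
  qed
  ultimately have "Pr (FG c q e S es g H) {F. \<not> (Mlo <= F \<and> F <= Mhi)} <= AA S * (89/96) ^ S"
   using lo(1,2) by (intro FG_bound no_case yes_case) auto
  moreover have "accG S e es H F" if F: "Mlo <= F" "F <= Mhi" for F
  proof -
   have "?g <= real S * 2 ^ (AA S + F)"
   proof (cases "Mlo = AA S")
    case True
    have "?g <= 2 ^ (AA S + AA S)" by (rule g)
    also have "\<dots> <= 2 ^ (AA S + F)" using True F by (intro power_increasing) auto
    also have "\<dots> <= real S * 2 ^ (AA S + F)" using S10 by simp
    finally show ?thesis .
   next
    case False
    then have "\<epsilon> / 4 * ?g <= 2 ^ (AA S + Suc Mlo)" using lo(3) by auto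
    also have "\<dots> <= 2 ^ (AA S + Suc F)" using F by (intro power_increasing) auto
    finally have "8 / \<epsilon> * (\<epsilon> / 4 * ?g) <= 8 / \<epsilon> * 2 ^ (AA S + Suc F)" using \<epsilon>(1) by (intro mult_left_mono) auto
    then have "?g <= 8 / \<epsilon> * 2 ^ (AA S + F)" using \<epsilon>(1) by simp
    also have "\<dots> <= real S * 2 ^ (AA S + F)" by (rule mult_right_mono[OF \<epsilon>(2)]) simp
    finally show ?thesis .
   qed
   moreover have "2 ^ (AA S + F) <= real S ^ (e + 1) * ?g"
   proof -
    have "2 ^ (AA S + F) <= 10 * real S ^ e * ?g"
    proof (cases "F = 0")
     case True
     have "1 * ?g <= 10 * real S ^ e * ?g" using Se(1) g(3) by (intro mult_right_mono) auto
     then have "2 ^ AA S <= 10 * real S ^ e * ?g" using g(1) by linarith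
     then show ?thesis unfolding True add_0_right .
    qed (use hi(2)[of F] F in auto)
    also have "\<dots> <= real S ^ (e + 1) * ?g" using S10 g(3) by (intro mult_right_mono) auto
    finally show ?thesis .
   qed
   ultimately show ?thesis by (simp add: accG_def)
  qed
  then have "Pr (FG c q e S es g H) {F. \<not> accG S e es H F} <= Pr (FG c q e S es g H) {F. \<not> (Mlo <= F \<and> F <= Mhi)}"
   by (intro measure_pmf.finite_measure_mono) auto
  ultimately show ?thesis by linarith
 next
  case False
  have "10 * real S ^ e <= \<epsilon> / 4" using False by simp
  then have "10 * 10 <= \<epsilon> / 4" using Se(2) by linarith
  then show ?thesis using \<epsilon>1 by linarith
 qed
qed

end

end

section \<open>Sizes and the choice of parameters\<close>

lemma size_enc_list_le: "(\<And>x. x \<in> set xs ==> size (f x) <= B) ==> size (enc_list f xs) <= length xs * (B + 1)"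
proof (induction xs)
 case (Cons x xs)
 then have "size (f x) <= B" "size (enc_list f xs) <= length xs * (B + 1)" by auto
 then show ?case by simp
qed simp

lemma size_wire_desc:
 assumes W: "size (enc_rat w) <= W" "size (enc_rat \<phi>) <= W" "size (enc_rat 0) <= W"
 shows "size (enc_ising (wire_desc A C r bm b Rel w \<phi>)) <=
  vnum A C r bm + (vnum A C r bm)\<^sup>2 * (4 * vnum A C r bm + W + 3) + vnum A C r bm * (2 * W + 2) + 2"
proof -
 let ?n = "vnum A C r bm"
 define es where "es = concat (map (%t. concat (map (%t'. if wire_edge A C r bm b t t' then [(t, t', w)]
    else if conn_edge A C r bm b Rel t t' then [(t, t', \<phi>)] else []) [0..<?n])) [0..<?n])"
 define fs where "fs = map (%t. (if left_end A C r bm b Rel t then \<phi> else 0, if right_end A C r bm b Rel t then \<phi> else 0)) [0..<?n]"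
 have "length es = length (map (%(u, v, w). (u, v)) es)" by simp
 also have "\<dots> <= length (List.product [0..<?n] [0..<?n])" unfolding es_def map_concat_pairs by (rule length_filter_le)
 finally have len: "length es <= ?n\<^sup>2" by (simp add: power2_eq_square)
 have "size ((%(u, v, w). Node (enc_nat u) (Node (enc_nat v) (enc_rat w))) x) <= 4 * ?n + W + 2" if x: "x \<in> set es" for x
 proof -
  obtain u v z where xu: "x = (u, v, z)" "u < ?n" "v < ?n" "z = w \<or> z = \<phi>" using x unfolding es_def by (auto split: if_splits)
  have "size (enc_nat u) <= 2 * ?n" "size (enc_nat v) <= 2 * ?n" using size_enc_nat_le[of u] size_enc_nat_le[of v] xu by linarith+
  moreover have "size (enc_rat z) <= W" using xu(4) W by auto
  ultimately show ?thesis using xu(1) by simp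
 qed
 then have "size (enc_list (%(u, v, w). Node (enc_nat u) (Node (enc_nat v) (enc_rat w))) es) <= length es * (4 * ?n + W + 2 + 1)"
  by (rule size_enc_list_le)
 also have "\<dots> <= ?n\<^sup>2 * (4 * ?n + W + 3)" using len by (intro mult_mono) auto
 finally have 1: "size (enc_list (%(u, v, w). Node (enc_nat u) (Node (enc_nat v) (enc_rat w))) es) <= ?n\<^sup>2 * (4 * ?n + W + 3)" .
 have "size ((%(a, b). Node (enc_rat a) (enc_rat b)) x) <= 2 * W + 1" if "x \<in> set fs" for x
  using that W unfolding fs_def by auto
 then have "size (enc_list (%(a, b). Node (enc_rat a) (enc_rat b)) fs) <= length fs * (2 * W + 1 + 1)" by (rule size_enc_list_le)
 then have 2: "size (enc_list (%(a, b). Node (enc_rat a) (enc_rat b)) fs) <= ?n * (2 * W + 2)" by (simp add: fs_def)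
 show ?thesis unfolding wire_desc_def es_def[symmetric] fs_def[symmetric] enc_ising_def using 1 2 by simp
qed

lemma size_enc_rat_power2: "size (enc_rat (2 ^ x)) <= 2 * x + 7" "size (enc_rat (1 / 2 ^ x)) <= 2 * x + 7" "size (enc_rat 0) <= 7"
proof -
 have b: "size (enc_nat (2 ^ x)) <= 2 * (x + 1)" by (rule size_enc_nat) simp
 have o: "size (enc_nat 1) <= 2" using size_enc_nat_le[of 1] by simp
 have z: "size (enc_nat 0) <= 0" using size_enc_nat_le[of 0] by simp
 have eb: "size (enc_bool v) <= 1" for v by (rule size_enc_bool)
 show "size (enc_rat (2 ^ x)) <= 2 * x + 7" using b o eb[of False] by (simp add: enc_rat_def quotient_of_power2 nat_power_eq)
 show "size (enc_rat (1 / 2 ^ x)) <= 2 * x + 7" using b o eb[of False] by (simp add: enc_rat_def quotient_of_inverse_power2 nat_power_eq)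
 show "size (enc_rat 0) <= 7" using z o eb[of False] by (simp add: enc_rat_def)
qed

lemma n1_eq: "n1 S = 6 * S ^ 16"
 unfolding n1_def AA_def CC_def kk_def wlen_def by (simp add: power_add[symmetric] eval_nat_numeral algebra_simps)

lemma n1_le: "6 <= S ==> n1 S <= S ^ 17"
proof -
 assume "6 <= S"
 then have "6 * S ^ 16 <= S * S ^ 16" by (rule mult_le_mono1)
 also have "\<dots> = S ^ 17" by (simp add: power_Suc[symmetric] del: power_Suc)
 finally show ?thesis by (simp add: n1_eq)
qed

lemma n1_ge: "1 <= S ==> S <= n1 S"
proof -
 assume "1 <= S"
 then have "S ^ 1 <= S ^ 16" by (intro power_increasing) auto
 then show ?thesis by (simp add: n1_eq)
qed

lemma nS_eq: "nS q S = n1 S ^ (q + 1)" by (simp add: nS_def vnum_def bmx_def n1_def)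

lemma bmx_le: "6 <= S ==> bmx q S <= S ^ (17 * q)"
 unfolding bmx_def power_mult by (intro power_mono n1_le) auto

lemma nS_ge: "1 <= S ==> S <= nS q S"
proof -
 assume S: "1 <= S"
 have "S <= n1 S ^ 1" using n1_ge[OF S] by simp
 also have "\<dots> <= n1 S ^ (q + 1)" using n1_ge[OF S] S by (intro power_increasing) auto
 finally show ?thesis by (simp add: nS_eq)
qed

text \<open>The bound is uniform in \<open>H\<close> and \<open>m\<close>, so that one clock
  \<open>S ^ e\<close> serves every call; \<open>20 <= S\<close> absorbs the factor 16, and the
  bound on the exponent in \<open>g\<close> keeps the encoded weights short.\<close>

lemma size_descG:
 assumes S: "20 <= S" and x: "fst (snd g) < S"
 shows "size (enc_ising (descG q S es g H m)) + 1 <= S ^ (51 * (q + 1) + 1)"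
proof -
 let ?n = "nS q S" and ?W = "2 * S + 7"
 have nS: "S <= ?n" by (rule nS_ge) (use S in simp)
 have W: "size (enc_rat (wtG g)) <= ?W" "size (enc_rat (phG g)) <= ?W" "size (enc_rat 0) <= ?W"
  using size_enc_rat_power2(1,2)[of "fst (snd g)"] size_enc_rat_power2(3) size_enc_rat_power2(1)[of 0] x by (auto simp: wtG_def phG_def)
 have "size (enc_ising (descG q S es g H m)) <= ?n + ?n\<^sup>2 * (4 * ?n + ?W + 3) + ?n * (2 * ?W + 2) + 2"
  unfolding descG_def nS_def by (rule size_wire_desc[OF W])
 also have "\<dots> <= ?n + ?n\<^sup>2 * (7 * ?n) + ?n * (6 * ?n) + ?n"
  using nS S by (intro add_mono mult_le_mono) auto
 also have "\<dots> + 1 <= 16 * ?n ^ 3"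
 proof -
  have n1: "1 <= ?n" using nS S by simp
  have "?n ^ 1 <= ?n ^ 3" "?n ^ 2 <= ?n ^ 3" "?n ^ 0 <= ?n ^ 3" using n1 by (intro power_increasing; simp)+
  moreover have "?n\<^sup>2 * (7 * ?n) = 7 * ?n ^ 3" "?n * (6 * ?n) = 6 * ?n ^ 2" by (simp_all add: power2_eq_square power3_eq_cube)
  ultimately show ?thesis by simp
 qed
 finally have "size (enc_ising (descG q S es g H m)) + 1 <= 16 * ?n ^ 3" by simp
 also have "?n ^ 3 <= (S ^ (17 * (q + 1))) ^ 3"
  unfolding nS_eq power_mult by (intro power_mono n1_le) (use S in auto)
 also have "16 * (S ^ (17 * (q + 1))) ^ 3 <= S * (S ^ (17 * (q + 1))) ^ 3" using S by (intro mult_le_mono1) simp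
 also have "\<dots> = S ^ (51 * (q + 1) + 1)" by (simp add: power_mult[symmetric] power_add[symmetric] power_Suc[symmetric] del: power_Suc)
 finally show ?thesis by simp
qed

lemma poly_bound: "\<exists>a k. \<forall>x::nat. poly p x <= a * (x + 1) ^ k"
proof (induction p)
 case 0
 show ?case by simp
next
 case (pCons c p)
 then obtain a k where ak: "\<And>x. poly p x <= a * (x + 1) ^ k" by blast
 have "poly (pCons c p) x <= (c + a) * (x + 1) ^ Suc k" for x
 proof -
  have "c * 1 <= c * (x + 1) ^ Suc k" by (intro mult_left_mono one_le_power) auto
  moreover have "x * poly p x <= (x + 1) * (a * (x + 1) ^ k)" using ak[of x] by (intro mult_le_mono) auto
  ultimately show ?thesis by (simp add: algebra_simps)
 qed
 then show ?case by blast
qed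

lemma eventually_exp:
 assumes a: "a > 0"
 shows "\<forall>\<^sub>F S in sequentially. c * real S ^ k <= exp (a * real S)"
proof -
 have "((%x. x ^ k / exp x) \<longlongrightarrow> (0::real)) at_top" by (rule tendsto_power_div_exp_0)
 moreover have "filterlim (%S. a * real S) at_top sequentially"
  by (intro filterlim_tendsto_pos_mult_at_top[OF tendsto_const a] filterlim_real_sequentially)
 ultimately have "((%S. (a * real S) ^ k / exp (a * real S)) \<longlongrightarrow> 0) sequentially" by (rule filterlim_compose)
 then have "((%S. \<bar>c\<bar> / a ^ k * ((a * real S) ^ k / exp (a * real S))) \<longlongrightarrow> \<bar>c\<bar> / a ^ k * 0) sequentially" by (intro tendsto_intros)
 then have "\<forall>\<^sub>F S in sequentially. \<bar>c\<bar> / a ^ k * ((a * real S) ^ k / exp (a * real S)) < 1" by (intro order_tendstoD) auto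
 then show ?thesis
 proof (rule eventually_mono)
  fix S assume h: "\<bar>c\<bar> / a ^ k * ((a * real S) ^ k / exp (a * real S)) < 1"
  have "\<bar>c\<bar> / a ^ k * ((a * real S) ^ k / exp (a * real S)) = \<bar>c\<bar> * real S ^ k / exp (a * real S)" using a by (simp add: power_mult_distrib)
  then have "\<bar>c\<bar> * real S ^ k <= exp (a * real S)" using h by simp
  moreover have "c * real S ^ k <= \<bar>c\<bar> * real S ^ k" by (intro mult_right_mono) auto
  ultimately show "c * real S ^ k <= exp (a * real S)" by linarith
 qed
qed

lemma exp_le_linear: "0 <= x ==> x <= 1 ==> exp x <= 1 + 2 * (x::real)"
 using exp_bound[of x] mult_left_le[of x x] by (simp add: power2_eq_square)

lemma one_add_power_le:
 fixes a y :: real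
 assumes "0 <= a" "real m * a <= y" "y <= 1"
 shows "(1 + a) ^ m <= 1 + 2 * y"
proof -
 have "(1 + a) ^ m <= exp a ^ m" using assms by (intro power_mono) auto
 also have "\<dots> = exp (real m * a)" by (simp add: exp_of_nat_mult)
 also have "\<dots> <= exp y" using assms by simp
 also have "\<dots> <= 1 + 2 * y"
 proof (rule exp_le_linear)
  have "0 <= real m * a" using assms by simp
  then show "0 <= y" using assms by linarith
 qed (rule assms)
 finally show ?thesis .
qed

lemma deltaG_bound:
 assumes S: "10 <= S" and b: "1 <= snd (snd g)" "snd (snd g) <= bmx q S"
  and wb: "4 * real (e + 17 * q + 40) * ln (real S) <= real_of_rat (wtG g) * real (snd (snd g))"
  and fb: "1 <= real_of_rat (phG g) * real (snd (snd g))"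
  and ex: "real S ^ (e + 29) <= exp (2 * real S)"
 shows "(1 + deltaG S g) ^ (AA S + CC S) <= 1 + 1 / (10 * real S ^ e)"
proof -
 let ?b = "snd (snd g)" and ?w = "real_of_rat (wtG g)" and ?f = "real_of_rat (phG g)"
 have gen: "2 * (x - 1) + y <= 2 * (2 * z) + v" if "x <= 1 + 2 * z" "y <= v" for x y z v :: real using that by argo
 interpret wire_model "AA S" "CC S" S "bmx q S" ?b "%_ _. True" ?w ?f
 proof
  show A: "0 < AA S" "0 < CC S" "0 < S" using S by (simp_all add: AA_def CC_def kk_def)
  have "2 <= CC S * S" using S A unfolding CC_def AA_def by simp
  then have "1 * 2 <= AA S * (CC S * S)" using A by (intro mult_mono) auto
  then show "2 <= AA S * CC S * S" by (simp add: mult.assoc)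
 qed (use b wtG_props in auto)
 have dG: "deltaG S g = delta" by (simp add: deltaG_def)
 let ?E = "e + 17 * q + 40"
 define s where "s = real S"
 have s: "10 <= s" using S by (simp add: s_def)
 have s0: "s > 0" using s by simp
 define a where "a = exp (- ?w * real ?b / 4)"
 have a: "0 <= a" "a <= 1 / s ^ ?E"
 proof -
  have "4 * (real ?E * ln s) <= ?w * real ?b" using wb unfolding s_def mult.assoc .
  then have "real ?E * ln s <= ?w * real ?b / 4" by linarith
  then have "a <= exp (- (real ?E * ln s))" unfolding a_def by simp
  also have "\<dots> = 1 / s ^ ?E" using s0 by (simp only: exp_minus exp_of_nat_mult exp_ln inverse_eq_divide)
  finally show "a <= 1 / s ^ ?E" .
 qed (simp add: a_def)
 let ?m = "wlen (AA S) (CC S) S * (?b + 1)"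
 have m: "real ?m <= 4 * s ^ (11 + 17 * q)"
 proof -
  have L: "wlen (AA S) (CC S) S = 2 * S ^ 11"
   unfolding wlen_def AA_def CC_def kk_def by (simp add: power_add[symmetric] eval_nat_numeral algebra_simps)
  have "?b + 1 <= 2 * S ^ (17 * q)" using b bmx_le[of S q] S by simp
  then have "?m <= 2 * S ^ 11 * (2 * S ^ (17 * q))" unfolding L by (rule mult_le_mono2)
  also have "\<dots> = 4 * S ^ (11 + 17 * q)" by (simp add: power_add)
  finally have "real ?m <= real (4 * S ^ (11 + 17 * q))" by (rule of_nat_mono)
  then show ?thesis by (simp add: s_def)
 qed
 have ma: "real ?m * a <= 4 / s ^ (e + 29)"
 proof -
  have "real ?m * a <= 4 * s ^ (11 + 17 * q) * (1 / s ^ ?E)" using m a s0 by (intro mult_mono) auto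
  also have "s ^ ?E = s ^ (11 + 17 * q) * s ^ (e + 29)" by (simp add: power_add[symmetric] algebra_simps)
  also have "4 * s ^ (11 + 17 * q) * (1 / (s ^ (11 + 17 * q) * s ^ (e + 29))) = 4 / s ^ (e + 29)" using s0 by simp
  finally show ?thesis .
 qed
 have big: "s <= s ^ (e + 29)" using power_increasing[of 1 "e + 29" s] s by simp
 have p1: "(1 + a) ^ ?m <= 1 + 2 * (4 / s ^ (e + 29))"
  by (rule one_add_power_le[OF a(1) ma]) (use big s in \<open>simp add: divide_le_eq\<close>)
 have p2: "exp (- 2 * ?f * (real S * real ?b)) <= 1 / s ^ (e + 29)"
 proof -
  have "s * 1 <= s * (?f * real ?b)" using fb s0 by (intro mult_left_mono) auto
  then have "exp (- 2 * ?f * (real S * real ?b)) <= exp (- (2 * s))" by (simp add: s_def mult_ac)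
  also have "\<dots> = 1 / exp (2 * s)" by (simp add: exp_minus inverse_eq_divide)
  also have "\<dots> <= 1 / s ^ (e + 29)" using ex s0 by (intro divide_left_mono) (auto simp: s_def)
  finally show ?thesis .
 qed
 have d: "delta <= 17 / s ^ (e + 29)"
 proof -
  have "delta = 2 * ((1 + a) ^ ?m - 1) + exp (- 2 * ?f * (real S * real ?b))" unfolding delta_def a_def by simp
  also have "\<dots> <= 2 * (2 * (4 / s ^ (e + 29))) + 1 / s ^ (e + 29)" by (rule gen[OF p1 p2])
  also have "\<dots> = 17 / s ^ (e + 29)" by simp
  finally show ?thesis .
 qed
 have AC: "real (AA S + CC S) = 3 * s ^ 5"
  unfolding AA_def CC_def kk_def s_def by (simp add: eval_nat_numeral algebra_simps)
 have md: "real (AA S + CC S) * delta <= 51 / s ^ (e + 24)"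
 proof -
  have "real (AA S + CC S) * delta <= 3 * s ^ 5 * (17 / s ^ (e + 29))" unfolding AC using d s0 by (intro mult_left_mono) auto
  also have "s ^ (e + 29) = s ^ 5 * s ^ (e + 24)" by (simp add: power_add[symmetric] add.commute)
  also have "3 * s ^ 5 * (17 / (s ^ 5 * s ^ (e + 24))) = 51 / s ^ (e + 24)" using s0 by simp
  finally show ?thesis .
 qed
 have s4: "1020 <= s ^ 24"
 proof -
  have "(10::real) ^ 24 <= s ^ 24" using s by (intro power_mono) auto
  then show ?thesis by simp
 qed
 have se: "1 <= s ^ e" using s by (intro one_le_power) auto
 have "1020 * 1 <= s ^ 24 * s ^ e" by (rule mult_mono[OF s4 se]) (use s0 in auto)
 then have "51 / s ^ (e + 24) <= 1" using s0 by (simp add: power_add divide_le_eq mult.commute)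
 then have "(1 + delta) ^ (AA S + CC S) <= 1 + 2 * (51 / s ^ (e + 24))" by (rule one_add_power_le[OF delta0 md])
 also have "2 * (51 / s ^ (e + 24)) <= 1 / (10 * s ^ e)"
 proof -
  have "1020 * s ^ e <= s ^ 24 * s ^ e" using s4 s0 by (intro mult_right_mono) auto
  then show ?thesis using s0 by (simp add: power_add field_simps)
 qed
 finally show ?thesis by (simp add: dG s_def)
qed

text \<open>Round \<open>K / b\<close> up to a power of two, which stays within
  \<open>2 * K / b <= \<beta>\<close>. If the quotient exceeds 1, the field is 1 and its product
  with \<open>b\<close> is at least 1; otherwise field and weight coincide and the product is at
  least \<open>K\<close>.\<close>

lemma guess_exists:
 fixes K \<beta> :: real
 assumes K: "1 <= K" "K <= 2 ^ (S - 1)" and b: "1 <= b" "b <= bmx q S" and bm: "bmx q S < 2 ^ S" and \<beta>: "2 * K / b <= \<beta>" and S: "1 <= S"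
 obtains g where "g \<in> set (guesses q S)" "snd (snd g) = b" "fst (snd g) < S" "K <= real_of_rat (wtG g) * b"
  "1 <= real_of_rat (phG g) * b" "real_of_rat (wtG g) <= \<beta>"
proof -
 define t where "t = K / real b"
 have b0: "real b > 0" "real b >= 1" using b by auto
 have tb: "t * b = K" using b0 by (simp add: t_def)
 have t\<beta>: "2 * t <= \<beta>" using \<beta> by (simp add: t_def)
 have mem: "(kd, x, b) \<in> set (guesses q S)" if "x < S" for kd x
 proof -
  have "(kd, x, Suc (b - 1)) \<in> (%b. (kd, x, Suc b)) ` {0..<bmx q S}" using b by (intro imageI) auto
  then have "(kd, x, b) \<in> (%b. (kd, x, Suc b)) ` {0..<bmx q S}" using b by simp
  moreover have "x \<in> {0..<S}" using that by simp
  moreover have "set (guesses q S) = (\<Union>kd\<in>{False, True}. \<Union>x\<in>{0..<S}. (%b. (kd, x, Suc b)) ` {0..<bmx q S})"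
   by (simp only: guesses_def set_concat set_map set_upt image_image list.set)
  moreover have "kd \<in> {False, True}" by (cases kd) simp_all
  ultimately show ?thesis by blast
 qed
 show thesis
 proof (cases "1 < t")
  case True
  have "t <= K" using b0 K(1) by (simp add: t_def divide_le_eq mult_le_cancel_left1)
  then have ex: "t <= 2 ^ (S - 1)" using K by linarith
  define x where "x = (LEAST x. t <= 2 ^ x)"
  have x: "t <= 2 ^ x" unfolding x_def by (rule LeastI[of _ "S - 1"]) (rule ex)
  have "x <= S - 1" unfolding x_def by (rule Least_le) (rule ex)
  then have xS: "x < S" using S by simp
  obtain y where y: "x = Suc y" using x True by (cases x) auto
  have "\<not> t <= 2 ^ y" using not_less_Least[of y "%x. t <= 2 ^ x"] y unfolding x_def[symmetric] by simp
  then have "2 ^ x <= \<beta>" using y t\<beta> by simp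
  moreover have "K <= 2 ^ x * b" using mult_right_mono[OF x, of "real b"] tb by simp
  ultimately show thesis
   by (intro that[of "(True, x, b)"]) (use mem xS b0 in \<open>auto simp: wtG_def phG_def of_rat_power\<close>)
 next
  case False
  have lt: "1 / 2 ^ Suc (S - 1) < t"
  proof -
   have "real b < 2 ^ S"
   proof -
    have "b < 2 ^ S" using b bm by simp
    then have "real b < real (2 ^ S)" by (rule of_nat_less_iff[THEN iffD2])
    then show ?thesis by simp
   qed
   then have "1 / 2 ^ S < 1 / real b" using b0 by (intro divide_strict_left_mono) auto
   also have "\<dots> <= t" unfolding t_def using K b0 by (intro divide_right_mono) auto
   finally show ?thesis using S by simp
  qed
  define x where "x = (LEAST x. 1 / 2 ^ Suc x < t)"
  have x: "1 / 2 ^ Suc x < t" unfolding x_def by (rule LeastI[of _ "S - 1"]) (rule lt)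
  have "x <= S - 1" unfolding x_def by (rule Least_le) (rule lt)
  then have xS: "x < S" using S by simp
  have le: "t <= 1 / 2 ^ x"
  proof (cases x)
   case (Suc y)
   have "\<not> 1 / 2 ^ Suc y < t" using not_less_Least[of y "%x. 1 / 2 ^ Suc x < t"] Suc unfolding x_def[symmetric] by simp
   then show ?thesis unfolding Suc by simp
  qed (use False in simp)
  have "1 / 2 ^ x = 2 * (1 / 2 ^ Suc x :: real)" by simp
  then have "1 / 2 ^ x <= \<beta>" using x t\<beta> by linarith
  moreover have kb: "K <= 1 / 2 ^ x * b" using mult_right_mono[OF le, of "real b"] tb by simp
  moreover have "1 <= 1 / 2 ^ x * real b" using kb K(1) by linarith
  ultimately show thesis
   by (intro that[of "(False, x, b)"]) (use mem xS b0 in \<open>auto simp: wtG_def phG_def of_rat_power of_rat_divide\<close>)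
 qed
qed

lemma length_guesses: "length (guesses q S) = 2 * (S * bmx q S)"
 by (simp add: guesses_def length_concat comp_def sum_list_triv)

text \<open>With \<kappa> = exp(1/S^3) and a denominator above S^4, one step costs at most a factor
  exp(1/S^3 + 2/S^4). Over N <= S steps this is at most exp(1/S), within the tolerance
  exp(\<rho>).\<close>

lemma sampler_precision:
 assumes S: "10 <= S" and N: "N <= S" and \<rho>: "1 / real S <= \<rho>"
 shows "(exp (1 / real S ^ 3) + 2 / QQ S) ^ N <= exp \<rho>"
proof -
 define s where "s = real S"
 have s: "10 <= s" using S by (simp add: s_def)
 then have s0: "s > 0" by simp
 have "S ^ 4 < QQ S" using length_bits[of "S ^ 4" "sQ S"] by (simp add: QQ_def sQ_def)
 then have "real (S ^ 4) <= real (QQ S)" by (intro of_nat_mono) simp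
 then have "2 / QQ S <= 2 / s ^ 4" using s0 QQ_pos[of S] by (intro divide_left_mono mult_pos_pos) (auto simp: s_def)
 also have "\<dots> <= exp (1 / s ^ 3) * (2 / s ^ 4)"
 proof -
  have "1 * (2 / s ^ 4) <= exp (1 / s ^ 3) * (2 / s ^ 4)" using s0 by (intro mult_right_mono) auto
  then show ?thesis by simp
 qed
 finally have "exp (1 / s ^ 3) + 2 / QQ S <= exp (1 / s ^ 3) * (1 + 2 / s ^ 4)" by (simp add: algebra_simps)
 also have "\<dots> <= exp (1 / s ^ 3) * exp (2 / s ^ 4)" by (intro mult_left_mono exp_ge_add_one_self) simp
 also have "\<dots> = exp (1 / s ^ 3 + 2 / s ^ 4)" by (simp add: exp_add)
 finally have 1: "exp (1 / s ^ 3) + 2 / QQ S <= exp (1 / s ^ 3 + 2 / s ^ 4)" .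
 have "(exp (1 / s ^ 3) + 2 / QQ S) ^ N <= exp (1 / s ^ 3 + 2 / s ^ 4) ^ N" by (rule power_mono[OF 1]) simp
 also have "\<dots> = exp (real N * (1 / s ^ 3 + 2 / s ^ 4))" by (simp add: exp_of_nat_mult)
 also have "\<dots> <= exp (s * (1 / s ^ 3 + 2 / s ^ 4))" using N s0 by (auto intro!: mult_right_mono simp: s_def)
 also have "s * (1 / s ^ 3 + 2 / s ^ 4) = (s + 2) / s ^ 3" using s0 by (simp add: field_simps eval_nat_numeral)
 also have "\<dots> <= 1 / s"
 proof -
  have "s * 10 <= s * s" using s s0 by (intro mult_left_mono) auto
  then have "s + 2 <= s * s" using s by linarith
  then have "(s + 2) / s ^ 3 <= s * s / s ^ 3" using s0 by (intro divide_right_mono) auto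
  also have "\<dots> = 1 / s" using s0 by (simp add: power3_eq_cube)
  finally show ?thesis .
 qed
 then have "exp ((s + 2) / s ^ 3) <= exp (1 / s)" by simp
 also have "exp (1 / s) <= exp \<rho>" using \<rho> by (simp add: s_def)
 finally show ?thesis by (simp add: s_def)
qed

lemma exp_inverse_cube: "1 <= exp (1 / real S ^ 3)" "0 < S ==> exp (1 / real S ^ 3) ^ (2 * kk S) = exp (2 * real S)"
proof -
 show "1 <= exp (1 / real S ^ 3)" by simp
 assume S: "0 < S"
 have "exp (1 / real S ^ 3) ^ (2 * kk S) = exp (real (2 * kk S) * (1 / real S ^ 3))" by (rule exp_of_nat_mult[symmetric])
 also have "real (2 * kk S) * (1 / real S ^ 3) = 2 * real S" using S by (simp add: kk_def eval_nat_numeral)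
 finally show "exp (1 / real S ^ 3) ^ (2 * kk S) = exp (2 * real S)" .
qed

lemma FPRAS_of_tester:
 fixes \<theta> \<epsilon> :: real and d :: "nat => nat" and \<beta> :: "nat => real"
 assumes \<theta>: "\<theta> < 1" and d: "\<forall>\<^sub>F n in sequentially. 3 <= d n \<and> real (d n) <= real n powr \<theta>"
  and \<epsilon>: "0 < \<epsilon>" "\<epsilon> < 1" and \<beta>: "\<And>n. 0 < \<beta> n" and \<omega>: "(%n. \<beta> n * real (d n)) \<in> \<omega>(%n. ln (real n))"
  and tester: "solves_identity_testing \<epsilon> (%n. inconsistent_ferro_RBMs n (d n) (\<beta> n) 1) c p"
 shows BIS_admits_FPRAS
proof -
 \<comment> \<open>Makes n^\<theta> at most n^(q/(q+1)), the largest blob size available.\<close>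
 obtain q :: nat where "1 / (1 - \<theta>) <= real q" using real_arch_simple by blast
 then have q: "\<theta> <= real q / (real q + 1)" using \<theta> by (simp add: field_simps)
 obtain a k where ak: "\<And>x::nat. poly p x <= a * (x + 1) ^ k" using poly_bound[of p] by blast
 \<comment> \<open>The input size is below S^(51 (q + 1) + 1); the degree \<open>k\<close> of the
   running time multiplies this exponent, and the last 1 absorbs the constant
   \<open>a <= S\<close>.\<close>
 define e where "e = k * (51 * (q + 1) + 1) + 1"
 \<comment> \<open>Chosen so that \<open>w * b >= K * ln S\<close> gives a contour mark weight at
   most S^-(e + 17 q + 40).\<close>
 define K where "K = 4 * real (e + 17 * q + 40)"
 have K1: "K >= 1" by (simp add: K_def)
 define T where "T n \<longleftrightarrow> (\<forall>M\<in>inconsistent_ferro_RBMs n (d n) (\<beta> n) 1. \<forall>M'\<in>inconsistent_ferro_RBMs n (d n) (\<beta> n) 1. \<forall>X. describes X M -->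
    (let inp = enc_ising X;
      t = poly p (size inp);
      D = map_pmf (enc_config n) (ising_gibbs M')
    in halts_within D c inp t \<and>
      (ising_gibbs M = ising_gibbs M' -->
       Pr (output_dist D c inp t) {enc_bool True} >= 3/4) \<and>
      (tv_dist (ising_gibbs M) (ising_gibbs M') >= 1 - \<epsilon> -->
       Pr (output_dist D c inp t) {enc_bool False} >= 3/4)))" for n
 have evT: "\<forall>\<^sub>F n in sequentially. T n" using tester unfolding solves_identity_testing_def T_def .
 \<comment> \<open>The factor 8 is 4 from bounding the degree by \<open>4 * b\<close>, times 2 from
   rounding the weight to a power of two.\<close>
 have ev\<omega>: "\<forall>\<^sub>F n in sequentially. 8 * K * norm (ln (real n)) <= norm (\<beta> n * real (d n))"
  by (rule landau_omega.smallD[OF \<omega>]) (use K1 in simp)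
 \<comment> \<open>Only the sizes \<open>nS q S\<close> occur; they tend to infinity with S, so
   whatever holds for large n holds for large S.\<close>
 have lim: "filterlim (nS q) sequentially sequentially"
  by (rule filterlim_at_top_mono[OF filterlim_ident eventually_mono[OF eventually_ge_at_top[of 1] nS_ge]])
 have "\<forall>\<^sub>F n in sequentially. T n \<and> (3 <= d n \<and> real (d n) <= real n powr \<theta>) \<and> 8 * K * norm (ln (real n)) <= norm (\<beta> n * real (d n))"
  by (intro eventually_conj evT d ev\<omega>)
 from eventually_compose_filterlim[OF this lim]
 have evn: "\<forall>\<^sub>F S in sequentially. T (nS q S) \<and> (3 <= d (nS q S) \<and> real (d (nS q S)) <= real (nS q S) powr \<theta>) \<and>
   8 * K * norm (ln (real (nS q S))) <= norm (\<beta> (nS q S) * real (d (nS q S)))" .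
 have ln89: "ln (96/89 :: real) > 0" by simp
 have "\<forall>\<^sub>F S in sequentially. (T (nS q S) \<and> (3 <= d (nS q S) \<and> real (d (nS q S)) <= real (nS q S) powr \<theta>) \<and>
   8 * K * norm (ln (real (nS q S))) <= norm (\<beta> (nS q S) * real (d (nS q S)))) \<and> 20 + a + nat \<lceil>8 / \<epsilon>\<rceil> <= S \<and>
   1 * real S ^ (e + 29) <= exp (2 * real S) \<and> 10 * real S ^ e <= exp (ln 2 * real S) \<and> 2 * K * real S ^ 1 <= exp (ln 2 * real S) \<and>
   2 * real S ^ (17 * q) <= exp (ln 2 * real S) \<and> 16 * real S ^ 9 <= exp (ln (96/89) * real S) \<and> 16 * real S ^ (17 * q + 1) <= exp (1 * real S)"
  by (rule eventually_conj[OF evn], intro eventually_conj eventually_ge_at_top eventually_exp) (use ln89 in simp_all)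
 then obtain cc where cc: "\<And>S. cc <= S ==> T (nS q S) \<and> (3 <= d (nS q S) \<and> real (d (nS q S)) <= real (nS q S) powr \<theta>) \<and>
   8 * K * norm (ln (real (nS q S))) <= norm (\<beta> (nS q S) * real (d (nS q S)))"
   "\<And>S. cc <= S ==> 20 + a + nat \<lceil>8 / \<epsilon>\<rceil> <= S"
   "\<And>S. cc <= S ==> 1 * real S ^ (e + 29) <= exp (2 * real S)" "\<And>S. cc <= S ==> 10 * real S ^ e <= exp (ln 2 * real S)"
   "\<And>S. cc <= S ==> 2 * K * real S ^ 1 <= exp (ln 2 * real S)" "\<And>S. cc <= S ==> 2 * real S ^ (17 * q) <= exp (ln 2 * real S)"
   "\<And>S. cc <= S ==> 16 * real S ^ 9 <= exp (ln (96/89) * real S)" "\<And>S. cc <= S ==> 16 * real S ^ (17 * q + 1) <= exp (1 * real S)"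
  unfolding eventually_sequentially by blast
 show ?thesis
 proof (rule FPRAS_I[where c = c and q = q and e = e and cc = cc])
  fix G and \<rho>' :: rat assume G: "G \<in> BIS_instances" and \<rho>': "\<rho>' > 0"
  define N es S \<rho> where "N = fst G" and "es = snd G" and "S = SS cc (G, \<rho>')" and "\<rho> = real_of_rat \<rho>'"
  have "cc <= S" by (simp add: S_def SS_def)
  note C = cc[OF this]
  have S20: "20 <= S" and Sa: "a <= S" using C(2) by simp_all
  have Se: "8 / \<epsilon> <= real S"
  proof -
   have "8 / \<epsilon> <= real (nat \<lceil>8 / \<epsilon>\<rceil>)" by (rule real_nat_ceiling_ge)
   also have "\<dots> <= real S" by (rule of_nat_mono) (use C(2) in linarith)
   finally show ?thesis .
  qed
  have NS: "N < S"
  proof -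
   have "20 <= cc" using cc(2)[of cc] by simp
   then show ?thesis by (simp add: S_def SS_def N_def)
  qed
  have \<rho>0: "\<rho> > 0" using \<rho>' by (simp add: \<rho>_def)
  have \<rho>S: "1 / real S <= \<rho>"
  proof -
   have "1 / \<rho> <= 2 * real (UU \<rho>')" unfolding \<rho>_def by (rule UU_bounds(1)[OF \<rho>'])
   also have "\<dots> <= real S" by (simp add: S_def SS_def)
   finally show ?thesis using \<rho>0 S20 by (simp add: field_simps)
  qed
  have two: "exp (ln 2 * real S) = 2 ^ S" by (simp add: exp_of_nat2_mult)
  let ?n = "nS q S"
  define dn where "dn = d ?n"
  have dn: "3 <= dn" "real dn <= real ?n powr \<theta>" using C(1) by (simp_all add: dn_def)
  \<comment> \<open>The largest blob size with \<open>2 * b + 1 <= dn\<close>. Since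
    \<open>dn >= 3\<close>, it is at least 1.\<close>
  define b where "b = (dn - 1) div 2"
  have b: "1 <= b" "2 * b + 1 <= dn" "dn <= 4 * b" using dn(1) unfolding b_def by presburger+
  have n1: "1 <= n1 S" using n1_ge[of S] S20 by simp
  have bb: "b <= bmx q S"
  proof -
   have n1p: "real (n1 S) > 0" using n1 by simp
   have "real ?n >= 1" using nS_ge[of S q] S20 by simp
   then have le: "real ?n powr \<theta> <= real ?n powr (real q / (real q + 1))" using q by (intro powr_mono) auto
   have "real ?n = real (n1 S) powr (real q + 1)"
    using powr_realpow[OF n1p, of "q + 1"] by (simp add: nS_eq add.commute)
   then have "real ?n powr (real q / (real q + 1)) = real (n1 S) powr real q" by (simp add: powr_powr)
   also have "\<dots> = real (bmx q S)" using powr_realpow[OF n1p, of q] by (simp add: bmx_def)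
   finally have "real dn <= real (bmx q S)" using dn(2) le by linarith
   then show ?thesis using b(2) by simp
  qed
  have lnS: "1 <= ln (real S)"
  proof -
   have "exp 1 <= real S" using exp_le S20 by linarith
   then show ?thesis using S20 by (simp add: ln_ge_iff)
  qed
  have KK: "1 <= K * ln (real S)" "K * ln (real S) <= 2 ^ (S - 1)"
  proof -
   show "1 <= K * ln (real S)" using mult_mono[OF K1 lnS] K1 by simp
   have "K * ln (real S) <= K * real S" using K1 S20 by (intro mult_left_mono ln_bound[THEN order_trans, OF _ order_refl]) auto
   moreover have "2 * (K * real S) <= 2 * 2 ^ (S - 1)"
    using C(5) S20 unfolding two by (simp add: power_Suc[symmetric] del: power_Suc)
   ultimately show "K * ln (real S) <= 2 ^ (S - 1)" by linarith
  qed
  have bm2: "bmx q S < 2 ^ S"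
  proof -
   have "2 * real (bmx q S) <= 2 * real (S ^ (17 * q))" using bmx_le[of S q] S20 by (simp del: of_nat_power)
   also have "\<dots> <= 2 ^ S" using C(6) unfolding two by simp
   finally have "real (2 * bmx q S) <= real (2 ^ S)" by simp
   then have "2 * bmx q S <= 2 ^ S" by (simp only: of_nat_le_iff)
   moreover have "0 < bmx q S" using n1 by (simp add: bmx_def)
   ultimately show ?thesis by linarith
  qed
  have \<beta>b: "2 * (K * ln (real S)) / real b <= \<beta> ?n"
  proof -
   have nS: "real S <= real ?n" using nS_ge[of S q] S20 by simp
   have l: "ln (real S) <= ln (real ?n)" using nS S20 by (subst ln_le_cancel_iff) auto
   have "8 * K * ln (real S) <= 8 * K * ln (real ?n)" using l K1 by (intro mult_left_mono) auto
   also have "\<dots> = 8 * K * norm (ln (real ?n))" using l lnS by simp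
   also have "\<dots> <= norm (\<beta> ?n * real dn)" using C(1) by (simp add: dn_def)
   also have "\<dots> = \<beta> ?n * real dn" using \<beta>[of ?n] by simp
   also have "\<dots> <= \<beta> ?n * real (4 * b)" using b(3) \<beta>[of ?n] by (intro mult_left_mono of_nat_mono) auto
   finally show ?thesis using b(1) by (simp add: divide_le_eq mult_ac)
  qed
  obtain g where g: "g \<in> set (guesses q S)" "snd (snd g) = b" "fst (snd g) < S" "K * ln (real S) <= real_of_rat (wtG g) * real b"
   "1 <= real_of_rat (phG g) * real b" "real_of_rat (wtG g) <= \<beta> ?n"
   by (rule guess_exists[OF KK b(1) bb bm2 \<beta>b]) (use S20 that in auto)
  have clock: "poly p (size (enc_ising (descG q S es g H m))) <= S ^ e" for H m
  proof -
   have "poly p (size (enc_ising (descG q S es g H m))) <= a * (size (enc_ising (descG q S es g H m)) + 1) ^ k" by (rule ak)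
   also have "\<dots> <= S * (S ^ (51 * (q + 1) + 1)) ^ k" by (intro mult_le_mono Sa power_mono size_descG S20 g(3)) simp
   also have "\<dots> = S ^ e" by (simp add: e_def power_mult[symmetric] mult.commute)
   finally show ?thesis .
  qed
  have dl: "(1 + deltaG S g) ^ (AA S + CC S) <= 1 + 1 / (10 * real S ^ e)"
   by (rule deltaG_bound[where q = q]) (use S20 b bb g C(3) in \<open>simp_all add: K_def\<close>)
  have A2: "10 * real S ^ e <= 2 ^ AA S"
  proof -
   have "S ^ 1 <= S ^ 5" using S20 by (intro power_increasing) auto
   then have "S <= AA S" by (simp add: AA_def kk_def power_Suc2[symmetric] del: power_Suc power_Suc2)
   then have "(2::real) ^ S <= 2 ^ AA S" by (intro power_increasing) auto
   then show ?thesis using C(4) unfolding two by linarith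
  qed
  define \<eta> where "\<eta> = real (AA S) * (89/96) ^ S"
  have acc: "Pr (FG c q e S es g H) {F. \<not> accG S e es H F} <= \<eta>" if H: "distinct H" "set H \<subseteq> {..<N}" for H
   unfolding \<eta>_def
  proof (rule FG_accurate[where p = p and d = dn and \<beta> = "\<beta> ?n" and \<epsilon> = \<epsilon>])
   show "length H < S" using card_mono[OF _ H(2)] distinct_card[OF H(1)] NS by simp
   show "set H \<subseteq> {..<S}" using H(2) NS by auto
  qed (use S20 \<epsilon> Se b bb g dl A2 clock H C(1) in \<open>simp_all add: T_def dn_def e_def\<close>)
  have e89: "(89/96) ^ S * exp (ln (96/89) * real S) = (1::real)"
   unfolding exp_of_nat2_mult by (simp add: power_mult_distrib[symmetric])
  have \<eta>8: "real (S ^ 3) * (real N * (2 * \<eta>)) <= 1/8"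
  proof -
   have "real (S ^ 3) * (real N * (2 * \<eta>)) <= real (S ^ 3) * (real S * (2 * \<eta>))"
    using NS by (intro mult_left_mono mult_right_mono) (auto simp: \<eta>_def)
   also have "\<dots> = (89/96) ^ S * (16 * real S ^ 9) / 8" by (simp add: \<eta>_def AA_def kk_def eval_nat_numeral)
   also have "\<dots> <= (89/96) ^ S * exp (ln (96/89) * real S) / 8" using C(7) by (intro divide_right_mono mult_left_mono) auto
   finally show ?thesis unfolding e89 .
  qed
  \<comment> \<open>As \<rho> >= 1/S, the S^3 repetitions bring the failure probability below
    exp(-S), which beats the polynomial number of guesses.\<close>
  have gs: "real (length (guesses q S)) * exp (- \<rho>) ^ (S ^ 3) <= 1/8"
  proof -
   have "real S * 1 <= real S * (real S * 1)" using S20 by simp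
   also have "\<dots> <= real S * (real S * (real S * \<rho>))"
    using \<rho>S S20 by (intro mult_left_mono) (auto simp: field_simps)
   finally have "exp (- (real (S ^ 3) * \<rho>)) <= exp (- real S)" by (simp add: power3_eq_cube mult_ac)
   then have x: "exp (- \<rho>) ^ (S ^ 3) <= exp (- real S)" by (simp add: exp_of_nat_mult[symmetric])
   have "real (length (guesses q S)) <= real (2 * (S * S ^ (17 * q)))"
    unfolding length_guesses using bmx_le[of S q] S20 by (intro of_nat_mono mult_le_mono) auto
   also have "\<dots> = 16 * real S ^ (17 * q + 1) / 8" by simp
   also have "\<dots> <= exp (real S) / 8" using C(8) by simp
   finally have "real (length (guesses q S)) * exp (- \<rho>) ^ (S ^ 3) <= exp (real S) / 8 * exp (- real S)"
    using x by (intro mult_mono) auto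
   also have "\<dots> = 1/8" using exp_minus_inverse[of "real S"] by simp
   finally show ?thesis .
  qed
  have S2: "real S ^ (e + 2) <= exp (1 / real S ^ 3) ^ (2 * kk S)"
  proof -
   have "real S ^ (e + 2) <= real S ^ (e + 29)" using S20 by (intro power_increasing) auto
   then show ?thesis using C(3) exp_inverse_cube(2)[of S] S20 by simp
  qed
  note inst = BIS_instance[OF G, folded N_def es_def]
  have best: "Pr (bestG c q e S N es) {J. J > 0 \<and> exp (- \<rho>) * ZH es [0..<N] <= real (QQ S ^ N) / real J \<and>
   real (QQ S ^ N) / real J <= exp \<rho> * ZH es [0..<N]} >= 3/4"
   by (rule bestG_ok[OF inst(1) NS exp_inverse_cube(1) S2 acc g(1) sampler_precision \<eta>8 gs]) (use S20 NS \<rho>S in auto)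
  have f: "fprasG c q e cc (G, \<rho>') = map_pmf (%J. (QQ S ^ N, J)) (bestG c q e S N es)"
   by (simp add: fprasG_def map_pmf_def S_def N_def es_def)
  show "3/4 <= Pr (fprasG c q e cc (G, \<rho>')) {(a, b). b > 0 \<and>
    exp (- real_of_rat \<rho>') * real (num_indep_sets G) <= real a / real b \<and>
    real a / real b <= exp (real_of_rat \<rho>') * real (num_indep_sets G)}"
   using best unfolding f measure_map_pmf inst(2) \<rho>_def[symmetric] by (simp add: vimage_def)
 qed
qed

theorem theorem1p2:
  fixes \<theta> \<epsilon> :: real and d :: "nat \<Rightarrow> nat"
  assumes "0 < \<theta>" and "\<theta> < 1"
    and "\<forall>\<^sub>F n in sequentially. 3 \<le> d n \<and> real (d n) \<le> real n powr \<theta>"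
    and "0 < \<epsilon>" and "\<epsilon> < 1"
    and "\<not> BIS_admits_FPRAS"
  shows "\<exists>h :: nat \<Rightarrow> real. h \<in> O(\<lambda>_. 1) \<and>
    (\<forall>\<beta> :: nat \<Rightarrow> real. (\<forall>n. 0 < \<beta> n) \<longrightarrow>
       (\<lambda>n. \<beta> n * real (d n)) \<in> \<omega>(\<lambda>n. ln (real n)) \<longrightarrow>
       \<not> poly_time_identity_testable \<epsilon>
           (\<lambda>n. inconsistent_ferro_RBMs n (d n) (\<beta> n) (h n)))"
proof (intro exI[of _ "\<lambda>_. 1"] conjI allI impI notI)
  fix \<beta> :: "nat \<Rightarrow> real"
  assume \<beta>: "\<forall>n. 0 < \<beta> n" and \<omega>: "(\<lambda>n. \<beta> n * real (d n)) \<in> \<omega>(\<lambda>n. ln (real n))"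
    and "poly_time_identity_testable \<epsilon> (\<lambda>n. inconsistent_ferro_RBMs n (d n) (\<beta> n) 1)"
  then obtain c p where "solves_identity_testing \<epsilon> (\<lambda>n. inconsistent_ferro_RBMs n (d n) (\<beta> n) 1) c p"
    unfolding poly_time_identity_testable_def by blast
  from FPRAS_of_tester[OF assms(2-5) _ \<omega> this] \<beta> assms(6) show False by blast
qed simp

end
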